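(* Let $k$ be a unital commutative ring with $k\supseteq \mathbb{Q}$. Let $A$ be a flat, augmented, commutative $k$-algebra with augmentation ideal $I$ and let $M$ be a symmetric $A$-bimodule. Then there is an isomorphism of graded $k$-modules \[H\Gamma_{\star}\left(I, M\right) \cong H\Gamma_{\star}\left( A , M\right).\]
   Context: All tensor products are over $k$ unless indicated; "flat" means flat over $k$. $A$ is augmented by a $k$-algebra homomorphism $\varepsilon\colon A\to k$, $I=\mathrm{Ker}(\varepsilon)$. A bimodule $M$ is symmetric if $am=ma$. Let $\Omega$ be the category with objects $\underline{n}=\{1,\dots,n\}$, $n\geqslant1$, and morphisms surjections. $N\Omega_n(\underline{x},\underline{1})$ is the set of strings $[f_n\mid\cdots\mid f_1]$ of composable morphisms $\underline{x}\xrightarrow{f_1}\underline{x_1}\xrightarrow{f_2}\cdots\xrightarrow{f_{n-1}}\underline{x_{n-1}}\xrightarrow{f_n}\underline{1}$ in $\Omega$. For $i\in\underline{x_{n-1}}$ the $i$-th component $[f_{n-1}^i\mid\cdots\mid f_1^i]$ is the string of morphisms obtained by restricting to the iterated preimages of $i$, re-indexed in order-preserving fashion so that the domain of the $j$-th morphism is $\underline{c}$ with $c=|f_j^{-1}\cdots f_{n-1}^{-1}(i)|$ and the final codomain is $\underline{1}$. A surjection $f\colon\underline{x}\to\underline{x_1}$ induces $f_\star\colon A^{\otimes x}\to A^{\otimes x_1}$ whose $j$-th output factor is the product of the $a_l$ with $f(l)=j$. Robinson–Whitehouse complex: $C\Gamma_0(A,M)=A\otimes M$ and $C\Gamma_n(A,M)=\bigoplus_{x\geqslant1}k[N\Omega_n(\underline{x},\underline{1})]\otimes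 A^{\otimes x}\otimes M$. It is a simplicial $k$-module, with face maps on $X=[f_n\mid\cdots\mid f_1]\otimes(a_1\otimes\cdots\otimes a_x)\otimes m$ given by $\partial_0(X)=[f_n\mid\cdots\mid f_2]\otimes f_{1\star}(a_1\otimes\cdots\otimes a_x)\otimes m$; $\partial_j(X)=[f_n\mid\cdots\mid f_{j+1}\circ f_j\mid\cdots\mid f_1]\otimes(a_1\otimes\cdots\otimes a_x)\otimes m$ for $1\leqslant j\leqslant n-1$; and $\partial_n(X)=\sum_{i\in\underline{x_{n-1}}}[f_{n-1}^i\mid\cdots\mid f_1^i]\otimes(a_{i_1}\otimes\cdots\otimes a_{i_r})\otimes\big(\prod_{j\notin f_1^{-1}\cdots f_{n-1}^{-1}(i)}a_j\big)m$, where $\{i_1<\cdots<i_r\}$ is the preimage of $i$ under $f_{n-1}\circ\cdots\circ f_1$; degeneracies insert identity morphisms. $C\Gamma_\star(A,M)$ also denotes the associated chain complex. $C\Gamma_\star(I,M)$ is the chain complex $C\Gamma_n(I,M)=\bigoplus_{x\geqslant1}k[N\Omega_n(\underline{x},\underline{1})]\otimes I^{\otimes x}\otimes M$ with boundary induced by that of $C\Gamma_\star(A,M)$, and $H\Gamma_n(I,M)=H_n(C\Gamma_\star(I,M))$. $\Gamma$-homology: $\Gamma$ is the category of finite based sets $[n]=\{0,1,\dots,n\}$ (based at $0$), $n\geqslant0$, and based maps. For a right $\Gamma$-module $G\colon\Gamma^{op}\to k\text{-Mod}$ and left $\Gamma$-module $F\colon\Gamma\to k\text{-Mod}$, $G\otimes_\Gamma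 F$ is the quotient of $\bigoplus_n G([n])\otimes_kF([n])$ by the submodule generated by all $G(\alpha)(x)\otimes y-x\otimes F(\alpha)(y)$; $\mathrm{Tor}^\Gamma_\star$ denotes the left derived functors of $-\otimes_\Gamma-$. Let $t=\mathrm{Hom}_{\mathbf{Set}_\star}(-,k)$ ($k$ based at $0$), and let the Loday functor $\mathscr{L}(A,M)\colon\Gamma\to k\text{-Mod}$ be $[n]\mapsto A^{\otimes n}\otimes M$, where $f\colon[p]\to[q]$ sends $a_1\otimes\cdots\otimes a_p\otimes m$ to $\big(\prod_{i\in f^{-1}(1)}a_i\big)\otimes\cdots\otimes\big(\prod_{i\in f^{-1}(q)}a_i\big)\otimes\big(\prod_{i\in f^{-1}(0),\,i\neq0}a_i\big)m$ (empty products are $1_A$). Then $H\Gamma_n(A,M)=\mathrm{Tor}_n^\Gamma(t,\mathscr{L}(A,M))$. By known results of Whitehouse and Pirashvili–Richter, $H\Gamma_n(A,M)\cong H_n(C\Gamma_\star(A,M))$. *)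

theory Defs
  imports Complex_Main "HOL-Algebra.AbelCoset" "HOL-Algebra.Module"
begin

section \<open>Linear algebra over a commutative ring\<close>

text \<open>
  Modules are records of type \<^typ>\<open>('k, 'v) module\<close>.  The fields mult and one that the library
  record carries are not part of a module structure; they are left undefined in the constructions
  below.
\<close>

definition rat_ring :: "rat ring" where
  "rat_ring = \<lparr>carrier = UNIV, monoid.mult = (*), one = 1, ring.zero = 0, add = (+)\<rparr>"

definition module_hom ::
    "('k, 'r) ring_scheme \<Rightarrow> ('k, 'v, 's) module_scheme \<Rightarrow> ('k, 'w, 't) module_scheme \<Rightarrow> ('v \<Rightarrow> 'w) set" where
  "module_hom R V W = {\<phi> \<in> carrier V \<rightarrow> carrier W.
     (\<forall>x\<in>carrier V. \<forall>y\<in>carrier V. \<phi> (x \<oplus>\<^bsub>V\<^esub> y) = \<phi> x \<oplus>\<^bsub>W\<^esub> \<phi> y) \<and>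
     (\<forall>c\<in>carrier R. \<forall>x\<in>carrier V. \<phi> (c \<odot>\<^bsub>V\<^esub> x) = c \<odot>\<^bsub>W\<^esub> \<phi> x)}"

definition module_iso ::
    "('k, 'r) ring_scheme \<Rightarrow> ('k, 'v, 's) module_scheme \<Rightarrow> ('k, 'w, 't) module_scheme \<Rightarrow> ('v \<Rightarrow> 'w) set" where
  "module_iso R V W = {\<phi> \<in> module_hom R V W. bij_betw \<phi> (carrier V) (carrier W)}"

definition graded_isomorphic ::
    "('k, 'r) ring_scheme \<Rightarrow> (nat \<Rightarrow> ('k, 'v, 's) module_scheme) \<Rightarrow> (nat \<Rightarrow> ('k, 'w, 't) module_scheme) \<Rightarrow> bool" where
  "graded_isomorphic R V W \<longleftrightarrow> (\<exists>\<phi>. \<forall>n. \<phi> n \<in> module_iso R (V n) (W n))"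

definition span_of :: "('k, 'r) ring_scheme \<Rightarrow> ('k, 'v, 's) module_scheme \<Rightarrow> 'v set \<Rightarrow> 'v set" where
  "span_of R V B = \<Inter>{N. submodule N R V \<and> B \<subseteq> N}"

definition quotient_module :: "('k, 'v, 's) module_scheme \<Rightarrow> 'v set \<Rightarrow> ('k, 'v set) module" where
  "quotient_module V N =
     \<lparr>carrier = a_rcosets\<^bsub>V\<^esub> N, monoid.mult = undefined, one = undefined,
      ring.zero = N, add = set_add V,
      smult = (\<lambda>c X. \<Union>x\<in>X. N +>\<^bsub>V\<^esub> (c \<odot>\<^bsub>V\<^esub> x))\<rparr>"

text \<open>The \<open>R\<close>-linear map \<open>V \<rightarrow> W\<close> sending the generator \<open>g s\<close> of \<open>V\<close> to \<open>h s\<close>, for all \<open>s \<in> S\<close>.\<close>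

definition linear_extension ::
    "('k, 'r) ring_scheme \<Rightarrow> ('k, 'v, 's) module_scheme \<Rightarrow> ('k, 'w, 't) module_scheme \<Rightarrow>
     'g set \<Rightarrow> ('g \<Rightarrow> 'v) \<Rightarrow> ('g \<Rightarrow> 'w) \<Rightarrow> 'v \<Rightarrow> 'w" where
  "linear_extension R V W S g h =
     (THE \<phi>. \<phi> \<in> module_hom R V W \<inter> extensional (carrier V) \<and> (\<forall>s\<in>S. \<phi> (g s) = h s))"

definition restrict_scalars ::
    "('k, 'a, 's) module_scheme \<Rightarrow> ('a, 'm, 't) module_scheme \<Rightarrow> ('k, 'm) module" where
  "restrict_scalars A M =
     \<lparr>carrier = carrier M, monoid.mult = undefined, one = undefined, ring.zero = \<zero>\<^bsub>M\<^esub>, add = add M,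
      smult = (\<lambda>c m. (c \<odot>\<^bsub>A\<^esub> \<one>\<^bsub>A\<^esub>) \<odot>\<^bsub>M\<^esub> m)\<rparr>"

subsection \<open>Free modules and direct sums\<close>

definition free_module :: "('k, 'r) ring_scheme \<Rightarrow> 's set \<Rightarrow> ('k, 's \<Rightarrow> 'k) module" where
  "free_module R S =
     \<lparr>carrier = {u. (\<forall>s. u s \<in> carrier R) \<and> (\<forall>s. s \<notin> S \<longrightarrow> u s = \<zero>\<^bsub>R\<^esub>) \<and> finite {s. u s \<noteq> \<zero>\<^bsub>R\<^esub>}},
      monoid.mult = undefined, one = undefined,
      ring.zero = (\<lambda>s. \<zero>\<^bsub>R\<^esub>), add = (\<lambda>u v s. u s \<oplus>\<^bsub>R\<^esub> v s),
      smult = (\<lambda>c u s. c \<otimes>\<^bsub>R\<^esub> u s)\<rparr>"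

definition basis_elem :: "('k, 'r) ring_scheme \<Rightarrow> 's \<Rightarrow> 's \<Rightarrow> 'k" where
  "basis_elem R s = (\<lambda>s'. if s' = s then \<one>\<^bsub>R\<^esub> else \<zero>\<^bsub>R\<^esub>)"

definition direct_sum :: "'j set \<Rightarrow> ('j \<Rightarrow> ('k, 'v, 's) module_scheme) \<Rightarrow> ('k, 'j \<Rightarrow> 'v) module" where
  "direct_sum J V =
     \<lparr>carrier = {u \<in> \<Pi>\<^sub>E j\<in>J. carrier (V j). finite {j \<in> J. u j \<noteq> \<zero>\<^bsub>V j\<^esub>}},
      monoid.mult = undefined, one = undefined,
      ring.zero = (\<lambda>j\<in>J. \<zero>\<^bsub>V j\<^esub>), add = (\<lambda>u v. \<lambda>j\<in>J. u j \<oplus>\<^bsub>V j\<^esub> v j),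
      smult = (\<lambda>c u. \<lambda>j\<in>J. c \<odot>\<^bsub>V j\<^esub> u j)\<rparr>"

definition sum_inj :: "'j set \<Rightarrow> ('j \<Rightarrow> ('k, 'v, 's) module_scheme) \<Rightarrow> 'j \<Rightarrow> 'v \<Rightarrow> 'j \<Rightarrow> 'v" where
  "sum_inj J V i x = (\<lambda>j\<in>J. if j = i then x else \<zero>\<^bsub>V j\<^esub>)"

subsection \<open>Tensor products\<close>

definition tensor_rel ::
    "('k, 'r) ring_scheme \<Rightarrow> ('k, 'v, 's) module_scheme \<Rightarrow> ('k, 'w, 't) module_scheme \<Rightarrow> ('v \<times> 'w \<Rightarrow> 'k) set" where
  "tensor_rel R V W =
    (let F = free_module R (carrier V \<times> carrier W); e = basis_elem R in
     span_of R F
      ({e (x \<oplus>\<^bsub>V\<^esub> x', y) \<ominus>\<^bsub>F\<^esub> (e (x, y) \<oplus>\<^bsub>F\<^esub> e (x', y)) | x x' y.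
          x \<in> carrier V \<and> x' \<in> carrier V \<and> y \<in> carrier W} \<union>
       {e (x, y \<oplus>\<^bsub>W\<^esub> y') \<ominus>\<^bsub>F\<^esub> (e (x, y) \<oplus>\<^bsub>F\<^esub> e (x, y')) | x y y'.
          x \<in> carrier V \<and> y \<in> carrier W \<and> y' \<in> carrier W} \<union>
       {e (c \<odot>\<^bsub>V\<^esub> x, y) \<ominus>\<^bsub>F\<^esub> c \<odot>\<^bsub>F\<^esub> e (x, y) | c x y.
          c \<in> carrier R \<and> x \<in> carrier V \<and> y \<in> carrier W} \<union>
       {e (x, c \<odot>\<^bsub>W\<^esub> y) \<ominus>\<^bsub>F\<^esub> c \<odot>\<^bsub>F\<^esub> e (x, y) | c x y.
          c \<in> carrier R \<and> x \<in> carrier V \<and> y \<in> carrier W}))"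

definition tensor ::
    "('k, 'r) ring_scheme \<Rightarrow> ('k, 'v, 's) module_scheme \<Rightarrow> ('k, 'w, 't) module_scheme \<Rightarrow>
     ('k, ('v \<times> 'w \<Rightarrow> 'k) set) module" where
  "tensor R V W = quotient_module (free_module R (carrier V \<times> carrier W)) (tensor_rel R V W)"

definition pure_tensor ::
    "('k, 'r) ring_scheme \<Rightarrow> ('k, 'v, 's) module_scheme \<Rightarrow> ('k, 'w, 't) module_scheme \<Rightarrow>
     'v \<Rightarrow> 'w \<Rightarrow> ('v \<times> 'w \<Rightarrow> 'k) set" where
  "pure_tensor R V W x y =
     tensor_rel R V W +>\<^bsub>free_module R (carrier V \<times> carrier W)\<^esub> basis_elem R (x, y)"

text \<open>
  The tensor power \<open>V\<^sup>\<otimes>\<^sup>n\<close> is presented by the tuples \<open>a\<^sub>1, \<dots>, a\<^sub>n\<close>, that is the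
  elements of \<open>{1..n} \<rightarrow>\<^sub>E carrier V\<close>, modulo multilinearity.  For \<open>n = 0\<close> there
  is a single tuple and no relation, so that \<open>V\<^sup>\<otimes>\<^sup>0\<close> is free of rank one.
\<close>

definition tuples :: "nat \<Rightarrow> 'v set \<Rightarrow> (nat \<Rightarrow> 'v) set" where
  "tuples n S = {1..n} \<rightarrow>\<^sub>E S"

definition tensor_power_rel ::
    "('k, 'r) ring_scheme \<Rightarrow> ('k, 'v, 's) module_scheme \<Rightarrow> nat \<Rightarrow> ((nat \<Rightarrow> 'v) \<Rightarrow> 'k) set" where
  "tensor_power_rel R V n =
    (let F = free_module R (tuples n (carrier V)); e = basis_elem R in
     span_of R F
      ({e (a(i := x \<oplus>\<^bsub>V\<^esub> y)) \<ominus>\<^bsub>F\<^esub> (e (a(i := x)) \<oplus>\<^bsub>F\<^esub> e (a(i := y))) | a i x y.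
          a \<in> tuples n (carrier V) \<and> i \<in> {1..n} \<and> x \<in> carrier V \<and> y \<in> carrier V} \<union>
       {e (a(i := c \<odot>\<^bsub>V\<^esub> x)) \<ominus>\<^bsub>F\<^esub> c \<odot>\<^bsub>F\<^esub> e (a(i := x)) | a i c x.
          a \<in> tuples n (carrier V) \<and> i \<in> {1..n} \<and> c \<in> carrier R \<and> x \<in> carrier V}))"

definition tensor_power ::
    "('k, 'r) ring_scheme \<Rightarrow> ('k, 'v, 's) module_scheme \<Rightarrow> nat \<Rightarrow> ('k, ((nat \<Rightarrow> 'v) \<Rightarrow> 'k) set) module" where
  "tensor_power R V n = quotient_module (free_module R (tuples n (carrier V))) (tensor_power_rel R V n)"

definition pure_power ::
    "('k, 'r) ring_scheme \<Rightarrow> ('k, 'v, 's) module_scheme \<Rightarrow> nat \<Rightarrow> (nat \<Rightarrow> 'v) \<Rightarrow> ((nat \<Rightarrow> 'v) \<Rightarrow> 'k) set" where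
  "pure_power R V n a =
     tensor_power_rel R V n +>\<^bsub>free_module R (tuples n (carrier V))\<^esub> basis_elem R a"

subsection \<open>Flatness\<close>

text \<open>
  Flatness of \<open>A\<close>: tensoring with \<open>A\<close> preserves injective module homomorphisms.  A definition in
  HOL has to fix the type that carries the test modules.  On the type chosen here every countably
  generated module, being a quotient of a submodule of a free module on \<open>nat\<close>, has an isomorphic
  copy; in particular all finitely generated ideals occur, and these suffice to detect flatness.
\<close>

definition flat_module :: "('k, 'r) ring_scheme \<Rightarrow> ('k, 'a, 's) module_scheme \<Rightarrow> bool" where
  "flat_module R A \<longleftrightarrow>
    (\<forall>(N :: ('k, (nat \<Rightarrow> 'k) set) module) (N' :: ('k, (nat \<Rightarrow> 'k) set) module) \<phi>.
       module R N \<and> module R N' \<and> \<phi> \<in> module_hom R N N' \<and> inj_on \<phi> (carrier N) \<longrightarrow>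
       inj_on
         (linear_extension R (tensor R N A) (tensor R N' A) (carrier N \<times> carrier A)
            (\<lambda>(x, a). pure_tensor R N A x a) (\<lambda>(x, a). pure_tensor R N' A (\<phi> x) a))
         (carrier (tensor R N A)))"

subsection \<open>Homology\<close>

text \<open>
  A chain complex is given by modules \<open>C n\<close> and maps \<open>d n : C n \<rightarrow> C (n - 1)\<close> for \<open>n \<ge> 1\<close>; the
  value of \<open>d 0\<close> is irrelevant, all of \<open>C 0\<close> being cycles.
\<close>

definition homology ::
    "(nat \<Rightarrow> ('k, 'v) module) \<Rightarrow> (nat \<Rightarrow> 'v \<Rightarrow> 'v) \<Rightarrow> nat \<Rightarrow> ('k, 'v set) module" where
  "homology C d n =
     quotient_module
       ((C n)\<lparr>carrier := {z \<in> carrier (C n). n = 0 \<or> d n z = \<zero>\<^bsub>C (n - 1)\<^esub>}\<rparr>)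
       (d (Suc n) ` carrier (C (Suc n)))"

section \<open>Augmented algebras and symmetric bimodules\<close>

definition augmentation :: "('k, 'r) ring_scheme \<Rightarrow> ('k, 'a, 's) module_scheme \<Rightarrow> ('a \<Rightarrow> 'k) \<Rightarrow> bool" where
  "augmentation R A \<epsilon> \<longleftrightarrow>
     \<epsilon> \<in> ring_hom A R \<and> (\<forall>c\<in>carrier R. \<forall>a\<in>carrier A. \<epsilon> (c \<odot>\<^bsub>A\<^esub> a) = c \<otimes>\<^bsub>R\<^esub> \<epsilon> a)"

text \<open>
  The left action is the scalar multiplication of \<open>M\<close>, the right action is \<open>ract m a\<close>.  By symmetry
  the two \<open>k\<close>-module structures induced on \<open>M\<close> agree; they are given by \<^const>\<open>restrict_scalars\<close>.
\<close>

locale symmetric_bimodule = module A M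
  for A :: "('a, 'r) ring_scheme" and M :: "('a, 'm, 's) module_scheme" +
  fixes ract :: "'m \<Rightarrow> 'a \<Rightarrow> 'm"
  assumes ract_closed: "\<lbrakk>m \<in> carrier M; a \<in> carrier A\<rbrakk> \<Longrightarrow> ract m a \<in> carrier M"
    and ract_add: "\<lbrakk>m \<in> carrier M; a \<in> carrier A; b \<in> carrier A\<rbrakk> \<Longrightarrow>
      ract m (a \<oplus>\<^bsub>A\<^esub> b) = ract m a \<oplus>\<^bsub>M\<^esub> ract m b"
    and add_ract: "\<lbrakk>m \<in> carrier M; m' \<in> carrier M; a \<in> carrier A\<rbrakk> \<Longrightarrow>
      ract (m \<oplus>\<^bsub>M\<^esub> m') a = ract m a \<oplus>\<^bsub>M\<^esub> ract m' a"
    and ract_mult: "\<lbrakk>m \<in> carrier M; a \<in> carrier A; b \<in> carrier A\<rbrakk> \<Longrightarrow>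
      ract m (a \<otimes>\<^bsub>A\<^esub> b) = ract (ract m a) b"
    and ract_one: "m \<in> carrier M \<Longrightarrow> ract m \<one>\<^bsub>A\<^esub> = m"
    and smult_ract: "\<lbrakk>a \<in> carrier A; m \<in> carrier M; b \<in> carrier A\<rbrakk> \<Longrightarrow>
      ract (a \<odot>\<^bsub>M\<^esub> m) b = a \<odot>\<^bsub>M\<^esub> ract m b"
    and symmetric: "\<lbrakk>a \<in> carrier A; m \<in> carrier M\<rbrakk> \<Longrightarrow> a \<odot>\<^bsub>M\<^esub> m = ract m a"

section \<open>The Robinson--Whitehouse complex\<close>

definition Surj :: "nat \<Rightarrow> nat \<Rightarrow> (nat \<Rightarrow> nat) set" where
  "Surj x y = {f \<in> {1..x} \<rightarrow>\<^sub>E {1..y}. f ` {1..x} = {1..y}}"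

text \<open>
  A string \<open>[f\<^sub>n | \<dots> | f\<^sub>1]\<close> of surjections \<open>f\<^sub>j : X\<^sub>j\<^sub>-\<^sub>1 \<rightarrow> X\<^sub>j\<close> with \<open>X\<^sub>0 = x\<close> and \<open>X\<^sub>n = 1\<close> is the
  pair of the family \<open>X\<close> of its objects and the family \<open>f\<close> of its morphisms.
\<close>

type_synonym strg = "(nat \<Rightarrow> nat) \<times> (nat \<Rightarrow> nat \<Rightarrow> nat)"

definition N_Omega :: "nat \<Rightarrow> nat \<Rightarrow> strg set" where
  "N_Omega n x = {(X, f).
     X \<in> {0..n} \<rightarrow>\<^sub>E {1..} \<and> X 0 = x \<and> X n = 1 \<and>
     f \<in> (\<Pi>\<^sub>E j\<in>{1..n}. Surj (X (j - 1)) (X j))}"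

definition drop_first :: "nat \<Rightarrow> strg \<Rightarrow> strg" where
  "drop_first n = (\<lambda>(X, f). (\<lambda>i\<in>{0..n - 1}. X (i + 1), \<lambda>i\<in>{1..n - 1}. f (i + 1)))"

definition compose_at :: "nat \<Rightarrow> nat \<Rightarrow> strg \<Rightarrow> strg" where
  "compose_at n j = (\<lambda>(X, f).
     (\<lambda>i\<in>{0..n - 1}. if i < j then X i else X (i + 1),
      \<lambda>i\<in>{1..n - 1}. if i < j then f i
                     else if i = j then compose {1..X (j - 1)} (f (j + 1)) (f j)
                     else f (i + 1)))"

text \<open>
  \<open>fibre n \<sigma> i j\<close> is the iterated preimage of \<open>i \<in> X\<^sub>n\<^sub>-\<^sub>1\<close> in \<open>X\<^sub>j\<close>, for \<open>j \<le> n - 1\<close>: the fold is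
  \<open>f\<^sub>n\<^sub>-\<^sub>1 \<circ> \<dots> \<circ> f\<^sub>j\<^sub>+\<^sub>1\<close>.  The order-preserving re-indexing of a finite set \<open>S\<close> of naturals by
  \<open>{1..card S}\<close> is \<open>nth_elem S\<close>, with inverse \<open>rank_in S\<close>.
\<close>

definition fibre :: "nat \<Rightarrow> strg \<Rightarrow> nat \<Rightarrow> nat \<Rightarrow> nat set" where
  "fibre n = (\<lambda>(X, f) i j. {l \<in> {1..X j}. fold f [Suc j..<n] l = i})"

definition nth_elem :: "nat set \<Rightarrow> nat \<Rightarrow> nat" where
  "nth_elem S l = sorted_list_of_set S ! (l - 1)"

definition rank_in :: "nat set \<Rightarrow> nat \<Rightarrow> nat" where
  "rank_in S s = card {s' \<in> S. s' \<le> s}"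

definition component :: "nat \<Rightarrow> strg \<Rightarrow> nat \<Rightarrow> strg" where
  "component n = (\<lambda>(X, f) i. let S = fibre n (X, f) i in
     (\<lambda>j\<in>{0..n - 1}. card (S j),
      \<lambda>j\<in>{1..n - 1}. \<lambda>l\<in>{1..card (S (j - 1))}. rank_in (S j) (f j (nth_elem (S (j - 1)) l))))"

definition push_tuple ::
    "('a, 's) ring_scheme \<Rightarrow> nat \<Rightarrow> nat \<Rightarrow> (nat \<Rightarrow> nat) \<Rightarrow> (nat \<Rightarrow> 'a) \<Rightarrow> nat \<Rightarrow> 'a" where
  "push_tuple A x y f a = (\<lambda>j\<in>{1..y}. \<Otimes>\<^bsub>A\<^esub>l\<in>{l \<in> {1..x}. f l = j}. a l)"

text \<open>
  The complex is defined for a \<open>k\<close>-submodule \<open>J\<close> of \<open>A\<close> closed under multiplication, such as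
  \<open>J = carrier A\<close>, which gives \<open>C\<Gamma>(A, M)\<close>, and the augmentation ideal \<open>J = I\<close>, which gives
  \<open>C\<Gamma>(I, M)\<close>.  In degree 0 only \<open>x = 1\<close> contributes, with the single string of length 0, whence
  \<open>J \<otimes> M\<close>.
\<close>

abbreviation sub_mod :: "('k, 'a) module \<Rightarrow> 'a set \<Rightarrow> ('k, 'a) module" where
  "sub_mod A J \<equiv> A\<lparr>carrier := J\<rparr>"

definition RW_coeff where
  "RW_coeff k A J M x = tensor k (tensor_power k (sub_mod A J) x) (restrict_scalars A M)"

definition RW_summand where
  "RW_summand k A J M n x = tensor k (free_module k (N_Omega n x)) (RW_coeff k A J M x)"

definition RW_chains where
  "RW_chains k A J M n = direct_sum {1..} (RW_summand k A J M n)"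

definition RW_gen where
  "RW_gen k A J M n = (\<lambda>(x, \<sigma>, a, m).
     sum_inj {1..} (RW_summand k A J M n) x
       (pure_tensor k (free_module k (N_Omega n x)) (RW_coeff k A J M x) (basis_elem k \<sigma>)
         (pure_tensor k (tensor_power k (sub_mod A J) x) (restrict_scalars A M)
            (pure_power k (sub_mod A J) x a) m)))"

definition RW_index where
  "RW_index J M n = {(x, \<sigma>, a, m). x \<ge> 1 \<and> \<sigma> \<in> N_Omega n x \<and> a \<in> tuples x J \<and> m \<in> carrier M}"

text \<open>\<open>RW_face_gen k A J M n j\<close> is the value of \<open>\<partial>\<^sub>j : C\<Gamma>\<^sub>n \<rightarrow> C\<Gamma>\<^sub>n\<^sub>-\<^sub>1\<close> on a generator.\<close>

definition RW_face_gen where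
  "RW_face_gen k A J M n j = (\<lambda>(x, \<sigma>, a, m).
     if j = 0 then
       (let y = fst \<sigma> 1 in
        RW_gen k A J M (n - 1) (y, drop_first n \<sigma>, push_tuple A x y (snd \<sigma> 1) a, m))
     else if j < n then
       RW_gen k A J M (n - 1) (x, compose_at n j \<sigma>, a, m)
     else
       (\<Oplus>\<^bsub>RW_chains k A J M (n - 1)\<^esub>i\<in>{1..fst \<sigma> (n - 1)}.
          let S = fibre n \<sigma> i 0 in
          RW_gen k A J M (n - 1)
            (card S, component n \<sigma> i, \<lambda>l\<in>{1..card S}. a (nth_elem S l),
             (\<Otimes>\<^bsub>A\<^esub>l\<in>{1..x} - S. a l) \<odot>\<^bsub>M\<^esub> m)))"

definition RW_face where
  "RW_face k A J M n j =
     linear_extension k (RW_chains k A J M n) (RW_chains k A J M (n - 1))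
       (RW_index J M n) (RW_gen k A J M n) (RW_face_gen k A J M n j)"

definition RW_boundary where
  "RW_boundary k A J M n z =
     (\<Oplus>\<^bsub>RW_chains k A J M (n - 1)\<^esub>j\<in>{0..n}.
        ((\<ominus>\<^bsub>k\<^esub> \<one>\<^bsub>k\<^esub>) [^]\<^bsub>k\<^esub> j) \<odot>\<^bsub>RW_chains k A J M (n - 1)\<^esub> RW_face k A J M n j z)"

definition HGamma_ideal where
  "HGamma_ideal k A J M = homology (RW_chains k A J M) (RW_boundary k A J M)"

section \<open>Functor homology over \<open>\<Gamma>\<close>\<close>

definition Gamma_hom :: "nat \<Rightarrow> nat \<Rightarrow> (nat \<Rightarrow> nat) set" where
  "Gamma_hom p q = {f \<in> {0..p} \<rightarrow>\<^sub>E {0..q}. f 0 = 0}"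

text \<open>
  Left and right \<open>\<Gamma>\<close>-modules share the same data: the module \<open>ob G n\<close> at the object \<open>[n]\<close>, and for a
  based map \<open>f : [p] \<rightarrow> [q]\<close> the map \<open>act G p q f\<close>, which goes from \<open>ob G p\<close> to \<open>ob G q\<close> for a left
  module and from \<open>ob G q\<close> to \<open>ob G p\<close> for a right module.
\<close>

record ('k, 'g) gamma_mod =
  ob :: "nat \<Rightarrow> ('k, 'g) module"
  act :: "nat \<Rightarrow> nat \<Rightarrow> (nat \<Rightarrow> nat) \<Rightarrow> 'g \<Rightarrow> 'g"

definition right_gamma_module :: "('k, 'r) ring_scheme \<Rightarrow> ('k, 'g) gamma_mod \<Rightarrow> bool" where
  "right_gamma_module k G \<longleftrightarrow>
     (\<forall>n. module k (ob G n)) \<and>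
     (\<forall>p q. \<forall>f\<in>Gamma_hom p q. act G p q f \<in> module_hom k (ob G q) (ob G p)) \<and>
     (\<forall>n. \<forall>u\<in>carrier (ob G n). act G n n (\<lambda>i\<in>{0..n}. i) u = u) \<and>
     (\<forall>p q r. \<forall>f\<in>Gamma_hom p q. \<forall>g\<in>Gamma_hom q r. \<forall>u\<in>carrier (ob G r).
        act G p r (compose {0..p} g f) u = act G p q f (act G q r g u))"

definition right_gamma_hom ::
    "('k, 'r) ring_scheme \<Rightarrow> ('k, 'g) gamma_mod \<Rightarrow> ('k, 'h) gamma_mod \<Rightarrow> (nat \<Rightarrow> 'g \<Rightarrow> 'h) set" where
  "right_gamma_hom k G H = {\<theta>.
     (\<forall>n. \<theta> n \<in> module_hom k (ob G n) (ob H n)) \<and>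
     (\<forall>p q. \<forall>f\<in>Gamma_hom p q. \<forall>u\<in>carrier (ob G q).
        \<theta> p (act G p q f u) = act H p q f (\<theta> q u))}"

text \<open>
  Projectivity in the category of right \<open>\<Gamma>\<close>-modules.  The type carrying the test modules is chosen so
  large that, over a nonzero ring, it contains up to isomorphism both \<open>P\<close> itself and the canonical
  free module \<open>\<Oplus>\<^sub>n \<Oplus>\<^bsub>x \<in> P[n]\<^esub> k[Hom(-, [n])]\<close> that maps onto \<open>P\<close>.  Lifting the identity of \<open>P\<close> then
  makes \<open>P\<close> a direct summand of a free module, so that \<open>P\<close> has the lifting property against modules
  carried by any type.
\<close>

definition projective_gamma :: "('k, 'r) ring_scheme \<Rightarrow> ('k, 'p) gamma_mod \<Rightarrow> bool" where
  "projective_gamma k P \<longleftrightarrow>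
     right_gamma_module k P \<and>
     (\<forall>(N :: ('k, nat \<times> 'p \<times> (nat \<Rightarrow> nat) \<Rightarrow> 'k) gamma_mod)
       (N' :: ('k, nat \<times> 'p \<times> (nat \<Rightarrow> nat) \<Rightarrow> 'k) gamma_mod) \<pi> \<phi>.
        right_gamma_module k N \<and> right_gamma_module k N' \<and>
        \<pi> \<in> right_gamma_hom k N N' \<and> (\<forall>n. \<pi> n ` carrier (ob N n) = carrier (ob N' n)) \<and>
        \<phi> \<in> right_gamma_hom k P N' \<longrightarrow>
        (\<exists>\<psi>\<in>right_gamma_hom k P N. \<forall>n. \<forall>u\<in>carrier (ob P n). \<pi> n (\<psi> n u) = \<phi> n u))"

text \<open>A projective resolution \<open>\<dots> \<rightarrow> P 2 \<rightarrow> P 1 \<rightarrow> P 0 \<rightarrow> G \<rightarrow> 0\<close> with \<open>d s : P s \<rightarrow> P (s - 1)\<close> for \<open>s \<ge> 1\<close>.\<close>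

definition projective_resolution ::
    "('k, 'r) ring_scheme \<Rightarrow> ('k, 'g) gamma_mod \<Rightarrow> (nat \<Rightarrow> ('k, 'p) gamma_mod) \<Rightarrow>
     (nat \<Rightarrow> nat \<Rightarrow> 'p \<Rightarrow> 'p) \<Rightarrow> (nat \<Rightarrow> 'p \<Rightarrow> 'g) \<Rightarrow> bool" where
  "projective_resolution k G P d \<eta> \<longleftrightarrow>
     (\<forall>s. projective_gamma k (P s)) \<and>
     (\<forall>s. d (Suc s) \<in> right_gamma_hom k (P (Suc s)) (P s)) \<and>
     \<eta> \<in> right_gamma_hom k (P 0) G \<and>
     (\<forall>n. \<eta> n ` carrier (ob (P 0) n) = carrier (ob G n)) \<and>
     (\<forall>n. {u \<in> carrier (ob (P 0) n). \<eta> n u = \<zero>\<^bsub>ob G n\<^esub>} = d 1 n ` carrier (ob (P 1) n)) \<and>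
     (\<forall>s n. {u \<in> carrier (ob (P (Suc s)) n). d (Suc s) n u = \<zero>\<^bsub>ob (P s) n\<^esub>} =
            d (Suc (Suc s)) n ` carrier (ob (P (Suc (Suc s))) n))"

subsection \<open>The tensor product over \<open>\<Gamma>\<close> and its left derived functors\<close>

definition gamma_sum where
  "gamma_sum k G F = direct_sum (UNIV :: nat set) (\<lambda>n. tensor k (ob G n) (ob F n))"

definition gamma_sum_gen where
  "gamma_sum_gen k G F n u v =
     sum_inj (UNIV :: nat set) (\<lambda>n. tensor k (ob G n) (ob F n)) n (pure_tensor k (ob G n) (ob F n) u v)"

definition gamma_rel where
  "gamma_rel k G F = span_of k (gamma_sum k G F)
     {gamma_sum_gen k G F p (act G p q f u) v \<ominus>\<^bsub>gamma_sum k G F\<^esub> gamma_sum_gen k G F q u (act F p q f v)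
       | p q f u v. f \<in> Gamma_hom p q \<and> u \<in> carrier (ob G q) \<and> v \<in> carrier (ob F p)}"

definition gamma_tensor where
  "gamma_tensor k G F = quotient_module (gamma_sum k G F) (gamma_rel k G F)"

definition gamma_tensor_gen where
  "gamma_tensor_gen k G F = (\<lambda>(n, u, v). gamma_rel k G F +>\<^bsub>gamma_sum k G F\<^esub> gamma_sum_gen k G F n u v)"

text \<open>The map \<open>\<theta> \<otimes>\<^sub>\<Gamma> F\<close> induced by a morphism \<open>\<theta> : G \<rightarrow> H\<close> of right \<open>\<Gamma>\<close>-modules.\<close>

definition gamma_tensor_map where
  "gamma_tensor_map k G H F \<theta> =
     linear_extension k (gamma_tensor k G F) (gamma_tensor k H F)
       {(n, u, v). u \<in> carrier (ob G n) \<and> v \<in> carrier (ob F n)}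
       (gamma_tensor_gen k G F) (\<lambda>(n, u, v). gamma_tensor_gen k H F (n, \<theta> n u, v))"

text \<open>
  If \<open>(P, d)\<close> is a projective resolution of \<open>G\<close>, then \<open>Tor_Gamma k P d F n\<close> is \<open>Tor\<^sub>n(G, F)\<close>, the value
  at \<open>G\<close> of the \<open>n\<close>-th left derived functor of \<open>- \<otimes>\<^sub>\<Gamma> F\<close>, as computed from that resolution; up to isomorphism it does not depend on
  the resolution.
\<close>

definition Tor_Gamma where
  "Tor_Gamma k P d F =
     homology (\<lambda>s. gamma_tensor k (P s) F) (\<lambda>s. gamma_tensor_map k (P s) (P (s - 1)) F (d s))"

subsection \<open>\<open>\<Gamma>\<close>-homology\<close>

definition t_mod :: "('k, 'r) ring_scheme \<Rightarrow> ('k, nat \<Rightarrow> 'k) gamma_mod" where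
  "t_mod k =
     \<lparr>ob = (\<lambda>n. \<lparr>carrier = {u \<in> {0..n} \<rightarrow>\<^sub>E carrier k. u 0 = \<zero>\<^bsub>k\<^esub>},
                  monoid.mult = undefined, one = undefined,
                  ring.zero = (\<lambda>i\<in>{0..n}. \<zero>\<^bsub>k\<^esub>),
                  add = (\<lambda>u v. \<lambda>i\<in>{0..n}. u i \<oplus>\<^bsub>k\<^esub> v i),
                  smult = (\<lambda>c u. \<lambda>i\<in>{0..n}. c \<otimes>\<^bsub>k\<^esub> u i)\<rparr>),
      act = (\<lambda>p q f u. compose {0..p} u f)\<rparr>"

definition Loday_ob where
  "Loday_ob k A M n = tensor k (tensor_power k A n) (restrict_scalars A M)"

definition Loday_gen where
  "Loday_gen k A M n = (\<lambda>(a, m).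
     pure_tensor k (tensor_power k A n) (restrict_scalars A M) (pure_power k A n a) m)"

definition Loday where
  "Loday k A M =
     \<lparr>ob = Loday_ob k A M,
      act = (\<lambda>p q f.
        linear_extension k (Loday_ob k A M p) (Loday_ob k A M q)
          (tuples p (carrier A) \<times> carrier M) (Loday_gen k A M p)
          (\<lambda>(a, m). Loday_gen k A M q
             (push_tuple A p q f a, (\<Otimes>\<^bsub>A\<^esub>i\<in>{i \<in> {1..p}. f i = 0}. a i) \<odot>\<^bsub>M\<^esub> m)))\<rparr>"

text \<open>
  \<open>H\<Gamma>\<^sub>n(A, M) = Tor\<^sub>n(t, L(A, M))\<close>, computed from a projective resolution \<open>(P, d)\<close> of \<open>t\<close>.
\<close>

definition HGamma where
  "HGamma k A M P d = Tor_Gamma k P d (Loday k A M)"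

end

theory Submission
  imports Defs
begin

text \<open>
  Call a based map a based surjection if it hits every point other than the base point, which it always
  hits. Tuples with entries in the ideal \<open>I\<close> can be pushed forward along such maps: the entries over a
  point are multiplied, a product that is never empty and so stays in \<open>I\<close>, and the entries over the base
  point act on \<open>M\<close>. So \<open>U(p) = I\<^sup>\<otimes>\<^sup>p \<otimes> M\<close> is a functor on the category of based surjections. The proof shows
  that both graded modules are the derived functors \<open>Tor(t, U)\<close> over that category.

  On the side of \<open>A\<close>, the splitting \<open>A = k \<oplus> I\<close> decomposes the Loday functor as
  \<open>L(A, M)(p) = \<Oplus>\<^sub>S I\<^sup>\<otimes>\<^sup>S \<otimes> M\<close>, the sum over the subsets \<open>S\<close> of \<open>{1..p}\<close>; equivalently, \<open>L(A, M)\<close> is the left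
  Kan extension of \<open>U\<close>. Hence for every right \<open>\<Gamma>\<close>-module \<open>P\<close> the tensor product \<open>P \<otimes> L(A, M)\<close> over \<open>\<Gamma>\<close> is the
  tensor product of \<open>P\<close> and \<open>U\<close> over the based surjections (\<open>pair_E_generates\<close>, \<open>pair_E_universal\<close>). Moreover
  projective right \<open>\<Gamma>\<close>-modules stay projective after restriction (\<open>projective_lift\<close>), because every based map
  factors uniquely as a based surjection followed by the inclusion of its image, so that \<open>\<Gamma>(-, [q])\<close> restricts to
  the direct sum of the representable functors at the subsets of \<open>{1..q}\<close>.

  On the side of \<open>I\<close>, let \<open>bar k n\<close> be the free right module over the based surjections with one generator
  of arity \<open>x\<close> for every string in \<open>N_Omega n x\<close>. Its tensor product with \<open>U\<close> is \<open>C\<Gamma>\<^sub>n(I, M)\<close> (\<open>pair_C_universal\<close>),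
  and the boundary of \<open>C\<Gamma>(I, M)\<close> comes from a differential on \<open>bar k\<close> (\<open>RW_boundary_pair_C\<close>): even the last face,
  which multiplies the entries outside a component onto \<open>M\<close>, is given by precomposing with based
  surjections that collapse a complement to the base point. The complex \<open>bar k\<close> is a resolution of \<open>t\<close>, since
  it has an extra degeneracy: a string \<open>\<sigma>\<close> starting at \<open>x\<close> together with a based surjection \<open>g\<close> to \<open>x\<close> can be prolonged by
  prepending the restriction of \<open>g\<close> to its support (\<open>face_Suc_prepend\<close>, \<open>bar_s_contraction\<close>).

  So \<open>bar k\<close> and the given resolution \<open>P\<close> are two projective resolutions of \<open>t\<close> over the based surjections.
  The mapping cone of a comparison map \<open>bar k \<rightarrow> P\<close> is exact, bounded below and projective, so it has a
  contraction natural in the based surjections (\<open>natural_contraction\<close>). A natural contraction survives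
  the tensor product with \<open>U\<close> (\<open>contraction_exact\<close>), so the cone of \<open>C\<Gamma>(I, M) \<rightarrow> P \<otimes> L(A, M)\<close> is exact, and
  this map induces the isomorphism (\<open>comparison_quasi_iso\<close>).

  Tensor products over the based surjections are handled through their universal property only: such a
  product of \<open>X\<close> and \<open>U\<close> is a module together with a pairing that is \<open>balanced\<close>, whose values generate, and
  through which every balanced pairing factors.
\<close>

section \<open>Linear algebra over a commutative ring\<close>

lemma mhomI:
  assumes "\<And>x. x \<in> carrier V \<Longrightarrow> \<phi> x \<in> carrier W"
    and "\<And>x y. x \<in> carrier V \<Longrightarrow> y \<in> carrier V \<Longrightarrow> \<phi> (x \<oplus>\<^bsub>V\<^esub> y) = \<phi> x \<oplus>\<^bsub>W\<^esub> \<phi> y"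
    and "\<And>c x. c \<in> carrier k \<Longrightarrow> x \<in> carrier V \<Longrightarrow> \<phi> (c \<odot>\<^bsub>V\<^esub> x) = c \<odot>\<^bsub>W\<^esub> \<phi> x"
  shows "\<phi> \<in> module_hom k V W"
  using assms unfolding module_hom_def by auto

lemma mhom_closed: "\<phi> \<in> module_hom k V W \<Longrightarrow> x \<in> carrier V \<Longrightarrow> \<phi> x \<in> carrier W"
  unfolding module_hom_def by auto

lemma mhom_add:
  "\<phi> \<in> module_hom k V W \<Longrightarrow> x \<in> carrier V \<Longrightarrow> y \<in> carrier V \<Longrightarrow> \<phi> (x \<oplus>\<^bsub>V\<^esub> y) = \<phi> x \<oplus>\<^bsub>W\<^esub> \<phi> y"
  unfolding module_hom_def by auto

lemma mhom_smult:
  "\<phi> \<in> module_hom k V W \<Longrightarrow> c \<in> carrier k \<Longrightarrow> x \<in> carrier V \<Longrightarrow> \<phi> (c \<odot>\<^bsub>V\<^esub> x) = c \<odot>\<^bsub>W\<^esub> \<phi> x"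
  unfolding module_hom_def by auto

lemma module_cring: "module k V \<Longrightarrow> cring k"
  by (simp add: module_def)

lemma module_abelian: "module k V \<Longrightarrow> abelian_group V"
  by (simp add: module_def)

lemma module_minus_eq_zero:
  assumes "module k V" "x \<in> carrier V" "y \<in> carrier V"
  shows "x \<ominus>\<^bsub>V\<^esub> y = \<zero>\<^bsub>V\<^esub> \<longleftrightarrow> x = y"
proof -
  interpret V: module k V by fact
  show ?thesis
    using assms by (metis V.add.inv_closed V.minus_equality V.minus_minus V.r_neg a_minus_def)
qed

lemma module_minus_zero:
  assumes "module k V" "x \<in> carrier V"
  shows "x \<ominus>\<^bsub>V\<^esub> \<zero>\<^bsub>V\<^esub> = x"
proof -
  interpret V: module k V by fact
  have "\<ominus>\<^bsub>V\<^esub> \<zero>\<^bsub>V\<^esub> = \<zero>\<^bsub>V\<^esub>" by (simp add: V.minus_equality)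
  then show ?thesis using assms(2) by (simp add: a_minus_def)
qed

lemma mhom_zero:
  assumes "module k V" "module k W" "\<phi> \<in> module_hom k V W"
  shows "\<phi> \<zero>\<^bsub>V\<^esub> = \<zero>\<^bsub>W\<^esub>"
proof -
  interpret V: module k V by fact
  interpret W: module k W by fact
  have "\<phi> (\<zero>\<^bsub>k\<^esub> \<odot>\<^bsub>V\<^esub> \<zero>\<^bsub>V\<^esub>) = \<zero>\<^bsub>k\<^esub> \<odot>\<^bsub>W\<^esub> \<phi> \<zero>\<^bsub>V\<^esub>"
    by (rule mhom_smult[OF assms(3)]) auto
  then show ?thesis using mhom_closed[OF assms(3)] by simp
qed

lemma mhom_uminus:
  assumes "module k V" "module k W" "\<phi> \<in> module_hom k V W" "x \<in> carrier V"
  shows "\<phi> (\<ominus>\<^bsub>V\<^esub> x) = \<ominus>\<^bsub>W\<^esub> \<phi> x"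
proof -
  interpret V: module k V by fact
  interpret W: module k W by fact
  have *: "\<ominus>\<^bsub>V\<^esub> x = (\<ominus>\<^bsub>k\<^esub> \<one>\<^bsub>k\<^esub>) \<odot>\<^bsub>V\<^esub> x" "\<ominus>\<^bsub>W\<^esub> \<phi> x = (\<ominus>\<^bsub>k\<^esub> \<one>\<^bsub>k\<^esub>) \<odot>\<^bsub>W\<^esub> \<phi> x"
    using mhom_closed[OF assms(3,4)] assms(4) by (simp_all add: V.smult_l_minus W.smult_l_minus)
  show ?thesis unfolding * by (rule mhom_smult[OF assms(3)]) (use assms(4) in auto)
qed

lemma mhom_minus:
  assumes "module k V" "module k W" "\<phi> \<in> module_hom k V W" "x \<in> carrier V" "y \<in> carrier V"
  shows "\<phi> (x \<ominus>\<^bsub>V\<^esub> y) = \<phi> x \<ominus>\<^bsub>W\<^esub> \<phi> y"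
proof -
  interpret V: module k V by fact
  show ?thesis
    unfolding a_minus_def using assms mhom_add[OF assms(3,4), of "\<ominus>\<^bsub>V\<^esub> y"] mhom_uminus[OF assms(1-3,5)]
    by simp
qed

lemma mhom_finsum:
  assumes "module k V" "module k W" "\<phi> \<in> module_hom k V W" "f \<in> B \<rightarrow> carrier V"
  shows "\<phi> (\<Oplus>\<^bsub>V\<^esub>i\<in>B. f i) = (\<Oplus>\<^bsub>W\<^esub>i\<in>B. \<phi> (f i))"
proof -
  interpret V: module k V by fact
  interpret W: module k W by fact
  show ?thesis
  proof (cases "finite B")
    case True
    then show ?thesis using assms(4)
    proof (induction B)
      case empty
      then show ?case using mhom_zero[OF assms(1-3)] by simp
    next
      case (insert x F)
      then have "f \<in> F \<rightarrow> carrier V" "f x \<in> carrier V" by auto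
      moreover from this have "(\<lambda>i. \<phi> (f i)) \<in> F \<rightarrow> carrier W" "\<phi> (f x) \<in> carrier W"
        using mhom_closed[OF assms(3)] by auto
      ultimately show ?case using insert
        by (simp add: mhom_add[OF assms(3)])
    qed
  next
    case False
    then show ?thesis using mhom_zero[OF assms(1-3)] V.finsum_infinite W.finsum_infinite by simp
  qed
qed

lemma mhom_id: "(\<lambda>x. x) \<in> module_hom k V V"
  by (rule mhomI) auto

lemma mhom_comp:
  "\<phi> \<in> module_hom k V W \<Longrightarrow> \<psi> \<in> module_hom k W X \<Longrightarrow> (\<lambda>x. \<psi> (\<phi> x)) \<in> module_hom k V X"
  unfolding module_hom_def by (auto simp: Pi_iff)

lemma mhom_0: assumes "module k W" shows "(\<lambda>x. \<zero>\<^bsub>W\<^esub>) \<in> module_hom k V W"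
proof -
  interpret W: module k W by fact
  show ?thesis by (rule mhomI) auto
qed

lemma mhom_sum:
  assumes "module k W" "\<phi> \<in> module_hom k V W" "\<psi> \<in> module_hom k V W"
  shows "(\<lambda>x. \<phi> x \<oplus>\<^bsub>W\<^esub> \<psi> x) \<in> module_hom k V W"
proof -
  interpret W: module k W by fact
  show ?thesis
    using assms(2,3)
    by (intro mhomI) (auto simp: mhom_closed mhom_add mhom_smult W.smult_r_distr W.a_ac)
qed

lemma mhom_scale:
  assumes "module k W" "\<phi> \<in> module_hom k V W" "c \<in> carrier k"
  shows "(\<lambda>x. c \<odot>\<^bsub>W\<^esub> \<phi> x) \<in> module_hom k V W"
proof -
  interpret W: module k W by fact
  show ?thesis
    using assms(2,3)
    by (intro mhomI)
       (auto simp: mhom_closed mhom_add mhom_smult W.smult_r_distr W.smult_assoc1[symmetric] W.R.m_comm)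
qed

lemma mhom_neg:
  assumes "module k W" "\<phi> \<in> module_hom k V W"
  shows "(\<lambda>x. \<ominus>\<^bsub>W\<^esub> \<phi> x) \<in> module_hom k V W"
proof -
  interpret W: module k W by fact
  show ?thesis
    using assms(2)
    by (intro mhomI)
       (auto simp: mhom_closed mhom_add mhom_smult W.minus_add W.smult_r_minus)
qed

lemma mhom_cong:
  assumes "module k V" "\<phi> \<in> module_hom k V W" "\<And>x. x \<in> carrier V \<Longrightarrow> \<psi> x = \<phi> x"
  shows "\<psi> \<in> module_hom k V W"
proof -
  interpret V: module k V by fact
  show ?thesis using assms(2,3) by (intro mhomI) (auto simp: mhom_closed mhom_add mhom_smult)
qed

lemma mhom_finite_sum:
  assumes V: "module k V" and W: "module k W" and \<phi>: "\<And>i. i \<in> B \<Longrightarrow> \<phi> i \<in> module_hom k V W"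
  shows "(\<lambda>x. \<Oplus>\<^bsub>W\<^esub>i\<in>B. \<phi> i x) \<in> module_hom k V W"
proof -
  interpret W: module k W by fact
  show ?thesis
  proof (cases "finite B")
    case True
    then show ?thesis using \<phi>
    proof (induction B)
      case empty
      then show ?case using mhom_0[OF W] by simp
    next
      case (insert i F)
      then have *: "(\<lambda>x. \<phi> i x \<oplus>\<^bsub>W\<^esub> (\<Oplus>\<^bsub>W\<^esub>i\<in>F. \<phi> i x)) \<in> module_hom k V W"
        by (intro mhom_sum[OF W]) auto
      have "(\<Oplus>\<^bsub>W\<^esub>j\<in>insert i F. \<phi> j x) = \<phi> i x \<oplus>\<^bsub>W\<^esub> (\<Oplus>\<^bsub>W\<^esub>j\<in>F. \<phi> j x)" if "x \<in> carrier V" for x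
        using insert that by (subst W.finsum_insert) (auto simp: mhom_closed[OF insert.prems])
      then show ?case by (rule mhom_cong[OF V *])
    qed
  next
    case False
    then show ?thesis using mhom_0[OF W] by (simp add: W.finsum_infinite)
  qed
qed

subsection \<open>Submodules and generators\<close>

lemma submoduleI':
  assumes V: "module k V" and "N \<subseteq> carrier V" "\<zero>\<^bsub>V\<^esub> \<in> N"
    and "\<And>x y. x \<in> N \<Longrightarrow> y \<in> N \<Longrightarrow> x \<oplus>\<^bsub>V\<^esub> y \<in> N"
    and sm: "\<And>c x. c \<in> carrier k \<Longrightarrow> x \<in> N \<Longrightarrow> c \<odot>\<^bsub>V\<^esub> x \<in> N"
  shows "submodule N k V"
proof -
  interpret V: module k V by fact
  have "\<ominus>\<^bsub>V\<^esub> x \<in> N" if "x \<in> N" for x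
  proof -
    have "\<ominus>\<^bsub>V\<^esub> x = (\<ominus>\<^bsub>k\<^esub> \<one>\<^bsub>k\<^esub>) \<odot>\<^bsub>V\<^esub> x"
      using that assms(2) by (subst V.smult_l_minus) auto
    then show ?thesis using sm[of "\<ominus>\<^bsub>k\<^esub> \<one>\<^bsub>k\<^esub>" x] that by simp
  qed
  then show ?thesis using assms by (intro V.submoduleI) auto
qed

lemma submoduleD:
  assumes "module k V" "submodule N k V"
  shows "N \<subseteq> carrier V" "\<zero>\<^bsub>V\<^esub> \<in> N"
    and "\<And>x y. x \<in> N \<Longrightarrow> y \<in> N \<Longrightarrow> x \<oplus>\<^bsub>V\<^esub> y \<in> N"
    and "\<And>x y. x \<in> N \<Longrightarrow> y \<in> N \<Longrightarrow> x \<ominus>\<^bsub>V\<^esub> y \<in> N"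
    and "\<And>c x. c \<in> carrier k \<Longrightarrow> x \<in> N \<Longrightarrow> c \<odot>\<^bsub>V\<^esub> x \<in> N"
    and "\<And>x. x \<in> N \<Longrightarrow> \<ominus>\<^bsub>V\<^esub> x \<in> N"
proof -
  interpret V: module k V by fact
  note E = V.submoduleE[OF assms(2)]
  show "N \<subseteq> carrier V" by (rule E)
  show "\<And>x. x \<in> N \<Longrightarrow> \<ominus>\<^bsub>V\<^esub> x \<in> N" by (rule E)
  show a: "\<And>x y. x \<in> N \<Longrightarrow> y \<in> N \<Longrightarrow> x \<oplus>\<^bsub>V\<^esub> y \<in> N" by (rule E)
  then show "\<And>x y. x \<in> N \<Longrightarrow> y \<in> N \<Longrightarrow> x \<ominus>\<^bsub>V\<^esub> y \<in> N" unfolding a_minus_def using E by blast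
  show "\<And>c x. c \<in> carrier k \<Longrightarrow> x \<in> N \<Longrightarrow> c \<odot>\<^bsub>V\<^esub> x \<in> N" using E by blast
  obtain x where x: "x \<in> N" using E(2) by auto
  have "\<zero>\<^bsub>k\<^esub> \<odot>\<^bsub>V\<^esub> x \<in> N" by (rule E(4)) (use x in auto)
  then show "\<zero>\<^bsub>V\<^esub> \<in> N" using x E(1) by (simp add: subset_iff)
qed

lemma span_of_submodule:
  assumes "module k V" "B \<subseteq> carrier V"
  shows "submodule (span_of k V B) k V"
proof -
  have c: "submodule (carrier V) k V" using assms(1) module.carrier_is_submodule by blast
  show ?thesis
  proof (rule submoduleI'[OF assms(1)])
    show "span_of k V B \<subseteq> carrier V" unfolding span_of_def using c assms(2) by auto
    show "\<zero>\<^bsub>V\<^esub> \<in> span_of k V B" unfolding span_of_def using submoduleD(2)[OF assms(1)] by auto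
    show "x \<oplus>\<^bsub>V\<^esub> y \<in> span_of k V B" if "x \<in> span_of k V B" "y \<in> span_of k V B" for x y
      using that unfolding span_of_def using submoduleD(3)[OF assms(1)] by auto
    show "c \<odot>\<^bsub>V\<^esub> y \<in> span_of k V B" if "c \<in> carrier k" "y \<in> span_of k V B" for c y
      using that unfolding span_of_def using submoduleD(5)[OF assms(1)] by auto
  qed
qed

lemma span_of_incl: "B \<subseteq> span_of k V B"
  unfolding span_of_def by auto

lemma mhom_kernel:
  assumes "module k V" "module k W" "\<phi> \<in> module_hom k V W"
  shows "submodule {x \<in> carrier V. \<phi> x = \<zero>\<^bsub>W\<^esub>} k V"
proof -
  interpret V: module k V by fact
  interpret W: module k W by fact
  show ?thesis
    by (rule submoduleI'[OF assms(1)])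
      (auto simp: mhom_zero[OF assms] mhom_add[OF assms(3)] mhom_smult[OF assms(3)])
qed

lemma mhom_image:
  assumes "module k V" "module k W" "\<phi> \<in> module_hom k V W"
  shows "submodule (\<phi> ` carrier V) k W"
proof -
  interpret V: module k V by fact
  interpret W: module k W by fact
  show ?thesis
  proof (rule submoduleI'[OF assms(2)])
    show "\<phi> ` carrier V \<subseteq> carrier W" using mhom_closed[OF assms(3)] by auto
    show "\<zero>\<^bsub>W\<^esub> \<in> \<phi> ` carrier V" using mhom_zero[OF assms] by (metis V.M.zero_closed imageI)
    show "x \<oplus>\<^bsub>W\<^esub> y \<in> \<phi> ` carrier V" if "x \<in> \<phi> ` carrier V" "y \<in> \<phi> ` carrier V" for x y
      using that by (auto simp: mhom_add[OF assms(3), symmetric])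
    show "c \<odot>\<^bsub>W\<^esub> y \<in> \<phi> ` carrier V" if "c \<in> carrier k" "y \<in> \<phi> ` carrier V" for c y
      using that by (auto simp: mhom_smult[OF assms(3), symmetric])
  qed
qed

lemma span_of_kill:
  assumes "module k V" "module k W" "\<phi> \<in> module_hom k V W"
    and "B \<subseteq> carrier V" "\<And>b. b \<in> B \<Longrightarrow> \<phi> b = \<zero>\<^bsub>W\<^esub>" "x \<in> span_of k V B"
  shows "\<phi> x = \<zero>\<^bsub>W\<^esub>"
proof -
  have "span_of k V B \<subseteq> {x \<in> carrier V. \<phi> x = \<zero>\<^bsub>W\<^esub>}"
    unfolding span_of_def using mhom_kernel[OF assms(1-3)] assms(4,5) by blast
  then show ?thesis using assms(6) by auto
qed

text \<open>
  Generation is expressed through submodules instead of linear combinations, so that linear maps can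
  be compared on generators, and generators can be carried along surjections, without mentioning
  sums.
\<close>

definition generates ::
    "('k, 'r) ring_scheme \<Rightarrow> ('k, 'v, 's) module_scheme \<Rightarrow> 'v set \<Rightarrow> bool" where
  "generates k V G \<longleftrightarrow> G \<subseteq> carrier V \<and> (\<forall>N. submodule N k V \<longrightarrow> G \<subseteq> N \<longrightarrow> carrier V \<subseteq> N)"

lemma generatesD: "generates k V G \<Longrightarrow> submodule N k V \<Longrightarrow> G \<subseteq> N \<Longrightarrow> x \<in> carrier V \<Longrightarrow> x \<in> N"
  unfolding generates_def by auto

lemma generates_carrier: "generates k V G \<Longrightarrow> g \<in> G \<Longrightarrow> g \<in> carrier V"
  unfolding generates_def by auto

lemma generates_induct [consumes 3, case_names zero add smult gen]:
  assumes "generates k V G" "module k V" "x \<in> carrier V"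
    and "P \<zero>\<^bsub>V\<^esub>"
    and "\<And>x y. x \<in> carrier V \<Longrightarrow> y \<in> carrier V \<Longrightarrow> P x \<Longrightarrow> P y \<Longrightarrow> P (x \<oplus>\<^bsub>V\<^esub> y)"
    and "\<And>c x. c \<in> carrier k \<Longrightarrow> x \<in> carrier V \<Longrightarrow> P x \<Longrightarrow> P (c \<odot>\<^bsub>V\<^esub> x)"
    and "\<And>g. g \<in> G \<Longrightarrow> P g"
  shows "P x"
proof -
  interpret V: module k V by fact
  have "submodule {x \<in> carrier V. P x} k V"
    by (rule submoduleI'[OF assms(2)]) (use assms in auto)
  then have "x \<in> {x \<in> carrier V. P x}"
    by (rule generatesD[OF assms(1)]) (use assms generates_carrier[OF assms(1)] in auto)
  then show ?thesis by auto
qed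

lemma mhom_eq_on_generators:
  assumes "generates k V G" "module k V" "module k W"
    and "\<phi> \<in> module_hom k V W" "\<psi> \<in> module_hom k V W"
    and "\<And>g. g \<in> G \<Longrightarrow> \<phi> g = \<psi> g" "x \<in> carrier V"
  shows "\<phi> x = \<psi> x"
  using assms(1,2,7)
proof (induction rule: generates_induct)
  case zero
  then show ?case by (simp add: mhom_zero[OF assms(2,3)] assms(4,5))
qed (use assms(4,5,6) in \<open>auto simp: mhom_add mhom_smult\<close>)

lemma generates_image:
  assumes "generates k V G" "module k V" "module k W" "\<phi> \<in> module_hom k V W"
    and "carrier W \<subseteq> \<phi> ` carrier V" "\<And>g. g \<in> G \<Longrightarrow> \<phi> g \<in> H" "H \<subseteq> carrier W"
  shows "generates k W H"
  unfolding generates_def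
proof (intro conjI allI impI subsetI)
  fix N y assume N: "submodule N k W" "H \<subseteq> N" and y: "y \<in> carrier W"
  obtain x where x: "x \<in> carrier V" "y = \<phi> x" using y assms(5) by auto
  note D = submoduleD[OF assms(3) N(1)]
  have "\<phi> x \<in> N" using assms(1,2) x(1)
  proof (induction rule: generates_induct)
    case zero
    then show ?case using D(2) by (simp add: mhom_zero[OF assms(2-4)])
  qed (use D N assms in \<open>auto simp: mhom_add mhom_smult\<close>)
  then show "y \<in> N" using x by simp
qed (use assms in auto)

lemma generates_trans:
  assumes "generates k V G" "H \<subseteq> carrier V" "module k V"
    and "\<And>N g. submodule N k V \<Longrightarrow> H \<subseteq> N \<Longrightarrow> g \<in> G \<Longrightarrow> g \<in> N"
  shows "generates k V H"
  using assms unfolding generates_def by blast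

lemma submodule_vimage:
  assumes "module k V" "module k W" "\<phi> \<in> module_hom k V W" "submodule N k W"
  shows "submodule {x \<in> carrier V. \<phi> x \<in> N} k V"
proof -
  interpret V: module k V by fact
  note D = submoduleD[OF assms(2,4)]
  show ?thesis
    by (rule submoduleI'[OF assms(1)])
      (use D in \<open>auto simp: mhom_zero[OF assms(1-3)] mhom_add[OF assms(3)] mhom_smult[OF assms(3)]\<close>)
qed

lemma linear_extension_eq:
  assumes "module k V" "module k W" "generates k V (g ` S)"
    and "\<phi> \<in> module_hom k V W" "\<And>s. s \<in> S \<Longrightarrow> \<phi> (g s) = h s"
  shows "linear_extension k V W S g h = restrict \<phi> (carrier V)"
  unfolding linear_extension_def
proof (rule the_equality)
  interpret V: module k V by fact
  have g: "s \<in> S \<Longrightarrow> g s \<in> carrier V" for s using generates_carrier[OF assms(3)] by auto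
  have "restrict \<phi> (carrier V) \<in> module_hom k V W"
    using assms(4) by (intro mhomI) (auto simp: mhom_closed mhom_add mhom_smult)
  then show "restrict \<phi> (carrier V) \<in> module_hom k V W \<inter> extensional (carrier V) \<and>
      (\<forall>s\<in>S. restrict \<phi> (carrier V) (g s) = h s)"
    using assms(5) g by auto
  fix \<psi> assume \<psi>: "\<psi> \<in> module_hom k V W \<inter> extensional (carrier V) \<and> (\<forall>s\<in>S. \<psi> (g s) = h s)"
  have "\<psi> x = \<phi> x" if "x \<in> carrier V" for x
    by (rule mhom_eq_on_generators[OF assms(3,1,2) _ assms(4) _ that]) (use \<psi> assms(5) in auto)
  then show "\<psi> = restrict \<phi> (carrier V)"
    using \<psi> by (auto simp: extensional_def restrict_def fun_eq_iff)
qed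

text \<open>
  A description operator makes sense here only if the extension exists and is unique; generation
  gives uniqueness, and existence has to come from the universal property of the module at hand.
\<close>

lemma linear_extension_hom:
  assumes "module k V" "module k W" "generates k V (g ` S)"
    and "\<exists>\<phi>\<in>module_hom k V W. \<forall>s\<in>S. \<phi> (g s) = h s"
  shows "linear_extension k V W S g h \<in> module_hom k V W"
    and "s \<in> S \<Longrightarrow> linear_extension k V W S g h (g s) = h s"
proof -
  interpret V: module k V by fact
  obtain \<phi> where \<phi>: "\<phi> \<in> module_hom k V W" "\<And>s. s \<in> S \<Longrightarrow> \<phi> (g s) = h s" using assms(4) by auto
  have eq: "linear_extension k V W S g h = restrict \<phi> (carrier V)"
    by (rule linear_extension_eq[OF assms(1-3) \<phi>])
  show "linear_extension k V W S g h \<in> module_hom k V W"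
    unfolding eq using \<phi>(1) by (intro mhomI) (auto simp: mhom_closed mhom_add mhom_smult)
  show "s \<in> S \<Longrightarrow> linear_extension k V W S g h (g s) = h s"
    unfolding eq using \<phi>(2) generates_carrier[OF assms(3)] by auto
qed

subsection \<open>Quotient modules\<close>

text \<open>
  Both quotients and copies of a module inside another type arise in this way: the operations of the
  new module are forced by the surjection \<open>q\<close>.
\<close>

lemma module_image:
  assumes V: "module k V" and car: "carrier W = q ` carrier V"
    and add: "\<And>x y. x \<in> carrier V \<Longrightarrow> y \<in> carrier V \<Longrightarrow> q x \<oplus>\<^bsub>W\<^esub> q y = q (x \<oplus>\<^bsub>V\<^esub> y)"
    and zero: "\<zero>\<^bsub>W\<^esub> = q \<zero>\<^bsub>V\<^esub>"
    and smult: "\<And>c x. c \<in> carrier k \<Longrightarrow> x \<in> carrier V \<Longrightarrow> c \<odot>\<^bsub>W\<^esub> q x = q (c \<odot>\<^bsub>V\<^esub> x)"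
  shows "module k W" "q \<in> module_hom k V W"
proof -
  interpret V: module k V by fact
  have "\<exists>y\<in>q ` carrier V. y \<oplus>\<^bsub>W\<^esub> q x = q \<zero>\<^bsub>V\<^esub>" if "x \<in> carrier V" for x
    using that by (intro bexI[of _ "q (\<ominus>\<^bsub>V\<^esub> x)"]) (auto simp: add V.l_neg)
  then have ab: "abelian_group W"
    by (intro abelian_groupI) (auto simp: car add zero V.a_ac)
  show "module k W"
    by (rule moduleI)
      (auto simp: ab V.R.is_cring add smult car V.smult_l_distr V.smult_r_distr V.smult_assoc1)
  show "q \<in> module_hom k V W" by (rule mhomI) (auto simp: car add smult)
qed

lemma
  assumes V: "module k V" and N: "submodule N k V"
  shows quotient_module_module: "module k (quotient_module V N)"
    and coset_hom: "(\<lambda>x. N +>\<^bsub>V\<^esub> x) \<in> module_hom k V (quotient_module V N)"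
    and coset_surj: "carrier (quotient_module V N) = (\<lambda>x. N +>\<^bsub>V\<^esub> x) ` carrier V"
    and coset_eq_iff: "x \<in> carrier V \<Longrightarrow> y \<in> carrier V \<Longrightarrow> N +>\<^bsub>V\<^esub> x = N +>\<^bsub>V\<^esub> y \<longleftrightarrow> x \<ominus>\<^bsub>V\<^esub> y \<in> N"
    and quotient_zero: "\<zero>\<^bsub>quotient_module V N\<^esub> = N +>\<^bsub>V\<^esub> \<zero>\<^bsub>V\<^esub>"
proof -
  interpret V: module k V by fact
  note D = submoduleD[OF V N]
  have sg: "subgroup N (add_monoid V)" using N unfolding submodule_def by auto
  interpret N: abelian_subgroup N V
    by (rule abelian_subgroupI3)
       (auto intro: V.abelian_group_axioms additive_subgroup.intro sg)
  let ?q = "\<lambda>x. N +>\<^bsub>V\<^esub> x"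
  show car: "carrier (quotient_module V N) = ?q ` carrier V"
    unfolding quotient_module_def A_RCOSETS_def' by auto
  show eq: "?q x = ?q y \<longleftrightarrow> x \<ominus>\<^bsub>V\<^esub> y \<in> N" if xy: "x \<in> carrier V" "y \<in> carrier V" for x y
  proof
    assume "?q x = ?q y"
    then have "x \<in> ?q y" using N.a_rcos_self[OF xy(1)] by simp
    then obtain n where n: "n \<in> N" "x = n \<oplus>\<^bsub>V\<^esub> y" unfolding a_r_coset_def' by auto
    then have "x \<ominus>\<^bsub>V\<^esub> y = n" using xy D(1) by (auto simp: a_minus_def V.a_assoc V.r_neg)
    then show "x \<ominus>\<^bsub>V\<^esub> y \<in> N" using n by simp
  next
    assume n: "x \<ominus>\<^bsub>V\<^esub> y \<in> N"
    have "x = (x \<ominus>\<^bsub>V\<^esub> y) \<oplus>\<^bsub>V\<^esub> y" using xy by (auto simp: a_minus_def V.a_assoc V.l_neg)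
    then have "x \<in> ?q y" using n unfolding a_r_coset_def' by blast
    then show "?q x = ?q y" using V.a_repr_independence[OF _ xy(2) sg] by simp
  qed
  show z: "\<zero>\<^bsub>quotient_module V N\<^esub> = ?q \<zero>\<^bsub>V\<^esub>"
    unfolding quotient_module_def using D(1) by simp
  have smult: "c \<odot>\<^bsub>quotient_module V N\<^esub> ?q x = ?q (c \<odot>\<^bsub>V\<^esub> x)" if cx: "c \<in> carrier k" "x \<in> carrier V" for c x
  proof -
    have "?q (c \<odot>\<^bsub>V\<^esub> y) = ?q (c \<odot>\<^bsub>V\<^esub> x)" if yq: "y \<in> ?q x" for y
    proof -
      obtain n where n: "n \<in> N" "y = n \<oplus>\<^bsub>V\<^esub> x" using yq unfolding a_r_coset_def' by auto
      have "c \<odot>\<^bsub>V\<^esub> y \<ominus>\<^bsub>V\<^esub> c \<odot>\<^bsub>V\<^esub> x = c \<odot>\<^bsub>V\<^esub> n"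
        using n cx D(1) by (auto simp: V.smult_r_distr a_minus_def V.a_assoc V.r_neg)
      then show ?thesis using n cx D(1) D(5)[OF cx(1) n(1)] by (subst eq) auto
    qed
    moreover have "x \<in> ?q x" using cx N.a_rcos_self by auto
    ultimately have "(\<Union>y\<in>?q x. ?q (c \<odot>\<^bsub>V\<^esub> y)) = ?q (c \<odot>\<^bsub>V\<^esub> x)" by blast
    then show ?thesis unfolding quotient_module_def by simp
  qed
  have add: "?q x \<oplus>\<^bsub>quotient_module V N\<^esub> ?q y = ?q (x \<oplus>\<^bsub>V\<^esub> y)" if "x \<in> carrier V" "y \<in> carrier V" for x y
    unfolding quotient_module_def using N.a_rcos_sum[OF that] by simp
  show "module k (quotient_module V N)" "?q \<in> module_hom k V (quotient_module V N)"
    by (rule module_image[OF V car add z smult]; assumption)+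
qed

lemma quotient_lift:
  assumes V: "module k V" and N: "submodule N k V" and W: "module k W"
    and \<phi>: "\<phi> \<in> module_hom k V W" "\<And>x. x \<in> N \<Longrightarrow> \<phi> x = \<zero>\<^bsub>W\<^esub>"
  shows "\<exists>\<psi>\<in>module_hom k (quotient_module V N) W. \<forall>x\<in>carrier V. \<psi> (N +>\<^bsub>V\<^esub> x) = \<phi> x"
proof -
  interpret V: module k V by fact
  interpret W: module k W by fact
  let ?q = "\<lambda>x. N +>\<^bsub>V\<^esub> x"
  note q = coset_hom[OF V N]
  define \<psi> where "\<psi> X = \<phi> (SOME x. x \<in> carrier V \<and> X = ?q x)" for X
  have \<psi>: "\<psi> (?q x) = \<phi> x" if x: "x \<in> carrier V" for x
  proof -
    define y where "y = (SOME y. y \<in> carrier V \<and> ?q x = ?q y)"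
    have y: "y \<in> carrier V" "?q x = ?q y"
      using someI[of "\<lambda>y. y \<in> carrier V \<and> ?q x = ?q y" x] x unfolding y_def by auto
    then have "x \<ominus>\<^bsub>V\<^esub> y \<in> N" using coset_eq_iff[OF V N x] by simp
    then have "\<phi> x \<ominus>\<^bsub>W\<^esub> \<phi> y = \<zero>\<^bsub>W\<^esub>" using \<phi>(2) mhom_minus[OF V W \<phi>(1) x y(1)] by simp
    then have "\<phi> x = \<phi> y"
      using module_minus_eq_zero[OF W mhom_closed[OF \<phi>(1) x] mhom_closed[OF \<phi>(1) y(1)]] by simp
    then show ?thesis unfolding \<psi>_def y_def by simp
  qed
  have "\<psi> \<in> module_hom k (quotient_module V N) W"
  proof (rule mhomI)
    fix X assume "X \<in> carrier (quotient_module V N)"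
    then obtain x where x: "x \<in> carrier V" "X = ?q x" unfolding coset_surj[OF V N] by blast
    show "\<psi> X \<in> carrier W" unfolding x(2) \<psi>[OF x(1)] by (rule mhom_closed[OF \<phi>(1) x(1)])
    show "\<psi> (c \<odot>\<^bsub>quotient_module V N\<^esub> X) = c \<odot>\<^bsub>W\<^esub> \<psi> X" if c: "c \<in> carrier k" for c
      unfolding x(2) mhom_smult[OF q c x(1), symmetric] \<psi>[OF x(1)] \<psi>[OF V.smult_closed[OF c x(1)]]
      by (rule mhom_smult[OF \<phi>(1) c x(1)])
    fix Y assume "Y \<in> carrier (quotient_module V N)"
    then obtain y where y: "y \<in> carrier V" "Y = ?q y" unfolding coset_surj[OF V N] by blast
    show "\<psi> (X \<oplus>\<^bsub>quotient_module V N\<^esub> Y) = \<psi> X \<oplus>\<^bsub>W\<^esub> \<psi> Y"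
      unfolding x(2) y(2) mhom_add[OF q x(1) y(1), symmetric] \<psi>[OF x(1)] \<psi>[OF y(1)] \<psi>[OF V.a_closed[OF x(1) y(1)]]
      by (rule mhom_add[OF \<phi>(1) x(1) y(1)])
  qed
  then show ?thesis using \<psi> by auto
qed

lemma quotient_generates:
  assumes V: "module k V" and N: "submodule N k V" and "generates k V G"
  shows "generates k (quotient_module V N) ((\<lambda>x. N +>\<^bsub>V\<^esub> x) ` G)"
  by (rule generates_image[OF assms(3) V quotient_module_module[OF V N] coset_hom[OF V N]])
     (use coset_surj[OF V N] generates_carrier[OF assms(3)] in auto)

text \<open>
  This is how homology modules are compared. The hypotheses on \<open>\<phi>\<close> say, in terms of representatives,
  that it induces a well-defined, injective and surjective map.
\<close>

lemma quotient_iso: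
  assumes V: "module k V" and N: "submodule N k V" and W: "module k W" and N': "submodule N' k W"
    and \<phi>: "\<phi> \<in> module_hom k V W" "\<And>x. x \<in> carrier V \<Longrightarrow> \<phi> x \<in> N' \<longleftrightarrow> x \<in> N"
    and surj: "\<And>y. y \<in> carrier W \<Longrightarrow> \<exists>x\<in>carrier V. y \<ominus>\<^bsub>W\<^esub> \<phi> x \<in> N'"
  shows "\<exists>\<psi>. \<psi> \<in> module_iso k (quotient_module V N) (quotient_module W N')"
proof -
  interpret V: module k V by fact
  interpret W: module k W by fact
  let ?q = "\<lambda>x. N +>\<^bsub>V\<^esub> x" and ?r = "\<lambda>x. N' +>\<^bsub>W\<^esub> x"
  note Q = quotient_module_module[OF W N']
  have z: "?r (\<phi> x) = \<zero>\<^bsub>quotient_module W N'\<^esub>" if "x \<in> N" for x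
  proof -
    have x: "x \<in> carrier V" using that submoduleD(1)[OF V N] by auto
    show ?thesis
      unfolding quotient_zero[OF W N'] using \<phi>(2)[OF x] that mhom_closed[OF \<phi>(1) x]
      by (subst coset_eq_iff[OF W N']) (auto simp: module_minus_zero[OF W])
  qed
  obtain \<psi> where \<psi>: "\<psi> \<in> module_hom k (quotient_module V N) (quotient_module W N')"
    "\<And>x. x \<in> carrier V \<Longrightarrow> \<psi> (?q x) = ?r (\<phi> x)"
    using quotient_lift[OF V N Q mhom_comp[OF \<phi>(1) coset_hom[OF W N']] z] by auto
  have "inj_on \<psi> (carrier (quotient_module V N))"
  proof (rule inj_onI)
    fix X Y assume XY: "X \<in> carrier (quotient_module V N)" "Y \<in> carrier (quotient_module V N)" "\<psi> X = \<psi> Y"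
    obtain x y where x: "x \<in> carrier V" "X = ?q x" and y: "y \<in> carrier V" "Y = ?q y"
      using XY coset_surj[OF V N] by auto
    have "?r (\<phi> x) = ?r (\<phi> y)" using XY(3) \<psi>(2)[OF x(1)] \<psi>(2)[OF y(1)] x(2) y(2) by simp
    then have "\<phi> x \<ominus>\<^bsub>W\<^esub> \<phi> y \<in> N'"
      using coset_eq_iff[OF W N' mhom_closed[OF \<phi>(1) x(1)] mhom_closed[OF \<phi>(1) y(1)]] by simp
    then have "\<phi> (x \<ominus>\<^bsub>V\<^esub> y) \<in> N'" by (simp only: mhom_minus[OF V W \<phi>(1) x(1) y(1)])
    then have "x \<ominus>\<^bsub>V\<^esub> y \<in> N" using \<phi>(2)[of "x \<ominus>\<^bsub>V\<^esub> y"] x(1) y(1) by blast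
    then show "X = Y" unfolding x(2) y(2) using coset_eq_iff[OF V N x(1) y(1)] by simp
  qed
  moreover have "\<psi> ` carrier (quotient_module V N) = carrier (quotient_module W N')"
  proof (intro equalityI subsetI)
    fix Y assume "Y \<in> carrier (quotient_module W N')"
    then obtain y where y: "y \<in> carrier W" "Y = ?r y" using coset_surj[OF W N'] by auto
    obtain x where x: "x \<in> carrier V" "y \<ominus>\<^bsub>W\<^esub> \<phi> x \<in> N'" using surj[OF y(1)] by auto
    then have "Y = \<psi> (?q x)"
      unfolding \<psi>(2)[OF x(1)] y(2) using coset_eq_iff[OF W N' y(1) mhom_closed[OF \<phi>(1) x(1)]] by simp
    then show "Y \<in> \<psi> ` carrier (quotient_module V N)" using x coset_surj[OF V N] by blast
  qed (use mhom_closed[OF \<psi>(1)] in auto)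
  ultimately show ?thesis using \<psi>(1) unfolding module_iso_def bij_betw_def by auto
qed

subsection \<open>Free modules and direct sums\<close>

definition lin_comb ::
    "('k, 'r) ring_scheme \<Rightarrow> ('k, 'v, 's) module_scheme \<Rightarrow> ('b \<Rightarrow> 'v) \<Rightarrow> ('b \<Rightarrow> 'k) \<Rightarrow> 'v" where
  "lin_comb k V h u = (\<Oplus>\<^bsub>V\<^esub>s\<in>{s. u s \<noteq> \<zero>\<^bsub>k\<^esub>}. u s \<odot>\<^bsub>V\<^esub> h s)"

lemma free_module_module:
  assumes "cring k" shows "module k (free_module k S)"
proof -
  interpret cring k by fact
  have fin: "finite {s. u s \<oplus>\<^bsub>k\<^esub> v s \<noteq> \<zero>\<^bsub>k\<^esub>}" if "finite {s. u s \<noteq> \<zero>\<^bsub>k\<^esub>}" "finite {s. v s \<noteq> \<zero>\<^bsub>k\<^esub>}"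
    for u v :: "_ \<Rightarrow> _"
    by (rule finite_subset[OF _ finite_UnI[OF that]]) auto
  have fin2: "finite {s. c \<otimes>\<^bsub>k\<^esub> u s \<noteq> \<zero>\<^bsub>k\<^esub>}" if "finite {s. u s \<noteq> \<zero>\<^bsub>k\<^esub>}" "c \<in> carrier k" for c and u :: "_ \<Rightarrow> _"
    by (rule finite_subset[OF _ that(1)]) (use that(2) in auto)
  have neg: "\<exists>y\<in>carrier (free_module k S). y \<oplus>\<^bsub>free_module k S\<^esub> x = \<zero>\<^bsub>free_module k S\<^esub>"
    if "x \<in> carrier (free_module k S)" for x
  proof
    have "{s. \<ominus>\<^bsub>k\<^esub> x s \<noteq> \<zero>\<^bsub>k\<^esub>} \<subseteq> {s. x s \<noteq> \<zero>\<^bsub>k\<^esub>}" by auto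
    then show "(\<lambda>s. \<ominus>\<^bsub>k\<^esub> x s) \<in> carrier (free_module k S)"
      using that unfolding free_module_def by (auto intro: finite_subset)
    show "(\<lambda>s. \<ominus>\<^bsub>k\<^esub> x s) \<oplus>\<^bsub>free_module k S\<^esub> x = \<zero>\<^bsub>free_module k S\<^esub>"
      using that unfolding free_module_def by (auto simp: l_neg)
  qed
  have "abelian_group (free_module k S)"
    by (rule abelian_groupI[OF _ _ _ _ _ neg]) (auto simp: free_module_def fin a_ac)
  then show ?thesis
    by (intro moduleI) (auto simp: is_cring free_module_def fin2 l_distr r_distr m_assoc)
qed

lemma free_module_carrierD:
  assumes "u \<in> carrier (free_module k S)"
  shows "u s \<in> carrier k" "s \<notin> S \<Longrightarrow> u s = \<zero>\<^bsub>k\<^esub>" "finite {s. u s \<noteq> \<zero>\<^bsub>k\<^esub>}" "{s. u s \<noteq> \<zero>\<^bsub>k\<^esub>} \<subseteq> S"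
  using assms unfolding free_module_def by auto

lemma basis_elem_closed:
  assumes "cring k" "s \<in> S" shows "basis_elem k s \<in> carrier (free_module k S)"
proof -
  interpret cring k by fact
  have "finite {s'. basis_elem k s s' \<noteq> \<zero>\<^bsub>k\<^esub>}"
    by (rule finite_subset[of _ "{s}"]) (auto simp: basis_elem_def)
  then show ?thesis using assms(2) unfolding free_module_def by (auto simp: basis_elem_def)
qed

lemma lin_comb_superset:
  assumes "module k V" "u \<in> carrier (free_module k S)" "finite F" "{s. u s \<noteq> \<zero>\<^bsub>k\<^esub>} \<subseteq> F" "F \<subseteq> S" "h \<in> S \<rightarrow> carrier V"
  shows "lin_comb k V h u = (\<Oplus>\<^bsub>V\<^esub>s\<in>F. u s \<odot>\<^bsub>V\<^esub> h s)"
proof -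
  interpret V: module k V by fact
  show ?thesis
    unfolding lin_comb_def
    by (rule V.add.finprod_mono_neutral_cong_left)
       (use assms free_module_carrierD[OF assms(2)] in \<open>auto simp: Pi_iff subset_iff\<close>)
qed

lemma lin_comb_hom:
  assumes V: "module k V" and h: "h \<in> S \<rightarrow> carrier V"
  shows "lin_comb k V h \<in> module_hom k (free_module k S) V"
proof -
  interpret V: module k V by fact
  note D = free_module_carrierD
  note hS = funcset_mem[OF h]
  show ?thesis
  proof (rule mhomI)
    fix u assume u: "u \<in> carrier (free_module k S)"
    then show "lin_comb k V h u \<in> carrier V"
      unfolding lin_comb_def using h D[OF u] by (intro V.finsum_closed) auto
    fix c assume c: "c \<in> carrier k"
    have cu: "c \<odot>\<^bsub>free_module k S\<^esub> u \<in> carrier (free_module k S)"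
      using module.smult_closed[OF free_module_module[OF V.R.is_cring] c u] .
    have "lin_comb k V h (c \<odot>\<^bsub>free_module k S\<^esub> u) = (\<Oplus>\<^bsub>V\<^esub>s\<in>{s. u s \<noteq> \<zero>\<^bsub>k\<^esub>}. (c \<otimes>\<^bsub>k\<^esub> u s) \<odot>\<^bsub>V\<^esub> h s)"
      by (subst lin_comb_superset[OF V cu D(3)[OF u]])
         (use D[OF u] h c in \<open>auto simp: free_module_def\<close>)
    also have "\<dots> = (\<Oplus>\<^bsub>V\<^esub>s\<in>{s. u s \<noteq> \<zero>\<^bsub>k\<^esub>}. c \<odot>\<^bsub>V\<^esub> (u s \<odot>\<^bsub>V\<^esub> h s))"
      using D[OF u] hS c by (intro V.finsum_cong') (auto simp: V.smult_assoc1 subset_iff)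
    also have "\<dots> = c \<odot>\<^bsub>V\<^esub> lin_comb k V h u"
      unfolding lin_comb_def using D[OF u] hS c by (subst V.finsum_smult_ldistr) auto
    finally show "lin_comb k V h (c \<odot>\<^bsub>free_module k S\<^esub> u) = c \<odot>\<^bsub>V\<^esub> lin_comb k V h u" .
  next
    fix u v assume u: "u \<in> carrier (free_module k S)" and v: "v \<in> carrier (free_module k S)"
    interpret F: module k "free_module k S" by (rule free_module_module[OF V.R.is_cring])
    let ?F = "{s. u s \<noteq> \<zero>\<^bsub>k\<^esub>} \<union> {s. v s \<noteq> \<zero>\<^bsub>k\<^esub>}"
    have uv: "u \<oplus>\<^bsub>free_module k S\<^esub> v \<in> carrier (free_module k S)" using u v by simp
    have F: "finite ?F" "?F \<subseteq> S" using D[OF u] D[OF v] by auto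
    have "lin_comb k V h (u \<oplus>\<^bsub>free_module k S\<^esub> v) = (\<Oplus>\<^bsub>V\<^esub>s\<in>?F. (u s \<oplus>\<^bsub>k\<^esub> v s) \<odot>\<^bsub>V\<^esub> h s)"
      by (subst lin_comb_superset[OF V uv F(1) _ F(2) h])
         (use D[OF u] D[OF v] in \<open>auto simp: free_module_def\<close>)
    also have "\<dots> = (\<Oplus>\<^bsub>V\<^esub>s\<in>?F. u s \<odot>\<^bsub>V\<^esub> h s \<oplus>\<^bsub>V\<^esub> v s \<odot>\<^bsub>V\<^esub> h s)"
      using D(1)[OF u] D(1)[OF v] hS F by (intro V.finsum_cong') (auto simp: V.smult_l_distr subset_iff)
    also have "\<dots> = (\<Oplus>\<^bsub>V\<^esub>s\<in>?F. u s \<odot>\<^bsub>V\<^esub> h s) \<oplus>\<^bsub>V\<^esub> (\<Oplus>\<^bsub>V\<^esub>s\<in>?F. v s \<odot>\<^bsub>V\<^esub> h s)"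
      using D(1)[OF u] D(1)[OF v] hS F(2) by (intro V.finsum_addf) (auto simp: subset_iff Pi_iff)
    also have "(\<Oplus>\<^bsub>V\<^esub>s\<in>?F. u s \<odot>\<^bsub>V\<^esub> h s) = lin_comb k V h u"
      by (subst lin_comb_superset[OF V u F(1) _ F(2) h]) auto
    also have "(\<Oplus>\<^bsub>V\<^esub>s\<in>?F. v s \<odot>\<^bsub>V\<^esub> h s) = lin_comb k V h v"
      by (subst lin_comb_superset[OF V v F(1) _ F(2) h]) auto
    finally show "lin_comb k V h (u \<oplus>\<^bsub>free_module k S\<^esub> v) = lin_comb k V h u \<oplus>\<^bsub>V\<^esub> lin_comb k V h v" .
  qed
qed

lemma lin_comb_basis:
  assumes V: "module k V" and h: "h \<in> S \<rightarrow> carrier V" and s: "s \<in> S"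
  shows "lin_comb k V h (basis_elem k s) = h s"
proof -
  interpret V: module k V by fact
  have "lin_comb k V h (basis_elem k s) = (\<Oplus>\<^bsub>V\<^esub>s'\<in>{s}. basis_elem k s s' \<odot>\<^bsub>V\<^esub> h s')"
    by (rule lin_comb_superset[OF V basis_elem_closed[OF V.R.is_cring s] _ _ _ h])
       (use s in \<open>auto simp: basis_elem_def\<close>)
  also have "\<dots> = h s" using funcset_mem[OF h s] by (subst V.finsum_insert) (auto simp: basis_elem_def)
  finally show ?thesis .
qed

lemma free_module_generates:
  assumes "cring k" shows "generates k (free_module k S) (basis_elem k ` S)"
  unfolding generates_def
proof (intro conjI allI impI subsetI)
  interpret cring k by fact
  let ?F = "free_module k S"
  interpret F: module k ?F by (rule free_module_module) fact
  fix N u assume N: "submodule N k ?F" "basis_elem k ` S \<subseteq> N" and u: "u \<in> carrier ?F"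
  note D = submoduleD[OF F.module_axioms N(1)]
  have "\<forall>u\<in>carrier ?F. card {s. u s \<noteq> \<zero>\<^bsub>k\<^esub>} = n \<longrightarrow> u \<in> N" for n
  proof (induction n)
    case 0
    have "u = \<zero>\<^bsub>?F\<^esub>" if "u \<in> carrier ?F" "card {s. u s \<noteq> \<zero>\<^bsub>k\<^esub>} = 0" for u
      using that free_module_carrierD(3)[OF that(1)] by (auto simp: free_module_def)
    then show ?case using D(2) by auto
  next
    case (Suc n)
    show ?case
    proof (intro ballI impI)
      fix u assume u: "u \<in> carrier ?F" and c: "card {s. u s \<noteq> \<zero>\<^bsub>k\<^esub>} = Suc n"
      then obtain s where s: "u s \<noteq> \<zero>\<^bsub>k\<^esub>" by (metis (mono_tags, lifting) Collect_empty_eq card.empty nat.distinct(1))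
      note Du = free_module_carrierD[OF u]
      have sS: "s \<in> S" using s Du by auto
      let ?v = "u(s := \<zero>\<^bsub>k\<^esub>)"
      have e: "{t. ?v t \<noteq> \<zero>\<^bsub>k\<^esub>} = {t. u t \<noteq> \<zero>\<^bsub>k\<^esub>} - {s}" by auto
      have v: "?v \<in> carrier ?F" using u Du unfolding free_module_def mem_Collect_eq partial_object.simps e by auto
      have "card {t. ?v t \<noteq> \<zero>\<^bsub>k\<^esub>} = n" unfolding e using c s Du(3) by simp
      then have "?v \<in> N" using Suc v by auto
      moreover have "u s \<odot>\<^bsub>?F\<^esub> basis_elem k s \<in> N" using D(5) N(2) sS Du(1) by auto
      moreover have "u = ?v \<oplus>\<^bsub>?F\<^esub> u s \<odot>\<^bsub>?F\<^esub> basis_elem k s"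
        using Du(1) by (auto simp: free_module_def basis_elem_def)
      ultimately show "u \<in> N" using D(3) by metis
    qed
  qed
  then show "u \<in> N" using u by blast
qed (use basis_elem_closed[OF assms] in auto)

lemma basis_elem_inj:
  assumes "\<one>\<^bsub>k\<^esub> \<noteq> \<zero>\<^bsub>k\<^esub>" shows "inj (basis_elem k)"
  by (rule injI) (metis (full_types) assms basis_elem_def)

lemma direct_sum_module:
  assumes k: "cring k" and V: "\<And>j. j \<in> J \<Longrightarrow> module k (V j)"
  shows "module k (direct_sum J V)"
proof -
  interpret cring k by fact
  have ab: "abelian_group (V j)" if "j \<in> J" for j using V[OF that] by (rule module_abelian)
  have mon: "abelian_monoid (V j)" if "j \<in> J" for j using ab[OF that] by (simp add: abelian_group_def)
  note cl = abelian_monoid.a_closed[OF mon] abelian_monoid.zero_closed[OF mon]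
    module.smult_closed[OF V] abelian_monoid.l_zero[OF mon]
  let ?D = "direct_sum J V"
  have car: "u \<in> carrier ?D \<longleftrightarrow> u \<in> extensional J \<and> (\<forall>j\<in>J. u j \<in> carrier (V j)) \<and> finite {j \<in> J. u j \<noteq> \<zero>\<^bsub>V j\<^esub>}" for u
    by (auto simp: direct_sum_def PiE_iff)
  have op: "u \<oplus>\<^bsub>?D\<^esub> v = (\<lambda>j\<in>J. u j \<oplus>\<^bsub>V j\<^esub> v j)" "c \<odot>\<^bsub>?D\<^esub> u = (\<lambda>j\<in>J. c \<odot>\<^bsub>V j\<^esub> u j)"
     "\<zero>\<^bsub>?D\<^esub> = (\<lambda>j\<in>J. \<zero>\<^bsub>V j\<^esub>)" for u v c
    by (simp_all add: direct_sum_def)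
  have finI: "finite {j \<in> J. P j}" if "finite {j \<in> J. Q j}" "\<And>j. j \<in> J \<Longrightarrow> P j \<Longrightarrow> Q j" for P Q :: "'c \<Rightarrow> bool"
    by (rule finite_subset[OF _ that(1)]) (use that(2) in auto)
  have addc: "u \<oplus>\<^bsub>?D\<^esub> v \<in> carrier ?D" if "u \<in> carrier ?D" "v \<in> carrier ?D" for u v
  proof -
    have "finite ({j \<in> J. u j \<noteq> \<zero>\<^bsub>V j\<^esub>} \<union> {j \<in> J. v j \<noteq> \<zero>\<^bsub>V j\<^esub>})" using that by (auto simp: car)
    then have "finite {j \<in> J. u j \<oplus>\<^bsub>V j\<^esub> v j \<noteq> \<zero>\<^bsub>V j\<^esub>}" by (rule rev_finite_subset) (auto simp: cl)
    then have "finite {j \<in> J. (\<lambda>j\<in>J. u j \<oplus>\<^bsub>V j\<^esub> v j) j \<noteq> \<zero>\<^bsub>V j\<^esub>}" by (rule finI) auto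
    then show ?thesis using that unfolding car op by (auto simp: cl)
  qed
  have smc: "c \<odot>\<^bsub>?D\<^esub> u \<in> carrier ?D" if "c \<in> carrier k" "u \<in> carrier ?D" for c u
  proof -
    have "finite {j \<in> J. u j \<noteq> \<zero>\<^bsub>V j\<^esub>}" using that by (auto simp: car)
    then have "finite {j \<in> J. (\<lambda>j\<in>J. c \<odot>\<^bsub>V j\<^esub> u j) j \<noteq> \<zero>\<^bsub>V j\<^esub>}"
      by (rule finI) (use that in \<open>auto simp: module.smult_r_null[OF V]\<close>)
    then show ?thesis using that unfolding car op by (auto simp: cl)
  qed
  have ext: "u = v" if "u \<in> extensional J" "v \<in> extensional J" "\<And>j. j \<in> J \<Longrightarrow> u j = v j" for u v :: "'c \<Rightarrow> 'd"
    using that by (rule extensionalityI)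
  have neg: "\<exists>y\<in>carrier ?D. y \<oplus>\<^bsub>?D\<^esub> x = \<zero>\<^bsub>?D\<^esub>" if x: "x \<in> carrier ?D" for x
  proof
    have z: "\<ominus>\<^bsub>V j\<^esub> \<zero>\<^bsub>V j\<^esub> = \<zero>\<^bsub>V j\<^esub>" if "j \<in> J" for j
      using ab[OF that] by (simp add: abelian_group.minus_equality cl that)
    have "finite {j \<in> J. x j \<noteq> \<zero>\<^bsub>V j\<^esub>}" using x by (auto simp: car)
    then have "finite {j \<in> J. (\<lambda>j\<in>J. \<ominus>\<^bsub>V j\<^esub> x j) j \<noteq> \<zero>\<^bsub>V j\<^esub>}"
      by (rule finI) (auto simp: z)
    then show "(\<lambda>j\<in>J. \<ominus>\<^bsub>V j\<^esub> x j) \<in> carrier ?D"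
      using x unfolding car by (auto simp: abelian_group.a_inv_closed[OF ab])
    show "(\<lambda>j\<in>J. \<ominus>\<^bsub>V j\<^esub> x j) \<oplus>\<^bsub>?D\<^esub> x = \<zero>\<^bsub>?D\<^esub>"
      using x unfolding car op by (intro ext) (auto simp: abelian_group.l_neg[OF ab])
  qed
  have "abelian_group ?D"
  proof (rule abelian_groupI[OF addc _ _ _ _ neg])
    show "\<zero>\<^bsub>?D\<^esub> \<in> carrier ?D" unfolding car op by (auto simp: cl)
    fix x y z assume c: "x \<in> carrier ?D" "y \<in> carrier ?D" "z \<in> carrier ?D"
    show "(x \<oplus>\<^bsub>?D\<^esub> y) \<oplus>\<^bsub>?D\<^esub> z = x \<oplus>\<^bsub>?D\<^esub> (y \<oplus>\<^bsub>?D\<^esub> z)"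
      using c unfolding car op by (intro ext) (auto simp: abelian_monoid.a_assoc[OF mon])
    show "x \<oplus>\<^bsub>?D\<^esub> y = y \<oplus>\<^bsub>?D\<^esub> x"
      using c unfolding car op by (intro ext) (auto simp: abelian_monoid.a_comm[OF mon])
    show "\<zero>\<^bsub>?D\<^esub> \<oplus>\<^bsub>?D\<^esub> x = x"
      using c unfolding car op by (intro ext) (auto simp: cl)
  qed
  then show ?thesis
  proof (rule moduleI[OF k _ smc])
    fix a b x y assume c: "x \<in> carrier ?D" "y \<in> carrier ?D" and ab: "a \<in> carrier k" "b \<in> carrier k"
    show "(a \<oplus>\<^bsub>k\<^esub> b) \<odot>\<^bsub>?D\<^esub> x = a \<odot>\<^bsub>?D\<^esub> x \<oplus>\<^bsub>?D\<^esub> b \<odot>\<^bsub>?D\<^esub> x"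
      using c ab unfolding car op by (intro ext) (auto simp: module.smult_l_distr[OF V])
    show "a \<odot>\<^bsub>?D\<^esub> (x \<oplus>\<^bsub>?D\<^esub> y) = a \<odot>\<^bsub>?D\<^esub> x \<oplus>\<^bsub>?D\<^esub> a \<odot>\<^bsub>?D\<^esub> y"
      using c ab unfolding car op by (intro ext) (auto simp: module.smult_r_distr[OF V])
    show "(a \<otimes>\<^bsub>k\<^esub> b) \<odot>\<^bsub>?D\<^esub> x = a \<odot>\<^bsub>?D\<^esub> (b \<odot>\<^bsub>?D\<^esub> x)"
      using c ab unfolding car op by (intro ext) (auto simp: module.smult_assoc1[OF V])
  next
    fix x assume c: "x \<in> carrier ?D"
    show "\<one>\<^bsub>k\<^esub> \<odot>\<^bsub>?D\<^esub> x = x"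
      using c unfolding car op by (intro ext) (auto simp: module.smult_one[OF V])
  qed
qed

text \<open>
  Generation is proved by induction on the number of nonzero components, and the map out of the sum
  is the sum of the \<open>\<phi> j\<close> over the finitely many nonzero components.
\<close>

lemma
  assumes k: "cring k" and V: "\<And>j. j \<in> J \<Longrightarrow> module k (V j)"
  shows sum_inj_hom: "i \<in> J \<Longrightarrow> sum_inj J V i \<in> module_hom k (V i) (direct_sum J V)"
    and direct_sum_lift: "module k W \<Longrightarrow> (\<And>j. j \<in> J \<Longrightarrow> \<phi> j \<in> module_hom k (V j) W) \<Longrightarrow>
      \<exists>\<psi>\<in>module_hom k (direct_sum J V) W. \<forall>j\<in>J. \<forall>x\<in>carrier (V j). \<psi> (sum_inj J V j x) = \<phi> j x"
    and direct_sum_generates: "(\<And>j. j \<in> J \<Longrightarrow> generates k (V j) (G j)) \<Longrightarrow>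
      generates k (direct_sum J V) (\<Union>j\<in>J. sum_inj J V j ` G j)"
proof -
  interpret cring k by fact
  have ab: "abelian_group (V j)" if "j \<in> J" for j using V[OF that] by (rule module_abelian)
  have mon: "abelian_monoid (V j)" if "j \<in> J" for j using ab[OF that] by (simp add: abelian_group_def)
  note cl = abelian_monoid.a_closed[OF mon] abelian_monoid.zero_closed[OF mon]
    module.smult_closed[OF V] abelian_monoid.l_zero[OF mon] abelian_monoid.r_zero[OF mon]
    module.smult_r_null[OF V]
  let ?D = "direct_sum J V"
  have car: "u \<in> carrier ?D \<longleftrightarrow> u \<in> extensional J \<and> (\<forall>j\<in>J. u j \<in> carrier (V j)) \<and> finite {j \<in> J. u j \<noteq> \<zero>\<^bsub>V j\<^esub>}" for u
    by (auto simp: direct_sum_def PiE_iff)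
  have op: "u \<oplus>\<^bsub>?D\<^esub> v = (\<lambda>j\<in>J. u j \<oplus>\<^bsub>V j\<^esub> v j)" "c \<odot>\<^bsub>?D\<^esub> u = (\<lambda>j\<in>J. c \<odot>\<^bsub>V j\<^esub> u j)"
     "\<zero>\<^bsub>?D\<^esub> = (\<lambda>j\<in>J. \<zero>\<^bsub>V j\<^esub>)" for u v c
    by (simp_all add: direct_sum_def)
  have Dm: "module k ?D" by (rule direct_sum_module[OF k V])
  interpret D: module k ?D by (rule Dm)
  show inj: "sum_inj J V i \<in> module_hom k (V i) ?D" if i: "i \<in> J" for i
  proof (rule mhomI)
    fix x assume x: "x \<in> carrier (V i)"
    have "finite {j \<in> J. (if j = i then x else \<zero>\<^bsub>V j\<^esub>) \<noteq> \<zero>\<^bsub>V j\<^esub>}"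
      by (rule finite_subset[of _ "{i}"]) auto
    then show "sum_inj J V i x \<in> carrier ?D" using x i unfolding car sum_inj_def
      by (auto simp: cl cong: conj_cong)
    show "sum_inj J V i (c \<odot>\<^bsub>V i\<^esub> x) = c \<odot>\<^bsub>?D\<^esub> sum_inj J V i x" if c: "c \<in> carrier k" for c
      using x i c unfolding op sum_inj_def by (auto simp: cl fun_eq_iff)
    fix y assume y: "y \<in> carrier (V i)"
    show "sum_inj J V i (x \<oplus>\<^bsub>V i\<^esub> y) = sum_inj J V i x \<oplus>\<^bsub>?D\<^esub> sum_inj J V i y"
      using x y i unfolding op sum_inj_def by (auto simp: cl fun_eq_iff)
  qed
  show "generates k ?D (\<Union>j\<in>J. sum_inj J V j ` G j)" if G: "\<And>j. j \<in> J \<Longrightarrow> generates k (V j) (G j)"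
    unfolding generates_def
  proof (intro conjI allI impI subsetI)
    fix u assume "u \<in> (\<Union>j\<in>J. sum_inj J V j ` G j)"
    then show "u \<in> carrier ?D" using mhom_closed[OF inj] generates_carrier[OF G] by auto
  next
    fix N u assume N: "submodule N k ?D" "(\<Union>j\<in>J. sum_inj J V j ` G j) \<subseteq> N" and u: "u \<in> carrier ?D"
    note DN = submoduleD[OF Dm N(1)]
    have injN: "sum_inj J V j x \<in> N" if "j \<in> J" "x \<in> carrier (V j)" for j x
      using generatesD[OF G[OF that(1)] submodule_vimage[OF V[OF that(1)] Dm inj[OF that(1)] N(1)] _ that(2)]
        generates_carrier[OF G[OF that(1)]] N(2) that(1) by auto
    have "\<forall>u\<in>carrier ?D. card {j \<in> J. u j \<noteq> \<zero>\<^bsub>V j\<^esub>} = n \<longrightarrow> u \<in> N" for n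
    proof (induction n)
      case 0
      have "u = \<zero>\<^bsub>?D\<^esub>" if "u \<in> carrier ?D" "card {j \<in> J. u j \<noteq> \<zero>\<^bsub>V j\<^esub>} = 0" for u
        using that unfolding car op by (auto simp: fun_eq_iff extensional_def)
      then show ?case using DN(2) by auto
    next
      case (Suc n)
      show ?case
      proof (intro ballI impI)
        fix u assume u: "u \<in> carrier ?D" and c: "card {j \<in> J. u j \<noteq> \<zero>\<^bsub>V j\<^esub>} = Suc n"
        then obtain i where i: "i \<in> J" "u i \<noteq> \<zero>\<^bsub>V i\<^esub>"
          by (metis (mono_tags, lifting) Collect_empty_eq card.empty nat.distinct(1))
        let ?v = "u(i := \<zero>\<^bsub>V i\<^esub>)"
        have e: "{j \<in> J. ?v j \<noteq> \<zero>\<^bsub>V j\<^esub>} = {j \<in> J. u j \<noteq> \<zero>\<^bsub>V j\<^esub>} - {i}" by auto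
        have v: "?v \<in> carrier ?D" using u i(1) unfolding car e by (auto simp: cl extensional_def)
        have "card {j \<in> J. ?v j \<noteq> \<zero>\<^bsub>V j\<^esub>} = n" unfolding e using c i u[unfolded car] by simp
        then have "?v \<in> N" using Suc v by auto
        moreover have "sum_inj J V i (u i) \<in> N" using injN i u[unfolded car] by auto
        moreover have "u = ?v \<oplus>\<^bsub>?D\<^esub> sum_inj J V i (u i)"
          using u i unfolding car op sum_inj_def by (auto simp: fun_eq_iff extensional_def cl)
        ultimately show "u \<in> N" using DN(3) by metis
      qed
    qed
    then show "u \<in> N" using u by blast
  qed
  show "\<exists>\<psi>\<in>module_hom k ?D W. \<forall>j\<in>J. \<forall>x\<in>carrier (V j). \<psi> (sum_inj J V j x) = \<phi> j x"
    if W: "module k W" and \<phi>: "\<And>j. j \<in> J \<Longrightarrow> \<phi> j \<in> module_hom k (V j) W"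
  proof -
    interpret W: module k W by fact
    define \<psi> where "\<psi> u = (\<Oplus>\<^bsub>W\<^esub>j\<in>{j \<in> J. u j \<noteq> \<zero>\<^bsub>V j\<^esub>}. \<phi> j (u j))" for u
    note \<phi>0 = mhom_zero[OF V W \<phi>]
    have \<psi>: "\<psi> u = (\<Oplus>\<^bsub>W\<^esub>j\<in>F. \<phi> j (u j))"
      if "u \<in> carrier ?D" "finite F" "F \<subseteq> J" "{j \<in> J. u j \<noteq> \<zero>\<^bsub>V j\<^esub>} \<subseteq> F" for u F
      unfolding \<psi>_def
      by (rule W.add.finprod_mono_neutral_cong_left)
         (use that in \<open>auto simp: car \<phi>0 mhom_closed[OF \<phi>] subset_iff\<close>)
    have "\<psi> \<in> module_hom k ?D W"
    proof (rule mhomI)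
      fix u assume u: "u \<in> carrier ?D"
      let ?S = "{j \<in> J. u j \<noteq> \<zero>\<^bsub>V j\<^esub>}"
      have u': "finite ?S" "\<And>j. j \<in> J \<Longrightarrow> u j \<in> carrier (V j)" using u by (auto simp: car)
      show "\<psi> u \<in> carrier W" unfolding \<psi>_def using u' by (intro W.finsum_closed) (auto simp: mhom_closed[OF \<phi>])
      {
      fix c assume c: "c \<in> carrier k"
      have cu: "c \<odot>\<^bsub>?D\<^esub> u \<in> carrier ?D" using c u by simp
      have "\<psi> (c \<odot>\<^bsub>?D\<^esub> u) = (\<Oplus>\<^bsub>W\<^esub>j\<in>?S. \<phi> j ((c \<odot>\<^bsub>?D\<^esub> u) j))"
        by (rule \<psi>[OF cu u'(1)]) (use c u' in \<open>auto simp: op cl\<close>)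
      also have "\<dots> = (\<Oplus>\<^bsub>W\<^esub>j\<in>?S. c \<odot>\<^bsub>W\<^esub> \<phi> j (u j))"
        using c u' by (intro W.finsum_cong') (auto simp: op mhom_smult[OF \<phi>] mhom_closed[OF \<phi>])
      also have "\<dots> = c \<odot>\<^bsub>W\<^esub> \<psi> u"
        unfolding \<psi>_def using c u' by (subst W.finsum_smult_ldistr) (auto simp: mhom_closed[OF \<phi>])
      finally show "\<psi> (c \<odot>\<^bsub>?D\<^esub> u) = c \<odot>\<^bsub>W\<^esub> \<psi> u" .
      }
      fix v assume v: "v \<in> carrier ?D"
      let ?T = "{j \<in> J. v j \<noteq> \<zero>\<^bsub>V j\<^esub>}"
      have v': "finite ?T" "\<And>j. j \<in> J \<Longrightarrow> v j \<in> carrier (V j)" using v by (auto simp: car)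
      have F: "finite (?S \<union> ?T)" "?S \<union> ?T \<subseteq> J" using u' v' by auto
      have uv: "u \<oplus>\<^bsub>?D\<^esub> v \<in> carrier ?D" using u v by simp
      have "\<psi> (u \<oplus>\<^bsub>?D\<^esub> v) = (\<Oplus>\<^bsub>W\<^esub>j\<in>?S \<union> ?T. \<phi> j ((u \<oplus>\<^bsub>?D\<^esub> v) j))"
        by (rule \<psi>[OF uv F]) (auto simp: op cl)
      also have "\<dots> = (\<Oplus>\<^bsub>W\<^esub>j\<in>?S \<union> ?T. \<phi> j (u j) \<oplus>\<^bsub>W\<^esub> \<phi> j (v j))"
        using u' v' by (intro W.finsum_cong') (auto simp: op mhom_add[OF \<phi>] mhom_closed[OF \<phi>])
      also have "\<dots> = (\<Oplus>\<^bsub>W\<^esub>j\<in>?S \<union> ?T. \<phi> j (u j)) \<oplus>\<^bsub>W\<^esub> (\<Oplus>\<^bsub>W\<^esub>j\<in>?S \<union> ?T. \<phi> j (v j))"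
        using u' v' by (intro W.finsum_addf) (auto simp: mhom_closed[OF \<phi>])
      also have "(\<Oplus>\<^bsub>W\<^esub>j\<in>?S \<union> ?T. \<phi> j (u j)) = \<psi> u" by (rule \<psi>[OF u F, symmetric]) auto
      also have "(\<Oplus>\<^bsub>W\<^esub>j\<in>?S \<union> ?T. \<phi> j (v j)) = \<psi> v" by (rule \<psi>[OF v F, symmetric]) auto
      finally show "\<psi> (u \<oplus>\<^bsub>?D\<^esub> v) = \<psi> u \<oplus>\<^bsub>W\<^esub> \<psi> v" .
    qed
    moreover have "\<psi> (sum_inj J V j x) = \<phi> j x" if "j \<in> J" "x \<in> carrier (V j)" for j x
    proof -
      have "\<psi> (sum_inj J V j x) = (\<Oplus>\<^bsub>W\<^esub>i\<in>{j}. \<phi> i (sum_inj J V j x i))"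
        by (rule \<psi>[OF mhom_closed[OF inj[OF that(1)] that(2)]]) (use that in \<open>auto simp: sum_inj_def\<close>)
      also have "\<dots> = \<phi> j x"
        using that mhom_closed[OF \<phi>[OF that(1)] that(2)] by (subst W.finsum_insert) (auto simp: sum_inj_def)
      finally show ?thesis .
    qed
    ultimately show ?thesis by blast
  qed
qed

subsection \<open>Tensor products\<close>

definition bilinear_map where
  "bilinear_map k V W X \<beta> \<longleftrightarrow>
     (\<forall>y\<in>carrier W. (\<lambda>x. \<beta> x y) \<in> module_hom k V X) \<and> (\<forall>x\<in>carrier V. \<beta> x \<in> module_hom k W X)"

lemma bilinear_mapD:
  assumes "bilinear_map k V W X \<beta>"
  shows "y \<in> carrier W \<Longrightarrow> (\<lambda>x. \<beta> x y) \<in> module_hom k V X"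
    and "x \<in> carrier V \<Longrightarrow> \<beta> x \<in> module_hom k W X"
    and "x \<in> carrier V \<Longrightarrow> y \<in> carrier W \<Longrightarrow> \<beta> x y \<in> carrier X"
  using assms mhom_closed[of "\<beta> x" k W X y] unfolding bilinear_map_def by simp_all

lemma quotient_relation:
  assumes V: "module k V" and B: "B \<subseteq> carrier V" and xy: "x \<in> carrier V" "y \<in> carrier V" "x \<ominus>\<^bsub>V\<^esub> y \<in> B"
  shows "span_of k V B +>\<^bsub>V\<^esub> x = span_of k V B +>\<^bsub>V\<^esub> y"
  using coset_eq_iff[OF V span_of_submodule[OF V B] xy(1,2)] span_of_incl[of B k V] xy(3) by (simp add: subset_iff)

text \<open>
  The relators in the construction of the tensor product, as a single set to which the universal
  property of the span can be applied.
\<close>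

definition tensor_gens where
  "tensor_gens k V W = (let F = free_module k (carrier V \<times> carrier W); e = basis_elem k in
      ({e (x \<oplus>\<^bsub>V\<^esub> x', y) \<ominus>\<^bsub>F\<^esub> (e (x, y) \<oplus>\<^bsub>F\<^esub> e (x', y)) | x x' y.
          x \<in> carrier V \<and> x' \<in> carrier V \<and> y \<in> carrier W} \<union>
       {e (x, y \<oplus>\<^bsub>W\<^esub> y') \<ominus>\<^bsub>F\<^esub> (e (x, y) \<oplus>\<^bsub>F\<^esub> e (x, y')) | x y y'.
          x \<in> carrier V \<and> y \<in> carrier W \<and> y' \<in> carrier W} \<union>
       {e (c \<odot>\<^bsub>V\<^esub> x, y) \<ominus>\<^bsub>F\<^esub> c \<odot>\<^bsub>F\<^esub> e (x, y) | c x y.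
          c \<in> carrier k \<and> x \<in> carrier V \<and> y \<in> carrier W} \<union>
       {e (x, c \<odot>\<^bsub>W\<^esub> y) \<ominus>\<^bsub>F\<^esub> c \<odot>\<^bsub>F\<^esub> e (x, y) | c x y.
          c \<in> carrier k \<and> x \<in> carrier V \<and> y \<in> carrier W}))"

text \<open>
  A bilinear map extends to the free module on pairs and kills the relators; conversely the relators
  are what makes pure tensors bilinear.
\<close>

lemma
  assumes V: "module k V" and W: "module k W"
  shows tensor_module: "module k (tensor k V W)"
    and pure_tensor_bilinear: "bilinear_map k V W (tensor k V W) (pure_tensor k V W)"
    and tensor_lift: "module k X \<Longrightarrow> bilinear_map k V W X \<beta> \<Longrightarrow>
      \<exists>\<psi>\<in>module_hom k (tensor k V W) X. \<forall>x\<in>carrier V. \<forall>y\<in>carrier W. \<psi> (pure_tensor k V W x y) = \<beta> x y"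
    and tensor_generates: "generates k V G \<Longrightarrow> generates k W H \<Longrightarrow>
      generates k (tensor k V W) {pure_tensor k V W x y | x y. x \<in> G \<and> y \<in> H}"
proof -
  interpret V: module k V by fact
  interpret W: module k W by fact
  let ?S = "carrier V \<times> carrier W"
  let ?F = "free_module k ?S" and ?e = "basis_elem k" and ?B = "tensor_gens k V W"
  let ?N = "tensor_rel k V W" and ?T = "tensor k V W" and ?p = "pure_tensor k V W"
  have Fm: "module k ?F" by (rule free_module_module[OF V.R.is_cring])
  interpret F: module k ?F by fact
  have e: "?e (x, y) \<in> carrier ?F" if "x \<in> carrier V" "y \<in> carrier W" for x y
    using that by (intro basis_elem_closed[OF V.R.is_cring]) auto
  have rel: "?N = span_of k ?F ?B"
    unfolding tensor_rel_def tensor_gens_def Let_def by simp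
  have B: "?B \<subseteq> carrier ?F"
    unfolding tensor_gens_def Let_def by (auto intro!: e F.M.minus_closed F.smult_closed)
  have N: "submodule ?N k ?F" unfolding rel by (rule span_of_submodule[OF Fm B])
  show T: "module k ?T" unfolding tensor_def by (rule quotient_module_module[OF Fm N])
  have q: "(\<lambda>u. ?N +>\<^bsub>?F\<^esub> u) \<in> module_hom k ?F ?T" unfolding tensor_def by (rule coset_hom[OF Fm N])
  have p: "?p x y = ?N +>\<^bsub>?F\<^esub> ?e (x, y)" for x y unfolding pure_tensor_def ..
  have eq: "?N +>\<^bsub>?F\<^esub> u = ?N +>\<^bsub>?F\<^esub> v" if "u \<in> carrier ?F" "v \<in> carrier ?F" "u \<ominus>\<^bsub>?F\<^esub> v \<in> ?B" for u v
    unfolding rel by (rule quotient_relation[OF Fm B that])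
  have gens:
    "x \<in> carrier V \<Longrightarrow> x' \<in> carrier V \<Longrightarrow> y \<in> carrier W \<Longrightarrow>
      ?e (x \<oplus>\<^bsub>V\<^esub> x', y) \<ominus>\<^bsub>?F\<^esub> (?e (x, y) \<oplus>\<^bsub>?F\<^esub> ?e (x', y)) \<in> ?B"
    "x \<in> carrier V \<Longrightarrow> y \<in> carrier W \<Longrightarrow> y' \<in> carrier W \<Longrightarrow>
      ?e (x, y \<oplus>\<^bsub>W\<^esub> y') \<ominus>\<^bsub>?F\<^esub> (?e (x, y) \<oplus>\<^bsub>?F\<^esub> ?e (x, y')) \<in> ?B"
    "c \<in> carrier k \<Longrightarrow> x \<in> carrier V \<Longrightarrow> y \<in> carrier W \<Longrightarrow>
      ?e (c \<odot>\<^bsub>V\<^esub> x, y) \<ominus>\<^bsub>?F\<^esub> c \<odot>\<^bsub>?F\<^esub> ?e (x, y) \<in> ?B"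
    "c \<in> carrier k \<Longrightarrow> x \<in> carrier V \<Longrightarrow> y \<in> carrier W \<Longrightarrow>
      ?e (x, c \<odot>\<^bsub>W\<^esub> y) \<ominus>\<^bsub>?F\<^esub> c \<odot>\<^bsub>?F\<^esub> ?e (x, y) \<in> ?B" for x x' y y' c
    unfolding tensor_gens_def Let_def by blast+
  show bil: "bilinear_map k V W ?T ?p"
    unfolding bilinear_map_def
  proof (intro conjI ballI mhomI)
    fix x y assume x: "x \<in> carrier V" and y: "y \<in> carrier W"
    show c: "?p x y \<in> carrier ?T" unfolding p by (rule mhom_closed[OF q e[OF x y]])
    show "?p x y \<in> carrier ?T" by (rule c)
    show "?p (c \<odot>\<^bsub>V\<^esub> x) y = c \<odot>\<^bsub>?T\<^esub> ?p x y" if c: "c \<in> carrier k" for c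
      unfolding p mhom_smult[OF q c e[OF x y], symmetric]
      by (rule eq) (use x y c e in \<open>simp_all add: gens F.smult_closed\<close>)
    show "?p x (c \<odot>\<^bsub>W\<^esub> y) = c \<odot>\<^bsub>?T\<^esub> ?p x y" if c: "c \<in> carrier k" for c
      unfolding p mhom_smult[OF q c e[OF x y], symmetric]
      by (rule eq) (use x y c e in \<open>simp_all add: gens F.smult_closed\<close>)
    show "?p (x \<oplus>\<^bsub>V\<^esub> x') y = ?p x y \<oplus>\<^bsub>?T\<^esub> ?p x' y" if x': "x' \<in> carrier V" for x'
      unfolding p mhom_add[OF q e[OF x y] e[OF x' y], symmetric]
      by (rule eq) (use x x' y e in \<open>simp_all add: gens\<close>)
    show "?p x (y \<oplus>\<^bsub>W\<^esub> y') = ?p x y \<oplus>\<^bsub>?T\<^esub> ?p x y'" if y': "y' \<in> carrier W" for y'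
      unfolding p mhom_add[OF q e[OF x y] e[OF x y'], symmetric]
      by (rule eq) (use x y y' e in \<open>simp_all add: gens\<close>)
  qed
  show "\<exists>\<psi>\<in>module_hom k ?T X. \<forall>x\<in>carrier V. \<forall>y\<in>carrier W. \<psi> (?p x y) = \<beta> x y"
    if X: "module k X" and \<beta>: "bilinear_map k V W X \<beta>"
  proof -
    interpret X: module k X by fact
    let ?l = "lin_comb k X (\<lambda>(x, y). \<beta> x y)"
    have h: "(\<lambda>(x, y). \<beta> x y) \<in> ?S \<rightarrow> carrier X" using bilinear_mapD(3)[OF \<beta>] by auto
    note l = lin_comb_hom[OF X h]
    have le: "?l (?e (x, y)) = \<beta> x y" if "x \<in> carrier V" "y \<in> carrier W" for x y
      using lin_comb_basis[OF X h, of "(x, y)"] that by simp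
    note \<beta>' = bilinear_mapD(1,2)[OF \<beta>]
    note simps = mhom_minus[OF Fm X l] mhom_add[OF l] mhom_smult[OF l] le e module_minus_eq_zero[OF X]
      mhom_add[OF \<beta>'(1)] mhom_add[OF \<beta>'(2)] mhom_smult[OF \<beta>'(1)] mhom_smult[OF \<beta>'(2)] mhom_closed[OF \<beta>'(2)]
    have kill: "?l b = \<zero>\<^bsub>X\<^esub>" if "b \<in> ?B" for b
    proof -
      from that show ?thesis unfolding tensor_gens_def Let_def
        by (elim UnE CollectE exE conjE; hypsubst) (simp_all add: simps)
    qed
    have "?l b = \<zero>\<^bsub>X\<^esub>" if "b \<in> ?N" for b
      by (rule span_of_kill[OF Fm X l B kill that[unfolded rel]])
    from quotient_lift[OF Fm N X l this] obtain \<psi>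
      where "\<psi> \<in> module_hom k ?T X" "\<And>x. x \<in> carrier ?F \<Longrightarrow> \<psi> (?N +>\<^bsub>?F\<^esub> x) = ?l x"
      unfolding tensor_def by blast
    then show ?thesis unfolding p using e le by (intro bexI[of _ \<psi>]) simp_all
  qed
  show "generates k ?T {?p x y | x y. x \<in> G \<and> y \<in> H}" if G: "generates k V G" and H: "generates k W H"
  proof (rule generates_trans[OF quotient_generates[OF Fm N free_module_generates[OF V.R.is_cring]], folded tensor_def, OF _ T])
    note bil' = bilinear_mapD[OF bil]
    show "{?p x y | x y. x \<in> G \<and> y \<in> H} \<subseteq> carrier ?T"
      using generates_carrier[OF G] generates_carrier[OF H] bil'(3) by auto
    fix N' g assume N': "submodule N' k ?T" "{?p x y | x y. x \<in> G \<and> y \<in> H} \<subseteq> N'"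
      and "g \<in> (\<lambda>x. ?N +>\<^bsub>?F\<^esub> x) ` ?e ` ?S"
    then obtain x y where g: "g = ?p x y" and xy: "x \<in> carrier V" "y \<in> carrier W" unfolding p by auto
    have pN: "?p x y \<in> N'" if "x \<in> G" "y \<in> H" for x y using N'(2) that by blast
    have 1: "?p x y \<in> N'" if x: "x \<in> G" and y: "y \<in> carrier W" for x y
    proof -
      have xc: "x \<in> carrier V" using generates_carrier[OF G x] .
      have "y \<in> {y \<in> carrier W. ?p x y \<in> N'}"
        by (rule generatesD[OF H submodule_vimage[OF W T _ N'(1)] _ y])
           (use bil' xc pN[OF x] generates_carrier[OF H] in \<open>auto simp: subset_iff\<close>)
      then show ?thesis by simp
    qed
    have "x \<in> {x \<in> carrier V. ?p x y \<in> N'}"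
      by (rule generatesD[OF G submodule_vimage[OF V T _ N'(1)] _ xy(1)])
         (use bil' xy 1 generates_carrier[OF G] in auto)
    then show "g \<in> N'" using g by simp
  qed
qed

subsection \<open>Tensor powers\<close>

definition multilinear_map where
  "multilinear_map k V n X \<beta> \<longleftrightarrow>
     (\<forall>a\<in>tuples n (carrier V). \<beta> a \<in> carrier X) \<and>
     (\<forall>a\<in>tuples n (carrier V). \<forall>i\<in>{1..n}. (\<lambda>x. \<beta> (a(i := x))) \<in> module_hom k V X)"

lemma tuples_upd: "a \<in> tuples n S \<Longrightarrow> i \<in> {1..n} \<Longrightarrow> x \<in> S \<Longrightarrow> a(i := x) \<in> tuples n S"
  unfolding tuples_def by (auto simp: PiE_iff extensional_def)

definition tensor_power_gens where
  "tensor_power_gens k V n = (let F = free_module k (tuples n (carrier V)); e = basis_elem k in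
      ({e (a(i := x \<oplus>\<^bsub>V\<^esub> y)) \<ominus>\<^bsub>F\<^esub> (e (a(i := x)) \<oplus>\<^bsub>F\<^esub> e (a(i := y))) | a i x y.
          a \<in> tuples n (carrier V) \<and> i \<in> {1..n} \<and> x \<in> carrier V \<and> y \<in> carrier V} \<union>
       {e (a(i := c \<odot>\<^bsub>V\<^esub> x)) \<ominus>\<^bsub>F\<^esub> c \<odot>\<^bsub>F\<^esub> e (a(i := x)) | a i c x.
          a \<in> tuples n (carrier V) \<and> i \<in> {1..n} \<and> c \<in> carrier k \<and> x \<in> carrier V}))"

lemma
  assumes V: "module k V"
  shows tensor_power_module: "module k (tensor_power k V n)"
    and pure_power_multilinear: "multilinear_map k V n (tensor_power k V n) (pure_power k V n)"
    and tensor_power_lift: "module k X \<Longrightarrow> multilinear_map k V n X \<beta> \<Longrightarrow>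
      \<exists>\<psi>\<in>module_hom k (tensor_power k V n) X. \<forall>a\<in>tuples n (carrier V). \<psi> (pure_power k V n a) = \<beta> a"
    and tensor_power_generates: "generates k (tensor_power k V n) (pure_power k V n ` tuples n (carrier V))"
proof -
  interpret V: module k V by fact
  let ?S = "tuples n (carrier V)"
  let ?F = "free_module k ?S" and ?e = "basis_elem k" and ?B = "tensor_power_gens k V n"
  let ?N = "tensor_power_rel k V n" and ?T = "tensor_power k V n" and ?p = "pure_power k V n"
  have Fm: "module k ?F" by (rule free_module_module[OF V.R.is_cring])
  interpret F: module k ?F by fact
  have e: "?e a \<in> carrier ?F" if "a \<in> ?S" for a
    using that by (intro basis_elem_closed[OF V.R.is_cring]) auto
  have rel: "?N = span_of k ?F ?B"
    unfolding tensor_power_rel_def tensor_power_gens_def Let_def by simp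
  have B: "?B \<subseteq> carrier ?F"
    unfolding tensor_power_gens_def Let_def by (auto intro!: e F.M.minus_closed F.smult_closed tuples_upd)
  have N: "submodule ?N k ?F" unfolding rel by (rule span_of_submodule[OF Fm B])
  show T: "module k ?T" unfolding tensor_power_def by (rule quotient_module_module[OF Fm N])
  have q: "(\<lambda>u. ?N +>\<^bsub>?F\<^esub> u) \<in> module_hom k ?F ?T" unfolding tensor_power_def by (rule coset_hom[OF Fm N])
  have p: "?p a = ?N +>\<^bsub>?F\<^esub> ?e a" for a unfolding pure_power_def ..
  have eq: "?N +>\<^bsub>?F\<^esub> u = ?N +>\<^bsub>?F\<^esub> v" if "u \<in> carrier ?F" "v \<in> carrier ?F" "u \<ominus>\<^bsub>?F\<^esub> v \<in> ?B" for u v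
    unfolding rel by (rule quotient_relation[OF Fm B that])
  have gens:
    "a \<in> ?S \<Longrightarrow> i \<in> {1..n} \<Longrightarrow> x \<in> carrier V \<Longrightarrow> y \<in> carrier V \<Longrightarrow>
      ?e (a(i := x \<oplus>\<^bsub>V\<^esub> y)) \<ominus>\<^bsub>?F\<^esub> (?e (a(i := x)) \<oplus>\<^bsub>?F\<^esub> ?e (a(i := y))) \<in> ?B"
    "a \<in> ?S \<Longrightarrow> i \<in> {1..n} \<Longrightarrow> c \<in> carrier k \<Longrightarrow> x \<in> carrier V \<Longrightarrow>
      ?e (a(i := c \<odot>\<^bsub>V\<^esub> x)) \<ominus>\<^bsub>?F\<^esub> c \<odot>\<^bsub>?F\<^esub> ?e (a(i := x)) \<in> ?B" for a i x y c
    unfolding tensor_power_gens_def Let_def by blast+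
  show "multilinear_map k V n ?T ?p"
    unfolding multilinear_map_def
  proof (intro conjI ballI mhomI)
    fix a assume a: "a \<in> ?S"
    show "?p a \<in> carrier ?T" unfolding p by (rule mhom_closed[OF q e[OF a]])
    fix i x assume i: "i \<in> {1..n}" and x: "x \<in> carrier V"
    note ea = e[OF tuples_upd[OF a i]]
    show "?p (a(i := x)) \<in> carrier ?T" unfolding p by (rule mhom_closed[OF q ea[OF x]])
    show "?p (a(i := c \<odot>\<^bsub>V\<^esub> x)) = c \<odot>\<^bsub>?T\<^esub> ?p (a(i := x))" if c: "c \<in> carrier k" for c
      unfolding p mhom_smult[OF q c ea[OF x], symmetric]
      by (rule eq) (use a i x c ea in \<open>simp_all add: gens F.smult_closed\<close>)
    fix y assume y: "y \<in> carrier V"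
    show "?p (a(i := x \<oplus>\<^bsub>V\<^esub> y)) = ?p (a(i := x)) \<oplus>\<^bsub>?T\<^esub> ?p (a(i := y))"
      unfolding p mhom_add[OF q ea[OF x] ea[OF y], symmetric]
      by (rule eq) (use a i x y ea in \<open>simp_all add: gens\<close>)
  qed
  show "\<exists>\<psi>\<in>module_hom k ?T X. \<forall>a\<in>?S. \<psi> (?p a) = \<beta> a"
    if X: "module k X" and \<beta>: "multilinear_map k V n X \<beta>"
  proof -
    interpret X: module k X by fact
    let ?l = "lin_comb k X \<beta>"
    have h: "\<beta> \<in> ?S \<rightarrow> carrier X" using \<beta> unfolding multilinear_map_def by auto
    note l = lin_comb_hom[OF X h]
    note le = lin_comb_basis[OF X h]
    note \<beta>h = \<beta>[unfolded multilinear_map_def, THEN conjunct2, rule_format]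
    have kill: "?l b = \<zero>\<^bsub>X\<^esub>" if "b \<in> ?B" for b
      using that unfolding tensor_power_gens_def Let_def
      by (elim UnE CollectE exE conjE; hypsubst)
         (simp_all add: mhom_minus[OF Fm X l] mhom_add[OF l] mhom_smult[OF l] le tuples_upd e
            mhom_add[OF \<beta>h] mhom_smult[OF \<beta>h] mhom_closed[OF \<beta>h] module_minus_eq_zero[OF X])
    have "?l b = \<zero>\<^bsub>X\<^esub>" if "b \<in> ?N" for b
      by (rule span_of_kill[OF Fm X l B kill that[unfolded rel]])
    from quotient_lift[OF Fm N X l this] obtain \<psi>
      where "\<psi> \<in> module_hom k ?T X" "\<And>x. x \<in> carrier ?F \<Longrightarrow> \<psi> (?N +>\<^bsub>?F\<^esub> x) = ?l x"
      unfolding tensor_power_def by blast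
    then show ?thesis unfolding p using e le by (intro bexI[of _ \<psi>]) simp_all
  qed
  show "generates k ?T (?p ` ?S)"
    using quotient_generates[OF Fm N free_module_generates[OF V.R.is_cring]]
    unfolding tensor_power_def p image_image by simp
qed

subsection \<open>Products\<close>

definition prod_module ::
    "('k, 'v, 's) module_scheme \<Rightarrow> ('k, 'w, 't) module_scheme \<Rightarrow> ('k, 'v \<times> 'w) module" where
  "prod_module V W =
     \<lparr>carrier = carrier V \<times> carrier W, monoid.mult = undefined, one = undefined,
      ring.zero = (\<zero>\<^bsub>V\<^esub>, \<zero>\<^bsub>W\<^esub>), add = (\<lambda>x y. (fst x \<oplus>\<^bsub>V\<^esub> fst y, snd x \<oplus>\<^bsub>W\<^esub> snd y)),
      smult = (\<lambda>c x. (c \<odot>\<^bsub>V\<^esub> fst x, c \<odot>\<^bsub>W\<^esub> snd x))\<rparr>"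

lemma prod_module_simps [simp]:
  "carrier (prod_module V W) = carrier V \<times> carrier W"
  "\<zero>\<^bsub>prod_module V W\<^esub> = (\<zero>\<^bsub>V\<^esub>, \<zero>\<^bsub>W\<^esub>)"
  "x \<oplus>\<^bsub>prod_module V W\<^esub> y = (fst x \<oplus>\<^bsub>V\<^esub> fst y, snd x \<oplus>\<^bsub>W\<^esub> snd y)"
  "c \<odot>\<^bsub>prod_module V W\<^esub> x = (c \<odot>\<^bsub>V\<^esub> fst x, c \<odot>\<^bsub>W\<^esub> snd x)"
  by (simp_all add: prod_module_def)

lemma prod_module_module:
  assumes V: "module k V" and W: "module k W"
  shows "module k (prod_module V W)"
proof -
  interpret V: module k V by fact
  interpret W: module k W by fact
  have neg: "\<exists>y\<in>carrier (prod_module V W). y \<oplus>\<^bsub>prod_module V W\<^esub> x = \<zero>\<^bsub>prod_module V W\<^esub>"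
    if "x \<in> carrier (prod_module V W)" for x
    by (rule bexI[of _ "(\<ominus>\<^bsub>V\<^esub> fst x, \<ominus>\<^bsub>W\<^esub> snd x)"]) (use that in \<open>auto simp: V.l_neg W.l_neg\<close>)
  have "abelian_group (prod_module V W)"
    by (rule abelian_groupI[OF _ _ _ _ _ neg]) (auto simp: V.a_ac W.a_ac)
  then show ?thesis
    by (intro moduleI)
      (auto simp: V.R.is_cring V.smult_l_distr V.smult_r_distr V.smult_assoc1
         W.smult_l_distr W.smult_r_distr W.smult_assoc1)
qed

lemma
  assumes V: "module k V" and W: "module k W"
  shows inl_hom: "(\<lambda>x. (x, \<zero>\<^bsub>W\<^esub>)) \<in> module_hom k V (prod_module V W)"
    and inr_hom: "(\<lambda>y. (\<zero>\<^bsub>V\<^esub>, y)) \<in> module_hom k W (prod_module V W)"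
    and fst_hom: "fst \<in> module_hom k (prod_module V W) V"
    and snd_hom: "snd \<in> module_hom k (prod_module V W) W"
proof -
  interpret V: module k V by fact
  interpret W: module k W by fact
  show "(\<lambda>x. (x, \<zero>\<^bsub>W\<^esub>)) \<in> module_hom k V (prod_module V W)"
    "(\<lambda>y. (\<zero>\<^bsub>V\<^esub>, y)) \<in> module_hom k W (prod_module V W)"
    "fst \<in> module_hom k (prod_module V W) V" "snd \<in> module_hom k (prod_module V W) W"
    by (rule mhomI; auto)+
qed

lemma copair_hom:
  assumes "module k V" "module k W" "module k X" "\<phi> \<in> module_hom k V X" "\<psi> \<in> module_hom k W X"
  shows "(\<lambda>x. \<phi> (fst x) \<oplus>\<^bsub>X\<^esub> \<psi> (snd x)) \<in> module_hom k (prod_module V W) X"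
  by (rule mhom_sum[OF assms(3) mhom_comp[OF fst_hom[OF assms(1,2)] assms(4)]
        mhom_comp[OF snd_hom[OF assms(1,2)] assms(5)]])

lemma pair_hom:
  "\<phi> \<in> module_hom k X V \<Longrightarrow> \<psi> \<in> module_hom k X W \<Longrightarrow> (\<lambda>x. (\<phi> x, \<psi> x)) \<in> module_hom k X (prod_module V W)"
  by (rule mhomI) (auto simp: mhom_closed mhom_add mhom_smult)

section \<open>Coefficients of an augmented algebra\<close>

text \<open>
  The right action on a symmetric bimodule repeats the left one, so \<open>M\<close> enters as a left module.
\<close>

locale augmented_algebra =
  fixes k :: "'k ring" and A :: "('k, 'a) module" and M :: "('a, 'm) module" and \<epsilon> :: "'a \<Rightarrow> 'k"
  assumes k_cring: "cring k" and alg: "algebra k A" and AM: "module A M" and aug: "augmentation k A \<epsilon>"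
begin

sublocale k: cring k by (rule k_cring)
sublocale A: algebra k A by (rule alg)
sublocale M: module A M by (rule AM)

abbreviation I where "I \<equiv> a_kernel A k \<epsilon>"

lemma aug_simps:
  "a \<in> carrier A \<Longrightarrow> \<epsilon> a \<in> carrier k"
  "a \<in> carrier A \<Longrightarrow> b \<in> carrier A \<Longrightarrow> \<epsilon> (a \<oplus>\<^bsub>A\<^esub> b) = \<epsilon> a \<oplus>\<^bsub>k\<^esub> \<epsilon> b"
  "a \<in> carrier A \<Longrightarrow> b \<in> carrier A \<Longrightarrow> \<epsilon> (a \<otimes>\<^bsub>A\<^esub> b) = \<epsilon> a \<otimes>\<^bsub>k\<^esub> \<epsilon> b"
  "\<epsilon> \<one>\<^bsub>A\<^esub> = \<one>\<^bsub>k\<^esub>"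
  "c \<in> carrier k \<Longrightarrow> a \<in> carrier A \<Longrightarrow> \<epsilon> (c \<odot>\<^bsub>A\<^esub> a) = c \<otimes>\<^bsub>k\<^esub> \<epsilon> a"
  using aug unfolding augmentation_def ring_hom_def by auto

lemma aug_zero: "\<epsilon> \<zero>\<^bsub>A\<^esub> = \<zero>\<^bsub>k\<^esub>"
proof -
  have "\<epsilon> (\<zero>\<^bsub>k\<^esub> \<odot>\<^bsub>A\<^esub> \<zero>\<^bsub>A\<^esub>) = \<zero>\<^bsub>k\<^esub> \<otimes>\<^bsub>k\<^esub> \<epsilon> \<zero>\<^bsub>A\<^esub>" by (rule aug_simps) auto
  then show ?thesis by (simp add: aug_simps)
qed

lemma I_eq: "I = {a \<in> carrier A. \<epsilon> a = \<zero>\<^bsub>k\<^esub>}"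
  unfolding a_kernel_def' ..

lemma kA: "module k A" by (rule A.module)

lemma I_submodule: "submodule I k A"
  unfolding I_eq by (rule submoduleI'[OF kA]) (auto simp: aug_simps aug_zero)

lemma I_carrier: "a \<in> I \<Longrightarrow> a \<in> carrier A" by (simp add: I_eq)

lemma I_mult: "a \<in> I \<Longrightarrow> b \<in> carrier A \<Longrightarrow> a \<otimes>\<^bsub>A\<^esub> b \<in> I"
  by (auto simp: I_eq aug_simps)

lemma A_submodule: "submodule (carrier A) k A"
  by (rule A.carrier_is_submodule)

lemma sub_mod_module: "submodule J k A \<Longrightarrow> module k (sub_mod A J)"
  by (rule submodule.submodule_is_module[OF _ kA])

lemma restrict_scalars_simps [simp]:
  "carrier (restrict_scalars A M) = carrier M" "\<zero>\<^bsub>restrict_scalars A M\<^esub> = \<zero>\<^bsub>M\<^esub>"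
  "x \<oplus>\<^bsub>restrict_scalars A M\<^esub> y = x \<oplus>\<^bsub>M\<^esub> y" "c \<odot>\<^bsub>restrict_scalars A M\<^esub> x = (c \<odot>\<^bsub>A\<^esub> \<one>\<^bsub>A\<^esub>) \<odot>\<^bsub>M\<^esub> x"
  by (simp_all add: restrict_scalars_def)

lemma restrict_scalars_module: "module k (restrict_scalars A M)"
proof -
  have neg: "\<exists>y\<in>carrier (restrict_scalars A M). y \<oplus>\<^bsub>restrict_scalars A M\<^esub> x = \<zero>\<^bsub>restrict_scalars A M\<^esub>"
    if "x \<in> carrier (restrict_scalars A M)" for x
    by (rule bexI[of _ "\<ominus>\<^bsub>M\<^esub> x"]) (use that in \<open>auto simp: M.M.l_neg\<close>)
  have ab: "abelian_group (restrict_scalars A M)"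
    by (rule abelian_groupI[OF _ _ _ _ _ neg]) (auto simp: M.M.a_ac)
  have mult: "((a \<otimes>\<^bsub>k\<^esub> b) \<odot>\<^bsub>A\<^esub> \<one>\<^bsub>A\<^esub>) = (a \<odot>\<^bsub>A\<^esub> \<one>\<^bsub>A\<^esub>) \<otimes>\<^bsub>A\<^esub> (b \<odot>\<^bsub>A\<^esub> \<one>\<^bsub>A\<^esub>)"
    if "a \<in> carrier k" "b \<in> carrier k" for a b
    using that by (simp add: A.smult_assoc2 A.smult_assoc1)
  show ?thesis
    by (rule moduleI)
      (auto simp: k_cring ab A.smult_l_distr M.smult_l_distr M.smult_r_distr mult M.smult_assoc1)
qed

lemma smult_M_hom: "a \<in> carrier A \<Longrightarrow> (\<lambda>m. a \<odot>\<^bsub>M\<^esub> m) \<in> module_hom k (restrict_scalars A M) (restrict_scalars A M)"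
  by (rule mhomI) (auto simp: M.smult_r_distr M.smult_assoc1[symmetric] A.m_comm)

lemma smult_M_hom_left: "m \<in> carrier M \<Longrightarrow> (\<lambda>a. a \<odot>\<^bsub>M\<^esub> m) \<in> module_hom k A (restrict_scalars A M)"
proof (rule mhomI)
  fix c a assume "c \<in> carrier k" "a \<in> carrier A" and m: "m \<in> carrier M"
  then have "(c \<odot>\<^bsub>A\<^esub> a) = (c \<odot>\<^bsub>A\<^esub> \<one>\<^bsub>A\<^esub>) \<otimes>\<^bsub>A\<^esub> a" by (simp add: A.smult_assoc2)
  then show "(c \<odot>\<^bsub>A\<^esub> a) \<odot>\<^bsub>M\<^esub> m = c \<odot>\<^bsub>restrict_scalars A M\<^esub> (a \<odot>\<^bsub>M\<^esub> m)"
    using \<open>c \<in> _\<close> \<open>a \<in> _\<close> m by (simp add: M.smult_assoc1)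
qed (auto simp: M.smult_l_distr)

text \<open>
  These are the maps that correspond to linear maps out of \<open>J\<^sup>\<otimes>\<^sup>p \<otimes> M\<close>, which is
  \<open>RW_coeff k A J M p\<close>. The cases of interest are \<open>J = I\<close>, for the Robinson--Whitehouse complex, and
  \<open>J = A\<close>, for the Loday functor.
\<close>

definition mlin where
  "mlin J p X \<beta> \<longleftrightarrow>
     (\<forall>a\<in>tuples p J. \<beta> a \<in> module_hom k (restrict_scalars A M) X) \<and>
     (\<forall>a\<in>tuples p J. \<forall>i\<in>{1..p}. \<forall>m\<in>carrier M. (\<lambda>x. \<beta> (a(i := x)) m) \<in> module_hom k (sub_mod A J) X)"

lemma mlinI:
  assumes "\<And>a. a \<in> tuples p J \<Longrightarrow> \<beta> a \<in> module_hom k (restrict_scalars A M) X"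
    and "\<And>a i m. a \<in> tuples p J \<Longrightarrow> i \<in> {1..p} \<Longrightarrow> m \<in> carrier M \<Longrightarrow>
      (\<lambda>x. \<beta> (a(i := x)) m) \<in> module_hom k (sub_mod A J) X"
  shows "mlin J p X \<beta>"
  using assms unfolding mlin_def by blast

lemma mlinD:
  assumes "mlin J p X \<beta>" "a \<in> tuples p J"
  shows "\<beta> a \<in> module_hom k (restrict_scalars A M) X"
    and "m \<in> carrier M \<Longrightarrow> \<beta> a m \<in> carrier X"
    and "i \<in> {1..p} \<Longrightarrow> m \<in> carrier M \<Longrightarrow> (\<lambda>x. \<beta> (a(i := x)) m) \<in> module_hom k (sub_mod A J) X"
proof -
  show *: "\<beta> a \<in> module_hom k (restrict_scalars A M) X" using assms unfolding mlin_def by blast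
  show "m \<in> carrier M \<Longrightarrow> \<beta> a m \<in> carrier X" using mhom_closed[OF *] by simp
  show "i \<in> {1..p} \<Longrightarrow> m \<in> carrier M \<Longrightarrow> (\<lambda>x. \<beta> (a(i := x)) m) \<in> module_hom k (sub_mod A J) X"
    using assms unfolding mlin_def by blast
qed

lemma mlin_comp:
  assumes "mlin J p X \<beta>" "\<phi> \<in> module_hom k X Y"
  shows "mlin J p Y (\<lambda>a m. \<phi> (\<beta> a m))"
proof (rule mlinI)
  show "(\<lambda>m. \<phi> (\<beta> a m)) \<in> module_hom k (restrict_scalars A M) Y" if "a \<in> tuples p J" for a
    by (rule mhom_comp[OF mlinD(1)[OF assms(1) that] assms(2)])
  show "(\<lambda>x. \<phi> (\<beta> (a(i := x)) m)) \<in> module_hom k (sub_mod A J) Y"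
    if "a \<in> tuples p J" "i \<in> {1..p}" "m \<in> carrier M" for a i m
    by (rule mhom_comp[OF mlinD(3)[OF assms(1) that] assms(2)])
qed

lemma mlin_sum:
  assumes J: "submodule J k A" and X: "module k X" and \<beta>: "\<And>s. s \<in> B \<Longrightarrow> mlin J p X (\<beta> s)"
  shows "mlin J p X (\<lambda>a m. \<Oplus>\<^bsub>X\<^esub>s\<in>B. \<beta> s a m)"
proof (rule mlinI)
  show "(\<lambda>m. \<Oplus>\<^bsub>X\<^esub>s\<in>B. \<beta> s a m) \<in> module_hom k (restrict_scalars A M) X" if "a \<in> tuples p J" for a
    by (rule mhom_finite_sum[OF restrict_scalars_module X mlinD(1)[OF \<beta> that]])
  show "(\<lambda>x. \<Oplus>\<^bsub>X\<^esub>s\<in>B. \<beta> s (a(i := x)) m) \<in> module_hom k (sub_mod A J) X"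
    if "a \<in> tuples p J" "i \<in> {1..p}" "m \<in> carrier M" for a i m
    by (rule mhom_finite_sum[OF sub_mod_module[OF J] X mlinD(3)[OF \<beta> that]])
qed

lemma mlin_scale:
  assumes "module k X" "c \<in> carrier k" "mlin J p X \<beta>"
  shows "mlin J p X (\<lambda>a m. c \<odot>\<^bsub>X\<^esub> \<beta> a m)"
proof (rule mlinI)
  show "(\<lambda>m. c \<odot>\<^bsub>X\<^esub> \<beta> a m) \<in> module_hom k (restrict_scalars A M) X" if "a \<in> tuples p J" for a
    by (rule mhom_scale[OF assms(1) mlinD(1)[OF assms(3) that] assms(2)])
  show "(\<lambda>x. c \<odot>\<^bsub>X\<^esub> \<beta> (a(i := x)) m) \<in> module_hom k (sub_mod A J) X"
    if "a \<in> tuples p J" "i \<in> {1..p}" "m \<in> carrier M" for a i m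
    by (rule mhom_scale[OF assms(1) mlinD(3)[OF assms(3) that] assms(2)])
qed

lemma mlin_zero: "module k X \<Longrightarrow> mlin J p X (\<lambda>a m. \<zero>\<^bsub>X\<^esub>)"
  by (rule mlinI) (rule mhom_0, assumption)+

definition coeff_gen where
  "coeff_gen J p a m = pure_tensor k (tensor_power k (sub_mod A J) p) (restrict_scalars A M)
     (pure_power k (sub_mod A J) p a) m"

text \<open>
  The tensor power and the tensor product with \<open>M\<close> are combined into one universal property, for
  maps that are linear in each of \<open>p + 1\<close> arguments.
\<close>

lemma
  assumes J: "submodule J k A"
  shows coeff_module: "module k (RW_coeff k A J M p)"
    and coeff_gen_mlin: "mlin J p (RW_coeff k A J M p) (coeff_gen J p)"
    and coeff_lift: "module k X \<Longrightarrow> mlin J p X \<beta> \<Longrightarrow>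
      \<exists>\<psi>\<in>module_hom k (RW_coeff k A J M p) X. \<forall>a\<in>tuples p J. \<forall>m\<in>carrier M. \<psi> (coeff_gen J p a m) = \<beta> a m"
    and coeff_generates: "generates k (RW_coeff k A J M p) {coeff_gen J p a m | a m. a \<in> tuples p J \<and> m \<in> carrier M}"
proof -
  let ?V = "sub_mod A J" and ?M = "restrict_scalars A M"
  let ?T = "tensor_power k ?V p"
  note V = sub_mod_module[OF J] and Mm = restrict_scalars_module
  note T = tensor_power_module[OF V, of p]
  have carV: "carrier ?V = J" by simp
  note bil = bilinear_mapD[OF pure_tensor_bilinear[OF T Mm]]
  note pow = pure_power_multilinear[OF V, of p, unfolded multilinear_map_def carV]
  show "module k (RW_coeff k A J M p)"
    unfolding RW_coeff_def by (rule tensor_module[OF T Mm])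
  show "mlin J p (RW_coeff k A J M p) (coeff_gen J p)"
  proof (rule mlinI)
    fix a assume a: "a \<in> tuples p J"
    show "coeff_gen J p a \<in> module_hom k ?M (RW_coeff k A J M p)"
      unfolding RW_coeff_def coeff_gen_def[abs_def] using pow a by (intro bil(2)) blast
    fix i m assume i: "i \<in> {1..p}" and m: "m \<in> carrier M"
    have "(\<lambda>x. pure_power k ?V p (a(i := x))) \<in> module_hom k ?V ?T" using pow a i by blast
    from mhom_comp[OF this bil(1)[of m]] m
    show "(\<lambda>x. coeff_gen J p (a(i := x)) m) \<in> module_hom k ?V (RW_coeff k A J M p)"
      unfolding RW_coeff_def coeff_gen_def by simp
  qed
  show "\<exists>\<psi>\<in>module_hom k (RW_coeff k A J M p) X. \<forall>a\<in>tuples p J. \<forall>m\<in>carrier M. \<psi> (coeff_gen J p a m) = \<beta> a m"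
    if X: "module k X" and \<beta>: "mlin J p X \<beta>"
  proof -
    note \<beta>' = mlinD[OF \<beta>]
    have "\<exists>\<psi>\<in>module_hom k ?T X. \<forall>a\<in>tuples p J. \<psi> (pure_power k ?V p a) = \<beta> a m" if m: "m \<in> carrier M" for m
      using tensor_power_lift[OF V X, of p "\<lambda>a. \<beta> a m"] \<beta>' m
      by (simp add: multilinear_map_def)
    then obtain \<psi> where \<psi>: "\<And>m. m \<in> carrier M \<Longrightarrow> \<psi> m \<in> module_hom k ?T X"
      "\<And>a m. m \<in> carrier M \<Longrightarrow> a \<in> tuples p J \<Longrightarrow> \<psi> m (pure_power k ?V p a) = \<beta> a m"
      by metis
    note gen = tensor_power_generates[OF V, of p, unfolded carV]
    have "bilinear_map k ?T ?M X (\<lambda>t m. \<psi> m t)"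
      unfolding bilinear_map_def
    proof (intro conjI ballI mhomI)
      fix t assume t: "t \<in> carrier ?T"
      fix m assume m: "m \<in> carrier ?M"
      then have m': "m \<in> carrier M" by simp
      show "\<psi> m t \<in> carrier X" using mhom_closed[OF \<psi>(1)] t m by simp
      show "\<psi> m t \<in> carrier X" using mhom_closed[OF \<psi>(1)] t m by simp
      show "\<psi> m (t \<oplus>\<^bsub>?T\<^esub> s) = \<psi> m t \<oplus>\<^bsub>X\<^esub> \<psi> m s" if "s \<in> carrier ?T" for s
        using mhom_add[OF \<psi>(1)] t m that by simp
      show "\<psi> m (c \<odot>\<^bsub>?T\<^esub> t) = c \<odot>\<^bsub>X\<^esub> \<psi> m t" if "c \<in> carrier k" for c
        using mhom_smult[OF \<psi>(1)] t m that by simp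
      show "\<psi> (m \<oplus>\<^bsub>?M\<^esub> n) t = \<psi> m t \<oplus>\<^bsub>X\<^esub> \<psi> n t" if n: "n \<in> carrier ?M" for n
      proof (rule mhom_eq_on_generators[OF gen T X _ mhom_sum[OF X] _ t])
        show "\<psi> (m \<oplus>\<^bsub>?M\<^esub> n) \<in> module_hom k ?T X" "\<psi> m \<in> module_hom k ?T X" "\<psi> n \<in> module_hom k ?T X"
          using \<psi>(1) m n by auto
        show "\<psi> (m \<oplus>\<^bsub>?M\<^esub> n) g = \<psi> m g \<oplus>\<^bsub>X\<^esub> \<psi> n g" if "g \<in> pure_power k ?V p ` tuples p J" for g
          using that m n mhom_add[OF \<beta>'(1)] by (auto simp: \<psi>(2))
      qed
      show "\<psi> (c \<odot>\<^bsub>?M\<^esub> m) t = c \<odot>\<^bsub>X\<^esub> \<psi> m t" if c: "c \<in> carrier k" for c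
      proof (rule mhom_eq_on_generators[OF gen T X _ mhom_scale[OF X _ c] _ t])
        show "\<psi> (c \<odot>\<^bsub>?M\<^esub> m) \<in> module_hom k ?T X" "\<psi> m \<in> module_hom k ?T X"
          using \<psi>(1) m c by auto
        show "\<psi> (c \<odot>\<^bsub>?M\<^esub> m) g = c \<odot>\<^bsub>X\<^esub> \<psi> m g" if "g \<in> pure_power k ?V p ` tuples p J" for g
          using that m c mhom_smult[OF \<beta>'(1)] by (auto simp: \<psi>(2))
      qed
    qed
    from tensor_lift[OF T Mm X this] obtain \<chi> where \<chi>: "\<chi> \<in> module_hom k (tensor k ?T ?M) X"
      "\<And>t m. t \<in> carrier ?T \<Longrightarrow> m \<in> carrier ?M \<Longrightarrow> \<chi> (pure_tensor k ?T ?M t m) = \<psi> m t" by blast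
    show ?thesis unfolding RW_coeff_def coeff_gen_def
      by (rule bexI[OF _ \<chi>(1)]) (use pow in \<open>simp add: \<chi>(2) \<psi>(2)\<close>)
  qed
  have "{coeff_gen J p a m | a m. a \<in> tuples p J \<and> m \<in> carrier M} =
      {pure_tensor k ?T ?M x y |x y. x \<in> pure_power k ?V p ` tuples p (carrier ?V) \<and> y \<in> carrier ?M}"
    unfolding coeff_gen_def by auto
  moreover have "generates k ?M (carrier ?M)" unfolding generates_def by auto
  ultimately show "generates k (RW_coeff k A J M p) {coeff_gen J p a m | a m. a \<in> tuples p J \<and> m \<in> carrier M}"
    unfolding RW_coeff_def using tensor_generates[OF T Mm tensor_power_generates[OF V]] by simp
qed

text \<open>
  A linear map out of \<open>C\<Gamma>\<^sub>n\<close> amounts to one multilinear map for each string, which may be chosen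
  freely.
\<close>

lemma
  assumes J: "submodule J k A"
  shows RW_chains_module: "module k (RW_chains k A J M n)"
    and RW_gen_mlin: "x \<ge> 1 \<Longrightarrow> \<sigma> \<in> N_Omega n x \<Longrightarrow>
      mlin J x (RW_chains k A J M n) (\<lambda>a m. RW_gen k A J M n (x, \<sigma>, a, m))"
    and RW_chains_lift: "module k X \<Longrightarrow> (\<And>x \<sigma>. x \<ge> 1 \<Longrightarrow> \<sigma> \<in> N_Omega n x \<Longrightarrow> mlin J x X (\<beta> x \<sigma>)) \<Longrightarrow>
      \<exists>\<psi>\<in>module_hom k (RW_chains k A J M n) X.
        \<forall>(x, \<sigma>, a, m)\<in>RW_index J M n. \<psi> (RW_gen k A J M n (x, \<sigma>, a, m)) = \<beta> x \<sigma> a m"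
    and RW_chains_generates: "generates k (RW_chains k A J M n) (RW_gen k A J M n ` RW_index J M n)"
proof -
  let ?F = "\<lambda>x. free_module k (N_Omega n x)" and ?C = "RW_coeff k A J M"
  let ?S = "RW_summand k A J M n" and ?D = "RW_chains k A J M n"
  note C = coeff_module[OF J] and F = free_module_module[OF k_cring]
  have S: "module k (?S x)" for x unfolding RW_summand_def by (rule tensor_module[OF F C])
  show D: "module k ?D" unfolding RW_chains_def by (rule direct_sum_module[OF k_cring S])
  have inj: "sum_inj {1..} ?S x \<in> module_hom k (?S x) ?D" if "x \<ge> 1" for x
    unfolding RW_chains_def by (rule sum_inj_hom[OF k_cring S]) (use that in auto)
  have "bilinear_map k (?F x) (?C x) (?S x) (pure_tensor k (?F x) (?C x))" for x
    unfolding RW_summand_def by (rule pure_tensor_bilinear[OF F C])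
  note bil = bilinear_mapD[OF this]
  have gen: "RW_gen k A J M n (x, \<sigma>, a, m) =
     sum_inj {1..} ?S x (pure_tensor k (?F x) (?C x) (basis_elem k \<sigma>) (coeff_gen J x a m))" for x \<sigma> a m
    unfolding RW_gen_def coeff_gen_def by simp
  have e: "basis_elem k \<sigma> \<in> carrier (?F x)" if "\<sigma> \<in> N_Omega n x" for x \<sigma>
    by (rule basis_elem_closed[OF k_cring that])
  show "mlin J x ?D (\<lambda>a m. RW_gen k A J M n (x, \<sigma>, a, m))" if x: "x \<ge> 1" and \<sigma>: "\<sigma> \<in> N_Omega n x" for x \<sigma>
    unfolding gen
    by (rule mlin_comp[OF mlin_comp[OF coeff_gen_mlin[OF J] bil(2)[OF e[OF \<sigma>]]] inj[OF x]])
  show "\<exists>\<psi>\<in>module_hom k ?D X. \<forall>(x, \<sigma>, a, m)\<in>RW_index J M n. \<psi> (RW_gen k A J M n (x, \<sigma>, a, m)) = \<beta> x \<sigma> a m"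
    if X: "module k X" and \<beta>: "\<And>x \<sigma>. x \<ge> 1 \<Longrightarrow> \<sigma> \<in> N_Omega n x \<Longrightarrow> mlin J x X (\<beta> x \<sigma>)"
  proof -
    have "\<exists>\<phi>\<in>module_hom k (?C x) X. \<forall>a\<in>tuples x J. \<forall>m\<in>carrier M. \<phi> (coeff_gen J x a m) = \<beta> x \<sigma> a m"
      if "x \<ge> 1" "\<sigma> \<in> N_Omega n x" for x \<sigma> by (rule coeff_lift[OF J X \<beta>[OF that]])
    then obtain \<phi> where \<phi>: "\<And>x \<sigma>. x \<ge> 1 \<Longrightarrow> \<sigma> \<in> N_Omega n x \<Longrightarrow> \<phi> x \<sigma> \<in> module_hom k (?C x) X"
      "\<And>x \<sigma> a m. x \<ge> 1 \<Longrightarrow> \<sigma> \<in> N_Omega n x \<Longrightarrow> a \<in> tuples x J \<Longrightarrow> m \<in> carrier M \<Longrightarrow>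
        \<phi> x \<sigma> (coeff_gen J x a m) = \<beta> x \<sigma> a m"
      by metis
    interpret X: module k X by (rule X)
    have "\<exists>\<psi>\<in>module_hom k (?S x) X. \<forall>\<sigma>\<in>N_Omega n x. \<forall>v\<in>carrier (?C x).
        \<psi> (pure_tensor k (?F x) (?C x) (basis_elem k \<sigma>) v) = \<phi> x \<sigma> v" if x: "x \<ge> 1" for x
    proof -
      have h: "(\<lambda>\<sigma>. \<phi> x \<sigma> v) \<in> N_Omega n x \<rightarrow> carrier X" if "v \<in> carrier (?C x)" for v
        using mhom_closed[OF \<phi>(1)[OF x]] that by auto
      have "bilinear_map k (?F x) (?C x) X (\<lambda>u v. lin_comb k X (\<lambda>\<sigma>. \<phi> x \<sigma> v) u)"
        unfolding bilinear_map_def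
      proof (intro conjI ballI)
        show "lin_comb k X (\<lambda>\<sigma>. \<phi> x \<sigma> v) \<in> module_hom k (?F x) X" if "v \<in> carrier (?C x)" for v
          by (rule lin_comb_hom[OF X h[OF that]])
        fix u assume u: "u \<in> carrier (?F x)"
        show "(\<lambda>v. lin_comb k X (\<lambda>\<sigma>. \<phi> x \<sigma> v) u) \<in> module_hom k (?C x) X"
          unfolding lin_comb_def
          by (intro mhom_finite_sum[OF C X] mhom_scale[OF X] \<phi>(1)[OF x]) (use free_module_carrierD[OF u] in auto)
      qed
      from tensor_lift[OF F C X this] obtain \<psi> where \<psi>: "\<psi> \<in> module_hom k (?S x) X"
        "\<And>u v. u \<in> carrier (?F x) \<Longrightarrow> v \<in> carrier (?C x) \<Longrightarrow>
          \<psi> (pure_tensor k (?F x) (?C x) u v) = lin_comb k X (\<lambda>\<sigma>. \<phi> x \<sigma> v) u"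
        unfolding RW_summand_def by blast
      show ?thesis
        by (rule bexI[OF _ \<psi>(1)]) (auto simp: \<psi>(2) e lin_comb_basis[OF X h])
    qed
    then obtain \<psi> where \<psi>: "\<And>x. x \<ge> 1 \<Longrightarrow> \<psi> x \<in> module_hom k (?S x) X"
      "\<And>x \<sigma> v. x \<ge> 1 \<Longrightarrow> \<sigma> \<in> N_Omega n x \<Longrightarrow> v \<in> carrier (?C x) \<Longrightarrow>
        \<psi> x (pure_tensor k (?F x) (?C x) (basis_elem k \<sigma>) v) = \<phi> x \<sigma> v"
      by metis
    have "\<exists>\<chi>\<in>module_hom k ?D X. \<forall>j\<in>{1..}. \<forall>x\<in>carrier (?S j). \<chi> (sum_inj {1..} ?S j x) = \<psi> j x"
      unfolding RW_chains_def by (rule direct_sum_lift[OF k_cring S X]) (use \<psi>(1) in auto)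
    then obtain \<chi> where \<chi>: "\<chi> \<in> module_hom k ?D X"
      "\<And>j x. j \<ge> 1 \<Longrightarrow> x \<in> carrier (?S j) \<Longrightarrow> \<chi> (sum_inj {1..} ?S j x) = \<psi> j x" by auto
    show ?thesis
      by (rule bexI[OF _ \<chi>(1)])
         (auto simp: RW_index_def gen \<chi>(2) \<psi>(2) \<phi>(2) bil(3) e mlinD(2)[OF coeff_gen_mlin[OF J]]
           simp del: One_nat_def)
  qed
  have "generates k ?D (\<Union>x\<in>{1..}. sum_inj {1..} ?S x ` {pure_tensor k (?F x) (?C x) u v | u v.
      u \<in> basis_elem k ` N_Omega n x \<and> v \<in> {coeff_gen J x a m | a m. a \<in> tuples x J \<and> m \<in> carrier M}})"
    unfolding RW_chains_def RW_summand_def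
    by (intro direct_sum_generates[OF k_cring] tensor_module[OF F C]
         tensor_generates[OF F C free_module_generates[OF k_cring] coeff_generates[OF J]])
  moreover have "(\<Union>x\<in>{1..}. sum_inj {1..} ?S x ` {pure_tensor k (?F x) (?C x) u v | u v.
      u \<in> basis_elem k ` N_Omega n x \<and> v \<in> {coeff_gen J x a m | a m. a \<in> tuples x J \<and> m \<in> carrier M}})
     = RW_gen k A J M n ` RW_index J M n"
    unfolding RW_index_def by (force simp: gen image_iff)
  ultimately show "generates k ?D (RW_gen k A J M n ` RW_index J M n)" by simp
qed

end

section \<open>Based surjections and their action on tuples\<close>

text \<open>
  The surjections among the based maps, as \<open>0\<close> is the image of \<open>0\<close>. They form the category over
  which both complexes are compared.
\<close>

definition based_surj :: "nat \<Rightarrow> nat \<Rightarrow> (nat \<Rightarrow> nat) set" where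
  "based_surj p q = {f \<in> Gamma_hom p q. {1..q} \<subseteq> f ` {1..p}}"

lemma based_surjD: "f \<in> based_surj p q \<Longrightarrow> f \<in> Gamma_hom p q"
  by (simp add: based_surj_def)

lemma based_surj_onto: "f \<in> based_surj p q \<Longrightarrow> j \<in> {1..q} \<Longrightarrow> \<exists>i\<in>{1..p}. f i = j"
  unfolding based_surj_def by auto

lemma Gamma_hom_app:
  assumes "f \<in> Gamma_hom p q"
  shows "i \<le> p \<Longrightarrow> f i \<le> q" "f 0 = 0" "f \<in> extensional {0..p}"
  using assms unfolding Gamma_hom_def by (auto simp: PiE_iff Ball_def)

lemma Gamma_homI: "f \<in> extensional {0..p} \<Longrightarrow> (\<And>i. i \<le> p \<Longrightarrow> f i \<le> q) \<Longrightarrow> f 0 = 0 \<Longrightarrow> f \<in> Gamma_hom p q"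
  unfolding Gamma_hom_def by (auto simp: PiE_iff)

lemma Gamma_hom_eqI:
  assumes "f \<in> Gamma_hom p q" "g \<in> Gamma_hom p r" "\<And>i. i \<in> {1..p} \<Longrightarrow> f i = g i"
  shows "f = g"
proof (rule extensionalityI[of _ "{0..p}"])
  show "f i = g i" if "i \<in> {0..p}" for i
    using that assms Gamma_hom_app(2)[OF assms(1)] Gamma_hom_app(2)[OF assms(2)] by (cases "i = 0") auto
qed (use assms Gamma_hom_app in auto)

lemma Gamma_hom_comp:
  "f \<in> Gamma_hom p q \<Longrightarrow> g \<in> Gamma_hom q r \<Longrightarrow> compose {0..p} g f \<in> Gamma_hom p r"
  by (rule Gamma_homI) (auto simp: compose_def Gamma_hom_app)

lemma Gamma_hom_id: "(\<lambda>i\<in>{0..n}. i) \<in> Gamma_hom n n"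
  by (rule Gamma_homI) auto

lemma comp_app: "i \<le> (p::nat) \<Longrightarrow> compose {0..p} g f i = g (f i)"
  by (simp add: compose_def)

lemma comp_id_left: "f \<in> Gamma_hom p q \<Longrightarrow> compose {0..p} (\<lambda>i\<in>{0..q}. i) f = f"
  by (rule Gamma_hom_eqI[OF Gamma_hom_comp[OF _ Gamma_hom_id]]) (auto simp: comp_app Gamma_hom_app)

lemma comp_id_right: "f \<in> Gamma_hom p q \<Longrightarrow> compose {0..p} f (\<lambda>i\<in>{0..p}. i) = f"
  by (rule Gamma_hom_eqI[OF Gamma_hom_comp[OF Gamma_hom_id]]) (auto simp: comp_app Gamma_hom_app)

lemma comp_assoc:
  "f \<in> Gamma_hom p q \<Longrightarrow> g \<in> Gamma_hom q r \<Longrightarrow> h \<in> Gamma_hom r s \<Longrightarrow>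
    compose {0..p} h (compose {0..p} g f) = compose {0..p} (compose {0..q} h g) f"
  by (rule Gamma_hom_eqI[OF Gamma_hom_comp[OF Gamma_hom_comp] Gamma_hom_comp[OF _ Gamma_hom_comp]])
     (auto simp: comp_app Gamma_hom_app)

lemma based_surj_comp:
  assumes "f \<in> based_surj p q" "g \<in> based_surj q r" shows "compose {0..p} g f \<in> based_surj p r"
proof -
  have "\<exists>i\<in>{1..p}. compose {0..p} g f i = j" if j: "j \<in> {1..r}" for j
  proof -
    obtain i where i: "i \<in> {1..q}" "g i = j" using based_surj_onto[OF assms(2) j] by blast
    obtain l where "l \<in> {1..p}" "f l = i" using based_surj_onto[OF assms(1) i(1)] by blast
    then show ?thesis using i by (intro bexI[of _ l]) (auto simp: comp_app)
  qed
  then show ?thesis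
    using Gamma_hom_comp[OF based_surjD[OF assms(1)] based_surjD[OF assms(2)]]
    unfolding based_surj_def by force
qed

lemma based_surj_id: "(\<lambda>i\<in>{0..n}. i) \<in> based_surj n n"
  unfolding based_surj_def using Gamma_hom_id by force

lemma based_surjI:
  "f \<in> Gamma_hom p q \<Longrightarrow> (\<And>j. j \<in> {1..q} \<Longrightarrow> \<exists>i\<in>{1..p}. f i = j) \<Longrightarrow> f \<in> based_surj p q"
  unfolding based_surj_def by force

text \<open>
  Right modules over the category of based surjections; every right \<open>\<Gamma>\<close>-module restricts to one.
\<close>

definition surj_module :: "('k, 'r) ring_scheme \<Rightarrow> ('k, 'g) gamma_mod \<Rightarrow> bool" where
  "surj_module k X \<longleftrightarrow>
     (\<forall>n. module k (ob X n)) \<and>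
     (\<forall>p q. \<forall>f\<in>based_surj p q. act X p q f \<in> module_hom k (ob X q) (ob X p)) \<and>
     (\<forall>n. \<forall>u\<in>carrier (ob X n). act X n n (\<lambda>i\<in>{0..n}. i) u = u) \<and>
     (\<forall>p q r. \<forall>f\<in>based_surj p q. \<forall>g\<in>based_surj q r. \<forall>u\<in>carrier (ob X r).
        act X p r (compose {0..p} g f) u = act X p q f (act X q r g u))"

lemma surj_moduleD:
  assumes "surj_module k X"
  shows "module k (ob X n)"
    and "f \<in> based_surj p q \<Longrightarrow> act X p q f \<in> module_hom k (ob X q) (ob X p)"
    and "u \<in> carrier (ob X n) \<Longrightarrow> act X n n (\<lambda>i\<in>{0..n}. i) u = u"
    and "f \<in> based_surj p q \<Longrightarrow> g \<in> based_surj q r \<Longrightarrow> u \<in> carrier (ob X r) \<Longrightarrow>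
        act X p r (compose {0..p} g f) u = act X p q f (act X q r g u)"
  using assms unfolding surj_module_def by blast+

lemma right_gamma_moduleD:
  assumes "right_gamma_module k X"
  shows "module k (ob X n)"
    and "f \<in> Gamma_hom p q \<Longrightarrow> act X p q f \<in> module_hom k (ob X q) (ob X p)"
    and "u \<in> carrier (ob X n) \<Longrightarrow> act X n n (\<lambda>i\<in>{0..n}. i) u = u"
    and "f \<in> Gamma_hom p q \<Longrightarrow> g \<in> Gamma_hom q r \<Longrightarrow> u \<in> carrier (ob X r) \<Longrightarrow>
        act X p r (compose {0..p} g f) u = act X p q f (act X q r g u)"
  using assms unfolding right_gamma_module_def by blast+

lemma gamma_surj_module: "right_gamma_module k X \<Longrightarrow> surj_module k X"
  unfolding surj_module_def by (simp add: right_gamma_moduleD based_surjD)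

definition surj_hom ::
    "('k, 'r) ring_scheme \<Rightarrow> ('k, 'g) gamma_mod \<Rightarrow> ('k, 'h) gamma_mod \<Rightarrow> (nat \<Rightarrow> 'g \<Rightarrow> 'h) set" where
  "surj_hom k X Y = {\<theta>.
     (\<forall>n. \<theta> n \<in> module_hom k (ob X n) (ob Y n)) \<and>
     (\<forall>p q. \<forall>f\<in>based_surj p q. \<forall>u\<in>carrier (ob X q). \<theta> p (act X p q f u) = act Y p q f (\<theta> q u))}"

lemma surj_homD:
  assumes "\<theta> \<in> surj_hom k X Y"
  shows "\<theta> n \<in> module_hom k (ob X n) (ob Y n)"
    and "f \<in> based_surj p q \<Longrightarrow> u \<in> carrier (ob X q) \<Longrightarrow> \<theta> p (act X p q f u) = act Y p q f (\<theta> q u)"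
  using assms unfolding surj_hom_def by blast+

lemma surj_homI:
  assumes "\<And>n. \<theta> n \<in> module_hom k (ob X n) (ob Y n)"
    and "\<And>p q f u. f \<in> based_surj p q \<Longrightarrow> u \<in> carrier (ob X q) \<Longrightarrow> \<theta> p (act X p q f u) = act Y p q f (\<theta> q u)"
  shows "\<theta> \<in> surj_hom k X Y"
  using assms unfolding surj_hom_def by blast

lemma right_gamma_homD:
  assumes "\<theta> \<in> right_gamma_hom k X Y"
  shows "\<theta> n \<in> module_hom k (ob X n) (ob Y n)"
    and "f \<in> Gamma_hom p q \<Longrightarrow> u \<in> carrier (ob X q) \<Longrightarrow> \<theta> p (act X p q f u) = act Y p q f (\<theta> q u)"
  using assms unfolding right_gamma_hom_def by blast+

lemma right_gamma_surj_hom: "\<theta> \<in> right_gamma_hom k X Y \<Longrightarrow> \<theta> \<in> surj_hom k X Y"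
  by (rule surj_homI) (auto simp: right_gamma_homD based_surjD)

lemma surj_hom_comp:
  "\<theta> \<in> surj_hom k X Y \<Longrightarrow> \<xi> \<in> surj_hom k Y Z \<Longrightarrow> (\<lambda>n u. \<xi> n (\<theta> n u)) \<in> surj_hom k X Z"
  by (rule surj_homI) (auto simp: surj_homD intro: mhom_comp[OF surj_homD(1) surj_homD(1)]
        dest: mhom_closed[OF surj_homD(1)])

context augmented_algebra
begin

text \<open>
  The factor by which a based map \<open>f\<close> acts on the coefficient in \<open>M\<close>.
\<close>

definition tail_prod :: "nat \<Rightarrow> (nat \<Rightarrow> nat) \<Rightarrow> (nat \<Rightarrow> 'a) \<Rightarrow> 'a" where
  "tail_prod p f a = (\<Otimes>\<^bsub>A\<^esub>i\<in>{i \<in> {1..p}. f i = 0}. a i)"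

lemma tuplesD: "a \<in> tuples p S \<Longrightarrow> i \<in> {1..p} \<Longrightarrow> a i \<in> S" "a \<in> tuples p S \<Longrightarrow> a \<in> extensional {1..p}"
  unfolding tuples_def by (auto simp: PiE_iff)

lemma tuples_mono: "a \<in> tuples p S \<Longrightarrow> S \<subseteq> T \<Longrightarrow> a \<in> tuples p T"
  unfolding tuples_def by (auto simp: PiE_iff)

lemma tuplesI: "a \<in> extensional {1..p} \<Longrightarrow> (\<And>i. i \<in> {1..p} \<Longrightarrow> a i \<in> S) \<Longrightarrow> a \<in> tuples p S"
  unfolding tuples_def by (auto simp: PiE_iff)

lemma fibre_prod_closed: "a \<in> tuples p (carrier A) \<Longrightarrow> B \<subseteq> {1..p} \<Longrightarrow> (\<Otimes>\<^bsub>A\<^esub>i\<in>B. a i) \<in> carrier A"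
  by (rule A.finprod_closed) (use tuplesD(1) in \<open>blast intro: funcsetI\<close>)

lemma fibre_prod_closed': "a \<in> tuples p (carrier A) \<Longrightarrow> (\<Otimes>\<^bsub>A\<^esub>i\<in>{i. Suc 0 \<le> i \<and> i \<le> p \<and> P i}. a i) \<in> carrier A"
  by (rule fibre_prod_closed) auto

lemma tail_prod_closed: "a \<in> tuples p (carrier A) \<Longrightarrow> tail_prod p f a \<in> carrier A"
  unfolding tail_prod_def by (rule fibre_prod_closed) auto

definition mult_ideal :: "'a set \<Rightarrow> bool" where
  "mult_ideal J \<longleftrightarrow> submodule J k A \<and> (\<forall>a\<in>J. \<forall>b\<in>carrier A. a \<otimes>\<^bsub>A\<^esub> b \<in> J)"

lemma mult_ideal_I: "mult_ideal I"
  unfolding mult_ideal_def using I_submodule I_mult by auto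

lemma mult_ideal_A: "mult_ideal (carrier A)"
  unfolding mult_ideal_def using A_submodule by auto

lemma mult_ideal_carrier: "mult_ideal J \<Longrightarrow> J \<subseteq> carrier A"
  unfolding mult_ideal_def using submoduleD(1)[OF kA] by blast

text \<open>
  The two cases in which tuples with entries in \<open>J\<close> can be pushed forward along \<open>f\<close>: an empty fibre
  contributes the factor \<open>1\<close>, which is in \<open>A\<close> but in general not in \<open>I\<close>.
\<close>

definition admissible :: "'a set \<Rightarrow> nat \<Rightarrow> nat \<Rightarrow> (nat \<Rightarrow> nat) \<Rightarrow> bool" where
  "admissible J p q f \<longleftrightarrow> f \<in> Gamma_hom p q \<and> mult_ideal J \<and> (J = carrier A \<or> f \<in> based_surj p q)"

lemma push_tuple_closed:
  assumes "admissible J p q f" "a \<in> tuples p J"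
  shows "push_tuple A p q f a \<in> tuples q J"
proof (rule tuplesI)
  show "push_tuple A p q f a \<in> extensional {1..q}" unfolding push_tuple_def by auto
  fix j assume j: "j \<in> {1..q}"
  have J: "mult_ideal J" using assms unfolding admissible_def by auto
  have a: "a \<in> tuples p (carrier A)" using tuples_mono[OF assms(2) mult_ideal_carrier[OF J]] .
  show "push_tuple A p q f a j \<in> J"
  proof (cases "J = carrier A")
    case True
    then show ?thesis unfolding push_tuple_def using j fibre_prod_closed'[OF a] by auto
  next
    case False
    then have "f \<in> based_surj p q" using assms unfolding admissible_def by auto
    then obtain i where i: "i \<in> {1..p}" "f i = j" using based_surj_onto j by blast
    have e: "{l \<in> {1..p}. f l = j} = insert i ({l \<in> {1..p}. f l = j} - {i})" using i by auto
    have "(\<Otimes>\<^bsub>A\<^esub>l\<in>{l \<in> {1..p}. f l = j}. a l) = a i \<otimes>\<^bsub>A\<^esub> (\<Otimes>\<^bsub>A\<^esub>l\<in>{l \<in> {1..p}. f l = j} - {i}. a l)"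
      by (subst e, subst A.finprod_insert) (use i tuplesD[OF a] in auto)
    also have "\<dots> \<in> J"
    proof -
      have "(\<Otimes>\<^bsub>A\<^esub>l\<in>{l \<in> {1..p}. f l = j} - {i}. a l) \<in> carrier A"
        by (rule fibre_prod_closed[OF a]) auto
      then show ?thesis using J tuplesD(1)[OF assms(2) i(1)] unfolding mult_ideal_def by blast
    qed
    finally show ?thesis unfolding push_tuple_def using j by simp
  qed
qed

lemma fibre_prod_prod:
  assumes a: "a \<in> tuples p (carrier A)" and T: "T \<subseteq> {1..q}"
  shows "(\<Otimes>\<^bsub>A\<^esub>j\<in>T. push_tuple A p q f a j) = (\<Otimes>\<^bsub>A\<^esub>l\<in>{l \<in> {1..p}. f l \<in> T}. a l)"
proof -
  have "(\<Otimes>\<^bsub>A\<^esub>j\<in>T. push_tuple A p q f a j) = (\<Otimes>\<^bsub>A\<^esub>j\<in>T. \<Otimes>\<^bsub>A\<^esub>l\<in>{l \<in> {1..p}. f l = j}. a l)"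
    by (rule A.finprod_cong') (use T fibre_prod_closed'[OF a] in \<open>auto simp: push_tuple_def\<close>)
  also have "\<dots> = (\<Otimes>\<^bsub>A\<^esub>l\<in>(\<Union>j\<in>T. {l \<in> {1..p}. f l = j}). a l)"
    by (rule A.finprod_UN_disjoint[symmetric])
       (use T finite_subset[OF T] tuplesD[OF a] in \<open>auto simp: pairwise_def disjnt_def\<close>)
  also have "(\<Union>j\<in>T. {l \<in> {1..p}. f l = j}) = {l \<in> {1..p}. f l \<in> T}" by auto
  finally show ?thesis .
qed

text \<open>
  Functoriality of the Loday functor on tuples: the fibre of a composite is the union of the fibres
  over a fibre, and what \<open>f\<close> and then \<open>g\<close> send to the base point is multiplied onto \<open>M\<close> in two
  portions.
\<close>

lemma push_tuple_comp:
  assumes a: "a \<in> tuples p (carrier A)" and f: "f \<in> Gamma_hom p q" and g: "g \<in> Gamma_hom q r"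
  shows "push_tuple A p r (compose {0..p} g f) a = push_tuple A q r g (push_tuple A p q f a)"
    and "tail_prod p (compose {0..p} g f) a = tail_prod q g (push_tuple A p q f a) \<otimes>\<^bsub>A\<^esub> tail_prod p f a"
proof -
  have "(\<Otimes>\<^bsub>A\<^esub>l\<in>{l \<in> {1..p}. compose {0..p} g f l = j}. a l) =
      (\<Otimes>\<^bsub>A\<^esub>l\<in>{l \<in> {1..q}. g l = j}. push_tuple A p q f a l)" if "j \<in> {1..r}" for j
  proof -
    have e: "{l \<in> {1..p}. compose {0..p} g f l = j} = {l \<in> {1..p}. f l \<in> {l \<in> {1..q}. g l = j}}"
      using that Gamma_hom_app[OF f] Gamma_hom_app[OF g] by (auto simp: comp_app Suc_le_eq intro: gr0I)
    show ?thesis unfolding e by (subst fibre_prod_prod[OF a]) auto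
  qed
  then show "push_tuple A p r (compose {0..p} g f) a = push_tuple A q r g (push_tuple A p q f a)"
    unfolding push_tuple_def[of A p r] push_tuple_def[of A q r] by (auto simp: fun_eq_iff)
  show "tail_prod p (compose {0..p} g f) a = tail_prod q g (push_tuple A p q f a) \<otimes>\<^bsub>A\<^esub> tail_prod p f a"
  proof -
    have e: "{l \<in> {1..p}. compose {0..p} g f l = 0} =
        {l \<in> {1..p}. f l \<in> {l \<in> {1..q}. g l = 0}} \<union> {l \<in> {1..p}. f l = 0}"
      using Gamma_hom_app[OF f] Gamma_hom_app[OF g] by (auto simp: comp_app Suc_le_eq)
    show ?thesis
      unfolding tail_prod_def e
      by (subst A.finprod_Un_disjoint, simp, simp, force, (use tuplesD[OF a] in auto)[2])
         (subst fibre_prod_prod[OF a], auto)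
  qed
qed

lemma push_tuple_id:
  assumes a: "a \<in> tuples p (carrier A)"
  shows "push_tuple A p p (\<lambda>i\<in>{0..p}. i) a = a" "tail_prod p (\<lambda>i\<in>{0..p}. i) a = \<one>\<^bsub>A\<^esub>"
proof -
  have "(\<Otimes>\<^bsub>A\<^esub>l\<in>{l \<in> {1..p}. (\<lambda>i\<in>{0..p}. i) l = j}. a l) = a j" if "j \<in> {1..p}" for j
  proof -
    have "{l \<in> {1..p}. (\<lambda>i\<in>{0..p}. i) l = j} = {j}" using that by auto
    then show ?thesis using tuplesD(1)[OF a that] by (simp add: A.finprod_insert)
  qed
  then show "push_tuple A p p (\<lambda>i\<in>{0..p}. i) a = a"
    using tuplesD(2)[OF a] unfolding push_tuple_def by (auto simp: fun_eq_iff extensional_def)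
  have e: "{i \<in> {1..p}. (\<lambda>i\<in>{0..p}. i) i = 0} = {}" by auto
  show "tail_prod p (\<lambda>i\<in>{0..p}. i) a = \<one>\<^bsub>A\<^esub>" unfolding tail_prod_def e by simp
qed

text \<open>
  The action of a based map on \<open>J\<^sup>\<otimes>\<^sup>p \<otimes> M\<close>, in its dual form on the multilinear maps \<open>\<beta>\<close> out of it.
  Compatibility with based maps can so be stated without choosing elements of a tensor power.
\<close>

definition act_tuple :: "nat \<Rightarrow> nat \<Rightarrow> (nat \<Rightarrow> nat) \<Rightarrow> ((nat \<Rightarrow> 'a) \<Rightarrow> 'm \<Rightarrow> 'x) \<Rightarrow> (nat \<Rightarrow> 'a) \<Rightarrow> 'm \<Rightarrow> 'x" where
  "act_tuple p q f \<beta> a m = \<beta> (push_tuple A p q f a) (tail_prod p f a \<odot>\<^bsub>M\<^esub> m)"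

lemma act_tuple_comp:
  assumes a: "a \<in> tuples p (carrier A)" and m: "m \<in> carrier M"
    and f: "f \<in> Gamma_hom p q" and g: "g \<in> Gamma_hom q r"
  shows "act_tuple p r (compose {0..p} g f) \<beta> a m = act_tuple p q f (act_tuple q r g \<beta>) a m"
proof -
  have "push_tuple A p q f a \<in> tuples q (carrier A)"
    using push_tuple_closed[of "carrier A"] a f by (simp add: admissible_def mult_ideal_A)
  then show ?thesis
    unfolding act_tuple_def
    using push_tuple_comp[OF a f g] a m by (simp add: M.smult_assoc1 tail_prod_closed)
qed

lemma act_tuple_id:
  "a \<in> tuples p (carrier A) \<Longrightarrow> m \<in> carrier M \<Longrightarrow> act_tuple p p (\<lambda>i\<in>{0..p}. i) \<beta> a m = \<beta> a m"
  unfolding act_tuple_def by (simp add: push_tuple_id)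

lemma sub_mod_hom:
  assumes "\<phi> \<in> module_hom k A X" "J \<subseteq> carrier A"
  shows "\<phi> \<in> module_hom k (sub_mod A J) X"
  using assms(2)
  by (intro mhomI)
     (auto simp: subset_iff intro!: mhom_closed[OF assms(1)] mhom_add[OF assms(1)] mhom_smult[OF assms(1)])

lemma mult_hom:
  assumes J: "mult_ideal J" and r: "r \<in> carrier A"
  shows "(\<lambda>x. x \<otimes>\<^bsub>A\<^esub> r) \<in> module_hom k (sub_mod A J) (sub_mod A J)"
  using mult_ideal_carrier[OF J] J r
  by (intro mhomI) (auto simp: mult_ideal_def A.l_distr A.smult_assoc2 subset_iff)

text \<open>
  Changing one entry \<open>a i\<close> changes one factor of the product over the fibre of \<open>f i\<close>, or of the
  product acting on \<open>M\<close> if \<open>f i = 0\<close>; in both cases the dependence is linear.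
\<close>

lemma act_tuple_mlin:
  assumes f: "admissible J p q f" and \<beta>: "mlin J q X \<beta>"
  shows "mlin J p X (act_tuple p q f \<beta>)"
proof (rule mlinI)
  have J: "mult_ideal J" using f unfolding admissible_def by auto
  have fG: "f \<in> Gamma_hom p q" using f unfolding admissible_def by auto
  fix a assume a: "a \<in> tuples p J"
  have a': "a \<in> tuples p (carrier A)" using tuples_mono[OF a mult_ideal_carrier[OF J]] .
  note b = push_tuple_closed[OF f a]
  show "act_tuple p q f \<beta> a \<in> module_hom k (restrict_scalars A M) X"
    unfolding act_tuple_def[abs_def]
    by (rule mhom_comp[OF smult_M_hom[OF tail_prod_closed[OF a']] mlinD(1)[OF \<beta> b]])
  fix i m assume i: "i \<in> {1..p}" and m: "m \<in> carrier M"
  have fi: "f i \<le> q" using Gamma_hom_app(1)[OF fG] i by auto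
  define S where "S = {l \<in> {1..p}. f l = f i} - {i}"
  define r where "r = (\<Otimes>\<^bsub>A\<^esub>l\<in>S. a l)"
  have S: "finite S" "i \<notin> S" "S \<subseteq> {1..p}" "{l \<in> {1..p}. f l = f i} = insert i S" using i unfolding S_def by auto
  have r: "r \<in> carrier A" unfolding r_def by (rule fibre_prod_closed[OF a' S(3)])
  have split: "(\<Otimes>\<^bsub>A\<^esub>l\<in>{l \<in> {1..p}. f l = f i}. (a(i := x)) l) = x \<otimes>\<^bsub>A\<^esub> r" if x: "x \<in> carrier A" for x
  proof -
    have "(\<Otimes>\<^bsub>A\<^esub>l\<in>insert i S. (a(i := x)) l) = x \<otimes>\<^bsub>A\<^esub> (\<Otimes>\<^bsub>A\<^esub>l\<in>S. (a(i := x)) l)"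
      by (subst A.finprod_insert) (use S x tuplesD(1)[OF a'] in \<open>auto simp: subset_iff\<close>)
    also have "(\<Otimes>\<^bsub>A\<^esub>l\<in>S. (a(i := x)) l) = r"
      unfolding r_def by (rule A.finprod_cong') (use S tuplesD(1)[OF a'] in \<open>auto simp: subset_iff\<close>)
    finally show ?thesis unfolding S(4) .
  qed
  have other: "(\<Otimes>\<^bsub>A\<^esub>l\<in>{l \<in> {1..p}. f l = j}. (a(i := x)) l) = (\<Otimes>\<^bsub>A\<^esub>l\<in>{l \<in> {1..p}. f l = j}. a l)"
    if "j \<noteq> f i" for j x
    by (rule A.finprod_cong') (use that i tuplesD(1)[OF a'] in auto)
  show "(\<lambda>x. act_tuple p q f \<beta> (a(i := x)) m) \<in> module_hom k (sub_mod A J) X"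
  proof (cases "f i = 0")
    case True
    have e: "act_tuple p q f \<beta> (a(i := x)) m = \<beta> (push_tuple A p q f a) (x \<odot>\<^bsub>M\<^esub> (r \<odot>\<^bsub>M\<^esub> m))" if "x \<in> J" for x
    proof -
      have x: "x \<in> carrier A" using that mult_ideal_carrier[OF J] by auto
      have "push_tuple A p q f (a(i := x)) = push_tuple A p q f a"
        unfolding push_tuple_def by (intro restrict_ext other) (use True in auto)
      moreover have "tail_prod p f (a(i := x)) = x \<otimes>\<^bsub>A\<^esub> r"
        unfolding tail_prod_def using split[OF x] unfolding True .
      ultimately show ?thesis unfolding act_tuple_def using x r m by (simp add: M.smult_assoc1)
    qed
    have "(\<lambda>x. x \<odot>\<^bsub>M\<^esub> (r \<odot>\<^bsub>M\<^esub> m)) \<in> module_hom k (sub_mod A J) (restrict_scalars A M)"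
      by (rule sub_mod_hom[OF smult_M_hom_left mult_ideal_carrier[OF J]]) (use r m in auto)
    from mhom_comp[OF this mlinD(1)[OF \<beta> b]] show ?thesis
      by (rule mhom_cong[OF sub_mod_module, rotated]) (use J e in \<open>auto simp: mult_ideal_def\<close>)
  next
    case False
    then have j: "f i \<in> {1..q}" using fi by auto
    have tm: "tail_prod p f a \<odot>\<^bsub>M\<^esub> m \<in> carrier M" using tail_prod_closed[OF a'] m by simp
    have e: "act_tuple p q f \<beta> (a(i := x)) m =
        \<beta> ((push_tuple A p q f a)(f i := x \<otimes>\<^bsub>A\<^esub> r)) (tail_prod p f a \<odot>\<^bsub>M\<^esub> m)" if "x \<in> J" for x
    proof -
      have x: "x \<in> carrier A" using that mult_ideal_carrier[OF J] by auto
      have "push_tuple A p q f (a(i := x)) = (push_tuple A p q f a)(f i := x \<otimes>\<^bsub>A\<^esub> r)"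
      proof (rule extensionalityI[of _ "{1..q}"])
        show "push_tuple A p q f (a(i := x)) l = ((push_tuple A p q f a)(f i := x \<otimes>\<^bsub>A\<^esub> r)) l" if l: "l \<in> {1..q}" for l
        proof (cases "l = f i")
          case True
          then show ?thesis unfolding push_tuple_def using split[OF x] l by (simp del: fun_upd_apply add: fun_upd_same)
        next
          case False
          then show ?thesis unfolding push_tuple_def using other[OF False, of x] l
            by (simp del: fun_upd_apply add: fun_upd_other)
        qed
      qed (use j in \<open>auto simp: push_tuple_def extensional_def\<close>)
      moreover have "tail_prod p f (a(i := x)) = tail_prod p f a"
        unfolding tail_prod_def by (rule other) (use False in simp)
      ultimately show ?thesis unfolding act_tuple_def by simp
    qed
    from mhom_comp[OF mult_hom[OF J r] mlinD(3)[OF \<beta> b j tm]] show ?thesis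
      by (rule mhom_cong[OF sub_mod_module, rotated]) (use J e in \<open>auto simp: mult_ideal_def\<close>)
  qed
qed

end

section \<open>Strings of surjections and their faces\<close>

subsection \<open>Order-preserving re-indexing\<close>

text \<open>
  All re-indexing of strings and tuples is done by \<open>rank_in S\<close> and \<open>nth_elem S\<close>, which are inverse
  order-preserving bijections between \<open>S\<close> and \<open>{1..card S}\<close>.
\<close>

lemma
  assumes "finite S" "l \<in> {1..card S}"
  shows nth_elem_in: "nth_elem S l \<in> S" and rank_nth: "rank_in S (nth_elem S l) = l"
proof -
  let ?xs = "sorted_list_of_set S"
  have len: "length ?xs = card S" and set: "set ?xs = S" using assms(1) by auto
  have sorted: "sorted_wrt (<) ?xs" by (rule strict_sorted_list_of_set)
  let ?k = "l - 1"
  have k: "?k < length ?xs" using assms(2) len by auto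
  show "nth_elem S l \<in> S" unfolding nth_elem_def using nth_mem[OF k] set by simp
  have "{s' \<in> S. s' \<le> ?xs ! ?k} = (!) ?xs ` {0..?k}"
  proof (intro equalityI subsetI)
    fix s assume "s \<in> {s' \<in> S. s' \<le> ?xs ! ?k}"
    then have "s \<in> set ?xs" "s \<le> ?xs ! ?k" using set by auto
    then obtain j where j: "j < length ?xs" "s = ?xs ! j" "s \<le> ?xs ! ?k" by (metis in_set_conv_nth)
    then have "j \<le> ?k" using sorted_wrt_nth_less[OF sorted, of ?k j] by (meson leD leI)
    then show "s \<in> (!) ?xs ` {0..?k}" using j by auto
  next
    fix s assume "s \<in> (!) ?xs ` {0..?k}"
    then obtain j where j: "j \<le> ?k" "s = ?xs ! j" by auto
    then show "s \<in> {s' \<in> S. s' \<le> ?xs ! ?k}"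
      using k set nth_mem[of j ?xs] sorted_wrt_nth_less[OF sorted, of j ?k] by (cases "j = ?k") auto
  qed
  moreover have "inj_on ((!) ?xs) {0..?k}"
    using k by (intro inj_on_nth) auto
  ultimately show "rank_in S (nth_elem S l) = l"
    unfolding rank_in_def nth_elem_def using assms(2) by (simp add: card_image)
qed

lemma rank_in_range:
  assumes "finite S" "s \<in> S" shows "rank_in S s \<in> {1..card S}"
proof -
  have "{s' \<in> S. s' \<le> s} \<subseteq> S" "s \<in> {s' \<in> S. s' \<le> s}" using assms by auto
  then show ?thesis unfolding rank_in_def
    using assms(1) card_mono[of S] by (auto simp: Suc_le_eq card_gt_0_iff)
qed

lemma rank_in_mono:
  assumes "finite S" "s \<in> S" "t \<in> S" shows "rank_in S s \<le> rank_in S t \<longleftrightarrow> s \<le> t"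
proof
  show "s \<le> t \<Longrightarrow> rank_in S s \<le> rank_in S t"
    unfolding rank_in_def using assms(1) by (intro card_mono) auto
  show "s \<le> t" if r: "rank_in S s \<le> rank_in S t"
  proof (rule ccontr)
    assume "\<not> s \<le> t"
    then have "{s' \<in> S. s' \<le> t} \<subset> {s' \<in> S. s' \<le> s}" using assms(2) by auto
    from psubset_card_mono[OF _ this] show False using r assms(1) unfolding rank_in_def by simp
  qed
qed

lemma rank_in_inj: "finite S \<Longrightarrow> inj_on (rank_in S) S"
  by (rule inj_onI) (metis rank_in_mono order_antisym order_refl)

lemma nth_rank:
  assumes "finite S" "s \<in> S" shows "nth_elem S (rank_in S s) = s"
  using inj_onD[OF rank_in_inj[OF assms(1)]] rank_nth[OF assms(1) rank_in_range[OF assms]]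
    nth_elem_in[OF assms(1) rank_in_range[OF assms]] assms(2) by blast

text \<open>
  Re-indexing in two steps, from \<open>T\<close> to positions in \<open>S\<close> and then to positions among those, agrees
  with re-indexing in one step.
\<close>

lemma
  assumes S: "finite S" and T: "T \<subseteq> S" and T': "T' = {l \<in> {1..card S}. nth_elem S l \<in> T}"
  shows card_reindex: "card T' = card T"
    and rank_reindex: "s \<in> T \<Longrightarrow> rank_in T' (rank_in S s) = rank_in T s"
    and nth_reindex: "l \<in> {1..card T} \<Longrightarrow> nth_elem S (nth_elem T' l) = nth_elem T l"
proof -
  have im: "T' = rank_in S ` T"
  proof (intro equalityI subsetI)
    fix l assume "l \<in> T'"
    then show "l \<in> rank_in S ` T" unfolding T' using rank_nth[OF S] by (metis (no_types, lifting) image_eqI mem_Collect_eq)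
  next
    fix l assume "l \<in> rank_in S ` T"
    then show "l \<in> T'" unfolding T' using rank_in_range[OF S] nth_rank[OF S] T by force
  qed
  have inj: "inj_on (rank_in S) T" using rank_in_inj[OF S] T by (rule inj_on_subset)
  show c: "card T' = card T" unfolding im by (rule card_image[OF inj])
  show r: "rank_in T' (rank_in S s) = rank_in T s" if s: "s \<in> T" for s
  proof -
    have "{t \<in> T'. t \<le> rank_in S s} = rank_in S ` {t \<in> T. t \<le> s}"
      unfolding im using rank_in_mono[OF S] T s by (auto simp: subset_iff)
    moreover have "inj_on (rank_in S) {t \<in> T. t \<le> s}" using inj by (rule inj_on_subset) auto
    ultimately show ?thesis unfolding rank_in_def[of T'] rank_in_def[of T] by (simp add: card_image)
  qed
  show "nth_elem S (nth_elem T' l) = nth_elem T l" if l: "l \<in> {1..card T}"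
  proof -
    have fT: "finite T" "finite T'" using finite_subset[OF T S] im by auto
    have l': "l \<in> {1..card T'}" using l c by simp
    have m: "nth_elem T' l \<in> T'" by (rule nth_elem_in[OF fT(2) l'])
    then have s: "nth_elem S (nth_elem T' l) \<in> T" "nth_elem T' l \<in> {1..card S}" unfolding T' by auto
    have "rank_in T (nth_elem S (nth_elem T' l)) = l"
      using r[OF s(1)] rank_nth[OF S s(2)] rank_nth[OF fT(2) l'] by simp
    then show ?thesis using nth_rank[OF fT(1) s(1)] by simp
  qed
qed

text \<open>
  The last face of the Robinson--Whitehouse complex acts on tuples through these maps: the entries
  at \<open>S\<close> are kept, and all others are multiplied onto \<open>M\<close>.
\<close>

definition collapse :: "nat \<Rightarrow> nat set \<Rightarrow> nat \<Rightarrow> nat" where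
  "collapse p S = (\<lambda>l\<in>{0..p}. if l \<in> S then rank_in S l else 0)"

lemma collapse_surj:
  assumes "S \<subseteq> {1..p}" shows "collapse p S \<in> based_surj p (card S)"
proof (rule based_surjI[OF Gamma_homI])
  have S: "finite S" using assms by (rule finite_subset) auto
  show "collapse p S \<in> extensional {0..p}" "collapse p S 0 = 0"
    using assms unfolding collapse_def by auto
  show "collapse p S i \<le> card S" if "i \<le> p" for i
    using rank_in_range[OF S] that unfolding collapse_def by auto
  show "\<exists>i\<in>{1..p}. collapse p S i = j" if j: "j \<in> {1..card S}" for j
    using nth_elem_in[OF S j] rank_nth[OF S j] assms
    by (intro bexI[of _ "nth_elem S j"]) (auto simp: collapse_def subset_iff)
qed

lemma collapse_app: "l \<in> {1..p} \<Longrightarrow> collapse p S l = (if l \<in> S then rank_in S l else 0)"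
  by (simp add: collapse_def)

lemma collapse_full: "collapse p {1..p} = (\<lambda>i\<in>{0..p}. i)"
proof (rule Gamma_hom_eqI)
  show "collapse p {1..p} \<in> Gamma_hom p (card {1..p})" by (intro based_surjD collapse_surj) simp
  show "collapse p {1..p} i = (\<lambda>i\<in>{0..p}. i) i" if "i \<in> {1..p}" for i
  proof -
    have "{s' \<in> {1..p}. s' \<le> i} = {1..i}" using that by auto
    then show ?thesis using that by (simp add: collapse_app rank_in_def)
  qed
qed (rule Gamma_hom_id)

subsection \<open>Strings\<close>

lemma N_Omega_iff:
  "(X, f) \<in> N_Omega n x \<longleftrightarrow> X \<in> extensional {0..n} \<and> (\<forall>i\<le>n. X i \<ge> 1) \<and> X 0 = x \<and> X n = 1 \<and>
     f \<in> extensional {1..n} \<and> (\<forall>j\<in>{1..n}. f j \<in> Surj (X (j - 1)) (X j))"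
  unfolding N_Omega_def by (auto simp: PiE_iff)

lemma Surj_iff:
  "f \<in> Surj x y \<longleftrightarrow> f \<in> extensional {1..x} \<and> (\<forall>i\<in>{1..x}. f i \<in> {1..y}) \<and> (\<forall>j\<in>{1..y}. \<exists>i\<in>{1..x}. f i = j)"
  unfolding Surj_def by (auto simp: PiE_iff image_iff Ball_def Bex_def set_eq_iff) metis

lemma Surj_comp: "f \<in> Surj x y \<Longrightarrow> g \<in> Surj y z \<Longrightarrow> compose {1..x} g f \<in> Surj x z"
  unfolding Surj_iff by (auto simp: compose_def) (metis atLeastAtMost_iff)

definition to_based :: "nat \<Rightarrow> (nat \<Rightarrow> nat) \<Rightarrow> nat \<Rightarrow> nat" where
  "to_based x f = (\<lambda>i\<in>{0..x}. if i = 0 then 0 else f i)"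

lemma to_based_surj: "f \<in> Surj x y \<Longrightarrow> to_based x f \<in> based_surj x y"
  by (rule based_surjI[OF Gamma_homI]) (auto simp: to_based_def Surj_iff)

lemma drop_first_in:
  assumes "n \<ge> 1" "(X, f) \<in> N_Omega n x" shows "drop_first n (X, f) \<in> N_Omega (n - 1) (X 1)"
proof -
  have "f (Suc j) \<in> Surj (X j) (X (Suc j))" if "j < n" for j
  proof -
    have "\<forall>j\<in>{1..n}. f j \<in> Surj (X (j - 1)) (X j)" using assms(2) by (simp add: N_Omega_iff)
    from bspec[OF this, of "Suc j"] show ?thesis using that by simp
  qed
  then show ?thesis using assms unfolding drop_first_def by (auto simp: N_Omega_iff)
qed

lemma compose_at_in:
  assumes "1 \<le> j" "j < n" "(X, f) \<in> N_Omega n x" shows "compose_at n j (X, f) \<in> N_Omega (n - 1) x"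
proof -
  have S: "f i \<in> Surj (X (i - 1)) (X i)" if "1 \<le> i" "i \<le> n" for i using assms(3) that by (auto simp: N_Omega_iff)
  have "compose {1..X (j - 1)} (f (Suc j)) (f j) \<in> Surj (X (j - 1)) (X (Suc j))"
    using Surj_comp[OF S S[of "Suc j"]] assms by auto
  moreover have "f (Suc i) \<in> Surj (X i) (X (Suc i))" if "i < n" for i using S[of "Suc i"] that by auto
  ultimately show ?thesis
    using assms S unfolding compose_at_def by (auto simp: N_Omega_iff)
qed

lemma fibre_iff:
  "l \<in> fibre n (X, f) i j \<longleftrightarrow> l \<in> {1..X j} \<and> fold f [Suc j..<n] l = i"
  unfolding fibre_def by auto

lemma fibre_step:
  assumes "(X, f) \<in> N_Omega n x" "j \<ge> 1" "j < n" "l \<in> {1..X (j - 1)}"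
  shows "l \<in> fibre n (X, f) i (j - 1) \<longleftrightarrow> f j l \<in> fibre n (X, f) i j"
proof -
  have "f j \<in> Surj (X (j - 1)) (X j)" using assms by (auto simp: N_Omega_iff)
  then have "f j l \<in> {1..X j}" using assms(4) by (auto simp: Surj_iff)
  moreover have "[Suc (j - 1)..<n] = j # [Suc j..<n]" using assms by (simp add: upt_conv_Cons)
  ultimately show ?thesis using assms(4) by (simp add: fibre_iff)
qed

lemma fibre_last:
  assumes "n \<ge> 1" "i \<in> {1..X (n - 1)}" shows "fibre n (X, f) i (n - 1) = {i}"
  using assms by (auto simp: fibre_iff)

lemma fibre_finite: "finite (fibre n \<sigma> i j)" "fibre n \<sigma> i j \<subseteq> {1..fst \<sigma> j}"
  unfolding fibre_def by (cases \<sigma>; auto)+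

lemma fibre_onto:
  assumes "(X, f) \<in> N_Omega n x" "j \<ge> 1" "j < n" "t \<in> fibre n (X, f) i j"
  shows "\<exists>l\<in>fibre n (X, f) i (j - 1). f j l = t"
proof -
  have "f j \<in> Surj (X (j - 1)) (X j)" using assms by (auto simp: N_Omega_iff)
  moreover have "t \<in> {1..X j}" using assms(4) by (simp add: fibre_iff)
  ultimately obtain l where "l \<in> {1..X (j - 1)}" "f j l = t" unfolding Surj_iff by blast
  then show ?thesis using fibre_step[OF assms(1-3)] assms(4) by auto
qed

lemma fibre_nonempty:
  assumes "(X, f) \<in> N_Omega n x" "n \<ge> 1" "i \<in> {1..X (n - 1)}" "j \<le> n - 1"
  shows "fibre n (X, f) i j \<noteq> {}"
  using assms(4)
proof (induction rule: inc_induct)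
  case base
  then show ?case using fibre_last[where X = X, OF assms(2,3)] by simp
next
  case (step j)
  then obtain t where "t \<in> fibre n (X, f) i (Suc j)" by auto
  then show ?case using fibre_onto[OF assms(1), of "Suc j"] step by fastforce
qed

lemma component_eq:
  "component n (X, f) i =
     (\<lambda>j\<in>{0..n - 1}. card (fibre n (X, f) i j),
      \<lambda>j\<in>{1..n - 1}. \<lambda>l\<in>{1..card (fibre n (X, f) i (j - 1))}.
        rank_in (fibre n (X, f) i j) (f j (nth_elem (fibre n (X, f) i (j - 1)) l)))"
  unfolding component_def Let_def by simp

lemma component_in:
  assumes N: "(X, f) \<in> N_Omega n x" and n: "n \<ge> 1" and i: "i \<in> {1..X (n - 1)}"
  shows "component n (X, f) i \<in> N_Omega (n - 1) (card (fibre n (X, f) i 0))"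
proof -
  let ?S = "fibre n (X, f) i"
  have fin: "finite (?S j)" for j by (rule fibre_finite)
  have "1 \<le> card (?S j)" if "j \<le> n - 1" for j
    using fibre_nonempty[OF N n i that] fin by (simp add: Suc_le_eq card_gt_0_iff)
  moreover have "card (?S (n - 1)) = 1" using fibre_last[where X = X, OF n i] by simp
  moreover have "(\<lambda>l\<in>{1..card (?S (j - 1))}. rank_in (?S j) (f j (nth_elem (?S (j - 1)) l)))
      \<in> Surj (card (?S (j - 1))) (card (?S j))" if j: "1 \<le> j" "j \<le> n - 1" for j
    unfolding Surj_iff
  proof (intro conjI ballI)
    have jn: "j < n" using j n by simp
    show "(\<lambda>l\<in>{1..card (?S (j - 1))}. rank_in (?S j) (f j (nth_elem (?S (j - 1)) l))) \<in> extensional {1..card (?S (j - 1))}"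
      by simp
    have m: "f j s \<in> ?S j" if "s \<in> ?S (j - 1)" for s
      using fibre_step[OF N j(1) jn] that by (auto simp: fibre_iff)
    fix l assume l: "l \<in> {1..card (?S (j - 1))}"
    show "(\<lambda>l\<in>{1..card (?S (j - 1))}. rank_in (?S j) (f j (nth_elem (?S (j - 1)) l))) l \<in> {1..card (?S j)}"
      using rank_in_range[OF fin m[OF nth_elem_in[OF fin l]]] l by simp
  next
    have jn: "j < n" using j n by simp
    fix r assume r: "r \<in> {1..card (?S j)}"
    obtain s where s: "s \<in> ?S (j - 1)" "f j s = nth_elem (?S j) r"
      using fibre_onto[OF N j(1) jn nth_elem_in[OF fin r]] by blast
    show "\<exists>l\<in>{1..card (?S (j - 1))}. (\<lambda>l\<in>{1..card (?S (j - 1))}. rank_in (?S j) (f j (nth_elem (?S (j - 1)) l))) l = r"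
      using rank_in_range[OF fin s(1)] nth_rank[OF fin s(1)] s(2) rank_nth[OF fin r]
      by (intro bexI[of _ "rank_in (?S (j - 1)) s"]) auto
  qed
  ultimately show ?thesis using n unfolding component_eq N_Omega_iff by auto
qed

text \<open>
  A face of a string \<open>\<sigma>\<close> starting at \<open>x\<close> is a sum of strings, each with a based surjection from \<open>x\<close>
  to its first object that says what happens to the tuple. The three definitions below describe the
  index set of this sum, the string and the map, uniformly for the first, the inner and the last
  face; there is more than one summand in the last face only.
\<close>

definition face_idx :: "nat \<Rightarrow> nat \<Rightarrow> strg \<Rightarrow> nat set" where
  "face_idx n j \<sigma> = (if j < n then {1} else {1..fst \<sigma> (n - 1)})"

definition face_str :: "nat \<Rightarrow> nat \<Rightarrow> strg \<Rightarrow> nat \<Rightarrow> strg" where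
  "face_str n j \<sigma> i = (if j = 0 then drop_first n \<sigma> else if j < n then compose_at n j \<sigma> else component n \<sigma> i)"

definition face_map :: "nat \<Rightarrow> nat \<Rightarrow> strg \<Rightarrow> nat \<Rightarrow> nat \<Rightarrow> nat" where
  "face_map n j \<sigma> i = (if j = 0 then to_based (fst \<sigma> 0) (snd \<sigma> 1)
     else if j < n then (\<lambda>i\<in>{0..fst \<sigma> 0}. i) else collapse (fst \<sigma> 0) (fibre n \<sigma> i 0))"

lemma face_in:
  assumes \<sigma>: "\<sigma> \<in> N_Omega n x" and n: "n \<ge> 1" and j: "j \<le> n" and i: "i \<in> face_idx n j \<sigma>"
  shows "face_str n j \<sigma> i \<in> N_Omega (n - 1) (fst (face_str n j \<sigma> i) 0)"
    and "face_map n j \<sigma> i \<in> based_surj x (fst (face_str n j \<sigma> i) 0)"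
proof -
  obtain X f where s: "\<sigma> = (X, f)" by (cases \<sigma>)
  note \<sigma>' = \<sigma>[unfolded s]
  have x: "X 0 = x" using \<sigma>' by (simp add: N_Omega_iff)
  have *: "\<exists>y. face_str n j \<sigma> i \<in> N_Omega (n - 1) y \<and> face_map n j \<sigma> i \<in> based_surj x y"
  proof -
    consider "j = 0" | "1 \<le> j" "j < n" | "j = n" "j \<noteq> 0" using j n by linarith
    then show ?thesis
    proof cases
      case 1
      have "f 1 \<in> Surj x (X 1)" using \<sigma>' n x by (force simp: N_Omega_iff)
      then show ?thesis using 1 drop_first_in[OF n \<sigma>'] x to_based_surj
        by (auto simp: face_str_def face_map_def s)
    next
      case 2
      then show ?thesis using compose_at_in[OF 2 \<sigma>'] x based_surj_id by (auto simp: face_str_def face_map_def s)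
    next
      case 3
      then have "i \<in> {1..X (n - 1)}" using i by (simp add: face_idx_def s)
      from component_in[OF \<sigma>' n this] show ?thesis
        using 3 x collapse_surj[OF fibre_finite(2)[of n \<sigma> i 0]] by (auto simp: face_str_def face_map_def s)
    qed
  qed
  moreover have "y = fst (face_str n j \<sigma> i) 0" if "face_str n j \<sigma> i \<in> N_Omega (n - 1) y" for y
    using that by (cases "face_str n j \<sigma> i") (simp add: N_Omega_iff)
  ultimately show "face_str n j \<sigma> i \<in> N_Omega (n - 1) (fst (face_str n j \<sigma> i) 0)"
    "face_map n j \<sigma> i \<in> based_surj x (fst (face_str n j \<sigma> i) 0)" by auto
qed

subsection \<open>Prepending a based surjection\<close>

definition supp :: "nat \<Rightarrow> (nat \<Rightarrow> nat) \<Rightarrow> nat set" where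
  "supp p g = {i \<in> {1..p}. g i \<noteq> 0}"

text \<open>
  The extra degeneracy. A based surjection \<open>g\<close> to the first object of \<open>\<sigma>\<close> restricts to a surjection
  on its support, which is re-indexed and becomes the new first map; the part of \<open>g\<close> that goes to
  the base point is recorded by \<open>collapse p (supp p g)\<close>.
\<close>

definition prepend :: "nat \<Rightarrow> nat \<Rightarrow> strg \<Rightarrow> (nat \<Rightarrow> nat) \<Rightarrow> strg" where
  "prepend n p \<sigma> g =
     (\<lambda>j\<in>{0..Suc n}. if j = 0 then card (supp p g) else fst \<sigma> (j - 1),
      \<lambda>j\<in>{1..Suc n}. if j = 1 then (\<lambda>l\<in>{1..card (supp p g)}. g (nth_elem (supp p g) l)) else snd \<sigma> (j - 1))"

lemma supp_finite: "finite (supp p g)" "supp p g \<subseteq> {1..p}"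
  unfolding supp_def by auto

lemma supp_comp_surj:
  assumes "\<And>i. i \<le> x \<Longrightarrow> h i = 0 \<longleftrightarrow> i = 0" "g \<in> Gamma_hom p x"
  shows "supp p (compose {0..p} h g) = supp p g"
proof -
  have "compose {0..p} h g i = 0 \<longleftrightarrow> g i = 0" if "i \<in> {1..p}" for i
    using that assms(1)[of "g i"] Gamma_hom_app(1)[OF assms(2), of i] by (simp add: comp_app)
  then show ?thesis unfolding supp_def by (intro Collect_cong conj_cong refl arg_cong[of _ _ Not])
qed

lemma first_surj:
  assumes g: "g \<in> based_surj p x"
  shows "(\<lambda>l\<in>{1..card (supp p g)}. g (nth_elem (supp p g) l)) \<in> Surj (card (supp p g)) x"
  unfolding Surj_iff
proof (intro conjI ballI)
  let ?S = "supp p g"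
  note fin = supp_finite(1)[of p g]
  fix l assume l: "l \<in> {1..card ?S}"
  have "nth_elem ?S l \<in> ?S" by (rule nth_elem_in[OF fin l])
  then show "(\<lambda>l\<in>{1..card ?S}. g (nth_elem ?S l)) l \<in> {1..x}"
    using l Gamma_hom_app(1)[OF based_surjD[OF g], of "nth_elem ?S l"] by (auto simp: supp_def)
next
  let ?S = "supp p g"
  note fin = supp_finite(1)[of p g]
  fix j assume j: "j \<in> {1..x}"
  obtain i where i: "i \<in> {1..p}" "g i = j" using based_surj_onto[OF g j] by blast
  then have "i \<in> ?S" using j by (auto simp: supp_def)
  from rank_in_range[OF fin this] nth_rank[OF fin this] i
  show "\<exists>l\<in>{1..card ?S}. (\<lambda>l\<in>{1..card ?S}. g (nth_elem ?S l)) l = j"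
    by (intro bexI[of _ "rank_in ?S i"]) auto
qed simp

lemma supp_card_pos:
  assumes g: "g \<in> based_surj p x" "x \<ge> 1" shows "card (supp p g) \<ge> 1"
proof -
  obtain i where "i \<in> {1..p}" "g i = 1" using based_surj_onto[OF g(1), of 1] g(2) by auto
  then have "i \<in> supp p g" by (auto simp: supp_def)
  then show ?thesis using supp_finite(1)[of p g] by (metis Suc_le_eq card_gt_0_iff empty_iff One_nat_def)
qed

lemma N_Omega_pos: "\<sigma> \<in> N_Omega n x \<Longrightarrow> x \<ge> 1 \<and> fst \<sigma> 0 = x"
  by (cases \<sigma>) (auto simp: N_Omega_iff)

lemma prepend_in:
  assumes \<sigma>: "\<sigma> \<in> N_Omega n x" and g: "g \<in> based_surj p x"
  shows "prepend n p \<sigma> g \<in> N_Omega (Suc n) (card (supp p g))"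
proof -
  obtain X f where s: "\<sigma> = (X, f)" by (cases \<sigma>)
  note \<sigma>' = \<sigma>[unfolded s N_Omega_iff]
  have 1: "card (supp p g) \<ge> 1" using supp_card_pos[OF g] N_Omega_pos[OF \<sigma>] by simp
  have "f (j - 1) \<in> Surj (X (j - 2)) (X (j - 1))" if "2 \<le> j" "j \<le> Suc n" for j
  proof -
    from \<sigma>' have "\<forall>j\<in>{1..n}. f j \<in> Surj (X (j - 1)) (X j)" by simp
    moreover have "j - 1 \<in> {1..n}" using that by auto
    ultimately have "f (j - 1) \<in> Surj (X (j - 1 - 1)) (X (j - 1))" by (rule bspec)
    moreover have "j - 1 - 1 = j - 2" by simp
    ultimately show ?thesis by metis
  qed
  then show ?thesis
    unfolding prepend_def s N_Omega_iff using \<sigma>' 1 first_surj[OF g]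
    by (auto simp: numeral_2_eq_2)
qed

lemma face_idx_prepend:
  "n \<ge> 1 \<Longrightarrow> face_idx (Suc n) (Suc j) (prepend n p \<sigma> g) = face_idx n j \<sigma>"
  unfolding face_idx_def prepend_def by (cases n) auto

text \<open>
  Dropping the prepended map turns it into the based map of the pair, and \<open>g\<close> is the collapse onto
  its support followed by its restriction to the support. This is the identity \<open>d\<^sub>0 s = id\<close>.
\<close>

lemma face_0_prepend:
  assumes \<sigma>: "\<sigma> \<in> N_Omega n x" and g: "g \<in> based_surj p x"
  shows "face_str (Suc n) 0 (prepend n p \<sigma> g) i = \<sigma>"
    and "compose {0..p} (face_map (Suc n) 0 (prepend n p \<sigma> g) i) (collapse p (supp p g)) = g"
proof -
  obtain X f where s: "\<sigma> = (X, f)" by (cases \<sigma>)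
  note \<sigma>' = \<sigma>[unfolded s N_Omega_iff]
  show "face_str (Suc n) 0 (prepend n p \<sigma> g) i = \<sigma>"
    using \<sigma>' unfolding face_str_def drop_first_def prepend_def s
    by (auto simp: fun_eq_iff extensional_def)
  let ?S = "supp p g"
  let ?h = "\<lambda>l\<in>{1..card ?S}. g (nth_elem ?S l)"
  have fm: "face_map (Suc n) 0 (prepend n p \<sigma> g) i = to_based (card ?S) ?h"
    unfolding face_map_def prepend_def by simp
  show "compose {0..p} (face_map (Suc n) 0 (prepend n p \<sigma> g) i) (collapse p ?S) = g"
    unfolding fm
  proof (rule Gamma_hom_eqI[OF Gamma_hom_comp])
    show "collapse p ?S \<in> Gamma_hom p (card ?S)" by (intro based_surjD collapse_surj supp_finite)
    show "to_based (card ?S) ?h \<in> Gamma_hom (card ?S) x" by (intro based_surjD to_based_surj first_surj g)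
    show "g \<in> Gamma_hom p x" by (rule based_surjD[OF g])
    fix l assume l: "l \<in> {1..p}"
    show "compose {0..p} (to_based (card ?S) ?h) (collapse p ?S) l = g l"
    proof (cases "l \<in> ?S")
      case True
      with rank_in_range[OF supp_finite(1) True] nth_rank[OF supp_finite(1) True] l show ?thesis
        by (auto simp: comp_app collapse_app to_based_def)
    next
      case False
      then show ?thesis using l by (auto simp: comp_app collapse_app to_based_def supp_def)
    qed
  qed
qed

text \<open>
  The fibres over objects after the first new map are computed by the same maps as before.
\<close>

lemma fibre_prepend_Suc:
  assumes \<sigma>: "\<sigma> \<in> N_Omega n x" and j: "j < n"
  shows "fibre (Suc n) (prepend n p \<sigma> g) i (Suc j) = fibre n \<sigma> i j"
proof -
  obtain X f where s: "\<sigma> = (X, f)" by (cases \<sigma>)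
  have "fold (snd (prepend n p \<sigma> g)) [Suc (Suc j)..<Suc n] l = fold f [Suc j..<n] l" for l
  proof -
    have "[Suc (Suc j)..<Suc n] = map Suc [Suc j..<n]" by (simp add: map_Suc_upt)
    then have "fold (snd (prepend n p \<sigma> g)) [Suc (Suc j)..<Suc n] l =
        fold (snd (prepend n p \<sigma> g) \<circ> Suc) [Suc j..<n] l" by (simp add: fold_map)
    also have "\<dots> = fold f [Suc j..<n] l"
      by (intro fold_cong) (auto simp: prepend_def s fun_eq_iff)
    finally show ?thesis .
  qed
  then show ?thesis unfolding s using j
    by (auto simp: fibre_iff[of _ _ X f] fibre_iff[of _ _ "fst (prepend n p (X, f) g)" "snd (prepend n p (X, f) g)", simplified] s)
      (auto simp: prepend_def)
qed

lemma fibre_prepend_0: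
  assumes \<sigma>: "\<sigma> \<in> N_Omega n x" and n: "n \<ge> 1" and g: "g \<in> based_surj p x"
  shows "fibre (Suc n) (prepend n p \<sigma> g) i 0 =
     {l \<in> {1..card (supp p g)}. g (nth_elem (supp p g) l) \<in> fibre n \<sigma> i 0}"
proof -
  let ?\<tau> = "prepend n p \<sigma> g"
  have \<tau>: "(fst ?\<tau>, snd ?\<tau>) \<in> N_Omega (Suc n) (card (supp p g))" using prepend_in[OF \<sigma> g] by simp
  have X: "fst ?\<tau> 0 = card (supp p g)" "l \<in> {1..card (supp p g)} \<Longrightarrow> snd ?\<tau> 1 l = g (nth_elem (supp p g) l)" for l
    by (auto simp: prepend_def)
  have 1: "l \<in> fibre (Suc n) ?\<tau> i 0 \<longleftrightarrow> g (nth_elem (supp p g) l) \<in> fibre n \<sigma> i 0" if l: "l \<in> {1..card (supp p g)}" for l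
  proof -
    have "l \<in> fibre (Suc n) (fst ?\<tau>, snd ?\<tau>) i (1 - 1) \<longleftrightarrow> snd ?\<tau> 1 l \<in> fibre (Suc n) (fst ?\<tau>, snd ?\<tau>) i 1"
      by (rule fibre_step[OF \<tau>]) (use l n X(1) in auto)
    moreover have "fibre (Suc n) ?\<tau> i 1 = fibre n \<sigma> i 0" using fibre_prepend_Suc[OF \<sigma>, of 0 p g i] n by simp
    ultimately show ?thesis unfolding X(2)[OF l] prod.collapse by simp
  qed
  have "l \<in> {1..card (supp p g)}" if "l \<in> fibre (Suc n) ?\<tau> i 0" for l
    using subsetD[OF fibre_finite(2)[of "Suc n" ?\<tau> i 0] that] unfolding X(1) .
  then show ?thesis using 1 by blast
qed

text \<open>
  The identity \<open>d\<^sub>j\<^sub>+\<^sub>1 s = s d\<^sub>j\<close> on strings and on based maps. For \<open>j = 0\<close> both sides compose \<open>g\<close>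
  with the first map of the string, which sends only \<open>0\<close> to \<open>0\<close> and so leaves the support alone. The
  inner faces do not meet the new map. For the last face, the component at \<open>i\<close> of the prolonged
  string starts with the points of the support of \<open>g\<close> that \<open>g\<close> sends into the fibre of \<open>i\<close>, and
  these are the support of \<open>g\<close> followed by the collapse onto that fibre; what remains is that
  re-indexing in two steps agrees with re-indexing at once.
\<close>

lemma face_Suc_prepend:
  assumes \<sigma>: "\<sigma> \<in> N_Omega n x" and n: "n \<ge> 1" and g: "g \<in> based_surj p x" and j: "j \<le> n"
    and i: "i \<in> face_idx n j \<sigma>"
  shows "face_str (Suc n) (Suc j) (prepend n p \<sigma> g) i =
      prepend (n - 1) p (face_str n j \<sigma> i) (compose {0..p} (face_map n j \<sigma> i) g)" (is ?A)
    and "compose {0..p} (face_map (Suc n) (Suc j) (prepend n p \<sigma> g) i) (collapse p (supp p g)) =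
      collapse p (supp p (compose {0..p} (face_map n j \<sigma> i) g))" (is ?B)
proof -
  obtain X f where s: "\<sigma> = (X, f)" by (cases \<sigma>)
  note \<sigma>' = \<sigma>[unfolded s N_Omega_iff]
  have Sj: "f j \<in> Surj (X (j - 1)) (X j)" if "1 \<le> j" "j \<le> n" for j using \<sigma>' that by auto
  have x: "X 0 = x" using \<sigma>' by simp
  have gG: "g \<in> Gamma_hom p x" by (rule based_surjD[OF g])
  let ?S = "supp p g"
  note fin = supp_finite(1)[of p g]
  have gS: "g (nth_elem ?S l) \<in> {1..x}" if "l \<in> {1..card ?S}" for l
    using first_surj[OF g] that unfolding Surj_iff by auto
  have nS: "nth_elem ?S l \<in> {1..p}" if "l \<in> {1..card ?S}" for l
    using nth_elem_in[OF fin that] by (simp add: supp_def)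
  have cG: "collapse p ?S \<in> Gamma_hom p (card ?S)" by (intro based_surjD collapse_surj supp_finite)
  consider (first) "j = 0" | (mid) "1 \<le> j" "j < n" | (last) "j = n" "j \<noteq> 0" using j n by linarith
  then have "?A \<and> ?B"
  proof cases
    case first
    have f1: "f 1 \<in> Surj x (X 1)" using Sj[of 1] n x by simp
    have fm: "face_map n j \<sigma> i = to_based x (f 1)" using first by (simp add: face_map_def s x)
    have sp: "supp p (compose {0..p} (to_based x (f 1)) g) = ?S"
    proof (rule supp_comp_surj[OF _ gG])
      show "to_based x (f 1) i = 0 \<longleftrightarrow> i = 0" if "i \<le> x" for i
      proof (cases "i = 0")
        case False
        then have "f 1 i \<in> {1..X 1}" using f1 that unfolding Surj_iff by auto
        then show ?thesis using False that by (simp add: to_based_def)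
      qed (simp add: to_based_def)
    qed
    have fs: "face_str n j \<sigma> i = drop_first n (X, f)" using first by (simp add: face_str_def s)
    have fs': "face_str (Suc n) (Suc j) (prepend n p \<sigma> g) i = compose_at (Suc n) 1 (prepend n p \<sigma> g)"
      using first n by (simp add: face_str_def)
    have eqf: "compose {1..card ?S} (f 1) (\<lambda>l\<in>{1..card ?S}. g (nth_elem ?S l)) =
        (\<lambda>l\<in>{1..card ?S}. compose {0..p} (to_based x (f 1)) g (nth_elem ?S l))"
    proof (rule extensionalityI[of _ "{1..card ?S}"])
      fix l assume l: "l \<in> {1..card ?S}"
      have "compose {0..p} (to_based x (f 1)) g (nth_elem ?S l) = f 1 (g (nth_elem ?S l))"
        using gS[OF l] nS[OF l] by (simp add: comp_app to_based_def)
      then show "compose {1..card ?S} (f 1) (\<lambda>l\<in>{1..card ?S}. g (nth_elem ?S l)) l =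
        (\<lambda>l\<in>{1..card ?S}. compose {0..p} (to_based x (f 1)) g (nth_elem ?S l)) l"
        using l by (simp add: compose_def)
    qed (auto simp: compose_def)
    have ?A unfolding fm fs fs'
    proof (rule prod_eqI)
      show "fst (compose_at (Suc n) 1 (prepend n p \<sigma> g)) =
          fst (prepend (n - 1) p (drop_first n (X, f)) (compose {0..p} (to_based x (f 1)) g))"
        unfolding prepend_def sp compose_at_def drop_first_def s using n
        by (intro extensionalityI[of _ "{0..n}"]) auto
      show "snd (compose_at (Suc n) 1 (prepend n p \<sigma> g)) =
          snd (prepend (n - 1) p (drop_first n (X, f)) (compose {0..p} (to_based x (f 1)) g))"
      proof (rule extensionalityI[of _ "{1..n}"])
        fix l assume l: "l \<in> {1..n}"
        show "snd (compose_at (Suc n) 1 (prepend n p \<sigma> g)) l =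
          snd (prepend (n - 1) p (drop_first n (X, f)) (compose {0..p} (to_based x (f 1)) g)) l"
        proof (cases "l = 1")
          case True
          then show ?thesis using n eqf unfolding prepend_def sp compose_at_def drop_first_def s by simp
        next
          case False
          then show ?thesis using l n unfolding prepend_def sp compose_at_def drop_first_def s by auto
        qed
      qed (use n in \<open>auto simp: prepend_def compose_at_def\<close>)
    qed
    moreover have ?B
      unfolding fm sp using first n comp_id_left[OF cG] by (simp add: face_map_def prepend_def)
    ultimately show ?thesis ..
  next
    case mid
    have fm: "compose {0..p} (face_map n j \<sigma> i) g = g"
      using mid comp_id_left[OF gG] by (simp add: face_map_def s x)
    have fs: "face_str n j \<sigma> i = compose_at n j (X, f)" using mid by (simp add: face_str_def s)
    have fs': "face_str (Suc n) (Suc j) (prepend n p \<sigma> g) i = compose_at (Suc n) (Suc j) (prepend n p \<sigma> g)"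
      using mid by (simp add: face_str_def)
    have "Suc n - 1 = Suc (n - 1)" using n by simp
    then have ?A unfolding fm fs fs' unfolding prepend_def compose_at_def s
      using mid by (auto simp: fun_eq_iff)
    moreover have ?B
      unfolding fm using mid n comp_id_left[OF cG] by (simp add: face_map_def prepend_def)
    ultimately show ?thesis ..
  next
    case last
    define F where "F = fibre n \<sigma> i"
    \<comment> \<open>\<open>T\<close> is the first object of the component as a subset of \<open>{1..p}\<close>, and \<open>T'\<close> the same
      set in the numbering of the support.\<close>
    define T where "T = {l \<in> {1..p}. g l \<in> F 0}"
    define T' where "T' = fibre (Suc n) (prepend n p \<sigma> g) i 0"
    have F: "finite (F j)" "F j \<subseteq> {1..X j}" for j
      unfolding F_def using fibre_finite[of n \<sigma> i j] by (auto simp: s)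
    have TS: "T \<subseteq> ?S" unfolding T_def supp_def using F[of 0] by force
    have T'e: "T' = {l \<in> {1..card ?S}. nth_elem ?S l \<in> T}"
      unfolding T'_def fibre_prepend_0[OF \<sigma> n g] T_def F_def[symmetric] using nS by auto
    note re = card_reindex[OF fin TS T'e] rank_reindex[OF fin TS T'e] nth_reindex[OF fin TS T'e]
    have fm: "face_map n j \<sigma> i = collapse x (F 0)" using last by (simp add: face_map_def s x F_def)
    have fm': "face_map (Suc n) (Suc j) (prepend n p \<sigma> g) i = collapse (card ?S) T'"
      using last by (simp add: face_map_def T'_def prepend_def)
    have sp: "supp p (compose {0..p} (collapse x (F 0)) g) = T"
    proof -
      have "compose {0..p} (collapse x (F 0)) g l \<noteq> 0 \<longleftrightarrow> g l \<in> F 0" if l: "l \<in> {1..p}" for l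
      proof -
        have "compose {0..p} (collapse x (F 0)) g l = (if g l \<in> F 0 then rank_in (F 0) (g l) else 0)"
          using l Gamma_hom_app(1)[OF gG, of l] by (simp add: comp_app collapse_def)
        then show ?thesis using rank_in_range[OF F(1)[of 0], of "g l"] by auto
      qed
      then show ?thesis unfolding supp_def T_def by (intro Collect_cong conj_cong refl)
    qed
    have T: "finite T" "T \<subseteq> {1..p}" unfolding T_def by auto
    have T'1: "T' \<subseteq> {1..card ?S}" unfolding T'e by auto
    have ?B unfolding fm fm' sp
    proof (rule Gamma_hom_eqI[OF Gamma_hom_comp[OF cG based_surjD[OF collapse_surj[OF T'1]]]
            based_surjD[OF collapse_surj[OF T(2)]]])
      fix l assume l: "l \<in> {1..p}"
      show "compose {0..p} (collapse (card ?S) T') (collapse p ?S) l = collapse p T l"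
      proof (cases "l \<in> ?S")
        case True
        note r = rank_in_range[OF fin True] nth_rank[OF fin True]
        have "rank_in ?S l \<in> T' \<longleftrightarrow> l \<in> T" unfolding T'e using r by auto
        then show ?thesis using l True r re(2) by (auto simp: comp_app collapse_app)
      next
        case False
        then have "l \<notin> T" using TS by auto
        moreover have "0 \<notin> T'" using T'1 by auto
        ultimately show ?thesis using l False by (auto simp: comp_app collapse_app collapse_def)
      qed
    qed
    moreover have ?A
    proof -
      have fs: "face_str n j \<sigma> i = component n (X, f) i" using last by (simp add: face_str_def s)
      have fs': "face_str (Suc n) (Suc j) (prepend n p \<sigma> g) i =
          component (Suc n) (fst (prepend n p \<sigma> g), snd (prepend n p \<sigma> g)) i" using last by (simp add: face_str_def)
      have FS: "fibre (Suc n) (prepend n p \<sigma> g) i j' = (if j' = 0 then T' else F (j' - 1))" if "j' \<le> n" for j'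
        using fibre_prepend_Suc[OF \<sigma>, of "j' - 1" p g i] that unfolding T'_def F_def by auto
      have 1: "rank_in (F 0) (g (nth_elem ?S (nth_elem T' l))) = collapse x (F 0) (g (nth_elem T l))"
        if l: "l \<in> {1..card T}" for l
      proof -
        have "nth_elem T l \<in> T" by (rule nth_elem_in[OF T(1) l])
        then have "g (nth_elem T l) \<in> F 0" "g (nth_elem T l) \<le> x" unfolding T_def using F(2)[of 0] x by auto
        then show ?thesis unfolding re(3)[OF l] by (simp add: collapse_def)
      qed
      have 2: "snd (prepend n p \<sigma> g) 1 (nth_elem T' l) = g (nth_elem ?S (nth_elem T' l))" if "l \<in> {1..card T}" for l
        using nth_elem_in[of T' l] T'1 finite_subset[OF T'1] that re(1) by (auto simp: prepend_def)
      have 3: "compose {0..p} (collapse x (F 0)) g (nth_elem T l) = collapse x (F 0) (g (nth_elem T l))"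
        if "l \<in> {1..card T}" for l
        using nth_elem_in[OF T(1) that] T(2) by (intro comp_app) auto
      let ?\<tau> = "prepend n p \<sigma> g"
      let ?L = "component (Suc n) (fst ?\<tau>, snd ?\<tau>) i"
      let ?R = "prepend (n - 1) p (component n (X, f) i) (compose {0..p} (collapse x (F 0)) g)"
      have FE: "component n (X, f) i = (\<lambda>j\<in>{0..n - 1}. card (F j),
          \<lambda>j\<in>{1..n - 1}. \<lambda>l\<in>{1..card (F (j - 1))}. rank_in (F j) (f j (nth_elem (F (j - 1)) l)))"
        unfolding component_eq F_def s ..
      have LE: "?L = (\<lambda>j\<in>{0..n}. card (fibre (Suc n) ?\<tau> i j),
          \<lambda>j\<in>{1..n}. \<lambda>l\<in>{1..card (fibre (Suc n) ?\<tau> i (j - 1))}.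
            rank_in (fibre (Suc n) ?\<tau> i j) (snd ?\<tau> j (nth_elem (fibre (Suc n) ?\<tau> i (j - 1)) l)))"
        unfolding component_eq by simp
      have R1: "fst ?R = (\<lambda>j\<in>{0..Suc (n - 1)}. if j = 0 then card T else (\<lambda>j\<in>{0..n - 1}. card (F j)) (j - 1))"
        unfolding prepend_def[of "n - 1"] sp FE by (simp only: fst_conv snd_conv)
      have R2: "snd ?R = (\<lambda>j\<in>{1..Suc (n - 1)}. if j = 1
               then \<lambda>l\<in>{1..card T}. compose {0..p} (collapse x (F 0)) g (nth_elem T l)
               else (\<lambda>j\<in>{1..n - 1}. \<lambda>l\<in>{1..card (F (j - 1))}. rank_in (F j) (f j (nth_elem (F (j - 1)) l))) (j - 1))"
        unfolding prepend_def[of "n - 1"] sp FE by (simp only: fst_conv snd_conv)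
      show ?A unfolding fm fs fs'
      proof (rule prod_eqI)
        show "fst ?L = fst ?R" unfolding R1 unfolding LE fst_conv
          by (rule extensionalityI[of _ "{0..n}"]) (use n FS re(1) in auto)
        show "snd ?L = snd ?R" unfolding R2 unfolding LE snd_conv
        proof (rule extensionalityI[of _ "{1..n}"])
          fix j' assume j': "j' \<in> {1..n}"
          show "(\<lambda>j\<in>{1..n}. \<lambda>l\<in>{1..card (fibre (Suc n) ?\<tau> i (j - 1))}.
              rank_in (fibre (Suc n) ?\<tau> i j) (snd ?\<tau> j (nth_elem (fibre (Suc n) ?\<tau> i (j - 1)) l))) j' =
            (\<lambda>j\<in>{1..Suc (n - 1)}. if j = 1
               then \<lambda>l\<in>{1..card T}. compose {0..p} (collapse x (F 0)) g (nth_elem T l)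
               else (\<lambda>j\<in>{1..n - 1}. \<lambda>l\<in>{1..card (F (j - 1))}. rank_in (F j) (f j (nth_elem (F (j - 1)) l))) (j - 1)) j'"
          proof (cases "j' = 1")
            case True
            then show ?thesis using n FS[of 0] FS[of 1] re(1) 1 2 3 by (auto simp: fun_eq_iff)
          next
            case False
            then have "snd ?\<tau> j' = f (j' - 1)" using j' by (auto simp: prepend_def s)
            then show ?thesis using n j' False FS[of j'] FS[of "j' - 1"] by auto
          qed
        qed (use n in auto)
      qed
    qed
    ultimately show ?thesis by blast
  qed
  then show ?A ?B by auto
qed

text \<open>
  A string of positive length is the result of prepending its own first map to the rest, so that
  every pair \<open>(\<sigma>, id)\<close> lies in the image of the extra degeneracy.
\<close>

lemma prepend_drop_first:
  assumes \<sigma>: "\<sigma> \<in> N_Omega (Suc n) x"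
  shows "prepend n x (face_str (Suc n) 0 \<sigma> i) (face_map (Suc n) 0 \<sigma> i) = \<sigma>"
    and "supp x (face_map (Suc n) 0 \<sigma> i) = {1..x}"
proof -
  obtain X f where s: "\<sigma> = (X, f)" by (cases \<sigma>)
  note \<sigma>' = \<sigma>[unfolded s N_Omega_iff]
  have f1: "f 1 \<in> Surj x (X 1)"
  proof -
    from \<sigma>' have "\<forall>j\<in>{1..Suc n}. f j \<in> Surj (X (j - 1)) (X j)" by simp
    from bspec[OF this, of 1] show ?thesis using \<sigma>' by simp
  qed
  have fm: "face_map (Suc n) 0 \<sigma> i = to_based x (f 1)" using \<sigma>' by (simp add: face_map_def s)
  have fs: "face_str (Suc n) 0 \<sigma> i = drop_first (Suc n) (X, f)" by (simp add: face_str_def s)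
  show sp: "supp x (face_map (Suc n) 0 \<sigma> i) = {1..x}"
    unfolding fm supp_def using f1 by (auto simp: to_based_def Surj_iff)
  have nth: "nth_elem {1..x} l = l" if "l \<in> {1..x}" for l
  proof -
    have "rank_in {1..x} l = l" using that collapse_full[of x] by (metis atLeastAtMost_iff collapse_app restrict_apply' zero_le)
    then show ?thesis using nth_rank[of "{1..x}" l] that by simp
  qed
  have "(\<lambda>l\<in>{1..x}. to_based x (f 1) (nth_elem {1..x} l)) = f 1"
  proof (rule extensionalityI[of _ "{1..x}"])
    show "f 1 \<in> extensional {1..x}" using f1 by (simp add: Surj_iff)
    show "(\<lambda>l\<in>{1..x}. to_based x (f 1) (nth_elem {1..x} l)) l = f 1 l" if "l \<in> {1..x}" for l
      using that unfolding restrict_apply'[OF that] nth[OF that] by (simp add: to_based_def)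
  qed simp
  then show "prepend n x (face_str (Suc n) 0 \<sigma> i) (face_map (Suc n) 0 \<sigma> i) = \<sigma>"
    unfolding prepend_def sp unfolding fm fs using \<sigma>'
    by (auto simp: s drop_first_def fun_eq_iff extensional_def)
qed

lemma N_Omega_0: "\<sigma> \<in> N_Omega 0 x \<longleftrightarrow> x = 1 \<and> \<sigma> = (\<lambda>i\<in>{0..0}. 1, \<lambda>i\<in>{}. undefined)"
  by (cases \<sigma>) (auto simp: N_Omega_iff fun_eq_iff extensional_def)

text \<open>
  Face numbers and degrees are written with the literal \<open>1\<close>; rewriting it to \<open>Suc 0\<close> would hide it
  from the rules about them.
\<close>

declare One_nat_def [simp del]

section \<open>A free resolution of \<open>t\<close> over the based surjections\<close>

definition bar_idx :: "nat \<Rightarrow> nat \<Rightarrow> (strg \<times> (nat \<Rightarrow> nat)) set" where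
  "bar_idx n p = {(\<sigma>, g). \<exists>x. \<sigma> \<in> N_Omega n x \<and> g \<in> based_surj p x}"

text \<open>
  The free right module over the based surjections with a generator of arity \<open>x\<close> for every string in
  \<open>N_Omega n x\<close>: the basis element \<open>(\<sigma>, g)\<close> is the generator \<open>\<sigma>\<close> moved along \<open>g\<close>.
\<close>

definition bar :: "('k, 'r) ring_scheme \<Rightarrow> nat \<Rightarrow> ('k, strg \<times> (nat \<Rightarrow> nat) \<Rightarrow> 'k) gamma_mod" where
  "bar k n = \<lparr>ob = (\<lambda>p. free_module k (bar_idx n p)),
     act = (\<lambda>p q f. lin_comb k (free_module k (bar_idx n p)) (\<lambda>(\<sigma>, g). basis_elem k (\<sigma>, compose {0..p} g f)))\<rparr>"

definition bar_sign :: "('k, 'r) ring_scheme \<Rightarrow> nat \<Rightarrow> 'k" where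
  "bar_sign k j = (\<ominus>\<^bsub>k\<^esub> \<one>\<^bsub>k\<^esub>) [^]\<^bsub>k\<^esub> j"

definition face_term where
  "face_term k n p j \<sigma> g = (\<Oplus>\<^bsub>ob (bar k (n - 1)) p\<^esub>i\<in>face_idx n j \<sigma>.
     basis_elem k (face_str n j \<sigma> i, compose {0..p} (face_map n j \<sigma> i) g))"

definition bar_d where
  "bar_d k n p = lin_comb k (ob (bar k (n - 1)) p)
     (\<lambda>(\<sigma>, g). \<Oplus>\<^bsub>ob (bar k (n - 1)) p\<^esub>j\<in>{0..n}. bar_sign k j \<odot>\<^bsub>ob (bar k (n - 1)) p\<^esub> face_term k n p j \<sigma> g)"

definition bar_s where
  "bar_s k n p = lin_comb k (ob (bar k (Suc n)) p)
     (\<lambda>(\<sigma>, g). basis_elem k (prepend n p \<sigma> g, collapse p (supp p g)))"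

text \<open>
  The basis element \<open>(\<sigma>, g)\<close> of degree \<open>0\<close>, where \<open>\<sigma>\<close> is trivial, goes to the characteristic
  function of the support of \<open>g\<close>.
\<close>

definition bar_aug where
  "bar_aug k p = lin_comb k (ob (t_mod k) p) (\<lambda>(\<sigma>, g). \<lambda>i\<in>{0..p}. if g i \<noteq> 0 then \<one>\<^bsub>k\<^esub> else \<zero>\<^bsub>k\<^esub>)"

text \<open>The only string of length \<open>0\<close>; it consists of the object \<open>1\<close>.\<close>

definition pt :: strg where
  "pt = (\<lambda>i\<in>{0..0}. 1, \<lambda>i\<in>{}. undefined)"

text \<open>
  A linear section of the augmentation; it is not natural in \<open>p\<close>, and neither is the contraction
  \<open>bar_s\<close>.
\<close>

definition bar_sec where
  "bar_sec k p u = (\<Oplus>\<^bsub>ob (bar k 0) p\<^esub>i\<in>{1..p}. u i \<odot>\<^bsub>ob (bar k 0) p\<^esub> basis_elem k (pt, collapse p {i}))"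

lemma bar_idxI: "\<sigma> \<in> N_Omega n x \<Longrightarrow> g \<in> based_surj p x \<Longrightarrow> (\<sigma>, g) \<in> bar_idx n p"
  unfolding bar_idx_def by auto

lemma bar_idxE:
  assumes "s \<in> bar_idx n p"
  obtains \<sigma> g x where "s = (\<sigma>, g)" "\<sigma> \<in> N_Omega n x" "g \<in> based_surj p x"
  using assms unfolding bar_idx_def by auto

lemma bar_idx_comp: "(\<sigma>, g) \<in> bar_idx n q \<Longrightarrow> f \<in> based_surj p q \<Longrightarrow> (\<sigma>, compose {0..p} g f) \<in> bar_idx n p"
  unfolding bar_idx_def using based_surj_comp by blast

lemma bar_idx_face:
  assumes "(\<sigma>, g) \<in> bar_idx n p" "n \<ge> 1" "j \<le> n" "i \<in> face_idx n j \<sigma>"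
  shows "(face_str n j \<sigma> i, compose {0..p} (face_map n j \<sigma> i) g) \<in> bar_idx (n - 1) p"
proof -
  obtain x where "\<sigma> \<in> N_Omega n x" "g \<in> based_surj p x" using assms(1) by (auto elim: bar_idxE)
  then show ?thesis using face_in[OF _ assms(2-4)] based_surj_comp by (blast intro: bar_idxI)
qed

lemma bar_idx_prepend:
  assumes "(\<sigma>, g) \<in> bar_idx n p"
  shows "(prepend n p \<sigma> g, collapse p (supp p g)) \<in> bar_idx (Suc n) p"
proof -
  obtain x where "\<sigma> \<in> N_Omega n x" "g \<in> based_surj p x" using assms by (auto elim: bar_idxE)
  then show ?thesis using prepend_in collapse_surj[OF supp_finite(2)] by (blast intro: bar_idxI)
qed

lemma pt_in: "pt \<in> N_Omega 0 1"
  by (simp add: N_Omega_0 pt_def)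

lemma bar_idx_pt: "i \<in> {1..p} \<Longrightarrow> (pt, collapse p {i}) \<in> bar_idx 0 p"
  using collapse_surj[of "{i}" p] by (intro bar_idxI[OF pt_in]) (auto simp: One_nat_def)

context cring
begin

lemma bar_module: "module R (ob (bar R n) p)"
  unfolding bar_def by (simp add: free_module_module[OF is_cring])

lemma bar_basis: "s \<in> bar_idx n p \<Longrightarrow> basis_elem R s \<in> carrier (ob (bar R n) p)"
  unfolding bar_def by (simp add: basis_elem_closed[OF is_cring])

lemma bar_generates: "generates R (ob (bar R n) p) (basis_elem R ` bar_idx n p)"
  unfolding bar_def by (simp add: free_module_generates[OF is_cring])

lemma bar_hom_eq:
  assumes "module R W" "\<phi> \<in> module_hom R (ob (bar R n) p) W" "\<psi> \<in> module_hom R (ob (bar R n) p) W"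
    and "\<And>\<sigma> g x. \<sigma> \<in> N_Omega n x \<Longrightarrow> g \<in> based_surj p x \<Longrightarrow> \<phi> (basis_elem R (\<sigma>, g)) = \<psi> (basis_elem R (\<sigma>, g))"
    and "v \<in> carrier (ob (bar R n) p)"
  shows "\<phi> v = \<psi> v"
  by (rule mhom_eq_on_generators[OF bar_generates bar_module assms(1-3) _ assms(5)])
     (use assms(4) in \<open>auto elim!: bar_idxE\<close>)

lemma bar_lin:
  assumes "module R W" "\<And>\<sigma> g x. \<sigma> \<in> N_Omega n x \<Longrightarrow> g \<in> based_surj p x \<Longrightarrow> h (\<sigma>, g) \<in> carrier W"
  shows "lin_comb R W h \<in> module_hom R (ob (bar R n) p) W"
    and "(\<sigma>, g) \<in> bar_idx n p \<Longrightarrow> lin_comb R W h (basis_elem R (\<sigma>, g)) = h (\<sigma>, g)"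
proof -
  have h: "h \<in> bar_idx n p \<rightarrow> carrier W" using assms(2) by (auto elim!: bar_idxE)
  show "lin_comb R W h \<in> module_hom R (ob (bar R n) p) W"
    unfolding bar_def using lin_comb_hom[OF assms(1) h] by simp
  show "(\<sigma>, g) \<in> bar_idx n p \<Longrightarrow> lin_comb R W h (basis_elem R (\<sigma>, g)) = h (\<sigma>, g)"
    by (rule lin_comb_basis[OF assms(1) h])
qed

lemma bar_act:
  assumes f: "f \<in> based_surj p q"
  shows "act (bar R n) p q f \<in> module_hom R (ob (bar R n) q) (ob (bar R n) p)"
    and "(\<sigma>, g) \<in> bar_idx n q \<Longrightarrow> act (bar R n) p q f (basis_elem R (\<sigma>, g)) = basis_elem R (\<sigma>, compose {0..p} g f)"
proof -
  have e: "act (bar R n) p q f = lin_comb R (ob (bar R n) p) (\<lambda>(\<sigma>, g). basis_elem R (\<sigma>, compose {0..p} g f))"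
    unfolding bar_def by simp
  have c: "(case (\<sigma>, g) of (\<sigma>, g) \<Rightarrow> basis_elem R (\<sigma>, compose {0..p} g f)) \<in> carrier (ob (bar R n) p)"
    if "\<sigma> \<in> N_Omega n x" "g \<in> based_surj q x" for \<sigma> g x
    using bar_basis[OF bar_idx_comp[OF bar_idxI[OF that] f]] by simp
  show "act (bar R n) p q f \<in> module_hom R (ob (bar R n) q) (ob (bar R n) p)"
    unfolding e by (rule bar_lin(1)[OF bar_module]) (rule c)
  show "(\<sigma>, g) \<in> bar_idx n q \<Longrightarrow> act (bar R n) p q f (basis_elem R (\<sigma>, g)) = basis_elem R (\<sigma>, compose {0..p} g f)"
    unfolding e by (rule trans, rule bar_lin(2)[OF bar_module], rule c, assumption, assumption, assumption, simp)
qed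

lemma bar_surj_module: "surj_module R (bar R n)"
  unfolding surj_module_def
proof (intro conjI allI ballI)
  show "module R (ob (bar R n) p)" for p by (rule bar_module)
  show "act (bar R n) p q f \<in> module_hom R (ob (bar R n) q) (ob (bar R n) p)" if "f \<in> based_surj p q" for p q f
    by (rule bar_act(1)[OF that])
  show "act (bar R n) p p (\<lambda>i\<in>{0..p}. i) u = u" if "u \<in> carrier (ob (bar R n) p)" for p u
    by (rule bar_hom_eq[OF bar_module bar_act(1)[OF based_surj_id] mhom_id _ that])
       (auto simp: bar_act(2)[OF based_surj_id bar_idxI] comp_id_right[OF based_surjD])
  fix p q r f g u
  assume f: "f \<in> based_surj p q" and g: "g \<in> based_surj q r" and u: "u \<in> carrier (ob (bar R n) r)"
  show "act (bar R n) p r (compose {0..p} g f) u = act (bar R n) p q f (act (bar R n) q r g u)"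
  proof (rule bar_hom_eq[OF bar_module bar_act(1)[OF based_surj_comp[OF f g]] mhom_comp[OF bar_act(1)[OF g] bar_act(1)[OF f]] _ u])
    fix \<sigma> h x assume h: "\<sigma> \<in> N_Omega n x" "h \<in> based_surj r x"
    note i = bar_idxI[OF h]
    show "act (bar R n) p r (compose {0..p} g f) (basis_elem R (\<sigma>, h)) =
        act (bar R n) p q f (act (bar R n) q r g (basis_elem R (\<sigma>, h)))"
      unfolding bar_act(2)[OF based_surj_comp[OF f g] i] bar_act(2)[OF g i] bar_act(2)[OF f bar_idx_comp[OF i g]]
      using comp_assoc[OF based_surjD[OF f] based_surjD[OF g] based_surjD[OF h(2)]] by simp
  qed
qed

lemma face_term_closed:
  assumes "(\<sigma>, g) \<in> bar_idx n p" "n \<ge> 1" "j \<le> n"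
  shows "face_term R n p j \<sigma> g \<in> carrier (ob (bar R (n - 1)) p)"
proof -
  interpret F: module R "ob (bar R (n - 1)) p" by (rule bar_module)
  show ?thesis
    unfolding face_term_def using bar_basis[OF bar_idx_face[OF assms]] by (intro F.finsum_closed) auto
qed

lemma bar_sign_closed: "bar_sign R j \<in> carrier R"
  unfolding bar_sign_def by auto

lemma bar_sign_0: "bar_sign R 0 = \<one>" and bar_sign_Suc: "bar_sign R (Suc j) = \<ominus> bar_sign R j"
  unfolding bar_sign_def by (simp_all add: r_minus)

lemma
  assumes n: "n \<ge> 1"
  shows bar_d_hom: "bar_d R n p \<in> module_hom R (ob (bar R n) p) (ob (bar R (n - 1)) p)"
    and bar_d_basis: "(\<sigma>, g) \<in> bar_idx n p \<Longrightarrow> bar_d R n p (basis_elem R (\<sigma>, g)) =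
       (\<Oplus>\<^bsub>ob (bar R (n - 1)) p\<^esub>j\<in>{0..n}. bar_sign R j \<odot>\<^bsub>ob (bar R (n - 1)) p\<^esub> face_term R n p j \<sigma> g)"
proof -
  interpret F: module R "ob (bar R (n - 1)) p" by (rule bar_module)
  have c: "(case (\<sigma>, g) of (\<sigma>, g) \<Rightarrow>
      \<Oplus>\<^bsub>ob (bar R (n - 1)) p\<^esub>j\<in>{0..n}. bar_sign R j \<odot>\<^bsub>ob (bar R (n - 1)) p\<^esub> face_term R n p j \<sigma> g) \<in> carrier (ob (bar R (n - 1)) p)"
    if "\<sigma> \<in> N_Omega n x" "g \<in> based_surj p x" for \<sigma> g x
    using face_term_closed[OF bar_idxI[OF that] n] bar_sign_closed by (auto intro!: F.finsum_closed)
  show "bar_d R n p \<in> module_hom R (ob (bar R n) p) (ob (bar R (n - 1)) p)"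
    unfolding bar_d_def by (rule bar_lin(1)[OF bar_module]) (rule c)
  show "(\<sigma>, g) \<in> bar_idx n p \<Longrightarrow> bar_d R n p (basis_elem R (\<sigma>, g)) =
       (\<Oplus>\<^bsub>ob (bar R (n - 1)) p\<^esub>j\<in>{0..n}. bar_sign R j \<odot>\<^bsub>ob (bar R (n - 1)) p\<^esub> face_term R n p j \<sigma> g)"
    unfolding bar_d_def by (rule trans, rule bar_lin(2)[OF bar_module], rule c, assumption, assumption, assumption, simp)
qed

text \<open>
  Faces act on the based map of a pair by composition on the left and based surjections by
  composition on the right, so the two commute.
\<close>

lemma act_face_term:
  assumes n: "n \<ge> 1" and f: "f \<in> based_surj p q" and s: "(\<sigma>, g) \<in> bar_idx n q" and j: "j \<le> n"
  shows "act (bar R (n - 1)) p q f (face_term R n q j \<sigma> g) = face_term R n p j \<sigma> (compose {0..p} g f)"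
proof -
  interpret F: module R "ob (bar R (n - 1)) p" by (rule bar_module)
  have "act (bar R (n - 1)) p q f (face_term R n q j \<sigma> g) = (\<Oplus>\<^bsub>ob (bar R (n - 1)) p\<^esub>i\<in>face_idx n j \<sigma>.
      act (bar R (n - 1)) p q f (basis_elem R (face_str n j \<sigma> i, compose {0..q} (face_map n j \<sigma> i) g)))"
    unfolding face_term_def
    by (rule mhom_finsum[OF bar_module bar_module bar_act(1)[OF f]]) (use bar_basis[OF bar_idx_face[OF s n j]] in auto)
  also have "\<dots> = face_term R n p j \<sigma> (compose {0..p} g f)"
    unfolding face_term_def
  proof (rule F.finsum_cong'[OF refl])
    show "(\<lambda>i. basis_elem R (face_str n j \<sigma> i, compose {0..p} (face_map n j \<sigma> i) (compose {0..p} g f)))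
        \<in> face_idx n j \<sigma> \<rightarrow> carrier (ob (bar R (n - 1)) p)"
      using bar_basis[OF bar_idx_face[OF bar_idx_comp[OF s f] n j]] by auto
    fix i assume i: "i \<in> face_idx n j \<sigma>"
    obtain x where x: "\<sigma> \<in> N_Omega n x" "g \<in> based_surj q x" using s by (auto elim: bar_idxE)
    show "act (bar R (n - 1)) p q f (basis_elem R (face_str n j \<sigma> i, compose {0..q} (face_map n j \<sigma> i) g)) =
        basis_elem R (face_str n j \<sigma> i, compose {0..p} (face_map n j \<sigma> i) (compose {0..p} g f))"
      unfolding bar_act(2)[OF f bar_idx_face[OF s n j i]]
      using comp_assoc[OF based_surjD[OF f] based_surjD[OF x(2)] based_surjD[OF face_in(2)[OF x(1) n j i]]] by simp
  qed
  finally show ?thesis .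
qed

lemma bar_d_natural:
  assumes n: "n \<ge> 1" and f: "f \<in> based_surj p q" and u: "u \<in> carrier (ob (bar R n) q)"
  shows "bar_d R n p (act (bar R n) p q f u) = act (bar R (n - 1)) p q f (bar_d R n q u)"
proof (rule bar_hom_eq[OF bar_module mhom_comp[OF bar_act(1)[OF f] bar_d_hom[OF n]] mhom_comp[OF bar_d_hom[OF n] bar_act(1)[OF f]] _ u])
  interpret F: module R "ob (bar R (n - 1)) p" by (rule bar_module)
  interpret F': module R "ob (bar R (n - 1)) q" by (rule bar_module)
  fix \<sigma> g x assume "\<sigma> \<in> N_Omega n x" "g \<in> based_surj q x"
  note s = bar_idxI[OF this]
  show "bar_d R n p (act (bar R n) p q f (basis_elem R (\<sigma>, g))) = act (bar R (n - 1)) p q f (bar_d R n q (basis_elem R (\<sigma>, g)))"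
    unfolding bar_act(2)[OF f s] bar_d_basis[OF n s] bar_d_basis[OF n bar_idx_comp[OF s f]]
    by (subst mhom_finsum[OF bar_module bar_module bar_act(1)[OF f]])
       (auto simp: face_term_closed[OF s n] face_term_closed[OF bar_idx_comp[OF s f] n] bar_sign_closed
          mhom_smult[OF bar_act(1)[OF f]] act_face_term[OF n f s] intro!: F.finsum_cong')
qed

lemma bar_s_hom: "bar_s R n p \<in> module_hom R (ob (bar R n) p) (ob (bar R (Suc n)) p)"
  and bar_s_basis: "(\<sigma>, g) \<in> bar_idx n p \<Longrightarrow>
    bar_s R n p (basis_elem R (\<sigma>, g)) = basis_elem R (prepend n p \<sigma> g, collapse p (supp p g))"
proof -
  have c: "(case (\<sigma>, g) of (\<sigma>, g) \<Rightarrow> basis_elem R (prepend n p \<sigma> g, collapse p (supp p g))) \<in> carrier (ob (bar R (Suc n)) p)"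
    if "\<sigma> \<in> N_Omega n x" "g \<in> based_surj p x" for \<sigma> g x
    using bar_basis[OF bar_idx_prepend[OF bar_idxI[OF that]]] by simp
  show "bar_s R n p \<in> module_hom R (ob (bar R n) p) (ob (bar R (Suc n)) p)"
    unfolding bar_s_def by (rule bar_lin(1)[OF bar_module]) (rule c)
  show "(\<sigma>, g) \<in> bar_idx n p \<Longrightarrow>
    bar_s R n p (basis_elem R (\<sigma>, g)) = basis_elem R (prepend n p \<sigma> g, collapse p (supp p g))"
    unfolding bar_s_def by (rule trans, rule bar_lin(2)[OF bar_module], rule c, assumption, assumption, assumption, simp)
qed

lemma face_term_0_prepend:
  assumes s: "(\<sigma>, g) \<in> bar_idx n p"
  shows "face_term R (Suc n) p 0 (prepend n p \<sigma> g) (collapse p (supp p g)) = basis_elem R (\<sigma>, g)"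
proof -
  interpret F: module R "ob (bar R n) p" by (rule bar_module)
  obtain x where x: "\<sigma> \<in> N_Omega n x" "g \<in> based_surj p x" using s by (auto elim: bar_idxE)
  have "face_idx (Suc n) 0 (prepend n p \<sigma> g) = {1}" by (simp add: face_idx_def)
  then show ?thesis unfolding face_term_def face_0_prepend[OF x] using bar_basis[OF s] by simp
qed

lemma face_term_Suc_prepend:
  assumes n: "n \<ge> 1" and s: "(\<sigma>, g) \<in> bar_idx n p" and j: "j \<le> n"
  shows "face_term R (Suc n) p (Suc j) (prepend n p \<sigma> g) (collapse p (supp p g)) =
    bar_s R (n - 1) p (face_term R n p j \<sigma> g)"
proof -
  interpret F: module R "ob (bar R n) p" by (rule bar_module)
  have n': "Suc (n - 1) = n" using n by simp
  obtain x where x: "\<sigma> \<in> N_Omega n x" "g \<in> based_surj p x" using s by (auto elim: bar_idxE)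
  note i = bar_idx_face[OF s n j]
  have "bar_s R (n - 1) p (face_term R n p j \<sigma> g) = (\<Oplus>\<^bsub>ob (bar R n) p\<^esub>i\<in>face_idx n j \<sigma>.
      bar_s R (n - 1) p (basis_elem R (face_str n j \<sigma> i, compose {0..p} (face_map n j \<sigma> i) g)))"
    unfolding face_term_def
    by (rule mhom_finsum[OF bar_module bar_module bar_s_hom[of "n - 1", unfolded n']]) (use bar_basis[OF i] in auto)
  also have "\<dots> = face_term R (Suc n) p (Suc j) (prepend n p \<sigma> g) (collapse p (supp p g))"
    unfolding face_term_def face_idx_prepend[OF n] diff_Suc_1
    by (rule F.finsum_cong'[OF refl])
       (use bar_basis[OF bar_idx_prepend[OF i], unfolded n'] in \<open>auto simp: bar_s_basis[OF i] face_Suc_prepend[OF x(1) n x(2) j]\<close>)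
  finally show ?thesis ..
qed

lemma alternating_split:
  assumes F: "module R F" and c: "\<And>j. j \<le> Suc n \<Longrightarrow> f j \<in> carrier F"
  shows "(\<Oplus>\<^bsub>F\<^esub>j\<in>{0..Suc n}. bar_sign R j \<odot>\<^bsub>F\<^esub> f j) = f 0 \<ominus>\<^bsub>F\<^esub> (\<Oplus>\<^bsub>F\<^esub>j\<in>{0..n}. bar_sign R j \<odot>\<^bsub>F\<^esub> f (Suc j))"
proof -
  interpret F: module R F by fact
  have e: "{0..Suc n} = insert 0 (Suc ` {0..n})" by (auto simp: image_iff)
  have c1: "bar_sign R j \<odot>\<^bsub>F\<^esub> f (Suc j) \<in> carrier F" if "j \<le> n" for j using c[of "Suc j"] bar_sign_closed that by simp
  have c2: "bar_sign R j \<odot>\<^bsub>F\<^esub> f j \<in> carrier F" if "j \<le> Suc n" for j using c[of j] bar_sign_closed that by simp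
  have "(\<Oplus>\<^bsub>F\<^esub>j\<in>{0..Suc n}. bar_sign R j \<odot>\<^bsub>F\<^esub> f j) = bar_sign R 0 \<odot>\<^bsub>F\<^esub> f 0 \<oplus>\<^bsub>F\<^esub> (\<Oplus>\<^bsub>F\<^esub>j\<in>Suc ` {0..n}. bar_sign R j \<odot>\<^bsub>F\<^esub> f j)"
    unfolding e by (rule F.finsum_insert) (use c2 in auto)
  also have "(\<Oplus>\<^bsub>F\<^esub>j\<in>Suc ` {0..n}. bar_sign R j \<odot>\<^bsub>F\<^esub> f j) = (\<Oplus>\<^bsub>F\<^esub>j\<in>{0..n}. bar_sign R (Suc j) \<odot>\<^bsub>F\<^esub> f (Suc j))"
    by (rule F.finsum_reindex) (use c2 in auto)
  also have "\<dots> = (\<Oplus>\<^bsub>F\<^esub>j\<in>{0..n}. (\<ominus> \<one>) \<odot>\<^bsub>F\<^esub> (bar_sign R j \<odot>\<^bsub>F\<^esub> f (Suc j)))"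
    by (rule F.finsum_cong') (use c1 c bar_sign_closed in \<open>auto simp: bar_sign_Suc F.smult_l_minus\<close>)
  also have "\<dots> = (\<ominus> \<one>) \<odot>\<^bsub>F\<^esub> (\<Oplus>\<^bsub>F\<^esub>j\<in>{0..n}. bar_sign R j \<odot>\<^bsub>F\<^esub> f (Suc j))"
    by (rule F.finsum_smult_ldistr[symmetric]) (use c1 in auto)
  also have "\<dots> = \<ominus>\<^bsub>F\<^esub> (\<Oplus>\<^bsub>F\<^esub>j\<in>{0..n}. bar_sign R j \<odot>\<^bsub>F\<^esub> f (Suc j))"
    using F.finsum_closed[of "\<lambda>j. bar_sign R j \<odot>\<^bsub>F\<^esub> f (Suc j)" "{0..n}"] c1 by (subst F.smult_l_minus) auto
  finally show ?thesis using c[of 0] by (simp add: bar_sign_0 a_minus_def)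
qed

text \<open>
  The extra degeneracy satisfies \<open>d\<^sub>0 s = id\<close> and \<open>d\<^sub>j\<^sub>+\<^sub>1 s = s d\<^sub>j\<close>, so that in the alternating
  sum everything but the first face reproduces \<open>- s d\<close>.
\<close>

lemma bar_s_contraction:
  assumes n: "n \<ge> 1" and v: "v \<in> carrier (ob (bar R n) p)"
  shows "bar_d R (Suc n) p (bar_s R n p v) = v \<ominus>\<^bsub>ob (bar R n) p\<^esub> bar_s R (n - 1) p (bar_d R n p v)"
proof -
  let ?F = "ob (bar R n) p"
  interpret F: module R ?F by (rule bar_module)
  have n': "Suc (n - 1) = n" using n by simp
  have rs': "bar_s R (n - 1) p \<in> module_hom R (ob (bar R (n - 1)) p) ?F" using bar_s_hom[of "n - 1" p] unfolding n' .
  have rd': "bar_d R (Suc n) p \<in> module_hom R (ob (bar R (Suc n)) p) ?F" using bar_d_hom[of "Suc n" p] by simp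
  note h1 = mhom_comp[OF bar_s_hom rd'] and h2 = mhom_comp[OF bar_d_hom[OF n] rs']
  have h3: "(\<lambda>v. v \<ominus>\<^bsub>?F\<^esub> bar_s R (n - 1) p (bar_d R n p v)) \<in> module_hom R ?F ?F"
    unfolding a_minus_def by (rule mhom_sum[OF bar_module mhom_id mhom_neg[OF bar_module h2]])
  show ?thesis
  proof (rule bar_hom_eq[OF bar_module h1 h3 _ v])
    fix \<sigma> g x assume "\<sigma> \<in> N_Omega n x" "g \<in> based_surj p x"
    note s = bar_idxI[OF this]
    let ?\<tau> = "prepend n p \<sigma> g" and ?c = "collapse p (supp p g)"
    note s' = bar_idx_prepend[OF s]
    have "bar_d R (Suc n) p (bar_s R n p (basis_elem R (\<sigma>, g))) = (\<Oplus>\<^bsub>?F\<^esub>j\<in>{0..Suc n}. bar_sign R j \<odot>\<^bsub>?F\<^esub> face_term R (Suc n) p j ?\<tau> ?c)"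
      unfolding bar_s_basis[OF s] using bar_d_basis[OF _ s'] by simp
    also have "\<dots> = face_term R (Suc n) p 0 ?\<tau> ?c \<ominus>\<^bsub>?F\<^esub> (\<Oplus>\<^bsub>?F\<^esub>j\<in>{0..n}. bar_sign R j \<odot>\<^bsub>?F\<^esub> face_term R (Suc n) p (Suc j) ?\<tau> ?c)"
      by (rule alternating_split[OF bar_module]) (use face_term_closed[OF s'] in simp)
    also have "(\<Oplus>\<^bsub>?F\<^esub>j\<in>{0..n}. bar_sign R j \<odot>\<^bsub>?F\<^esub> face_term R (Suc n) p (Suc j) ?\<tau> ?c) =
        bar_s R (n - 1) p (bar_d R n p (basis_elem R (\<sigma>, g)))"
    proof -
      have c: "face_term R n p j \<sigma> g \<in> carrier (ob (bar R (n - 1)) p)" if "j \<le> n" for j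
        by (rule face_term_closed[OF s n that])
      interpret F': module R "ob (bar R (n - 1)) p" by (rule bar_module)
      show ?thesis unfolding bar_d_basis[OF n s]
        by (subst mhom_finsum[OF bar_module bar_module rs'])
           (auto simp: c bar_sign_closed mhom_smult[OF rs'] mhom_closed[OF rs'] face_term_Suc_prepend[OF n s]
             intro!: F.finsum_cong')
    qed
    finally show "bar_d R (Suc n) p (bar_s R n p (basis_elem R (\<sigma>, g))) =
        basis_elem R (\<sigma>, g) \<ominus>\<^bsub>?F\<^esub> bar_s R (n - 1) p (bar_d R n p (basis_elem R (\<sigma>, g)))"
      unfolding face_term_0_prepend[OF s] .
  qed
qed

lemma t_simps:
  "carrier (ob (t_mod R) p) = {u \<in> {0..p} \<rightarrow>\<^sub>E carrier R. u 0 = \<zero>}"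
  "u \<oplus>\<^bsub>ob (t_mod R) p\<^esub> v = (\<lambda>i\<in>{0..p}. u i \<oplus> v i)"
  "c \<odot>\<^bsub>ob (t_mod R) p\<^esub> u = (\<lambda>i\<in>{0..p}. c \<otimes> u i)"
  "\<zero>\<^bsub>ob (t_mod R) p\<^esub> = (\<lambda>i\<in>{0..p}. \<zero>)"
  "act (t_mod R) p q f u = compose {0..p} u f"
  by (simp_all add: t_mod_def)

lemma t_ext: "u \<in> carrier (ob (t_mod R) p) \<Longrightarrow> v \<in> carrier (ob (t_mod R) p) \<Longrightarrow>
   (\<And>i. i \<in> {1..p} \<Longrightarrow> u i = v i) \<Longrightarrow> u = v"
proof (rule extensionalityI[of _ "{0..p}"])
  fix i assume "u \<in> carrier (ob (t_mod R) p)" "v \<in> carrier (ob (t_mod R) p)"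
    "\<And>i. i \<in> {1..p} \<Longrightarrow> u i = v i" "i \<in> {0..p}"
  then show "u i = v i" by (cases "i = 0") (auto simp: t_simps)
qed (auto simp: t_simps PiE_iff)

lemma t_module: "module R (ob (t_mod R) p)"
proof -
  let ?T = "ob (t_mod R) p"
  have neg: "\<exists>y\<in>carrier ?T. y \<oplus>\<^bsub>?T\<^esub> x = \<zero>\<^bsub>?T\<^esub>" if "x \<in> carrier ?T" for x
    by (rule bexI[of _ "\<lambda>i\<in>{0..p}. \<ominus> x i"])
       (use that in \<open>auto simp: t_simps PiE_iff l_neg intro!: restrict_ext\<close>)
  have "abelian_group ?T"
  proof (rule abelian_groupI[OF _ _ _ _ _ neg])
    fix x y z assume c: "x \<in> carrier ?T" "y \<in> carrier ?T" "z \<in> carrier ?T"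
    show "x \<oplus>\<^bsub>?T\<^esub> y \<in> carrier ?T" using c by (auto simp: t_simps PiE_iff)
    show "(x \<oplus>\<^bsub>?T\<^esub> y) \<oplus>\<^bsub>?T\<^esub> z = x \<oplus>\<^bsub>?T\<^esub> (y \<oplus>\<^bsub>?T\<^esub> z)" "x \<oplus>\<^bsub>?T\<^esub> y = y \<oplus>\<^bsub>?T\<^esub> x" "\<zero>\<^bsub>?T\<^esub> \<oplus>\<^bsub>?T\<^esub> x = x"
      using c by (auto simp: t_simps PiE_iff a_ac intro!: restrict_ext extensionalityI[of _ "{0..p}"])
  qed (auto simp: t_simps PiE_iff)
  then show ?thesis
  proof (rule moduleI[OF is_cring])
    fix a b x y assume c: "x \<in> carrier ?T" "y \<in> carrier ?T" "a \<in> carrier R" "b \<in> carrier R"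
    show "(a \<oplus> b) \<odot>\<^bsub>?T\<^esub> x = a \<odot>\<^bsub>?T\<^esub> x \<oplus>\<^bsub>?T\<^esub> b \<odot>\<^bsub>?T\<^esub> x"
      "a \<odot>\<^bsub>?T\<^esub> (x \<oplus>\<^bsub>?T\<^esub> y) = a \<odot>\<^bsub>?T\<^esub> x \<oplus>\<^bsub>?T\<^esub> a \<odot>\<^bsub>?T\<^esub> y" "(a \<otimes> b) \<odot>\<^bsub>?T\<^esub> x = a \<odot>\<^bsub>?T\<^esub> (b \<odot>\<^bsub>?T\<^esub> x)"
      using c by (auto simp: t_simps PiE_iff l_distr r_distr m_assoc intro!: restrict_ext)
  next
    fix a x assume c: "x \<in> carrier ?T" "a \<in> carrier R"
    show "a \<odot>\<^bsub>?T\<^esub> x \<in> carrier ?T" using c by (auto simp: t_simps PiE_iff)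
  next
    fix x assume c: "x \<in> carrier ?T"
    then show "\<one> \<odot>\<^bsub>?T\<^esub> x = x" by (auto simp: t_simps PiE_iff intro!: extensionalityI[of _ "{0..p}"])
  qed
qed

lemma t_right_gamma_module: "right_gamma_module R (t_mod R)"
  unfolding right_gamma_module_def
proof (intro conjI allI ballI)
  show "module R (ob (t_mod R) n)" for n by (rule t_module)
  show "act (t_mod R) p q f \<in> module_hom R (ob (t_mod R) q) (ob (t_mod R) p)" if f: "f \<in> Gamma_hom p q" for p q f
    using Gamma_hom_app[OF f]
    by (intro mhomI) (auto simp: t_simps PiE_iff comp_app compose_def intro!: restrict_ext)
  show "act (t_mod R) n n (\<lambda>i\<in>{0..n}. i) u = u" if "u \<in> carrier (ob (t_mod R) n)" for n u
    using that by (auto simp: t_simps PiE_iff compose_def intro!: extensionalityI[of _ "{0..n}"])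
  show "act (t_mod R) p r (compose {0..p} g f) u = act (t_mod R) p q f (act (t_mod R) q r g u)"
    if f: "f \<in> Gamma_hom p q" and g: "g \<in> Gamma_hom q r" for p q r f g u
    using Gamma_hom_app[OF f] by (auto simp: t_simps compose_def intro!: restrict_ext)
qed

lemma bar_aug_hom: "bar_aug R p \<in> module_hom R (ob (bar R 0) p) (ob (t_mod R) p)"
  and bar_aug_basis: "(\<sigma>, g) \<in> bar_idx 0 p \<Longrightarrow>
    bar_aug R p (basis_elem R (\<sigma>, g)) = (\<lambda>i\<in>{0..p}. if g i \<noteq> 0 then \<one> else \<zero>)"
proof -
  have c: "(case (\<sigma>, g) of (\<sigma>, g) \<Rightarrow> \<lambda>i\<in>{0..p}. if g i \<noteq> 0 then \<one> else \<zero>) \<in> carrier (ob (t_mod R) p)"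
    if "\<sigma> \<in> N_Omega 0 x" "g \<in> based_surj p x" for \<sigma> g x
    using Gamma_hom_app(2)[OF based_surjD[OF that(2)]] by (auto simp: t_simps)
  show "bar_aug R p \<in> module_hom R (ob (bar R 0) p) (ob (t_mod R) p)"
    unfolding bar_aug_def by (rule bar_lin(1)[OF t_module]) (rule c)
  show "(\<sigma>, g) \<in> bar_idx 0 p \<Longrightarrow>
    bar_aug R p (basis_elem R (\<sigma>, g)) = (\<lambda>i\<in>{0..p}. if g i \<noteq> 0 then \<one> else \<zero>)"
    unfolding bar_aug_def
    by (rule trans, rule bar_lin(2)[OF t_module], rule c, assumption, assumption, assumption, simp)
qed

lemma bar_aug_natural:
  assumes f: "f \<in> based_surj p q" and u: "u \<in> carrier (ob (bar R 0) q)"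
  shows "bar_aug R p (act (bar R 0) p q f u) = act (t_mod R) p q f (bar_aug R q u)"
proof (rule bar_hom_eq[OF t_module mhom_comp[OF bar_act(1)[OF f] bar_aug_hom]
        mhom_comp[OF bar_aug_hom right_gamma_moduleD(2)[OF t_right_gamma_module based_surjD[OF f]]] _ u])
  fix \<sigma> g x assume "\<sigma> \<in> N_Omega 0 x" "g \<in> based_surj q x"
  note s = bar_idxI[OF this]
  show "bar_aug R p (act (bar R 0) p q f (basis_elem R (\<sigma>, g))) = act (t_mod R) p q f (bar_aug R q (basis_elem R (\<sigma>, g)))"
    unfolding bar_act(2)[OF f s] bar_aug_basis[OF s] bar_aug_basis[OF bar_idx_comp[OF s f]]
    using Gamma_hom_app(1)[OF based_surjD[OF f]] by (auto simp: t_simps compose_def intro!: restrict_ext)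
qed

lemma bar_sec_hom: "bar_sec R p \<in> module_hom R (ob (t_mod R) p) (ob (bar R 0) p)"
proof -
  let ?F = "ob (bar R 0) p"
  interpret F: module R ?F by (rule bar_module)
  have "(\<lambda>u. u i \<odot>\<^bsub>?F\<^esub> basis_elem R (pt, collapse p {i})) \<in> module_hom R (ob (t_mod R) p) ?F"
    if i: "i \<in> {1..p}" for i
    using bar_basis[OF bar_idx_pt[OF i]] i
    by (intro mhomI) (auto simp: t_simps PiE_iff F.smult_l_distr F.smult_assoc1)
  then show ?thesis unfolding bar_sec_def by (rule mhom_finite_sum[OF t_module bar_module])
qed

text \<open>
  The \<open>i\<close>-th summand of the section goes to the \<open>i\<close>-th coordinate function, because \<open>collapse p {i}\<close>
  has support \<open>{i}\<close>.
\<close>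

lemma bar_aug_bar_sec:
  assumes u: "u \<in> carrier (ob (t_mod R) p)" shows "bar_aug R p (bar_sec R p u) = u"
proof -
  let ?F = "ob (bar R 0) p" and ?T = "ob (t_mod R) p"
  interpret F: module R ?F by (rule bar_module)
  interpret T: module R ?T by (rule t_module)
  have ui: "u i \<in> carrier R" if "i \<le> p" for i using u that by (auto simp: t_simps)
  let ?d = "\<lambda>i. \<lambda>l\<in>{0..p}. if l = i then \<one> else \<zero>"
  have d: "?d i \<in> carrier ?T" if "i \<in> {1..p}" for i using that by (auto simp: t_simps)
  have rb: "bar_aug R p (basis_elem R (pt, collapse p {i})) = ?d i" if i: "i \<in> {1..p}" for i
  proof -
    have "collapse p {i} l \<noteq> 0 \<longleftrightarrow> l = i" if "l \<le> p" for l
      using that rank_in_range[of "{i}" i] i by (auto simp: collapse_def)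
    then show ?thesis unfolding bar_aug_basis[OF bar_idx_pt[OF i]] by (auto intro!: restrict_ext)
  qed
  have "bar_aug R p (bar_sec R p u) = (\<Oplus>\<^bsub>?T\<^esub>i\<in>{1..p}. u i \<odot>\<^bsub>?T\<^esub> ?d i)"
    unfolding bar_sec_def
    by (subst mhom_finsum[OF bar_module t_module bar_aug_hom])
       (use bar_basis[OF bar_idx_pt] ui d in \<open>auto simp: mhom_smult[OF bar_aug_hom] rb intro!: T.finsum_cong'\<close>)
  also have "\<dots> = u"
  proof (rule t_ext[OF _ u])
    show "(\<Oplus>\<^bsub>?T\<^esub>i\<in>{1..p}. u i \<odot>\<^bsub>?T\<^esub> ?d i) \<in> carrier ?T" using d ui by (intro T.finsum_closed) auto
    fix l assume l: "l \<in> {1..p}"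
    have cl: "w l \<in> carrier R" if "w \<in> carrier ?T" for w using that l by (auto simp: t_simps PiE_iff)
    \<comment> \<open>Sums of functions are evaluated pointwise.\<close>
    have ev: "(\<Oplus>\<^bsub>?T\<^esub>i\<in>B. f i) l = (\<Oplus>i\<in>B. f i l)" if "finite B" "f \<in> B \<rightarrow> carrier ?T" for B and f :: "nat \<Rightarrow> nat \<Rightarrow> 'a"
      using that
    proof (induction B)
      case (insert i B)
      then have "f i \<in> carrier ?T" "f \<in> B \<rightarrow> carrier ?T" by auto
      moreover have "(\<lambda>i. f i l) \<in> B \<rightarrow> carrier R" "f i l \<in> carrier R" using insert.prems cl by auto
      ultimately show ?case using insert l by (simp add: t_simps(2))
    qed (use l in \<open>simp add: t_simps\<close>)
    have "(\<Oplus>\<^bsub>?T\<^esub>i\<in>{1..p}. u i \<odot>\<^bsub>?T\<^esub> ?d i) l = (\<Oplus>i\<in>{1..p}. (u i \<odot>\<^bsub>?T\<^esub> ?d i) l)"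
      by (rule ev) (use d ui in auto)
    also have "\<dots> = (\<Oplus>i\<in>{1..p}. if l = i then u i else \<zero>)"
      by (rule finsum_cong') (use l ui in \<open>auto simp: t_simps\<close>)
    also have "\<dots> = u l" by (rule finsum_singleton) (use l ui in auto)
    finally show "(\<Oplus>\<^bsub>?T\<^esub>i\<in>{1..p}. u i \<odot>\<^bsub>?T\<^esub> ?d i) l = u l" .
  qed
  finally show ?thesis .
qed

text \<open>
  In degree \<open>0\<close> the last face of the prolonged string is a sum over the points of the support of
  \<open>g\<close>, the one at \<open>i\<close> being the trivial string with \<open>collapse p {i}\<close>. This is the section applied to
  the characteristic function of the support.
\<close>

lemma bar_s_contraction_0:
  assumes v: "v \<in> carrier (ob (bar R 0) p)"
  shows "bar_d R 1 p (bar_s R 0 p v) = v \<ominus>\<^bsub>ob (bar R 0) p\<^esub> bar_sec R p (bar_aug R p v)"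
proof -
  let ?F = "ob (bar R 0) p"
  interpret F: module R ?F by (rule bar_module)
  have rs': "bar_s R 0 p \<in> module_hom R ?F (ob (bar R 1) p)" using bar_s_hom[of 0 p] by (simp add: One_nat_def)
  have rd': "bar_d R 1 p \<in> module_hom R (ob (bar R 1) p) ?F" using bar_d_hom[of 1 p] by simp
  note h1 = mhom_comp[OF rs' rd'] and h2 = mhom_comp[OF bar_aug_hom bar_sec_hom]
  have h3: "(\<lambda>v. v \<ominus>\<^bsub>?F\<^esub> bar_sec R p (bar_aug R p v)) \<in> module_hom R ?F ?F"
    unfolding a_minus_def by (rule mhom_sum[OF bar_module mhom_id mhom_neg[OF bar_module h2]])
  show ?thesis
  proof (rule bar_hom_eq[OF bar_module h1 h3 _ v])
    fix \<sigma> g x assume x: "\<sigma> \<in> N_Omega 0 x" "g \<in> based_surj p x"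
    note s = bar_idxI[OF x]
    let ?\<tau> = "prepend 0 p \<sigma> g" and ?S = "supp p g"
    let ?c = "collapse p ?S"
    note fin = supp_finite(1)[of p g]
    have s': "(?\<tau>, ?c) \<in> bar_idx 1 p" using bar_idx_prepend[OF s] by (simp add: One_nat_def)
    have \<tau>: "fst ?\<tau> 0 = card ?S" by (simp add: prepend_def)
    have c: "face_term R 1 p j ?\<tau> ?c \<in> carrier ?F" if "j \<le> 1" for j
      using face_term_closed[OF s', of j] that by simp
    have "bar_d R 1 p (bar_s R 0 p (basis_elem R (\<sigma>, g))) = (\<Oplus>\<^bsub>?F\<^esub>j\<in>{0..Suc 0}. bar_sign R j \<odot>\<^bsub>?F\<^esub> face_term R 1 p j ?\<tau> ?c)"
      unfolding bar_s_basis[OF s] using bar_d_basis[OF _ s'] by (simp add: One_nat_def)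
    also have "\<dots> = face_term R 1 p 0 ?\<tau> ?c \<ominus>\<^bsub>?F\<^esub> (\<Oplus>\<^bsub>?F\<^esub>j\<in>{0..0}. bar_sign R j \<odot>\<^bsub>?F\<^esub> face_term R 1 p (Suc j) ?\<tau> ?c)"
      by (rule alternating_split[OF bar_module]) (use c in \<open>simp add: One_nat_def\<close>)
    also have "(\<Oplus>\<^bsub>?F\<^esub>j\<in>{0..0}. bar_sign R j \<odot>\<^bsub>?F\<^esub> face_term R 1 p (Suc j) ?\<tau> ?c) = face_term R 1 p 1 ?\<tau> ?c"
      using c[of 1] by (simp add: bar_sign_0 One_nat_def)
    also have "face_term R 1 p 0 ?\<tau> ?c = basis_elem R (\<sigma>, g)"
      using face_term_0_prepend[OF s] by (simp add: One_nat_def)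
    also have "face_term R 1 p 1 ?\<tau> ?c = bar_sec R p (bar_aug R p (basis_elem R (\<sigma>, g)))"
    proof -
      have b: "basis_elem R (pt, collapse p {i}) \<in> carrier ?F" if "i \<in> {1..p}" for i
        by (rule bar_basis[OF bar_idx_pt[OF that]])
      have S: "?S \<subseteq> {1..p}" by (rule supp_finite)
      have "bar_sec R p (bar_aug R p (basis_elem R (\<sigma>, g))) = (\<Oplus>\<^bsub>?F\<^esub>i\<in>?S. basis_elem R (pt, collapse p {i}))"
        unfolding bar_sec_def bar_aug_basis[OF s]
        by (rule F.add.finprod_mono_neutral_cong_right)
           (use S b in \<open>auto simp: supp_def\<close>)
      also have "?S = nth_elem ?S ` {1..card ?S}"
        using nth_elem_in[OF fin] nth_rank[OF fin] rank_in_range[OF fin] by (auto simp: image_iff) (metis atLeastAtMost_iff)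
      also have "(\<Oplus>\<^bsub>?F\<^esub>i\<in>nth_elem ?S ` {1..card ?S}. basis_elem R (pt, collapse p {i})) =
          (\<Oplus>\<^bsub>?F\<^esub>l\<in>{1..card ?S}. basis_elem R (pt, collapse p {nth_elem ?S l}))"
      proof (rule F.finsum_reindex)
        show "inj_on (nth_elem ?S) {1..card ?S}" by (metis inj_onI rank_nth[OF fin])
        show "(\<lambda>i. basis_elem R (pt, collapse p {i})) \<in> nth_elem ?S ` {1..card ?S} \<rightarrow> carrier ?F"
          using b nth_elem_in[OF fin] S by blast
      qed
      also have "\<dots> = face_term R 1 p 1 ?\<tau> ?c"
        unfolding face_term_def diff_self_eq_0
      proof (rule F.finsum_cong'[symmetric])
        show idx: "face_idx 1 1 ?\<tau> = {1..card ?S}" by (simp add: face_idx_def \<tau>)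
        show "(\<lambda>l. basis_elem R (pt, collapse p {nth_elem ?S l})) \<in> {1..card ?S} \<rightarrow> carrier ?F"
          using b nth_elem_in[OF fin] S by blast
        fix l assume l: "l \<in> {1..card ?S}"
        have l': "l \<in> face_idx 1 1 ?\<tau>" using l idx by simp
        have fl: "fibre 1 ?\<tau> l 0 = {l}"
          using fibre_last[of 1 l "fst ?\<tau>" "snd ?\<tau>"] l \<tau> by simp
        have fm: "face_map 1 1 ?\<tau> l = collapse (card ?S) {l}" by (simp add: face_map_def fl \<tau>)
        have "face_str 1 1 ?\<tau> l \<in> N_Omega 0 (fst (face_str 1 1 ?\<tau> l) 0)"
          using face_in(1)[of ?\<tau> 1 "card ?S" 1 l] prepend_in[OF x] l' by (simp add: One_nat_def)
        then have "face_str 1 1 ?\<tau> l = pt" unfolding N_Omega_0 pt_def by simp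
        moreover have "compose {0..p} (collapse (card ?S) {l}) ?c = collapse p {nth_elem ?S l}"
        proof (rule Gamma_hom_eqI[OF Gamma_hom_comp])
          have nS: "nth_elem ?S l \<in> ?S" by (rule nth_elem_in[OF fin l])
          show "?c \<in> Gamma_hom p (card ?S)" by (intro based_surjD collapse_surj S)
          show "collapse (card ?S) {l} \<in> Gamma_hom (card ?S) (card {l})" using l by (intro based_surjD collapse_surj) auto
          show "collapse p {nth_elem ?S l} \<in> Gamma_hom p (card {nth_elem ?S l})" using nS S by (intro based_surjD collapse_surj) auto
          fix i assume i: "i \<in> {1..p}"
          show "compose {0..p} (collapse (card ?S) {l}) ?c i = collapse p {nth_elem ?S l} i"
          proof (cases "i \<in> ?S")
            case True
            have r: "rank_in ?S i \<in> {1..card ?S}" "nth_elem ?S (rank_in ?S i) = i"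
              using rank_in_range[OF fin True] nth_rank[OF fin True] by auto
            have "rank_in ?S i = l \<longleftrightarrow> i = nth_elem ?S l" using r(2) rank_nth[OF fin l] by auto
            moreover have "rank_in {l} l = 1" "rank_in {nth_elem ?S l} (nth_elem ?S l) = 1"
              unfolding rank_in_def by (simp_all add: Collect_conv_if One_nat_def cong: conj_cong)
            ultimately show ?thesis using i True r by (auto simp: comp_app collapse_app)
          next
            case False
            then show ?thesis using i nS l by (auto simp: comp_app collapse_app collapse_def)
          qed
        qed
        ultimately show "basis_elem R (face_str 1 1 ?\<tau> l, compose {0..p} (face_map 1 1 ?\<tau> l) ?c) =
            basis_elem R (pt, collapse p {nth_elem ?S l})" unfolding fm by simp
      qed
      finally show ?thesis ..
    qed
    finally show "bar_d R 1 p (bar_s R 0 p (basis_elem R (\<sigma>, g))) =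
        basis_elem R (\<sigma>, g) \<ominus>\<^bsub>?F\<^esub> bar_sec R p (bar_aug R p (basis_elem R (\<sigma>, g)))" .
  qed
qed

text \<open>
  Up to translation by a based surjection, every basis element of positive degree is in the image of
  the contraction. A map whose kernel is stable under translation therefore vanishes if it vanishes
  on that image. In this way \<open>d \<circ> d = 0\<close> follows from the contraction.
\<close>

lemma bar_hom_zero_on_contraction:
  assumes W: "\<And>p. module R (W p)" and \<phi>: "\<And>p. \<phi> p \<in> module_hom R (ob (bar R (Suc n)) p) (W p)"
    and nat: "\<And>p q f u. f \<in> based_surj p q \<Longrightarrow> u \<in> carrier (ob (bar R (Suc n)) q) \<Longrightarrow> \<phi> q u = \<zero>\<^bsub>W q\<^esub> \<Longrightarrow>
      \<phi> p (act (bar R (Suc n)) p q f u) = \<zero>\<^bsub>W p\<^esub>"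
    and zero: "\<And>p u. u \<in> carrier (ob (bar R n) p) \<Longrightarrow> \<phi> p (bar_s R n p u) = \<zero>\<^bsub>W p\<^esub>"
    and v: "v \<in> carrier (ob (bar R (Suc n)) p)"
  shows "\<phi> p v = \<zero>\<^bsub>W p\<^esub>"
proof (rule bar_hom_eq[OF W \<phi> mhom_0[OF W] _ v])
  fix \<sigma> g x assume x: "\<sigma> \<in> N_Omega (Suc n) x" "g \<in> based_surj p x"
  have f: "(face_str (Suc n) 0 \<sigma> 1, face_map (Suc n) 0 \<sigma> 1) \<in> bar_idx n x"
    using face_in[OF x(1), of 0 1] by (auto simp: face_idx_def intro!: bar_idxI)
  have i: "(\<sigma>, \<lambda>i\<in>{0..x}. i) \<in> bar_idx (Suc n) x" by (rule bar_idxI[OF x(1) based_surj_id])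
  have "basis_elem R (\<sigma>, \<lambda>i\<in>{0..x}. i) = bar_s R n x (basis_elem R (face_str (Suc n) 0 \<sigma> 1, face_map (Suc n) 0 \<sigma> 1))"
    unfolding bar_s_basis[OF f] prepend_drop_first[OF x(1)] collapse_full ..
  then have "\<phi> x (basis_elem R (\<sigma>, \<lambda>i\<in>{0..x}. i)) = \<zero>\<^bsub>W x\<^esub>" using zero[OF bar_basis[OF f]] by simp
  from nat[OF x(2) bar_basis[OF i] this] show "\<phi> p (basis_elem R (\<sigma>, g)) = \<zero>\<^bsub>W p\<^esub>"
    unfolding bar_act(2)[OF x(2) i] comp_id_left[OF based_surjD[OF x(2)]] .
qed

lemma bar_aug_bar_d:
  assumes v: "v \<in> carrier (ob (bar R 1) p)"
  shows "bar_aug R p (bar_d R 1 p v) = \<zero>\<^bsub>ob (t_mod R) p\<^esub>"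
proof -
  have rd': "bar_d R 1 p \<in> module_hom R (ob (bar R 1) p) (ob (bar R 0) p)" for p using bar_d_hom[of 1 p] by simp
  note T = right_gamma_moduleD[OF t_right_gamma_module]
  show ?thesis
  proof (rule bar_hom_zero_on_contraction[of "\<lambda>p. ob (t_mod R) p" "\<lambda>p v. bar_aug R p (bar_d R 1 p v)" 0, folded One_nat_def])
    show "module R (ob (t_mod R) p)" for p by (rule t_module)
    show "(\<lambda>v. bar_aug R p (bar_d R 1 p v)) \<in> module_hom R (ob (bar R 1) p) (ob (t_mod R) p)" for p
      by (rule mhom_comp[OF rd' bar_aug_hom])
    show "bar_aug R p (bar_d R 1 p (act (bar R 1) p q f u)) = \<zero>\<^bsub>ob (t_mod R) p\<^esub>"
      if f: "f \<in> based_surj p q" and u: "u \<in> carrier (ob (bar R 1) q)" and z: "bar_aug R q (bar_d R 1 q u) = \<zero>\<^bsub>ob (t_mod R) q\<^esub>" for p q f u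
      using bar_d_natural[OF _ f u] bar_aug_natural[OF f mhom_closed[OF rd' u]] z mhom_zero[OF T(1,1) T(2)[OF based_surjD[OF f]]]
      by simp
    show "bar_aug R p (bar_d R 1 p (bar_s R 0 p u)) = \<zero>\<^bsub>ob (t_mod R) p\<^esub>" if u: "u \<in> carrier (ob (bar R 0) p)" for p u
    proof -
      note ru = mhom_closed[OF bar_aug_hom u]
      have "bar_aug R p (bar_d R 1 p (bar_s R 0 p u)) = bar_aug R p u \<ominus>\<^bsub>ob (t_mod R) p\<^esub> bar_aug R p (bar_sec R p (bar_aug R p u))"
        unfolding bar_s_contraction_0[OF u] by (rule mhom_minus[OF bar_module t_module bar_aug_hom u mhom_closed[OF bar_sec_hom ru]])
      also have "\<dots> = \<zero>\<^bsub>ob (t_mod R) p\<^esub>" unfolding bar_aug_bar_sec[OF ru] using module_minus_eq_zero[OF t_module ru ru] by simp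
      finally show ?thesis .
    qed
    show "v \<in> carrier (ob (bar R 1) p)" by (rule v)
  qed
qed

text \<open>
  On cycles the contraction formula says that \<open>s\<close> produces a preimage under the differential.
\<close>

lemma bar_s_cycle:
  assumes n: "n \<ge> 1" and w: "w \<in> carrier (ob (bar R (n - 1)) p)"
    and cyc: "n = 1 \<Longrightarrow> bar_aug R p w = \<zero>\<^bsub>ob (t_mod R) p\<^esub>"
      "n \<noteq> 1 \<Longrightarrow> bar_d R (n - 1) p w = \<zero>\<^bsub>ob (bar R (n - 1 - 1)) p\<^esub>"
  shows "bar_d R n p (bar_s R (n - 1) p w) = w"
proof (cases "n = 1")
  case True
  then show ?thesis
    using bar_s_contraction_0[of w p] w cyc(1) mhom_zero[OF t_module bar_module bar_sec_hom] module_minus_zero[OF bar_module]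
    by simp
next
  case False
  define m where "m = n - 1"
  have m: "m \<ge> 1" "n = Suc m" using False n unfolding m_def by auto
  have h: "bar_s R (m - 1) p \<in> module_hom R (ob (bar R (m - 1)) p) (ob (bar R m) p)"
    using bar_s_hom[of "m - 1" p] m(1) by simp
  show ?thesis
    using bar_s_contraction[OF m(1), of w p] w cyc(2)[OF False] mhom_zero[OF bar_module bar_module h]
      module_minus_zero[OF bar_module]
    unfolding m(2) by simp
qed

text \<open>
  By induction on the degree: \<open>d d s = d (id - s d) = d - d s d\<close>, and \<open>d s\<close> fixes the cycle \<open>d u\<close>.
  Hence \<open>d d\<close> vanishes on the image of the contraction.
\<close>

lemma bar_d_bar_d:
  assumes "n \<ge> 1" "v \<in> carrier (ob (bar R (Suc n)) p)"
  shows "bar_d R n p (bar_d R (Suc n) p v) = \<zero>\<^bsub>ob (bar R (n - 1)) p\<^esub>"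
  using assms
proof (induction n arbitrary: v p rule: less_induct)
  case (less n)
  note n = less.prems(1)
  have rd': "bar_d R (Suc n) p \<in> module_hom R (ob (bar R (Suc n)) p) (ob (bar R n) p)" for p using bar_d_hom[of "Suc n" p] by simp
  show ?case
  proof (rule bar_hom_zero_on_contraction[of "\<lambda>p. ob (bar R (n - 1)) p" "\<lambda>p v. bar_d R n p (bar_d R (Suc n) p v)" n])
    show "module R (ob (bar R (n - 1)) p)" for p by (rule bar_module)
    show "(\<lambda>v. bar_d R n p (bar_d R (Suc n) p v)) \<in> module_hom R (ob (bar R (Suc n)) p) (ob (bar R (n - 1)) p)" for p
      by (rule mhom_comp[OF rd' bar_d_hom[OF n]])
    show "bar_d R n p (bar_d R (Suc n) p (act (bar R (Suc n)) p q f u)) = \<zero>\<^bsub>ob (bar R (n - 1)) p\<^esub>"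
      if f: "f \<in> based_surj p q" and u: "u \<in> carrier (ob (bar R (Suc n)) q)"
        and z: "bar_d R n q (bar_d R (Suc n) q u) = \<zero>\<^bsub>ob (bar R (n - 1)) q\<^esub>" for p q f u
      using bar_d_natural[of "Suc n", OF _ f u] bar_d_natural[OF n f mhom_closed[OF rd' u]] z
        mhom_zero[OF bar_module bar_module bar_act(1)[OF f]] by simp
    show "bar_d R n p (bar_d R (Suc n) p (bar_s R n p u)) = \<zero>\<^bsub>ob (bar R (n - 1)) p\<^esub>" if u: "u \<in> carrier (ob (bar R n) p)" for p u
    proof -
      let ?w = "bar_d R n p u"
      have w: "?w \<in> carrier (ob (bar R (n - 1)) p)" by (rule mhom_closed[OF bar_d_hom[OF n] u])
      have rw: "bar_s R (n - 1) p ?w \<in> carrier (ob (bar R n) p)" using mhom_closed[OF bar_s_hom w] n by simp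
      have "bar_d R n p (bar_s R (n - 1) p ?w) = ?w"
      proof (rule bar_s_cycle[OF n w])
        show "bar_aug R p ?w = \<zero>\<^bsub>ob (t_mod R) p\<^esub>" if "n = 1" using bar_aug_bar_d u that by simp
        show "bar_d R (n - 1) p ?w = \<zero>\<^bsub>ob (bar R (n - 1 - 1)) p\<^esub>" if "n \<noteq> 1"
          using less.IH[of "n - 1" u p] n u that by simp
      qed
      moreover have "bar_d R n p (bar_d R (Suc n) p (bar_s R n p u)) = ?w \<ominus>\<^bsub>ob (bar R (n - 1)) p\<^esub> bar_d R n p (bar_s R (n - 1) p ?w)"
        unfolding bar_s_contraction[OF n u] by (rule mhom_minus[OF bar_module bar_module bar_d_hom[OF n] u rw])
      ultimately show ?thesis using module_minus_eq_zero[OF bar_module w w] by simp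
    qed
    show "v \<in> carrier (ob (bar R (Suc n)) p)" by (rule less.prems(2))
  qed
qed

end

section \<open>Balanced pairings\<close>

context augmented_algebra
begin

text \<open>
  Balanced pairings \<open>X(p) \<times> I\<^sup>p \<times> M \<rightarrow> Z\<close> are the linear maps from the tensor product of \<open>X\<close> and \<open>U\<close>
  over the based surjections to \<open>Z\<close>. The last conjunct moves a based surjection from \<open>X\<close> to the
  tuple.
\<close>

definition balanced where
  "balanced X Z \<tau> \<longleftrightarrow>
     (\<forall>p. \<forall>a\<in>tuples p I. \<forall>m\<in>carrier M. (\<lambda>u. \<tau> p u a m) \<in> module_hom k (ob X p) Z) \<and>
     (\<forall>p. \<forall>u\<in>carrier (ob X p). mlin I p Z (\<tau> p u)) \<and>
     (\<forall>p q. \<forall>f\<in>based_surj p q. \<forall>u\<in>carrier (ob X q). \<forall>a\<in>tuples p I. \<forall>m\<in>carrier M.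
        \<tau> p (act X p q f u) a m = act_tuple p q f (\<tau> q u) a m)"

lemma balancedD:
  assumes "balanced X Z \<tau>"
  shows "a \<in> tuples p I \<Longrightarrow> m \<in> carrier M \<Longrightarrow> (\<lambda>u. \<tau> p u a m) \<in> module_hom k (ob X p) Z"
    and "u \<in> carrier (ob X p) \<Longrightarrow> mlin I p Z (\<tau> p u)"
    and "f \<in> based_surj p q \<Longrightarrow> u \<in> carrier (ob X q) \<Longrightarrow> a \<in> tuples p I \<Longrightarrow> m \<in> carrier M \<Longrightarrow>
        \<tau> p (act X p q f u) a m = act_tuple p q f (\<tau> q u) a m"
    and "u \<in> carrier (ob X p) \<Longrightarrow> a \<in> tuples p I \<Longrightarrow> m \<in> carrier M \<Longrightarrow> \<tau> p u a m \<in> carrier Z"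
proof -
  show "a \<in> tuples p I \<Longrightarrow> m \<in> carrier M \<Longrightarrow> (\<lambda>u. \<tau> p u a m) \<in> module_hom k (ob X p) Z"
    "f \<in> based_surj p q \<Longrightarrow> u \<in> carrier (ob X q) \<Longrightarrow> a \<in> tuples p I \<Longrightarrow> m \<in> carrier M \<Longrightarrow>
        \<tau> p (act X p q f u) a m = act_tuple p q f (\<tau> q u) a m"
    using assms unfolding balanced_def by blast+
  show *: "mlin I p Z (\<tau> p u)" if "u \<in> carrier (ob X p)" for u
    using assms that unfolding balanced_def by blast
  show "u \<in> carrier (ob X p) \<Longrightarrow> a \<in> tuples p I \<Longrightarrow> m \<in> carrier M \<Longrightarrow> \<tau> p u a m \<in> carrier Z"
    by (rule mlinD(2)[OF *])
qed

lemma balancedI: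
  assumes "\<And>p a m. a \<in> tuples p I \<Longrightarrow> m \<in> carrier M \<Longrightarrow> (\<lambda>u. \<tau> p u a m) \<in> module_hom k (ob X p) Z"
    and "\<And>p u. u \<in> carrier (ob X p) \<Longrightarrow> mlin I p Z (\<tau> p u)"
    and "\<And>p q f u a m. f \<in> based_surj p q \<Longrightarrow> u \<in> carrier (ob X q) \<Longrightarrow> a \<in> tuples p I \<Longrightarrow> m \<in> carrier M \<Longrightarrow>
        \<tau> p (act X p q f u) a m = act_tuple p q f (\<tau> q u) a m"
  shows "balanced X Z \<tau>"
  using assms unfolding balanced_def by blast

lemma admissible_I: "f \<in> based_surj p q \<Longrightarrow> admissible I p q f"
  unfolding admissible_def using mult_ideal_I by (auto dest: based_surjD)

lemma I_tuples: "a \<in> tuples p I \<Longrightarrow> a \<in> tuples p (carrier A)"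
  by (rule tuples_mono) (auto dest: I_carrier)

lemma push_I: "f \<in> based_surj p q \<Longrightarrow> a \<in> tuples p I \<Longrightarrow> push_tuple A p q f a \<in> tuples q I"
  by (rule push_tuple_closed[OF admissible_I])

lemma tail_M: "a \<in> tuples p I \<Longrightarrow> m \<in> carrier M \<Longrightarrow> tail_prod p f a \<odot>\<^bsub>M\<^esub> m \<in> carrier M"
  using tail_prod_closed[OF I_tuples] by simp

lemma balanced_pull:
  assumes \<xi>: "\<xi> \<in> surj_hom k X Y" and \<tau>: "balanced Y Z \<tau>"
  shows "balanced X Z (\<lambda>p u. \<tau> p (\<xi> p u))"
proof (rule balancedI)
  note h = surj_homD[OF \<xi>] and t = balancedD[OF \<tau>]
  show "(\<lambda>u. \<tau> p (\<xi> p u) a m) \<in> module_hom k (ob X p) Z" if "a \<in> tuples p I" "m \<in> carrier M" for p a m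
    by (rule mhom_comp[OF h(1) t(1)[OF that]])
  show "mlin I p Z (\<tau> p (\<xi> p u))" if "u \<in> carrier (ob X p)" for p u
    by (rule t(2)[OF mhom_closed[OF h(1) that]])
  show "\<tau> p (\<xi> p (act X p q f u)) a m = act_tuple p q f (\<tau> q (\<xi> q u)) a m"
    if "f \<in> based_surj p q" "u \<in> carrier (ob X q)" "a \<in> tuples p I" "m \<in> carrier M" for p q f u a m
    unfolding h(2)[OF that(1,2)] by (rule t(3)[OF that(1) mhom_closed[OF h(1) that(2)] that(3,4)])
qed

abbreviation pairing_values where
  "pairing_values X \<tau> \<equiv> {\<tau> p u a m | p u a m. u \<in> carrier (ob X p) \<and> a \<in> tuples p I \<and> m \<in> carrier M}"

abbreviation factors_through where
  "factors_through X \<tau> T Z \<beta> \<equiv> \<exists>h\<in>module_hom k T Z.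
     \<forall>p. \<forall>u\<in>carrier (ob X p). \<forall>a\<in>tuples p I. \<forall>m\<in>carrier M. h (\<tau> p u a m) = \<beta> p u a m"

abbreviation C where "C n \<equiv> RW_chains k A I M n"

text \<open>
  The generator \<open>\<sigma>\<close> moved along \<open>g\<close>, paired with a tuple, is the chain of \<open>\<sigma>\<close> with the tuple pushed
  forward along \<open>g\<close>; the formula is forced by balancedness.
\<close>

definition pair_C where
  "pair_C n p r a m = lin_comb k (C n)
     (\<lambda>(\<sigma>, g). act_tuple p (fst \<sigma> 0) g (\<lambda>b m. RW_gen k A I M n (fst \<sigma> 0, \<sigma>, b, m)) a m) r"

lemma C_module: "module k (C n)"
  by (rule RW_chains_module[OF I_submodule])

lemma pair_C_mlin_basis:
  assumes "\<sigma> \<in> N_Omega n x" "g \<in> based_surj p x"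
  shows "mlin I p (C n) (act_tuple p (fst \<sigma> 0) g (\<lambda>b m. RW_gen k A I M n (fst \<sigma> 0, \<sigma>, b, m)))"
proof -
  have x: "fst \<sigma> 0 = x" "x \<ge> 1" using N_Omega_pos[OF assms(1)] by auto
  show ?thesis unfolding x(1)
    by (rule act_tuple_mlin[OF admissible_I[OF assms(2)] RW_gen_mlin[OF I_submodule x(2) assms(1)]])
qed

lemma pair_C_hom:
  assumes "a \<in> tuples p I" "m \<in> carrier M"
  shows "(\<lambda>r. pair_C n p r a m) \<in> module_hom k (ob (bar k n) p) (C n)"
  unfolding pair_C_def
  by (rule k.bar_lin(1)[OF C_module]) (use mlinD(2)[OF pair_C_mlin_basis assms] in simp)

lemma pair_C_basis:
  assumes "\<sigma> \<in> N_Omega n x" "g \<in> based_surj p x" "a \<in> tuples p I" "m \<in> carrier M"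
  shows "pair_C n p (basis_elem k (\<sigma>, g)) a m = act_tuple p x g (\<lambda>b m. RW_gen k A I M n (x, \<sigma>, b, m)) a m"
proof -
  have x: "fst \<sigma> 0 = x" using N_Omega_pos[OF assms(1)] by auto
  have "pair_C n p (basis_elem k (\<sigma>, g)) a m =
      (case (\<sigma>, g) of (\<sigma>, g) \<Rightarrow> act_tuple p (fst \<sigma> 0) g (\<lambda>b m. RW_gen k A I M n (fst \<sigma> 0, \<sigma>, b, m)) a m)"
    unfolding pair_C_def
    by (rule k.bar_lin(2)[OF C_module _ bar_idxI[OF assms(1,2)]]) (use mlinD(2)[OF pair_C_mlin_basis assms(3,4)] in simp)
  then show ?thesis by (simp add: x)
qed

lemma pair_C_mlin: "r \<in> carrier (ob (bar k n) p) \<Longrightarrow> mlin I p (C n) (pair_C n p r)"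
proof -
  assume r: "r \<in> carrier (ob (bar k n) p)"
  then have r': "r \<in> carrier (free_module k (bar_idx n p))" by (simp add: bar_def)
  have "mlin I p (C n) (\<lambda>a m. \<Oplus>\<^bsub>C n\<^esub>s\<in>{s. r s \<noteq> \<zero>\<^bsub>k\<^esub>}. r s \<odot>\<^bsub>C n\<^esub>
      (case s of (\<sigma>, g) \<Rightarrow> act_tuple p (fst \<sigma> 0) g (\<lambda>b m. RW_gen k A I M n (fst \<sigma> 0, \<sigma>, b, m)) a m))"
  proof (rule mlin_sum[OF I_submodule C_module mlin_scale[OF C_module]])
    fix s assume "s \<in> {s. r s \<noteq> \<zero>\<^bsub>k\<^esub>}"
    then have "s \<in> bar_idx n p" using free_module_carrierD(4)[OF r'] by blast
    then obtain \<sigma> g x where s: "s = (\<sigma>, g)" "\<sigma> \<in> N_Omega n x" "g \<in> based_surj p x" by (rule bar_idxE)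
    show "mlin I p (C n) (\<lambda>a m. case s of (\<sigma>, g) \<Rightarrow> act_tuple p (fst \<sigma> 0) g (\<lambda>b m. RW_gen k A I M n (fst \<sigma> 0, \<sigma>, b, m)) a m)"
      using pair_C_mlin_basis[OF s(2,3)] unfolding s(1) by simp
  qed (rule free_module_carrierD(1)[OF r'])
  then show ?thesis unfolding pair_C_def[abs_def] lin_comb_def .
qed

lemma pair_C_balanced: "balanced (bar k n) (C n) (pair_C n)"
proof (rule balancedI[OF pair_C_hom pair_C_mlin])
  fix p q f u a m
  assume f: "f \<in> based_surj p q" and u: "u \<in> carrier (ob (bar k n) q)" and a: "a \<in> tuples p I" and m: "m \<in> carrier M"
  note pa = push_I[OF f a] and tm = tail_M[OF a m]
  show "pair_C n p (act (bar k n) p q f u) a m = act_tuple p q f (pair_C n q u) a m"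
    unfolding act_tuple_def
  proof (rule k.bar_hom_eq[OF C_module mhom_comp[OF k.bar_act(1)[OF f] pair_C_hom[OF a m]] pair_C_hom[OF pa tm] _ u])
    fix \<sigma> g x assume x: "\<sigma> \<in> N_Omega n x" "g \<in> based_surj q x"
    show "pair_C n p (act (bar k n) p q f (basis_elem k (\<sigma>, g))) a m =
        pair_C n q (basis_elem k (\<sigma>, g)) (push_tuple A p q f a) (tail_prod p f a \<odot>\<^bsub>M\<^esub> m)"
      unfolding k.bar_act(2)[OF f bar_idxI[OF x]] pair_C_basis[OF x pa tm] pair_C_basis[OF x(1) based_surj_comp[OF f x(2)] a m]
        act_tuple_comp[OF I_tuples[OF a] m based_surjD[OF f] based_surjD[OF x(2)]]
      unfolding act_tuple_def ..
  qed
qed auto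

lemma pair_C_id:
  assumes "\<sigma> \<in> N_Omega n x" "a \<in> tuples x I" "m \<in> carrier M"
  shows "pair_C n x (basis_elem k (\<sigma>, \<lambda>i\<in>{0..x}. i)) a m = RW_gen k A I M n (x, \<sigma>, a, m)"
  unfolding pair_C_basis[OF assms(1) based_surj_id assms(2,3)] by (rule act_tuple_id[OF I_tuples[OF assms(2)] assms(3)])

lemma pair_C_generates:
  "generates k (C n) (pairing_values (bar k n) (pair_C n))"
proof (rule generates_trans[OF RW_chains_generates[OF I_submodule] _ C_module])
  show "pairing_values (bar k n) (pair_C n) \<subseteq> carrier (C n)"
    using balancedD(4)[OF pair_C_balanced] by blast
  fix N g assume N: "pairing_values (bar k n) (pair_C n) \<subseteq> N"
    and "g \<in> RW_gen k A I M n ` RW_index I M n"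
  then obtain x \<sigma> a m where g: "g = RW_gen k A I M n (x, \<sigma>, a, m)" "\<sigma> \<in> N_Omega n x" "a \<in> tuples x I" "m \<in> carrier M"
    unfolding RW_index_def by auto
  have "g = pair_C n x (basis_elem k (\<sigma>, \<lambda>i\<in>{0..x}. i)) a m" unfolding pair_C_id[OF g(2-4)] by (rule g(1))
  moreover have "basis_elem k (\<sigma>, \<lambda>i\<in>{0..x}. i) \<in> carrier (ob (bar k n) x)"
    by (rule k.bar_basis[OF bar_idxI[OF g(2) based_surj_id]])
  ultimately show "g \<in> N" using N g(3,4) by blast
qed

lemma balanced_bar_basis:
  assumes \<beta>: "balanced (bar k n) Z \<beta>" and x: "\<sigma> \<in> N_Omega n x" "g \<in> based_surj p x" and a: "a \<in> tuples p I" and m: "m \<in> carrier M"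
  shows "\<beta> p (basis_elem k (\<sigma>, g)) a m = act_tuple p x g (\<beta> x (basis_elem k (\<sigma>, \<lambda>i\<in>{0..x}. i))) a m"
proof -
  have i: "(\<sigma>, \<lambda>i\<in>{0..x}. i) \<in> bar_idx n x" by (rule bar_idxI[OF x(1) based_surj_id])
  show ?thesis
    using balancedD(3)[OF \<beta> x(2) k.bar_basis[OF i] a m]
    unfolding k.bar_act(2)[OF x(2) i] comp_id_left[OF based_surjD[OF x(2)]] .
qed

text \<open>
  A balanced pairing on a free module is determined by its values on the generators \<open>(\<sigma>, id)\<close>, which
  can be arbitrary multilinear maps; these are the linear maps out of \<open>C\<Gamma>\<^sub>n(I, M)\<close>.
\<close>

lemma pair_C_universal:
  assumes Z: "module k Z" and \<beta>: "balanced (bar k n) Z \<beta>"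
  shows "factors_through (bar k n) (pair_C n) (C n) Z \<beta>"
proof -
  let ?e = "\<lambda>x \<sigma>. basis_elem k (\<sigma>, \<lambda>i\<in>{0..x}. i)"
  have e: "?e x \<sigma> \<in> carrier (ob (bar k n) x)" if "\<sigma> \<in> N_Omega n x" for x \<sigma>
    by (rule k.bar_basis[OF bar_idxI[OF that based_surj_id]])
  have "\<exists>h\<in>module_hom k (C n) Z. \<forall>(x, \<sigma>, a, m)\<in>RW_index I M n. h (RW_gen k A I M n (x, \<sigma>, a, m)) = \<beta> x (?e x \<sigma>) a m"
    by (rule RW_chains_lift[OF I_submodule Z]) (rule balancedD(2)[OF \<beta> e])
  then obtain h where h: "h \<in> module_hom k (C n) Z"
    "\<And>x \<sigma> a m. x \<ge> 1 \<Longrightarrow> \<sigma> \<in> N_Omega n x \<Longrightarrow> a \<in> tuples x I \<Longrightarrow> m \<in> carrier M \<Longrightarrow>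
      h (RW_gen k A I M n (x, \<sigma>, a, m)) = \<beta> x (?e x \<sigma>) a m"
    unfolding RW_index_def by auto
  have "h (pair_C n p r a m) = \<beta> p r a m"
    if r: "r \<in> carrier (ob (bar k n) p)" and a: "a \<in> tuples p I" and m: "m \<in> carrier M" for p r a m
  proof (rule k.bar_hom_eq[OF Z mhom_comp[OF pair_C_hom[OF a m] h(1)] balancedD(1)[OF \<beta> a m] _ r])
    fix \<sigma> g x assume x: "\<sigma> \<in> N_Omega n x" "g \<in> based_surj p x"
    show "h (pair_C n p (basis_elem k (\<sigma>, g)) a m) = \<beta> p (basis_elem k (\<sigma>, g)) a m"
      unfolding pair_C_basis[OF x a m] balanced_bar_basis[OF \<beta> x a m] unfolding act_tuple_def
      using h(2)[OF _ x(1) push_I[OF x(2) a] tail_M[OF a m]] N_Omega_pos[OF x(1)] by simp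
  qed
  then show ?thesis using h(1) by blast
qed

subsection \<open>The boundary of the Robinson--Whitehouse complex\<close>

text \<open>
  The three kinds of faces of \<open>C\<Gamma>(I, M)\<close> are those of \<open>bar k\<close>: the first one pushes the tuple along
  \<open>f 1\<close>, where no entry goes to the base point, the inner ones leave it alone, and the last one
  keeps the entries in a fibre and lets the product of the others act on \<open>M\<close>.
\<close>

lemma RW_face_gen_eq:
  assumes n: "n \<ge> 1" and j: "j \<le> n" and \<sigma>: "\<sigma> \<in> N_Omega n x" and a: "a \<in> tuples x I" and m: "m \<in> carrier M"
  shows "RW_face_gen k A I M n j (x, \<sigma>, a, m) = pair_C (n - 1) x (face_term k n x j \<sigma> (\<lambda>i\<in>{0..x}. i)) a m"
proof -
  interpret Cm: module k "C (n - 1)" by (rule C_module)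
  have a': "a \<in> tuples x (carrier A)" by (rule I_tuples[OF a])
  have x: "fst \<sigma> 0 = x" using N_Omega_pos[OF \<sigma>] by simp
  obtain X f where s: "\<sigma> = (X, f)" by (cases \<sigma>)
  note s0 = bar_idxI[OF \<sigma> based_surj_id]
  let ?y = "\<lambda>i. fst (face_str n j \<sigma> i) 0"
  let ?G = "\<lambda>i. act_tuple x (?y i) (face_map n j \<sigma> i) (\<lambda>b m. RW_gen k A I M (n - 1) (?y i, face_str n j \<sigma> i, b, m)) a m"
  have t: "pair_C (n - 1) x (basis_elem k (face_str n j \<sigma> i, compose {0..x} (face_map n j \<sigma> i) (\<lambda>i\<in>{0..x}. i))) a m = ?G i"
    if i: "i \<in> face_idx n j \<sigma>" for i
    unfolding comp_id_right[OF based_surjD[OF face_in(2)[OF \<sigma> n j i]]] by (rule pair_C_basis[OF face_in[OF \<sigma> n j i] a m])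
  have c: "?G i \<in> carrier (C (n - 1))" if i: "i \<in> face_idx n j \<sigma>" for i
    unfolding t[OF i, symmetric] by (rule balancedD(4)[OF pair_C_balanced k.bar_basis[OF bar_idx_face[OF s0 n j i]] a m])
  have sum: "pair_C (n - 1) x (face_term k n x j \<sigma> (\<lambda>i\<in>{0..x}. i)) a m = (\<Oplus>\<^bsub>C (n - 1)\<^esub>i\<in>face_idx n j \<sigma>. ?G i)"
    unfolding face_term_def
    by (subst mhom_finsum[OF k.bar_module C_module pair_C_hom[OF a m]])
       (use k.bar_basis[OF bar_idx_face[OF s0 n j]] t c in \<open>auto intro!: Cm.finsum_cong'\<close>)
  consider (first) "j = 0" | (mid) "1 \<le> j" "j < n" | (last) "j = n" "j \<noteq> 0" using j n by linarith
  then show ?thesis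
  proof cases
    case first
    have f1: "f 1 \<in> Surj x (X 1)"
    proof -
      have "\<forall>j\<in>{1..n}. f j \<in> Surj (X (j - 1)) (X j)" using \<sigma> by (simp add: s N_Omega_iff)
      from bspec[OF this, of 1] show ?thesis using n x s by simp
    qed
    have idx: "face_idx n j \<sigma> = {1}" using first n by (simp add: face_idx_def)
    have y: "?y 1 = X 1" using first by (simp add: face_str_def drop_first_def s)
    have fm: "face_map n j \<sigma> 1 = to_based x (f 1)" using first x by (simp add: face_map_def s)
    have e: "{l \<in> {1..x}. to_based x (f 1) l = i} = {l \<in> {1..x}. f 1 l = i}" for i
      by (auto simp: to_based_def)
    have "push_tuple A x (X 1) (to_based x (f 1)) a = push_tuple A x (X 1) (f 1) a"
      unfolding push_tuple_def e ..
    moreover have z: "{l \<in> {1..x}. f 1 l = 0} = {}" using f1 unfolding Surj_iff by force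
    have "tail_prod x (to_based x (f 1)) a = \<one>\<^bsub>A\<^esub>" unfolding tail_prod_def e z by simp
    ultimately have "?G 1 = RW_face_gen k A I M n j (x, \<sigma>, a, m)"
      unfolding y fm act_tuple_def using m first by (simp add: RW_face_gen_def face_str_def s Let_def)
    then show ?thesis unfolding sum idx using c idx by simp
  next
    case mid
    have idx: "face_idx n j \<sigma> = {1}" using mid n by (simp add: face_idx_def)
    have y: "?y 1 = x" using mid x by (simp add: face_str_def compose_at_def s)
    have fm: "face_map n j \<sigma> 1 = (\<lambda>i\<in>{0..x}. i)" using mid x by (simp add: face_map_def s)
    have "?G 1 = RW_face_gen k A I M n j (x, \<sigma>, a, m)"
      unfolding y fm act_tuple_id[OF a' m] using mid by (simp add: RW_face_gen_def face_str_def)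
    then show ?thesis unfolding sum idx using c idx by simp
  next
    case last
    have idx: "face_idx n j \<sigma> = {1..fst \<sigma> (n - 1)}" using last by (simp add: face_idx_def)
    have "RW_face_gen k A I M n j (x, \<sigma>, a, m) = (\<Oplus>\<^bsub>C (n - 1)\<^esub>i\<in>{1..fst \<sigma> (n - 1)}.
          let S = fibre n \<sigma> i 0 in
          RW_gen k A I M (n - 1) (card S, component n \<sigma> i, \<lambda>l\<in>{1..card S}. a (nth_elem S l),
             (\<Otimes>\<^bsub>A\<^esub>l\<in>{1..x} - S. a l) \<odot>\<^bsub>M\<^esub> m))"
      using last by (simp add: RW_face_gen_def)
    also have "\<dots> = (\<Oplus>\<^bsub>C (n - 1)\<^esub>i\<in>{1..fst \<sigma> (n - 1)}. ?G i)"
    proof (rule Cm.finsum_cong'[OF refl])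
      show "?G \<in> {1..fst \<sigma> (n - 1)} \<rightarrow> carrier (C (n - 1))" using c idx by auto
      fix i assume i: "i \<in> {1..fst \<sigma> (n - 1)}"
      define S where "S = fibre n \<sigma> i 0"
      have S: "finite S" "S \<subseteq> {1..x}" unfolding S_def using fibre_finite[of n \<sigma> i 0] x by auto
      have fs: "face_str n j \<sigma> i = component n \<sigma> i" using last by (simp add: face_str_def)
      have y: "?y i = card S" unfolding fs S_def using component_eq[of n X f i] by (simp add: s)
      have fm: "face_map n j \<sigma> i = collapse x S" using last x by (simp add: face_map_def S_def)
      have "push_tuple A x (card S) (collapse x S) a = (\<lambda>l\<in>{1..card S}. a (nth_elem S l))"
        unfolding push_tuple_def
      proof (rule restrict_ext)
        fix l assume l: "l \<in> {1..card S}"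
        have "{l' \<in> {1..x}. collapse x S l' = l} = {nth_elem S l}"
          using nth_elem_in[OF S(1) l] rank_nth[OF S(1) l] nth_rank[OF S(1)] S(2) l
          by (auto simp: collapse_app split: if_splits)
        then show "(\<Otimes>\<^bsub>A\<^esub>l'\<in>{l' \<in> {1..x}. collapse x S l' = l}. a l') = a (nth_elem S l)"
          using tuplesD(1)[OF a'] nth_elem_in[OF S(1) l] S(2) by (auto simp: A.finprod_insert subset_iff)
      qed
      moreover have "{l \<in> {1..x}. collapse x S l = 0} = {1..x} - S"
        using rank_in_range[OF S(1)] by (fastforce simp: collapse_app)
      then have "tail_prod x (collapse x S) a = (\<Otimes>\<^bsub>A\<^esub>l\<in>{1..x} - S. a l)" unfolding tail_prod_def by simp
      ultimately show "(let S = fibre n \<sigma> i 0 in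
          RW_gen k A I M (n - 1) (card S, component n \<sigma> i, \<lambda>l\<in>{1..card S}. a (nth_elem S l),
             (\<Otimes>\<^bsub>A\<^esub>l\<in>{1..x} - S. a l) \<odot>\<^bsub>M\<^esub> m)) = ?G i"
        unfolding y fm act_tuple_def unfolding fs Let_def S_def[symmetric] by simp
    qed
    finally show ?thesis unfolding sum idx .
  qed
qed

text \<open>
  On a chain with \<open>g = id\<close> this is the comparison of faces; it extends to all basis elements because
  both differentials are compatible with based surjections.
\<close>

lemma
  assumes n: "n \<ge> 1"
  shows RW_boundary_hom: "RW_boundary k A I M n \<in> module_hom k (C n) (C (n - 1))"
    and RW_boundary_pair_C: "r \<in> carrier (ob (bar k n) p) \<Longrightarrow> a \<in> tuples p I \<Longrightarrow> m \<in> carrier M \<Longrightarrow>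
      RW_boundary k A I M n (pair_C n p r a m) = pair_C (n - 1) p (bar_d k n p r) a m"
proof -
  interpret Cm: module k "C (n - 1)" by (rule C_module)
  have ft: "face_term k n x j \<sigma> (\<lambda>i\<in>{0..x}. i) \<in> carrier (ob (bar k (n - 1)) x)"
    if "\<sigma> \<in> N_Omega n x" "j \<le> n" for \<sigma> x j
    by (rule k.face_term_closed[OF bar_idxI[OF that(1) based_surj_id] n that(2)])
  have ex: "\<exists>\<phi>\<in>module_hom k (C n) (C (n - 1)). \<forall>s\<in>RW_index I M n. \<phi> (RW_gen k A I M n s) = RW_face_gen k A I M n j s"
    if j: "j \<le> n" for j
  proof -
    have "\<exists>\<psi>\<in>module_hom k (C n) (C (n - 1)). \<forall>(x, \<sigma>, a, m)\<in>RW_index I M n.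
        \<psi> (RW_gen k A I M n (x, \<sigma>, a, m)) = pair_C (n - 1) x (face_term k n x j \<sigma> (\<lambda>i\<in>{0..x}. i)) a m"
      by (rule RW_chains_lift[OF I_submodule C_module]) (rule pair_C_mlin[OF ft[OF _ j]])
    then show ?thesis by (auto simp: RW_index_def RW_face_gen_eq[OF n j])
  qed
  note fh = linear_extension_hom[OF C_module C_module RW_chains_generates[OF I_submodule] ex, folded RW_face_def]
  have b: "RW_boundary k A I M n = (\<lambda>z. \<Oplus>\<^bsub>C (n - 1)\<^esub>j\<in>{0..n}. bar_sign k j \<odot>\<^bsub>C (n - 1)\<^esub> RW_face k A I M n j z)"
    unfolding RW_boundary_def[abs_def] bar_sign_def ..
  show bh: "RW_boundary k A I M n \<in> module_hom k (C n) (C (n - 1))"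
    unfolding b by (intro mhom_finite_sum[OF C_module C_module] mhom_scale[OF C_module fh(1)] k.bar_sign_closed) auto
  have gen: "RW_boundary k A I M n (RW_gen k A I M n (x, \<sigma>, a, m)) =
      pair_C (n - 1) x (bar_d k n x (basis_elem k (\<sigma>, \<lambda>i\<in>{0..x}. i))) a m"
    if \<sigma>: "\<sigma> \<in> N_Omega n x" and a: "a \<in> tuples x I" and m: "m \<in> carrier M" for x \<sigma> a m
  proof -
    have i: "(x, \<sigma>, a, m) \<in> RW_index I M n" using N_Omega_pos[OF \<sigma>] \<sigma> a m by (simp add: RW_index_def)
    interpret F: module k "ob (bar k (n - 1)) x" by (rule k.bar_module)
    have "RW_boundary k A I M n (RW_gen k A I M n (x, \<sigma>, a, m)) =
        (\<Oplus>\<^bsub>C (n - 1)\<^esub>j\<in>{0..n}. bar_sign k j \<odot>\<^bsub>C (n - 1)\<^esub> pair_C (n - 1) x (face_term k n x j \<sigma> (\<lambda>i\<in>{0..x}. i)) a m)"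
      unfolding b
      by (rule Cm.finsum_cong')
         (use fh(2)[OF _ i] RW_face_gen_eq[OF n _ \<sigma> a m] balancedD(4)[OF pair_C_balanced ft[OF \<sigma>] a m] k.bar_sign_closed in auto)
    also have "\<dots> = pair_C (n - 1) x (bar_d k n x (basis_elem k (\<sigma>, \<lambda>i\<in>{0..x}. i))) a m"
      unfolding k.bar_d_basis[OF n bar_idxI[OF \<sigma> based_surj_id]]
      by (subst mhom_finsum[OF k.bar_module C_module pair_C_hom[OF a m]])
         (use ft[OF \<sigma>] k.bar_sign_closed balancedD(4)[OF pair_C_balanced ft[OF \<sigma>] a m] in
           \<open>auto simp: mhom_smult[OF pair_C_hom[OF a m]] intro!: Cm.finsum_cong'\<close>)
    finally show ?thesis .
  qed
  show "RW_boundary k A I M n (pair_C n p r a m) = pair_C (n - 1) p (bar_d k n p r) a m"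
    if r: "r \<in> carrier (ob (bar k n) p)" and a: "a \<in> tuples p I" and m: "m \<in> carrier M"
  proof (rule k.bar_hom_eq[OF C_module mhom_comp[OF pair_C_hom[OF a m] bh] mhom_comp[OF k.bar_d_hom[OF n] pair_C_hom[OF a m]] _ r])
    fix \<sigma> g x assume x: "\<sigma> \<in> N_Omega n x" "g \<in> based_surj p x"
    have i: "(\<sigma>, \<lambda>i\<in>{0..x}. i) \<in> bar_idx n x" by (rule bar_idxI[OF x(1) based_surj_id])
    note e = k.bar_basis[OF i]
    have ag: "act (bar k n) p x g (basis_elem k (\<sigma>, \<lambda>i\<in>{0..x}. i)) = basis_elem k (\<sigma>, g)"
      unfolding k.bar_act(2)[OF x(2) i] comp_id_left[OF based_surjD[OF x(2)]] ..
    have "RW_boundary k A I M n (pair_C n p (basis_elem k (\<sigma>, g)) a m) =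
        act_tuple p x g (pair_C (n - 1) x (bar_d k n x (basis_elem k (\<sigma>, \<lambda>i\<in>{0..x}. i)))) a m"
      unfolding pair_C_basis[OF x a m] act_tuple_def by (rule gen[OF x(1) push_I[OF x(2) a] tail_M[OF a m]])
    also have "\<dots> = pair_C (n - 1) p (act (bar k (n - 1)) p x g (bar_d k n x (basis_elem k (\<sigma>, \<lambda>i\<in>{0..x}. i)))) a m"
      by (rule balancedD(3)[OF pair_C_balanced x(2) mhom_closed[OF k.bar_d_hom[OF n] e] a m, symmetric])
    also have "\<dots> = pair_C (n - 1) p (bar_d k n p (basis_elem k (\<sigma>, g))) a m"
      unfolding k.bar_d_natural[OF n x(2) e, symmetric] ag ..
    finally show "RW_boundary k A I M n (pair_C n p (basis_elem k (\<sigma>, g)) a m) = pair_C (n - 1) p (bar_d k n p (basis_elem k (\<sigma>, g))) a m" .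
  qed
qed

end

section \<open>Tensor products over \<open>\<Gamma>\<close>\<close>

definition left_module_data where
  "left_module_data k F \<longleftrightarrow> (\<forall>n. module k (ob F n)) \<and>
     (\<forall>p q. \<forall>f\<in>Gamma_hom p q. act F p q f \<in> module_hom k (ob F p) (ob F q))"

lemma left_module_dataD:
  assumes "left_module_data k F"
  shows "module k (ob F n)" "f \<in> Gamma_hom p q \<Longrightarrow> act F p q f \<in> module_hom k (ob F p) (ob F q)"
  using assms unfolding left_module_data_def by auto

lemma
  assumes G: "right_gamma_module k G" and F: "left_module_data k F"
  shows gamma_tensor_module: "module k (gamma_tensor k G F)"
    and gamma_gen_bilinear: "bilinear_map k (ob G n) (ob F n) (gamma_tensor k G F) (\<lambda>u v. gamma_tensor_gen k G F (n, u, v))"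
    and gamma_gen_balanced: "f \<in> Gamma_hom p q \<Longrightarrow> u \<in> carrier (ob G q) \<Longrightarrow> v \<in> carrier (ob F p) \<Longrightarrow>
       gamma_tensor_gen k G F (p, act G p q f u, v) = gamma_tensor_gen k G F (q, u, act F p q f v)"
    and gamma_generates: "generates k (gamma_tensor k G F)
       (gamma_tensor_gen k G F ` {(n, u, v). u \<in> carrier (ob G n) \<and> v \<in> carrier (ob F n)})"
    and gamma_lift: "module k Z \<Longrightarrow> (\<And>n. bilinear_map k (ob G n) (ob F n) Z (\<gamma> n)) \<Longrightarrow>
       (\<And>p q f u v. f \<in> Gamma_hom p q \<Longrightarrow> u \<in> carrier (ob G q) \<Longrightarrow> v \<in> carrier (ob F p) \<Longrightarrow>
          \<gamma> p (act G p q f u) v = \<gamma> q u (act F p q f v)) \<Longrightarrow>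
       \<exists>h\<in>module_hom k (gamma_tensor k G F) Z. \<forall>n. \<forall>u\<in>carrier (ob G n). \<forall>v\<in>carrier (ob F n).
          h (gamma_tensor_gen k G F (n, u, v)) = \<gamma> n u v"
proof -
  note Gm = right_gamma_moduleD[OF G] and Fm = left_module_dataD[OF F]
  have k: "cring k" using module_cring[OF Gm(1)] .
  let ?T = "\<lambda>n. tensor k (ob G n) (ob F n)" and ?S = "gamma_sum k G F"
  let ?pt = "\<lambda>n. pure_tensor k (ob G n) (ob F n)" and ?g = "gamma_sum_gen k G F"
  note T = tensor_module[OF Gm(1) Fm(1)]
  have S: "module k ?S" unfolding gamma_sum_def by (rule direct_sum_module[OF k T])
  have inj: "sum_inj UNIV ?T n \<in> module_hom k (?T n) ?S" for n
    unfolding gamma_sum_def by (rule sum_inj_hom[OF k T]) auto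
  note pt = bilinear_mapD[OF pure_tensor_bilinear[OF Gm(1) Fm(1)]]
  have g: "?g n u v = sum_inj UNIV ?T n (?pt n u v)" for n u v unfolding gamma_sum_gen_def ..
  have gc: "?g n u v \<in> carrier ?S" if "u \<in> carrier (ob G n)" "v \<in> carrier (ob F n)" for n u v
    unfolding g by (rule mhom_closed[OF inj pt(3)[OF that]])
  define B where "B = {?g p (act G p q f u) v \<ominus>\<^bsub>?S\<^esub> ?g q u (act F p q f v)
       | p q f u v. f \<in> Gamma_hom p q \<and> u \<in> carrier (ob G q) \<and> v \<in> carrier (ob F p)}"
  interpret S: module k ?S by (rule S)
  have gc1: "?g p (act G p q f u) v \<in> carrier ?S" "?g q u (act F p q f v) \<in> carrier ?S"
    if "f \<in> Gamma_hom p q" "u \<in> carrier (ob G q)" "v \<in> carrier (ob F p)" for p q f u v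
    using gc mhom_closed[OF Gm(2)[OF that(1)] that(2)] mhom_closed[OF Fm(2)[OF that(1)] that(3)] that by auto
  have B: "B \<subseteq> carrier ?S" unfolding B_def using gc1 S.M.minus_closed by blast
  have rel: "gamma_rel k G F = span_of k ?S B" unfolding gamma_rel_def B_def ..
  note N = span_of_submodule[OF S B, folded rel]
  show E: "module k (gamma_tensor k G F)"
    unfolding gamma_tensor_def by (rule quotient_module_module[OF S N])
  have q: "(\<lambda>x. gamma_rel k G F +>\<^bsub>?S\<^esub> x) \<in> module_hom k ?S (gamma_tensor k G F)"
    unfolding gamma_tensor_def by (rule coset_hom[OF S N])
  have gg: "gamma_tensor_gen k G F (n, u, v) = gamma_rel k G F +>\<^bsub>?S\<^esub> ?g n u v" for n u v
    unfolding gamma_tensor_gen_def by simp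
  show "bilinear_map k (ob G n) (ob F n) (gamma_tensor k G F) (\<lambda>u v. gamma_tensor_gen k G F (n, u, v))" for n
    unfolding bilinear_map_def gg g
    by (auto intro!: mhom_comp[OF _ mhom_comp[OF inj q]] pt)
  show "gamma_tensor_gen k G F (p, act G p q f u, v) = gamma_tensor_gen k G F (q, u, act F p q f v)"
    if "f \<in> Gamma_hom p q" "u \<in> carrier (ob G q)" "v \<in> carrier (ob F p)" for f p q u v
    unfolding gg rel by (rule quotient_relation[OF S B gc1[OF that]]) (unfold B_def, use that in blast)
  have gs: "generates k ?S (\<Union>n\<in>UNIV. sum_inj UNIV ?T n ` {?pt n x y | x y. x \<in> carrier (ob G n) \<and> y \<in> carrier (ob F n)})"
    unfolding gamma_sum_def
    by (rule direct_sum_generates[OF k T tensor_generates[OF Gm(1) Fm(1)]]) (auto simp: generates_def)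
  show "generates k (gamma_tensor k G F)
       (gamma_tensor_gen k G F ` {(n, u, v). u \<in> carrier (ob G n) \<and> v \<in> carrier (ob F n)})"
  proof (rule generates_trans[OF quotient_generates[OF S N gs, folded gamma_tensor_def] _ E])
    show "gamma_tensor_gen k G F ` {(n, u, v). u \<in> carrier (ob G n) \<and> v \<in> carrier (ob F n)} \<subseteq> carrier (gamma_tensor k G F)"
      using mhom_closed[OF q gc] by (auto simp: gg)
    fix N' x assume N': "gamma_tensor_gen k G F ` {(n, u, v). u \<in> carrier (ob G n) \<and> v \<in> carrier (ob F n)} \<subseteq> N'"
      and "x \<in> (\<lambda>x. gamma_rel k G F +>\<^bsub>?S\<^esub> x) `
        (\<Union>n\<in>UNIV. sum_inj UNIV ?T n ` {?pt n x y | x y. x \<in> carrier (ob G n) \<and> y \<in> carrier (ob F n)})"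
    then obtain n u v where "x = gamma_tensor_gen k G F (n, u, v)" "u \<in> carrier (ob G n)" "v \<in> carrier (ob F n)"
      unfolding gg g by blast
    then show "x \<in> N'" using N' by blast
  qed
  show "\<exists>h\<in>module_hom k (gamma_tensor k G F) Z. \<forall>n. \<forall>u\<in>carrier (ob G n). \<forall>v\<in>carrier (ob F n).
          h (gamma_tensor_gen k G F (n, u, v)) = \<gamma> n u v"
    if Z: "module k Z" and \<gamma>: "\<And>n. bilinear_map k (ob G n) (ob F n) Z (\<gamma> n)"
      and bal: "\<And>p q f u v. f \<in> Gamma_hom p q \<Longrightarrow> u \<in> carrier (ob G q) \<Longrightarrow> v \<in> carrier (ob F p) \<Longrightarrow>
          \<gamma> p (act G p q f u) v = \<gamma> q u (act F p q f v)"
  proof -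
    interpret Z: module k Z by (rule Z)
    have "\<exists>\<phi>\<in>module_hom k (?T n) Z. \<forall>u\<in>carrier (ob G n). \<forall>v\<in>carrier (ob F n). \<phi> (?pt n u v) = \<gamma> n u v" for n
      by (rule tensor_lift[OF Gm(1) Fm(1) Z \<gamma>])
    then obtain \<phi> where \<phi>: "\<And>n. \<phi> n \<in> module_hom k (?T n) Z"
      "\<And>n u v. u \<in> carrier (ob G n) \<Longrightarrow> v \<in> carrier (ob F n) \<Longrightarrow> \<phi> n (?pt n u v) = \<gamma> n u v" by metis
    have "\<exists>\<psi>\<in>module_hom k ?S Z. \<forall>n\<in>UNIV. \<forall>x\<in>carrier (?T n). \<psi> (sum_inj UNIV ?T n x) = \<phi> n x"
      unfolding gamma_sum_def by (rule direct_sum_lift[OF k T Z \<phi>(1)])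
    then obtain \<psi> where \<psi>: "\<psi> \<in> module_hom k ?S Z" "\<And>n x. x \<in> carrier (?T n) \<Longrightarrow> \<psi> (sum_inj UNIV ?T n x) = \<phi> n x" by auto
    have \<psi>g: "\<psi> (?g n u v) = \<gamma> n u v" if "u \<in> carrier (ob G n)" "v \<in> carrier (ob F n)" for n u v
      unfolding g using \<psi>(2)[OF pt(3)[OF that]] \<phi>(2)[OF that] by simp
    have "\<psi> b = \<zero>\<^bsub>Z\<^esub>" if b: "b \<in> B" for b
    proof -
      obtain p q f u v where f: "b = ?g p (act G p q f u) v \<ominus>\<^bsub>?S\<^esub> ?g q u (act F p q f v)"
        "f \<in> Gamma_hom p q" "u \<in> carrier (ob G q)" "v \<in> carrier (ob F p)" using b unfolding B_def by blast
      note fu = mhom_closed[OF Gm(2)[OF f(2)] f(3)] and fv = mhom_closed[OF Fm(2)[OF f(2)] f(4)]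
      show ?thesis
        unfolding f(1) mhom_minus[OF S Z \<psi>(1) gc1[OF f(2-4)]] \<psi>g[OF fu f(4)] \<psi>g[OF f(3) fv] bal[OF f(2-4)]
        using bilinear_mapD(3)[OF \<gamma> f(3) fv] by (subst module_minus_eq_zero[OF Z]) auto
    qed
    then have "\<psi> x = \<zero>\<^bsub>Z\<^esub>" if "x \<in> gamma_rel k G F" for x
      by (rule span_of_kill[OF S Z \<psi>(1) B]) (use that rel in auto)
    from quotient_lift[OF S N Z \<psi>(1) this] obtain h where "h \<in> module_hom k (gamma_tensor k G F) Z"
      "\<And>x. x \<in> carrier ?S \<Longrightarrow> h (gamma_rel k G F +>\<^bsub>?S\<^esub> x) = \<psi> x" unfolding gamma_tensor_def by blast
    then show ?thesis unfolding gg using \<psi>g gc by (intro bexI[of _ h]) auto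
  qed
qed

lemma
  assumes G: "right_gamma_module k G" and H: "right_gamma_module k H" and F: "left_module_data k F"
    and \<theta>: "\<theta> \<in> right_gamma_hom k G H"
  shows gamma_tensor_map_hom: "gamma_tensor_map k G H F \<theta> \<in> module_hom k (gamma_tensor k G F) (gamma_tensor k H F)"
    and gamma_tensor_map_gen: "u \<in> carrier (ob G n) \<Longrightarrow> v \<in> carrier (ob F n) \<Longrightarrow>
      gamma_tensor_map k G H F \<theta> (gamma_tensor_gen k G F (n, u, v)) = gamma_tensor_gen k H F (n, \<theta> n u, v)"
proof -
  note t = right_gamma_homD[OF \<theta>] and bil = bilinear_mapD[OF gamma_gen_bilinear[OF H F]]
  have "\<exists>h\<in>module_hom k (gamma_tensor k G F) (gamma_tensor k H F). \<forall>n. \<forall>u\<in>carrier (ob G n). \<forall>v\<in>carrier (ob F n).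
          h (gamma_tensor_gen k G F (n, u, v)) = gamma_tensor_gen k H F (n, \<theta> n u, v)"
  proof (rule gamma_lift[OF G F gamma_tensor_module[OF H F]])
    show "bilinear_map k (ob G n) (ob F n) (gamma_tensor k H F) (\<lambda>u v. gamma_tensor_gen k H F (n, \<theta> n u, v))" for n
      unfolding bilinear_map_def using mhom_comp[OF t(1) bil(1)] bil(2) mhom_closed[OF t(1)] by auto
    fix p q f u v assume f: "f \<in> Gamma_hom p q" and u: "u \<in> carrier (ob G q)" and v: "v \<in> carrier (ob F p)"
    show "gamma_tensor_gen k H F (p, \<theta> p (act G p q f u), v) = gamma_tensor_gen k H F (q, \<theta> q u, act F p q f v)"
      unfolding t(2)[OF f u] by (rule gamma_gen_balanced[OF H F f mhom_closed[OF t(1) u] v])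
  qed
  then have ex: "\<exists>h\<in>module_hom k (gamma_tensor k G F) (gamma_tensor k H F).
      \<forall>s\<in>{(n, u, v). u \<in> carrier (ob G n) \<and> v \<in> carrier (ob F n)}.
        h (gamma_tensor_gen k G F s) = (\<lambda>(n, u, v). gamma_tensor_gen k H F (n, \<theta> n u, v)) s"
    by (elim bexE, intro bexI) auto
  note l = linear_extension_hom[OF gamma_tensor_module[OF G F] gamma_tensor_module[OF H F] gamma_generates[OF G F] ex,
      folded gamma_tensor_map_def]
  show "gamma_tensor_map k G H F \<theta> \<in> module_hom k (gamma_tensor k G F) (gamma_tensor k H F)" by (rule l(1))
  show "u \<in> carrier (ob G n) \<Longrightarrow> v \<in> carrier (ob F n) \<Longrightarrow>
      gamma_tensor_map k G H F \<theta> (gamma_tensor_gen k G F (n, u, v)) = gamma_tensor_gen k H F (n, \<theta> n u, v)"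
    using l(2)[of "(n, u, v)"] by simp
qed

text \<open>
  Every based map factors as a based surjection (\<open>onto_image\<close>) followed by such an inclusion of its
  image.
\<close>

definition incl :: "nat set \<Rightarrow> nat \<Rightarrow> nat" where
  "incl S = (\<lambda>l\<in>{0..card S}. if l = 0 then 0 else nth_elem S l)"

lemma incl_Gamma: "S \<subseteq> {1..p} \<Longrightarrow> incl S \<in> Gamma_hom (card S) p"
proof (rule Gamma_homI)
  assume S: "S \<subseteq> {1..p}"
  have fin: "finite S" using S by (rule finite_subset) auto
  show "incl S i \<le> p" if "i \<le> card S" for i
    using nth_elem_in[OF fin, of i] that S by (auto simp: incl_def subset_iff)
qed (auto simp: incl_def)

definition image_supp :: "nat \<Rightarrow> (nat \<Rightarrow> nat) \<Rightarrow> nat set" where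
  "image_supp p f = f ` {1..p} - {0}"

definition onto_image :: "nat \<Rightarrow> (nat \<Rightarrow> nat) \<Rightarrow> nat \<Rightarrow> nat" where
  "onto_image p f = (\<lambda>i\<in>{0..p}. if f i = 0 then 0 else rank_in (image_supp p f) (f i))"

lemma image_supp_sub: "f \<in> Gamma_hom p q \<Longrightarrow> image_supp p f \<subseteq> {1..q}"
  using Gamma_hom_app(1) unfolding image_supp_def by (auto simp: Suc_le_eq One_nat_def)

lemma image_supp_finite: "finite (image_supp p f)"
  unfolding image_supp_def by simp

lemma onto_image_surj:
  assumes f: "f \<in> Gamma_hom p q"
  shows "onto_image p f \<in> based_surj p (card (image_supp p f))"
    and "compose {0..p} (incl (image_supp p f)) (onto_image p f) = f"
proof -
  let ?S = "image_supp p f"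
  note fin = image_supp_finite[of p f]
  have m: "f i \<in> ?S" if "i \<in> {1..p}" "f i \<noteq> 0" for i using that unfolding image_supp_def by auto
  have m0: "f i \<in> ?S" if "i \<le> p" "f i \<noteq> 0" for i
    using m[of i] that Gamma_hom_app(2)[OF f] by (cases "i = 0") auto
  show *: "onto_image p f \<in> based_surj p (card ?S)"
  proof (rule based_surjI[OF Gamma_homI])
    show "onto_image p f \<in> extensional {0..p}" "onto_image p f 0 = 0"
      using Gamma_hom_app(2)[OF f] by (simp_all add: onto_image_def)
    show "onto_image p f i \<le> card ?S" if "i \<le> p" for i
      using rank_in_range[OF fin m0[OF that]] that by (auto simp: onto_image_def)
    fix j assume j: "j \<in> {1..card ?S}"
    obtain i where i: "i \<in> {1..p}" "f i = nth_elem ?S j" "f i \<noteq> 0"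
      using nth_elem_in[OF fin j] unfolding image_supp_def by auto
    then show "\<exists>i\<in>{1..p}. onto_image p f i = j"
      using rank_nth[OF fin j] by (intro bexI[of _ i]) (auto simp: onto_image_def)
  qed
  show "compose {0..p} (incl ?S) (onto_image p f) = f"
  proof (rule Gamma_hom_eqI[OF Gamma_hom_comp[OF based_surjD[OF *] incl_Gamma[OF image_supp_sub[OF f]]] f])
    fix i assume i: "i \<in> {1..p}"
    show "compose {0..p} (incl ?S) (onto_image p f) i = f i"
      using i rank_in_range[OF fin m[OF i]] nth_rank[OF fin m[OF i]]
      by (cases "f i = 0") (auto simp: comp_app onto_image_def incl_def)
  qed
qed

text \<open>
  Precomposing with a based surjection does not change the image. So the based maps into \<open>[q]\<close> with
  image \<open>S\<close> form a subfunctor on the based surjections, and it is represented by \<open>[card S]\<close>.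
\<close>

lemma
  assumes h: "h \<in> based_surj p' p" and f: "f \<in> Gamma_hom p q"
  shows image_supp_comp: "image_supp p' (compose {0..p'} f h) = image_supp p f"
    and onto_image_comp: "onto_image p' (compose {0..p'} f h) = compose {0..p'} (onto_image p f) h"
proof -
  note hG = based_surjD[OF h]
  show e: "image_supp p' (compose {0..p'} f h) = image_supp p f"
  proof (intro equalityI subsetI)
    fix j assume "j \<in> image_supp p' (compose {0..p'} f h)"
    then obtain i where i: "i \<in> {1..p'}" "j = f (h i)" "j \<noteq> 0" unfolding image_supp_def by (auto simp: comp_app)
    then have "h i \<noteq> 0" using Gamma_hom_app(2)[OF f] by (metis)
    then have "h i \<in> {1..p}" using Gamma_hom_app(1)[OF hG, of i] i(1) by simp
    then show "j \<in> image_supp p f" using i unfolding image_supp_def by blast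
  next
    fix j assume "j \<in> image_supp p f"
    then obtain i where i: "i \<in> {1..p}" "j = f i" "j \<noteq> 0" unfolding image_supp_def by auto
    obtain l where "l \<in> {1..p'}" "h l = i" using based_surj_onto[OF h i(1)] by blast
    then show "j \<in> image_supp p' (compose {0..p'} f h)"
      using i unfolding image_supp_def by (auto simp: comp_app image_iff intro!: bexI[of _ l])
  qed
  show "onto_image p' (compose {0..p'} f h) = compose {0..p'} (onto_image p f) h"
    using Gamma_hom_app(1)[OF hG] unfolding onto_image_def e by (auto simp: compose_def fun_eq_iff)
qed

section \<open>The Loday functor of an augmented algebra\<close>

context augmented_algebra
begin

abbreviation L where "L \<equiv> Loday k A M"
abbreviation Lgen where "Lgen \<equiv> coeff_gen (carrier A)"

lemma sub_mod_A: "sub_mod A (carrier A) = A"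
  by simp

lemma Loday_ob: "ob L p = RW_coeff k A (carrier A) M p"
  unfolding Loday_def Loday_ob_def[abs_def] RW_coeff_def by simp

lemma Loday_gen: "Loday_gen k A M p (a, m) = Lgen p a m"
  unfolding Loday_gen_def coeff_gen_def by simp

lemma L_module: "module k (ob L p)"
  unfolding Loday_ob by (rule coeff_module[OF A_submodule])

lemma Lgen_mlin: "mlin (carrier A) p (ob L p) (Lgen p)"
  unfolding Loday_ob by (rule coeff_gen_mlin[OF A_submodule])

lemma L_generates: "generates k (ob L p) {Lgen p a m | a m. a \<in> tuples p (carrier A) \<and> m \<in> carrier M}"
  unfolding Loday_ob by (rule coeff_generates[OF A_submodule])

lemma L_lift: "module k X \<Longrightarrow> mlin (carrier A) p X \<beta> \<Longrightarrow>
      \<exists>\<psi>\<in>module_hom k (ob L p) X. \<forall>a\<in>tuples p (carrier A). \<forall>m\<in>carrier M. \<psi> (Lgen p a m) = \<beta> a m"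
  unfolding Loday_ob by (rule coeff_lift[OF A_submodule])

lemma admissible_A: "f \<in> Gamma_hom p q \<Longrightarrow> admissible (carrier A) p q f"
  unfolding admissible_def using mult_ideal_A by auto

lemma push_A: "f \<in> Gamma_hom p q \<Longrightarrow> a \<in> tuples p (carrier A) \<Longrightarrow> push_tuple A p q f a \<in> tuples q (carrier A)"
  by (rule push_tuple_closed[OF admissible_A])

lemma
  assumes f: "f \<in> Gamma_hom p q"
  shows L_act_hom: "act L p q f \<in> module_hom k (ob L p) (ob L q)"
    and L_act_gen: "a \<in> tuples p (carrier A) \<Longrightarrow> m \<in> carrier M \<Longrightarrow> act L p q f (Lgen p a m) = act_tuple p q f (Lgen q) a m"
proof -
  have e: "act L p q f = linear_extension k (ob L p) (ob L q) (tuples p (carrier A) \<times> carrier M) (\<lambda>(a, m). Lgen p a m)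
      (\<lambda>(a, m). act_tuple p q f (Lgen q) a m)"
    unfolding act_tuple_def tail_prod_def Loday_gen[symmetric]
    by (simp add: Loday_def case_prod_eta)
  have g: "generates k (ob L p) ((\<lambda>(a, m). Lgen p a m) ` (tuples p (carrier A) \<times> carrier M))"
  proof -
    have "(\<lambda>(a, m). Lgen p a m) ` (tuples p (carrier A) \<times> carrier M) =
        {Lgen p a m | a m. a \<in> tuples p (carrier A) \<and> m \<in> carrier M}" by auto
    then show ?thesis using L_generates by simp
  qed
  have "mlin (carrier A) p (ob L q) (act_tuple p q f (Lgen q))"
    by (rule act_tuple_mlin[OF admissible_A[OF f] Lgen_mlin])
  from L_lift[OF L_module this]
  have ex: "\<exists>\<phi>\<in>module_hom k (ob L p) (ob L q). \<forall>s\<in>tuples p (carrier A) \<times> carrier M.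
      \<phi> ((\<lambda>(a, m). Lgen p a m) s) = (\<lambda>(a, m). act_tuple p q f (Lgen q) a m) s" by auto
  note l = linear_extension_hom[OF L_module L_module g ex, folded e]
  show "act L p q f \<in> module_hom k (ob L p) (ob L q)" by (rule l(1))
  show "a \<in> tuples p (carrier A) \<Longrightarrow> m \<in> carrier M \<Longrightarrow> act L p q f (Lgen p a m) = act_tuple p q f (Lgen q) a m"
    using l(2)[of "(a, m)"] by simp
qed

lemma L_left_module: "left_module_data k L"
  unfolding left_module_data_def using L_module L_act_hom by auto

text \<open>
  Since \<open>A = k \<oplus> I\<close>, tuples whose entries are in \<open>I\<close> or equal to \<open>1\<close> suffice to generate the Loday
  functor. Such a tuple comes from a tuple with entries in \<open>I\<close> by an inclusion, which fills the gaps
  with \<open>1\<close>.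
\<close>

definition split_tuple where
  "split_tuple p S a \<longleftrightarrow> S \<subseteq> {1..p} \<and> a \<in> tuples p (carrier A) \<and> (\<forall>i\<in>S. a i \<in> I) \<and> (\<forall>i\<in>{1..p} - S. a i = \<one>\<^bsub>A\<^esub>)"

definition sub_tuple where
  "sub_tuple S a = (\<lambda>l\<in>{1..card S}. a (nth_elem S l))"

lemma split_tuple_incl:
  assumes "split_tuple p S a"
  shows "sub_tuple S a \<in> tuples (card S) I"
    and "push_tuple A (card S) p (incl S) (sub_tuple S a) = a"
    and "tail_prod (card S) (incl S) (sub_tuple S a) = \<one>\<^bsub>A\<^esub>"
proof -
  note D = assms[unfolded split_tuple_def]
  have fin: "finite S" using D by (auto intro: finite_subset)
  note nS = nth_elem_in[OF fin]
  have np: "nth_elem S l \<in> {1..p}" if "l \<in> {1..card S}" for l using nS[OF that] D by auto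
  show "sub_tuple S a \<in> tuples (card S) I"
    using D nS by (intro tuplesI) (auto simp: sub_tuple_def)
  show "push_tuple A (card S) p (incl S) (sub_tuple S a) = a"
  proof (rule extensionalityI[of _ "{1..p}"])
    fix j assume j: "j \<in> {1..p}"
    show "push_tuple A (card S) p (incl S) (sub_tuple S a) j = a j"
    proof (cases "j \<in> S")
      case True
      note r = rank_in_range[OF fin True] nth_rank[OF fin True]
      have e: "{l \<in> {1..card S}. incl S l = j} = {rank_in S j}"
        using r rank_nth[OF fin] by (auto simp: incl_def)
      have "a j \<in> carrier A" using D j tuplesD by blast
      then show ?thesis unfolding push_tuple_def restrict_apply'[OF j] e using r by (simp add: sub_tuple_def)
    next
      case False
      have e: "{l \<in> {1..card S}. incl S l = j} = {}" using nS False by (auto simp: incl_def)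
      show ?thesis unfolding push_tuple_def restrict_apply'[OF j] e using False D j by simp
    qed
  qed (use D tuplesD(2) in \<open>auto simp: push_tuple_def\<close>)
  have e: "{l \<in> {1..card S}. incl S l = 0} = {}" using np by (fastforce simp: incl_def)
  show "tail_prod (card S) (incl S) (sub_tuple S a) = \<one>\<^bsub>A\<^esub>" unfolding tail_prod_def e by simp
qed

text \<open>The projection of \<open>A = k \<oplus> I\<close> onto \<open>I\<close>.\<close>

definition I_part where "I_part x = x \<ominus>\<^bsub>A\<^esub> \<epsilon> x \<odot>\<^bsub>A\<^esub> \<one>\<^bsub>A\<^esub>"

lemma I_part_hom: "I_part \<in> module_hom k A (sub_mod A I)"
proof -
  interpret MA: module k A by (rule kA)
  have 1: "(\<lambda>x. \<epsilon> x \<odot>\<^bsub>A\<^esub> \<one>\<^bsub>A\<^esub>) \<in> module_hom k A A"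
    by (rule mhomI) (auto simp: aug_simps A.smult_l_distr A.smult_assoc1)
  have h: "I_part \<in> module_hom k A A"
    unfolding I_part_def[abs_def] a_minus_def by (rule mhom_sum[OF kA mhom_id mhom_neg[OF kA 1]])
  have "\<epsilon> (\<ominus>\<^bsub>A\<^esub> x) = \<ominus>\<^bsub>k\<^esub> \<epsilon> x" if "x \<in> carrier A" for x
  proof -
    have "\<ominus>\<^bsub>A\<^esub> x = (\<ominus>\<^bsub>k\<^esub> \<one>\<^bsub>k\<^esub>) \<odot>\<^bsub>A\<^esub> x" using that by (simp add: A.smult_l_minus)
    then show ?thesis using that by (simp add: aug_simps k.l_minus)
  qed
  then have "I_part x \<in> I" if "x \<in> carrier A" for x
    unfolding I_eq using mhom_closed[OF h that] that mhom_closed[OF 1 that]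
    by (simp add: I_part_def a_minus_def aug_simps k.r_neg)
  then show ?thesis using h by (intro mhomI) (auto simp: mhom_add mhom_smult)
qed

lemma I_part_I: "x \<in> carrier A \<Longrightarrow> I_part x \<in> I"
  using mhom_closed[OF I_part_hom] by simp

lemma I_part_split: "x \<in> carrier A \<Longrightarrow> x = \<epsilon> x \<odot>\<^bsub>A\<^esub> \<one>\<^bsub>A\<^esub> \<oplus>\<^bsub>A\<^esub> I_part x"
  unfolding I_part_def a_minus_def by (simp add: aug_simps A.M.a_ac A.M.r_neg)

text \<open>
  The entries are replaced one at a time: each is the sum of a multiple of \<open>1\<close> and an element of
  \<open>I\<close>, and generators are multilinear in the tuple.
\<close>

lemma L_split_generates:
  "generates k (ob L p) {Lgen p a m | S a m. split_tuple p S a \<and> m \<in> carrier M}"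
proof (rule generates_trans[OF L_generates _ L_module])
  note ml = mlinD[OF Lgen_mlin]
  show "{Lgen p a m | S a m. split_tuple p S a \<and> m \<in> carrier M} \<subseteq> carrier (ob L p)"
    using ml(2) unfolding split_tuple_def by blast
  fix N g assume N: "submodule N k (ob L p)" "{Lgen p a m | S a m. split_tuple p S a \<and> m \<in> carrier M} \<subseteq> N"
    and "g \<in> {Lgen p a m | a m. a \<in> tuples p (carrier A) \<and> m \<in> carrier M}"
  then obtain a m where g: "g = Lgen p a m" "a \<in> tuples p (carrier A)" and m: "m \<in> carrier M" by blast
  note D = submoduleD[OF L_module N(1)]
  have "\<forall>a. a \<in> tuples p (carrier A) \<longrightarrow> (\<forall>i\<in>{r + 1..p}. a i \<in> I \<or> a i = \<one>\<^bsub>A\<^esub>) \<longrightarrow> Lgen p a m \<in> N" if "r \<le> p" for r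
    using that
  proof (induction r)
    case 0
    show ?case
    proof (intro allI impI)
      fix a assume a: "a \<in> tuples p (carrier A)" "\<forall>i\<in>{0 + 1..p}. a i \<in> I \<or> a i = \<one>\<^bsub>A\<^esub>"
      then have "split_tuple p {i \<in> {1..p}. a i \<in> I} a" unfolding split_tuple_def by auto
      then show "Lgen p a m \<in> N" using N(2) m by blast
    qed
  next
    case (Suc r)
    show ?case
    proof (intro allI impI)
      fix a assume a: "a \<in> tuples p (carrier A)" "\<forall>i\<in>{Suc r + 1..p}. a i \<in> I \<or> a i = \<one>\<^bsub>A\<^esub>"
      have i: "Suc r \<in> {1..p}" using Suc.prems by auto
      let ?x = "a (Suc r)"
      have x: "?x \<in> carrier A" by (rule tuplesD(1)[OF a(1) i])
      have up: "Lgen p (a(Suc r := y)) m \<in> N" if "y \<in> carrier A" "y \<in> I \<or> y = \<one>\<^bsub>A\<^esub>" for y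
        using Suc.IH Suc.prems tuples_upd[OF a(1) i that(1)] a(2) that(2) by auto
      have rx: "I_part ?x \<in> carrier A" using I_part_I[OF x] I_carrier by blast
      note h = ml(3)[OF a(1) i m, unfolded sub_mod_A]
      have "Lgen p a m = Lgen p (a(Suc r := \<epsilon> ?x \<odot>\<^bsub>A\<^esub> \<one>\<^bsub>A\<^esub> \<oplus>\<^bsub>A\<^esub> I_part ?x)) m"
        using I_part_split[OF x] by simp
      also have "\<dots> = \<epsilon> ?x \<odot>\<^bsub>ob L p\<^esub> Lgen p (a(Suc r := \<one>\<^bsub>A\<^esub>)) m \<oplus>\<^bsub>ob L p\<^esub> Lgen p (a(Suc r := I_part ?x)) m"
        using mhom_add[OF h _ rx] mhom_smult[OF h aug_simps(1)[OF x] A.one_closed] aug_simps(1)[OF x] by simp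
      finally show "Lgen p a m \<in> N" using D(3) D(5)[OF aug_simps(1)[OF x] up[of "\<one>\<^bsub>A\<^esub>"]] up[OF rx] I_part_I[OF x] by simp
    qed
  qed
  from this[of p] show "g \<in> N" using g by auto
qed

end

section \<open>Tensor products over \<open>\<Gamma>\<close> with the Loday functor\<close>

context augmented_algebra
begin

text \<open>
  The pairing into \<open>P \<otimes> L(A, M)\<close> is defined on all tuples, although only its restriction to tuples
  with entries in \<open>I\<close> is a pairing with \<open>U\<close>.
\<close>

definition pair_E where
  "pair_E P p u a m = gamma_tensor_gen k P L (p, u, Lgen p a m)"

lemma mlin_sub: "mlin (carrier A) p X \<beta> \<Longrightarrow> mlin I p X \<beta>"
proof (rule mlinI)
  assume \<beta>: "mlin (carrier A) p X \<beta>"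
  show "\<beta> a \<in> module_hom k (restrict_scalars A M) X" if "a \<in> tuples p I" for a
    by (rule mlinD(1)[OF \<beta> I_tuples[OF that]])
  show "(\<lambda>x. \<beta> (a(i := x)) m) \<in> module_hom k (sub_mod A I) X"
    if "a \<in> tuples p I" "i \<in> {1..p}" "m \<in> carrier M" for a i m
    by (rule sub_mod_hom[OF mlinD(3)[OF \<beta> I_tuples[OF that(1)] that(2,3), unfolded sub_mod_A]]) (auto dest: I_carrier)
qed

context
  fixes P :: "('k, 'p) gamma_mod"
  assumes P: "right_gamma_module k P"
begin

abbreviation E where "E \<equiv> gamma_tensor k P L"

lemma E_module: "module k E"
  by (rule gamma_tensor_module[OF P L_left_module])

lemma pair_E_mlin_A: "u \<in> carrier (ob P p) \<Longrightarrow> mlin (carrier A) p E (pair_E P p u)"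
  unfolding pair_E_def[abs_def]
  by (rule mlin_comp[OF Lgen_mlin bilinear_mapD(2)[OF gamma_gen_bilinear[OF P L_left_module]]])

lemma pair_E_hom_A:
  assumes "a \<in> tuples p (carrier A)" "m \<in> carrier M"
  shows "(\<lambda>u. pair_E P p u a m) \<in> module_hom k (ob P p) E"
  unfolding pair_E_def by (rule bilinear_mapD(1)[OF gamma_gen_bilinear[OF P L_left_module] mlinD(2)[OF Lgen_mlin assms]])

lemma pair_E_Gamma_balanced:
  assumes f: "f \<in> Gamma_hom p q" and u: "u \<in> carrier (ob P q)" and a: "a \<in> tuples p (carrier A)" and m: "m \<in> carrier M"
  shows "pair_E P p (act P p q f u) a m = act_tuple p q f (pair_E P q u) a m"
  unfolding pair_E_def gamma_gen_balanced[OF P L_left_module f u mlinD(2)[OF Lgen_mlin a m]] L_act_gen[OF f a m]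
  unfolding act_tuple_def ..

lemma pair_E_balanced: "balanced P E (pair_E P)"
  by (rule balancedI[OF pair_E_hom_A[OF I_tuples] mlin_sub[OF pair_E_mlin_A] pair_E_Gamma_balanced[OF based_surjD _ I_tuples]])

text \<open>
  The inclusion that fills the gaps of a split tuple with \<open>1\<close> can be moved across the tensor product
  over \<open>\<Gamma>\<close>, which leaves a tuple with entries in \<open>I\<close>.
\<close>

lemma pair_E_split:
  assumes a: "split_tuple p S a" and u: "u \<in> carrier (ob P p)" and m: "m \<in> carrier M"
  shows "pair_E P p u a m = pair_E P (card S) (act P (card S) p (incl S) u) (sub_tuple S a) m"
proof -
  have "incl S \<in> Gamma_hom (card S) p" using a by (intro incl_Gamma) (simp add: split_tuple_def)
  from pair_E_Gamma_balanced[OF this u I_tuples[OF split_tuple_incl(1)[OF a]] m]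
  show ?thesis unfolding act_tuple_def split_tuple_incl(2,3)[OF a] using m by simp
qed

lemma pair_E_generates:
  "generates k E (pairing_values P (pair_E P))"
proof (rule generates_trans[OF gamma_generates[OF P L_left_module] _ E_module])
  show "pairing_values P (pair_E P) \<subseteq> carrier E"
    using balancedD(4)[OF pair_E_balanced] by blast
  fix N g assume N: "submodule N k E" "pairing_values P (pair_E P) \<subseteq> N"
    and "g \<in> gamma_tensor_gen k P L ` {(n, u, v). u \<in> carrier (ob P n) \<and> v \<in> carrier (ob L n)}"
  then obtain p u v where g: "g = gamma_tensor_gen k P L (p, u, v)" and u: "u \<in> carrier (ob P p)" and v: "v \<in> carrier (ob L p)"
    by auto
  note h = bilinear_mapD(2)[OF gamma_gen_bilinear[OF P L_left_module] u]
  have "v \<in> {v \<in> carrier (ob L p). gamma_tensor_gen k P L (p, u, v) \<in> N}"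
  proof (rule generatesD[OF L_split_generates submodule_vimage[OF L_module E_module h N(1)] _ v], safe)
    fix S a m assume s: "split_tuple p S a" and m: "m \<in> carrier M"
    have a: "a \<in> tuples p (carrier A)" using s by (simp add: split_tuple_def)
    show "Lgen p a m \<in> carrier (ob L p)" by (rule mlinD(2)[OF Lgen_mlin a m])
    have i: "incl S \<in> Gamma_hom (card S) p" using s by (intro incl_Gamma) (simp add: split_tuple_def)
    show "gamma_tensor_gen k P L (p, u, Lgen p a m) \<in> N"
      using pair_E_split[OF s u m] mhom_closed[OF right_gamma_moduleD(2)[OF P i] u] split_tuple_incl(1)[OF s] m N(2)
      unfolding pair_E_def by blast
  qed
  then show "g \<in> N" unfolding g by simp
qed

text \<open>
  To extend a pairing \<open>\<beta>\<close> from tuples in \<open>I\<close> to tuples in \<open>A\<close>, write every entry as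
  \<open>\<epsilon> (a i) + I_part (a i)\<close> and expand. This is the summand in which the entries in \<open>S\<close> contribute
  their part in \<open>I\<close>; the gaps are then moved to \<open>P\<close> by \<open>incl S\<close>.
\<close>

definition extend_summand where
  "extend_summand Z \<beta> p u S a m = (\<Otimes>\<^bsub>k\<^esub>i\<in>{1..p} - S. \<epsilon> (a i)) \<odot>\<^bsub>Z\<^esub>
     \<beta> (card S) (act P (card S) p (incl S) u) (sub_tuple S (\<lambda>i. I_part (a i))) m"

definition extend_pairing where
  "extend_pairing Z \<beta> p u a m = (\<Oplus>\<^bsub>Z\<^esub>S\<in>Pow {1..p}. extend_summand Z \<beta> p u S a m)"

lemma eps_prod_closed: "a \<in> tuples p (carrier A) \<Longrightarrow> T \<subseteq> {1..p} \<Longrightarrow> (\<Otimes>\<^bsub>k\<^esub>i\<in>T. \<epsilon> (a i)) \<in> carrier k"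
proof (rule k.finprod_closed, rule funcsetI)
  fix i assume "a \<in> tuples p (carrier A)" "T \<subseteq> {1..p}" "i \<in> T"
  then show "\<epsilon> (a i) \<in> carrier k" using tuplesD(1)[of a p "carrier A" i] by (intro aug_simps) auto
qed

lemma sub_tuple_I_part: "a \<in> tuples p (carrier A) \<Longrightarrow> S \<subseteq> {1..p} \<Longrightarrow> sub_tuple S (\<lambda>i. I_part (a i)) \<in> tuples (card S) I"
proof (rule tuplesI)
  fix l assume a: "a \<in> tuples p (carrier A)" and S: "S \<subseteq> {1..p}" and l: "l \<in> {1..card S}"
  have "finite S" using S by (rule finite_subset) auto
  from nth_elem_in[OF this l] S have "nth_elem S l \<in> {1..p}" by auto
  from I_part_I[OF tuplesD(1)[OF a this]] show "sub_tuple S (\<lambda>i. I_part (a i)) l \<in> I" using l by (simp add: sub_tuple_def)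
qed (simp add: sub_tuple_def)

lemma extend_summand_mlin:
  assumes Z: "module k Z" and \<beta>: "balanced P Z \<beta>" and u: "u \<in> carrier (ob P p)" and S: "S \<subseteq> {1..p}"
  shows "mlin (carrier A) p Z (extend_summand Z \<beta> p u S)"
proof (rule mlinI, unfold sub_mod_A)
  interpret Z: module k Z by (rule Z)
  have fin: "finite S" using S by (rule finite_subset) auto
  note iS = right_gamma_moduleD(2)[OF P incl_Gamma[OF S]]
  note b = mlinD[OF balancedD(2)[OF \<beta> mhom_closed[OF iS u]]]
  fix a assume a: "a \<in> tuples p (carrier A)"
  note sa = sub_tuple_I_part[OF a S]
  have ec: "(\<Otimes>\<^bsub>k\<^esub>i\<in>{1..p} - S. \<epsilon> (a i)) \<in> carrier k" by (rule eps_prod_closed[OF a]) auto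
  show "extend_summand Z \<beta> p u S a \<in> module_hom k (restrict_scalars A M) Z"
    unfolding extend_summand_def[abs_def] by (rule mhom_scale[OF Z b(1)[OF sa] ec])
  fix i m assume i: "i \<in> {1..p}" and m: "m \<in> carrier M"
  show "(\<lambda>x. extend_summand Z \<beta> p u S (a(i := x)) m) \<in> module_hom k A Z"
  proof (cases "i \<in> S")
    case True
    note r = rank_in_range[OF fin True] nth_rank[OF fin True]
    have "(\<Otimes>\<^bsub>k\<^esub>j\<in>{1..p} - S. \<epsilon> ((a(i := x)) j)) = (\<Otimes>\<^bsub>k\<^esub>j\<in>{1..p} - S. \<epsilon> (a j))" for x
      by (rule k.finprod_cong') (use True tuplesD(1)[OF a] aug_simps(1) in auto)
    moreover have "sub_tuple S (\<lambda>j. I_part ((a(i := x)) j)) = (sub_tuple S (\<lambda>j. I_part (a j)))(rank_in S i := I_part x)" for x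
      unfolding sub_tuple_def using r rank_nth[OF fin] by (auto simp: fun_eq_iff)
    ultimately have e: "(\<lambda>x. extend_summand Z \<beta> p u S (a(i := x)) m) = (\<lambda>x. (\<Otimes>\<^bsub>k\<^esub>j\<in>{1..p} - S. \<epsilon> (a j)) \<odot>\<^bsub>Z\<^esub>
        \<beta> (card S) (act P (card S) p (incl S) u) ((sub_tuple S (\<lambda>j. I_part (a j)))(rank_in S i := I_part x)) m)"
      unfolding extend_summand_def by simp
    show ?thesis unfolding e by (rule mhom_scale[OF Z mhom_comp[OF I_part_hom b(3)[OF sa r(1) m]] ec])
  next
    case False
    define T where "T = {1..p} - S - {i}"
    have T: "{1..p} - S = insert i T" "i \<notin> T" "T \<subseteq> {1..p}" using i False unfolding T_def by auto
    define c where "c = (\<Otimes>\<^bsub>k\<^esub>j\<in>T. \<epsilon> (a j))"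
    have c: "c \<in> carrier k" unfolding c_def by (rule eps_prod_closed[OF a T(3)])
    define z where "z = \<beta> (card S) (act P (card S) p (incl S) u) (sub_tuple S (\<lambda>j. I_part (a j))) m"
    have z: "z \<in> carrier Z" unfolding z_def by (rule b(2)[OF sa m])
    have "(\<Otimes>\<^bsub>k\<^esub>j\<in>insert i T. \<epsilon> ((a(i := x)) j)) = \<epsilon> x \<otimes>\<^bsub>k\<^esub> c" if x: "x \<in> carrier A" for x
    proof -
      have "\<epsilon> (a j) \<in> carrier k" if "j \<in> T" for j using that T(3) tuplesD(1)[OF a] aug_simps(1) by auto
      then have "(\<Otimes>\<^bsub>k\<^esub>j\<in>insert i T. \<epsilon> ((a(i := x)) j)) = \<epsilon> x \<otimes>\<^bsub>k\<^esub> (\<Otimes>\<^bsub>k\<^esub>j\<in>T. \<epsilon> ((a(i := x)) j))"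
        using T aug_simps(1)[OF x] finite_subset[OF T(3)] by (subst k.finprod_insert) auto
      also have "(\<Otimes>\<^bsub>k\<^esub>j\<in>T. \<epsilon> ((a(i := x)) j)) = c"
        unfolding c_def by (rule k.finprod_cong') (use T tuplesD(1)[OF a] aug_simps(1) in auto)
      finally show ?thesis .
    qed
    moreover have "sub_tuple S (\<lambda>j. I_part ((a(i := x)) j)) = sub_tuple S (\<lambda>j. I_part (a j))" for x
      unfolding sub_tuple_def using nth_elem_in[OF fin] False by (auto simp: fun_eq_iff)
    ultimately have e: "extend_summand Z \<beta> p u S (a(i := x)) m = (\<epsilon> x \<otimes>\<^bsub>k\<^esub> c) \<odot>\<^bsub>Z\<^esub> z" if "x \<in> carrier A" for x
      unfolding extend_summand_def T(1) z_def using that by simp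
    show ?thesis
      by (rule mhomI)
         (use c z in \<open>auto simp: e aug_simps k.l_distr Z.smult_l_distr k.m_assoc Z.smult_assoc1\<close>)
  qed
qed

lemma extend_summand_hom:
  assumes Z: "module k Z" and \<beta>: "balanced P Z \<beta>" and a: "a \<in> tuples p (carrier A)" and m: "m \<in> carrier M" and S: "S \<subseteq> {1..p}"
  shows "(\<lambda>u. extend_summand Z \<beta> p u S a m) \<in> module_hom k (ob P p) Z"
  unfolding extend_summand_def
  by (rule mhom_scale[OF Z mhom_comp[OF right_gamma_moduleD(2)[OF P incl_Gamma[OF S]] balancedD(1)[OF \<beta> sub_tuple_I_part[OF a S] m]]
        eps_prod_closed[OF a]]) auto

lemma extend_pairing_mlin:
  assumes "module k Z" "balanced P Z \<beta>" "u \<in> carrier (ob P p)"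
  shows "mlin (carrier A) p Z (extend_pairing Z \<beta> p u)"
  unfolding extend_pairing_def[abs_def] by (rule mlin_sum[OF A_submodule assms(1)]) (use extend_summand_mlin[OF assms] in auto)

lemma extend_pairing_hom:
  assumes Z: "module k Z" and "balanced P Z \<beta>" "a \<in> tuples p (carrier A)" "m \<in> carrier M"
  shows "(\<lambda>u. extend_pairing Z \<beta> p u a m) \<in> module_hom k (ob P p) Z"
  unfolding extend_pairing_def
  by (rule mhom_finite_sum[OF right_gamma_moduleD(1)[OF P] Z]) (use extend_summand_hom[OF assms] in auto)

lemma I_part_I_id: "x \<in> I \<Longrightarrow> I_part x = x" and I_part_one: "I_part \<one>\<^bsub>A\<^esub> = \<zero>\<^bsub>A\<^esub>"
proof -
  show "x \<in> I \<Longrightarrow> I_part x = x"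
    using module_minus_zero[OF kA, of x] unfolding I_part_def I_eq by simp
  show "I_part \<one>\<^bsub>A\<^esub> = \<zero>\<^bsub>A\<^esub>" unfolding I_part_def aug_simps using module_minus_eq_zero[OF kA] by simp
qed

lemma mlin_zero_entry:
  assumes Z: "module k Z" and \<beta>: "mlin J p Z \<beta>" and J: "submodule J k A" and b: "b \<in> tuples p J" and i: "i \<in> {1..p}" "b i = \<zero>\<^bsub>A\<^esub>"
    and m: "m \<in> carrier M"
  shows "\<beta> b m = \<zero>\<^bsub>Z\<^esub>"
proof -
  have "b(i := \<zero>\<^bsub>A\<^esub>) = b" using i(2) by auto
  then show ?thesis using mhom_zero[OF sub_mod_module[OF J] Z mlinD(3)[OF \<beta> b i(1) m]] by simp
qed

text \<open>
  An entry in \<open>I\<close> has augmentation \<open>0\<close> and the entry \<open>1\<close> has no part in \<open>I\<close>, so that every summand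
  other than the one of \<open>S\<close> contains a factor \<open>0\<close>.
\<close>

lemma extend_pairing_split:
  assumes Z: "module k Z" and \<beta>: "balanced P Z \<beta>" and u: "u \<in> carrier (ob P p)" and a: "split_tuple p S a" and m: "m \<in> carrier M"
  shows "extend_pairing Z \<beta> p u a m = \<beta> (card S) (act P (card S) p (incl S) u) (sub_tuple S a) m"
proof -
  interpret Z: module k Z by (rule Z)
  have D: "S \<subseteq> {1..p}" "a \<in> tuples p (carrier A)" "\<And>i. i \<in> S \<Longrightarrow> a i \<in> I" "\<And>i. i \<in> {1..p} - S \<Longrightarrow> a i = \<one>\<^bsub>A\<^esub>"
    using a unfolding split_tuple_def by auto
  have iS: "act P (card T) p (incl T) u \<in> carrier (ob P (card T))" if "T \<subseteq> {1..p}" for T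
    by (rule mhom_closed[OF right_gamma_moduleD(2)[OF P incl_Gamma[OF that]] u])
  have z: "extend_summand Z \<beta> p u T a m = \<zero>\<^bsub>Z\<^esub>" if T: "T \<subseteq> {1..p}" "T \<noteq> S" for T
  proof -
    note bl = balancedD(2)[OF \<beta> iS[OF T(1)]]
    have bc: "\<beta> (card T) (act P (card T) p (incl T) u) (sub_tuple T (\<lambda>i. I_part (a i))) m \<in> carrier Z"
      by (rule mlinD(2)[OF bl sub_tuple_I_part[OF D(2) T(1)] m])
    have finT: "finite T" using T(1) by (rule finite_subset) auto
    consider i where "i \<in> S - T" | i where "i \<in> T - S" using T(2) by auto
    then show ?thesis
    proof cases
      case 1
      have e: "\<epsilon> (a i) = \<zero>\<^bsub>k\<^esub>" "i \<in> {1..p} - T" using 1 D(1) D(3)[of i] by (auto simp: I_eq)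
      have "(\<Otimes>\<^bsub>k\<^esub>j\<in>insert i ({1..p} - T - {i}). \<epsilon> (a j)) = \<epsilon> (a i) \<otimes>\<^bsub>k\<^esub> (\<Otimes>\<^bsub>k\<^esub>j\<in>{1..p} - T - {i}. \<epsilon> (a j))"
        by (rule k.finprod_insert) (use tuplesD(1)[OF D(2)] aug_simps(1) e in auto)
      moreover have "insert i ({1..p} - T - {i}) = {1..p} - T" using e by auto
      moreover have "(\<Otimes>\<^bsub>k\<^esub>j\<in>{1..p} - T - {i}. \<epsilon> (a j)) \<in> carrier k" by (rule eps_prod_closed[OF D(2)]) auto
      ultimately have "(\<Otimes>\<^bsub>k\<^esub>j\<in>{1..p} - T. \<epsilon> (a j)) = \<zero>\<^bsub>k\<^esub>" using e(1) by simp
      then show ?thesis unfolding extend_summand_def using bc by simp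
    next
      case 2
      note r = rank_in_range[OF finT] nth_rank[OF finT]
      have iT: "i \<in> T" "i \<in> {1..p} - S" using 2 T(1) by auto
      have "\<beta> (card T) (act P (card T) p (incl T) u) (sub_tuple T (\<lambda>i. I_part (a i))) m = \<zero>\<^bsub>Z\<^esub>"
        by (rule mlin_zero_entry[OF Z bl I_submodule sub_tuple_I_part[OF D(2) T(1)] r(1)[OF iT(1)] _ m])
           (use r(1)[OF iT(1)] r(2)[OF iT(1)] D(4)[OF iT(2)] I_part_one in \<open>simp add: sub_tuple_def\<close>)
      then show ?thesis unfolding extend_summand_def using eps_prod_closed[OF D(2), of "{1..p} - T"] by auto
    qed
  qed
  have fin: "finite S" using D(1) by (rule finite_subset) auto
  have "(\<Otimes>\<^bsub>k\<^esub>i\<in>{1..p} - S. \<epsilon> (a i)) = \<one>\<^bsub>k\<^esub>"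
    by (rule k.finprod_one_eqI) (use D(4) aug_simps(4) in auto)
  moreover have st: "sub_tuple S (\<lambda>i. I_part (a i)) = sub_tuple S a"
    unfolding sub_tuple_def using nth_elem_in[OF fin] D(3) I_part_I_id by (auto intro!: restrict_ext)
  ultimately have s: "extend_summand Z \<beta> p u S a m = \<beta> (card S) (act P (card S) p (incl S) u) (sub_tuple S a) m"
    unfolding extend_summand_def using balancedD(4)[OF \<beta> iS[OF D(1)] split_tuple_incl(1)[OF a] m] by simp
  have xc: "extend_summand Z \<beta> p u T a m \<in> carrier Z" if "T \<subseteq> {1..p}" for T
    by (rule mlinD(2)[OF extend_summand_mlin[OF Z \<beta> u that] D(2) m])
  note sc = xc[OF D(1)]
  have "extend_pairing Z \<beta> p u a m = (\<Oplus>\<^bsub>Z\<^esub>T\<in>{S}. extend_summand Z \<beta> p u T a m)"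
    unfolding extend_pairing_def by (rule Z.add.finprod_mono_neutral_cong_right) (use D(1) z xc in auto)
  then show ?thesis using sc s by simp
qed

text \<open>
  Extended pairings are compatible with all based maps and not only with surjections. On split
  tuples this reduces to \<open>\<beta>\<close> being balanced: \<open>f\<close> restricted to \<open>S\<close> is a based surjection \<open>g\<close>
  followed by the inclusion of the image \<open>T\<close>, and pushing a split tuple along \<open>f\<close> gives the split
  tuple on \<open>T\<close> of the tuple pushed along \<open>g\<close>.
\<close>

lemma extend_pairing_Gamma_balanced:
  assumes Z: "module k Z" and \<beta>: "balanced P Z \<beta>" and f: "f \<in> Gamma_hom p q" and u: "u \<in> carrier (ob P q)"
    and a: "split_tuple p S a" and m: "m \<in> carrier M"
  shows "extend_pairing Z \<beta> p (act P p q f u) a m = act_tuple p q f (extend_pairing Z \<beta> q u) a m"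
proof -
  have D: "S \<subseteq> {1..p}" "a \<in> tuples p (carrier A)" "\<And>i. i \<in> S \<Longrightarrow> a i \<in> I" "\<And>i. i \<in> {1..p} - S \<Longrightarrow> a i = \<one>\<^bsub>A\<^esub>"
    using a unfolding split_tuple_def by auto
  have fin: "finite S" using D(1) by (rule finite_subset) auto
  let ?fS = "compose {0..card S} f (incl S)"
  have fS: "?fS \<in> Gamma_hom (card S) q" by (rule Gamma_hom_comp[OF incl_Gamma[OF D(1)] f])
  define T where "T = image_supp (card S) ?fS"
  define g where "g = onto_image (card S) ?fS"
  have Tq: "T \<subseteq> {1..q}" unfolding T_def by (rule image_supp_sub[OF fS])
  have finT: "finite T" unfolding T_def by (rule image_supp_finite)
  have g: "g \<in> based_surj (card S) (card T)" unfolding T_def g_def by (rule onto_image_surj(1)[OF fS])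
  have fac: "?fS = compose {0..card S} (incl T) g" unfolding T_def g_def by (rule onto_image_surj(2)[OF fS, symmetric])
  let ?b = "push_tuple A p q f a"
  have pa: "push_tuple A (card S) p (incl S) (sub_tuple S a) = a" "tail_prod (card S) (incl S) (sub_tuple S a) = \<one>\<^bsub>A\<^esub>"
    and sI: "sub_tuple S a \<in> tuples (card S) I" using split_tuple_incl[OF a] by auto
  have b: "?b = push_tuple A (card T) q (incl T) (push_tuple A (card S) (card T) g (sub_tuple S a))"
    using push_tuple_comp(1)[OF I_tuples[OF sI] incl_Gamma[OF D(1)] f] push_tuple_comp(1)[OF I_tuples[OF sI] based_surjD[OF g] incl_Gamma[OF Tq]]
    unfolding fac pa by simp
  note c = push_I[OF g sI]
  have inT: "{l \<in> {1..card T}. incl T l = j} = (if j \<in> T then {rank_in T j} else {})" if "j \<in> {1..q}" for j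
  proof (cases "j \<in> T")
    case True
    have "rank_in T j \<noteq> 0" "rank_in T j \<in> {1..card T}" using rank_in_range[OF finT True] by auto
    then show ?thesis using rank_nth[OF finT] nth_rank[OF finT True] True by (auto simp: incl_def)
  next
    case False
    then show ?thesis using nth_elem_in[OF finT] by (auto simp: incl_def)
  qed
  have bj: "?b j = (if j \<in> T then push_tuple A (card S) (card T) g (sub_tuple S a) (rank_in T j) else \<one>\<^bsub>A\<^esub>)" if j: "j \<in> {1..q}" for j
    unfolding b using inT[OF j] tuplesD(1)[OF I_tuples[OF c] rank_in_range[OF finT]] j
    by (simp add: push_tuple_def[of A "card T" q])
  have bs: "split_tuple q T ?b"
    unfolding split_tuple_def
  proof (intro conjI ballI)
    show "?b \<in> tuples q (carrier A)" by (rule push_A[OF f D(2)])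
    show "?b j \<in> I" if "j \<in> T" for j
      using that bj[of j] Tq tuplesD(1)[OF c rank_in_range[OF finT that]] by auto
    show "?b j = \<one>\<^bsub>A\<^esub>" if "j \<in> {1..q} - T" for j using bj[of j] that by auto
  qed (rule Tq)
  have sb: "sub_tuple T ?b = push_tuple A (card S) (card T) g (sub_tuple S a)"
  proof (rule extensionalityI[of _ "{1..card T}"])
    fix l assume l: "l \<in> {1..card T}"
    have "nth_elem T l \<in> T" "nth_elem T l \<in> {1..q}" using nth_elem_in[OF finT l] Tq by auto
    then show "sub_tuple T ?b l = push_tuple A (card S) (card T) g (sub_tuple S a) l"
      using bj[of "nth_elem T l"] rank_nth[OF finT l] l by (simp add: sub_tuple_def)
  qed (auto simp: sub_tuple_def push_tuple_def)
  have tail: "tail_prod p f a = tail_prod (card S) g (sub_tuple S a)"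
  proof -
    have ta: "tail_prod p f a \<in> carrier A" by (rule tail_prod_closed[OF D(2)])
    have tg: "tail_prod (card S) g (sub_tuple S a) \<in> carrier A" by (rule tail_prod_closed[OF I_tuples[OF sI]])
    have "tail_prod (card T) (incl T) h = \<one>\<^bsub>A\<^esub>" for h
    proof -
      have e: "{l \<in> {1..card T}. incl T l = 0} = {}" using nth_elem_in[OF finT] Tq by (fastforce simp: incl_def)
      show ?thesis unfolding tail_prod_def e by simp
    qed
    then show ?thesis
      using push_tuple_comp(2)[OF I_tuples[OF sI] incl_Gamma[OF D(1)] f] push_tuple_comp(2)[OF I_tuples[OF sI] based_surjD[OF g] incl_Gamma[OF Tq]] ta tg
      unfolding fac pa by simp
  qed
  have fu: "act P p q f u \<in> carrier (ob P p)" by (rule mhom_closed[OF right_gamma_moduleD(2)[OF P f] u])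
  have uT: "act P (card T) q (incl T) u \<in> carrier (ob P (card T))"
    by (rule mhom_closed[OF right_gamma_moduleD(2)[OF P incl_Gamma[OF Tq]] u])
  have tm: "tail_prod p f a \<odot>\<^bsub>M\<^esub> m \<in> carrier M" using tail_prod_closed[OF D(2)] m by simp
  have "extend_pairing Z \<beta> p (act P p q f u) a m = \<beta> (card S) (act P (card S) p (incl S) (act P p q f u)) (sub_tuple S a) m"
    by (rule extend_pairing_split[OF Z \<beta> fu a m])
  also have "act P (card S) p (incl S) (act P p q f u) = act P (card S) (card T) g (act P (card T) q (incl T) u)"
    using right_gamma_moduleD(4)[OF P incl_Gamma[OF D(1)] f u] right_gamma_moduleD(4)[OF P based_surjD[OF g] incl_Gamma[OF Tq] u]
    unfolding fac by simp
  also have "\<beta> (card S) \<dots> (sub_tuple S a) m = act_tuple (card S) (card T) g (\<beta> (card T) (act P (card T) q (incl T) u)) (sub_tuple S a) m"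
    by (rule balancedD(3)[OF \<beta> g uT sI m])
  also have "\<dots> = \<beta> (card T) (act P (card T) q (incl T) u) (sub_tuple T ?b) (tail_prod p f a \<odot>\<^bsub>M\<^esub> m)"
    unfolding act_tuple_def sb tail ..
  also have "\<dots> = extend_pairing Z \<beta> q u ?b (tail_prod p f a \<odot>\<^bsub>M\<^esub> m)"
    by (rule extend_pairing_split[OF Z \<beta> u bs tm, symmetric])
  finally show ?thesis unfolding act_tuple_def .
qed

text \<open>
  Together with balancedness and generation, this identifies \<open>P \<otimes> L(A, M)\<close> over \<open>\<Gamma>\<close> with the tensor
  product of \<open>P\<close> and \<open>U\<close> over the based surjections: the factorisation of \<open>\<beta>\<close> is induced by its
  extension to all tuples.
\<close>

lemma pair_E_universal:
  assumes Z: "module k Z" and \<beta>: "balanced P Z \<beta>"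
  shows "factors_through P (pair_E P) E Z \<beta>"
proof -
  define ok where "ok p u \<psi> \<longleftrightarrow> \<psi> \<in> module_hom k (ob L p) Z \<and>
      (\<forall>a\<in>tuples p (carrier A). \<forall>m\<in>carrier M. \<psi> (Lgen p a m) = extend_pairing Z \<beta> p u a m)" for p u \<psi>
  define \<gamma> where "\<gamma> p u = (SOME \<psi>. ok p u \<psi>)" for p u
  have "\<exists>\<psi>. ok p u \<psi>" if "u \<in> carrier (ob P p)" for p u
    using L_lift[OF Z extend_pairing_mlin[OF Z \<beta> that]] unfolding ok_def by blast
  then have "ok p u (\<gamma> p u)" if "u \<in> carrier (ob P p)" for p u
    using that unfolding \<gamma>_def by (metis someI_ex)
  then have \<gamma>: "\<And>p u. u \<in> carrier (ob P p) \<Longrightarrow> \<gamma> p u \<in> module_hom k (ob L p) Z"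
    "\<And>p u a m. u \<in> carrier (ob P p) \<Longrightarrow> a \<in> tuples p (carrier A) \<Longrightarrow> m \<in> carrier M \<Longrightarrow> \<gamma> p u (Lgen p a m) = extend_pairing Z \<beta> p u a m"
    unfolding ok_def by blast+
  note Pm = right_gamma_moduleD[OF P]
  have "\<exists>h\<in>module_hom k E Z. \<forall>n. \<forall>u\<in>carrier (ob P n). \<forall>v\<in>carrier (ob L n).
          h (gamma_tensor_gen k P L (n, u, v)) = \<gamma> n u v"
  proof (rule gamma_lift[OF P L_left_module Z])
    fix n
    interpret Pn: module k "ob P n" by (rule Pm(1))
    show "bilinear_map k (ob P n) (ob L n) Z (\<gamma> n)"
      unfolding bilinear_map_def
    proof (intro conjI ballI mhomI)
      fix u v assume u: "u \<in> carrier (ob P n)" and v: "v \<in> carrier (ob L n)"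
      show "\<gamma> n u v \<in> carrier Z" by (rule mhom_closed[OF \<gamma>(1)[OF u] v])
      show "\<gamma> n (u \<oplus>\<^bsub>ob P n\<^esub> w) v = \<gamma> n u v \<oplus>\<^bsub>Z\<^esub> \<gamma> n w v" if w: "w \<in> carrier (ob P n)" for w
        by (rule mhom_eq_on_generators[OF L_generates L_module Z \<gamma>(1) mhom_sum[OF Z \<gamma>(1)[OF u] \<gamma>(1)[OF w]] _ v])
           (use u w \<gamma>(2) mhom_add[OF extend_pairing_hom[OF Z \<beta>] u w] in auto)
      show "\<gamma> n (c \<odot>\<^bsub>ob P n\<^esub> u) v = c \<odot>\<^bsub>Z\<^esub> \<gamma> n u v" if c: "c \<in> carrier k" for c
        by (rule mhom_eq_on_generators[OF L_generates L_module Z \<gamma>(1) mhom_scale[OF Z \<gamma>(1)[OF u] c] _ v])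
           (use u c \<gamma>(2) mhom_smult[OF extend_pairing_hom[OF Z \<beta>] c u] in auto)
    next
      fix u assume u: "u \<in> carrier (ob P n)"
      note h = \<gamma>(1)[OF u]
      show "\<gamma> n u v \<in> carrier Z" if "v \<in> carrier (ob L n)" for v by (rule mhom_closed[OF h that])
      show "\<gamma> n u (v \<oplus>\<^bsub>ob L n\<^esub> w) = \<gamma> n u v \<oplus>\<^bsub>Z\<^esub> \<gamma> n u w"
        if "v \<in> carrier (ob L n)" "w \<in> carrier (ob L n)" for v w by (rule mhom_add[OF h that])
      show "\<gamma> n u (c \<odot>\<^bsub>ob L n\<^esub> v) = c \<odot>\<^bsub>Z\<^esub> \<gamma> n u v"
        if "c \<in> carrier k" "v \<in> carrier (ob L n)" for v c by (rule mhom_smult[OF h that])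
    qed
  next
    fix p q f u v assume f: "f \<in> Gamma_hom p q" and u: "u \<in> carrier (ob P q)" and v: "v \<in> carrier (ob L p)"
    have fu: "act P p q f u \<in> carrier (ob P p)" by (rule mhom_closed[OF Pm(2)[OF f] u])
    show "\<gamma> p (act P p q f u) v = \<gamma> q u (act L p q f v)"
    proof (rule mhom_eq_on_generators[OF L_split_generates L_module Z \<gamma>(1)[OF fu] mhom_comp[OF L_act_hom[OF f] \<gamma>(1)[OF u]] _ v])
      fix g assume "g \<in> {Lgen p a m | S a m. split_tuple p S a \<and> m \<in> carrier M}"
      then obtain S a m where g: "g = Lgen p a m" and s: "split_tuple p S a" and m: "m \<in> carrier M" by blast
      have a: "a \<in> tuples p (carrier A)" using s by (simp add: split_tuple_def)
      have tm: "tail_prod p f a \<odot>\<^bsub>M\<^esub> m \<in> carrier M" using tail_prod_closed[OF a] m by simp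
      show "\<gamma> p (act P p q f u) g = \<gamma> q u (act L p q f g)"
        unfolding g L_act_gen[OF f a m] act_tuple_def \<gamma>(2)[OF fu a m] \<gamma>(2)[OF u push_A[OF f a] tm]
          extend_pairing_Gamma_balanced[OF Z \<beta> f u s m] ..
    qed
  qed
  then obtain h where h: "h \<in> module_hom k E Z"
    "\<And>n u v. u \<in> carrier (ob P n) \<Longrightarrow> v \<in> carrier (ob L n) \<Longrightarrow> h (gamma_tensor_gen k P L (n, u, v)) = \<gamma> n u v" by blast
  have "h (pair_E P p u a m) = \<beta> p u a m"
    if u: "u \<in> carrier (ob P p)" and a: "a \<in> tuples p I" and m: "m \<in> carrier M" for p u a m
  proof -
    note aA = I_tuples[OF a]
    have s: "split_tuple p {1..p} a" unfolding split_tuple_def using aA tuplesD(1)[OF a] by auto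
    have incl: "incl {1..p} = (\<lambda>i\<in>{0..p}. i)" and sub: "sub_tuple {1..p} a = a"
    proof -
      have nth: "nth_elem {1..p} l = l" if "l \<in> {1..p}" for l
      proof -
        have "rank_in {1..p} l = l"
          using arg_cong[OF collapse_full[of p], of "\<lambda>h. h l"] that by (simp add: collapse_def)
        then show ?thesis using nth_rank[of "{1..p}" l] that by simp
      qed
      show "incl {1..p} = (\<lambda>i\<in>{0..p}. i)" unfolding incl_def card_atLeastAtMost diff_Suc_1
        by (rule restrict_ext) (use nth in auto)
      show "sub_tuple {1..p} a = a" unfolding sub_tuple_def card_atLeastAtMost diff_Suc_1
        by (rule extensionalityI[of _ "{1..p}"]) (use nth tuplesD(2)[OF a] in auto)
    qed
    have "h (pair_E P p u a m) = extend_pairing Z \<beta> p u a m"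
      unfolding pair_E_def h(2)[OF u mlinD(2)[OF Lgen_mlin aA m]] by (rule \<gamma>(2)[OF u aA m])
    also have "\<dots> = \<beta> p u a m"
      using extend_pairing_split[OF Z \<beta> u s m] Pm(3)[OF u] unfolding incl sub by simp
    finally show ?thesis .
  qed
  then show ?thesis using h(1) by blast
qed

end

lemma pair_E_map:
  assumes P: "right_gamma_module k P" and Q: "right_gamma_module k Q" and \<theta>: "\<theta> \<in> right_gamma_hom k P Q"
    and u: "u \<in> carrier (ob P p)" and a: "a \<in> tuples p I" and m: "m \<in> carrier M"
  shows "gamma_tensor_map k P Q L \<theta> (pair_E P p u a m) = pair_E Q p (\<theta> p u) a m"
  unfolding pair_E_def by (rule gamma_tensor_map_gen[OF P Q L_left_module \<theta> u mlinD(2)[OF Lgen_mlin I_tuples[OF a] m]])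

end

section \<open>Lifting properties over the based surjections\<close>

abbreviation lifts_along where
  "lifts_along k X Y \<pi> \<zeta> \<equiv> \<exists>\<xi>\<in>surj_hom k X Y. \<forall>p. \<forall>u\<in>carrier (ob X p). \<pi> p (\<xi> p u) = \<zeta> p u"

subsection \<open>The free resolution\<close>

text \<open>
  By freeness it suffices to choose preimages for the generators \<open>(\<sigma>, id)\<close>; naturality then dictates
  the rest.
\<close>

lemma (in cring) bar_lift:
  assumes Y: "surj_module R Y" and Z: "surj_module R Z"
    and \<pi>: "\<pi> \<in> surj_hom R Y Z" and \<zeta>: "\<zeta> \<in> surj_hom R (bar R n) Z"
    and im: "\<And>p u. u \<in> carrier (ob (bar R n) p) \<Longrightarrow> \<zeta> p u \<in> \<pi> p ` carrier (ob Y p)"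
  shows "lifts_along R (bar R n) Y \<pi> \<zeta>"
proof -
  note Ym = surj_moduleD[OF Y] and Zm = surj_moduleD[OF Z]
  let ?e = "\<lambda>\<sigma> x. basis_elem R (\<sigma>, \<lambda>i\<in>{0..x}. i)"
  have i: "(\<sigma>, \<lambda>i\<in>{0..x}. i) \<in> bar_idx n x" if "\<sigma> \<in> N_Omega n x" for \<sigma> x by (rule bar_idxI[OF that based_surj_id])
  note e = bar_basis[OF i]
  define y where "y \<sigma> = (SOME y. y \<in> carrier (ob Y (fst \<sigma> 0)) \<and> \<pi> (fst \<sigma> 0) y = \<zeta> (fst \<sigma> 0) (?e \<sigma> (fst \<sigma> 0)))" for \<sigma> :: strg
  have y: "y \<sigma> \<in> carrier (ob Y x)" "\<pi> x (y \<sigma>) = \<zeta> x (?e \<sigma> x)" if \<sigma>: "\<sigma> \<in> N_Omega n x" for \<sigma> x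
  proof -
    have x: "fst \<sigma> 0 = x" using N_Omega_pos[OF \<sigma>] by simp
    have "\<exists>y. y \<in> carrier (ob Y x) \<and> \<pi> x y = \<zeta> x (?e \<sigma> x)" using im[OF e[OF \<sigma>]] by (metis imageE)
    from someI_ex[OF this] show "y \<sigma> \<in> carrier (ob Y x)" "\<pi> x (y \<sigma>) = \<zeta> x (?e \<sigma> x)" unfolding y_def x by auto
  qed
  define \<xi> where "\<xi> p = lin_comb R (ob Y p) (\<lambda>(\<sigma>, g). act Y p (fst \<sigma> 0) g (y \<sigma>))" for p
  have c: "(case (\<sigma>, g) of (\<sigma>, g) \<Rightarrow> act Y p (fst \<sigma> 0) g (y \<sigma>)) \<in> carrier (ob Y p)"
    if "\<sigma> \<in> N_Omega n x" "g \<in> based_surj p x" for \<sigma> g x p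
    using mhom_closed[OF Ym(2)[OF that(2)] y(1)[OF that(1)]] N_Omega_pos[OF that(1)] by simp
  have \<xi>h: "\<xi> p \<in> module_hom R (ob (bar R n) p) (ob Y p)" for p
    unfolding \<xi>_def by (rule bar_lin(1)[OF Ym(1)]) (rule c)
  have \<xi>b: "\<xi> p (basis_elem R (\<sigma>, g)) = act Y p x g (y \<sigma>)" if "\<sigma> \<in> N_Omega n x" "g \<in> based_surj p x" for \<sigma> g x p
  proof -
    have "\<xi> p (basis_elem R (\<sigma>, g)) = (case (\<sigma>, g) of (\<sigma>, g) \<Rightarrow> act Y p (fst \<sigma> 0) g (y \<sigma>))"
      unfolding \<xi>_def by (rule bar_lin(2)[OF Ym(1) _ bar_idxI[OF that]]) (rule c)
    then show ?thesis using N_Omega_pos[OF that(1)] by simp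
  qed
  have "\<xi> \<in> surj_hom R (bar R n) Y"
  proof (rule surj_homI[OF \<xi>h])
    fix p q f u assume f: "f \<in> based_surj p q" and u: "u \<in> carrier (ob (bar R n) q)"
    show "\<xi> p (act (bar R n) p q f u) = act Y p q f (\<xi> q u)"
    proof (rule bar_hom_eq[OF Ym(1) mhom_comp[OF bar_act(1)[OF f] \<xi>h] mhom_comp[OF \<xi>h Ym(2)[OF f]] _ u])
      fix \<sigma> g x assume x: "\<sigma> \<in> N_Omega n x" "g \<in> based_surj q x"
      show "\<xi> p (act (bar R n) p q f (basis_elem R (\<sigma>, g))) = act Y p q f (\<xi> q (basis_elem R (\<sigma>, g)))"
        unfolding bar_act(2)[OF f bar_idxI[OF x]] \<xi>b[OF x] \<xi>b[OF x(1) based_surj_comp[OF f x(2)]]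
        by (rule Ym(4)[OF f x(2) y(1)[OF x(1)]])
    qed
  qed
  moreover have "\<pi> p (\<xi> p u) = \<zeta> p u" if u: "u \<in> carrier (ob (bar R n) p)" for p u
  proof (rule bar_hom_eq[OF Zm(1) mhom_comp[OF \<xi>h surj_homD(1)[OF \<pi>]] surj_homD(1)[OF \<zeta>] _ u])
    fix \<sigma> g x assume x: "\<sigma> \<in> N_Omega n x" "g \<in> based_surj p x"
    have "\<zeta> p (act (bar R n) p x g (?e \<sigma> x)) = act Z p x g (\<zeta> x (?e \<sigma> x))"
      by (rule surj_homD(2)[OF \<zeta> x(2) e[OF x(1)]])
    then show "\<pi> p (\<xi> p (basis_elem R (\<sigma>, g))) = \<zeta> p (basis_elem R (\<sigma>, g))"
      unfolding \<xi>b[OF x] surj_homD(2)[OF \<pi> x(2) y(1)[OF x(1)]] y(2)[OF x(1)]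
        bar_act(2)[OF x(2) i[OF x(1)]] comp_id_left[OF based_surjD[OF x(2)]] by simp
  qed
  ultimately show ?thesis by blast
qed

subsection \<open>Projective right \<open>\<Gamma>\<close>-modules\<close>

definition free_idx :: "('k, 'p) gamma_mod \<Rightarrow> nat \<Rightarrow> (nat \<times> 'p \<times> (nat \<Rightarrow> nat)) set" where
  "free_idx P p = {(q, x, g). x \<in> carrier (ob P q) \<and> g \<in> Gamma_hom p q}"

text \<open>
  The free right \<open>\<Gamma>\<close>-module on the underlying family of sets of \<open>P\<close>, which maps onto \<open>P\<close> by
  \<open>free_cover\<close>.
\<close>

definition free_on :: "('k, 'r) ring_scheme \<Rightarrow> ('k, 'p) gamma_mod \<Rightarrow> ('k, nat \<times> 'p \<times> (nat \<Rightarrow> nat) \<Rightarrow> 'k) gamma_mod" where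
  "free_on k P = \<lparr>ob = (\<lambda>p. free_module k (free_idx P p)),
     act = (\<lambda>p q f. lin_comb k (free_module k (free_idx P p)) (\<lambda>(r, x, g). basis_elem k (r, x, compose {0..p} g f)))\<rparr>"

text \<open>An isomorphic copy of \<open>V\<close> on the range of the injection \<open>j\<close>.\<close>

definition transport_module :: "('v \<Rightarrow> 'w) \<Rightarrow> ('k, 'v) module \<Rightarrow> ('k, 'w) module" where
  "transport_module j V = \<lparr>carrier = j ` carrier V, monoid.mult = undefined, one = undefined, ring.zero = j \<zero>\<^bsub>V\<^esub>,
     add = (\<lambda>x y. j (the_inv j x \<oplus>\<^bsub>V\<^esub> the_inv j y)), smult = (\<lambda>c x. j (c \<odot>\<^bsub>V\<^esub> the_inv j x))\<rparr>"

lemma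
  assumes "module k V" "inj j"
  shows transport_module: "module k (transport_module j V)"
    and transport_hom: "j \<in> module_hom k V (transport_module j V)"
    and transport_carrier: "carrier (transport_module j V) = j ` carrier V"
  using module_image[OF assms(1), of "transport_module j V" j] assms(2)
  by (simp_all add: transport_module_def the_inv_f_f)

context cring
begin

lemma free_on_module: "module R (ob (free_on R P) p)"
  unfolding free_on_def by (simp add: free_module_module[OF is_cring])

lemma free_on_basis: "s \<in> free_idx P p \<Longrightarrow> basis_elem R s \<in> carrier (ob (free_on R P) p)"
  unfolding free_on_def by (simp add: basis_elem_closed[OF is_cring])

lemma free_idxI: "x \<in> carrier (ob P q) \<Longrightarrow> g \<in> Gamma_hom p q \<Longrightarrow> (q, x, g) \<in> free_idx P p"
  unfolding free_idx_def by auto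

lemma free_on_hom_eq:
  assumes "module R W" "\<phi> \<in> module_hom R (ob (free_on R P) p) W" "\<psi> \<in> module_hom R (ob (free_on R P) p) W"
    and "\<And>q x g. x \<in> carrier (ob P q) \<Longrightarrow> g \<in> Gamma_hom p q \<Longrightarrow> \<phi> (basis_elem R (q, x, g)) = \<psi> (basis_elem R (q, x, g))"
    and "v \<in> carrier (ob (free_on R P) p)"
  shows "\<phi> v = \<psi> v"
proof -
  have g: "generates R (ob (free_on R P) p) (basis_elem R ` free_idx P p)"
    unfolding free_on_def by (simp add: free_module_generates[OF is_cring])
  show ?thesis
    by (rule mhom_eq_on_generators[OF g free_on_module assms(1-3) _ assms(5)]) (use assms(4) in \<open>auto simp: free_idx_def\<close>)
qed

lemma free_on_lin:
  assumes "module R W" "\<And>q x g. x \<in> carrier (ob P q) \<Longrightarrow> g \<in> Gamma_hom p q \<Longrightarrow> h (q, x, g) \<in> carrier W"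
  shows "lin_comb R W h \<in> module_hom R (ob (free_on R P) p) W"
    and "x \<in> carrier (ob P q) \<Longrightarrow> g \<in> Gamma_hom p q \<Longrightarrow> lin_comb R W h (basis_elem R (q, x, g)) = h (q, x, g)"
proof -
  have h: "h \<in> free_idx P p \<rightarrow> carrier W" using assms(2) by (auto simp: free_idx_def)
  show "lin_comb R W h \<in> module_hom R (ob (free_on R P) p) W"
    unfolding free_on_def using lin_comb_hom[OF assms(1) h] by simp
  show "x \<in> carrier (ob P q) \<Longrightarrow> g \<in> Gamma_hom p q \<Longrightarrow> lin_comb R W h (basis_elem R (q, x, g)) = h (q, x, g)"
    by (rule lin_comb_basis[OF assms(1) h free_idxI])
qed

lemma free_on_act:
  assumes f: "f \<in> Gamma_hom p q"
  shows "act (free_on R P) p q f \<in> module_hom R (ob (free_on R P) q) (ob (free_on R P) p)"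
    and "x \<in> carrier (ob P r) \<Longrightarrow> g \<in> Gamma_hom q r \<Longrightarrow>
      act (free_on R P) p q f (basis_elem R (r, x, g)) = basis_elem R (r, x, compose {0..p} g f)"
proof -
  have e: "act (free_on R P) p q f = lin_comb R (ob (free_on R P) p) (\<lambda>(r, x, g). basis_elem R (r, x, compose {0..p} g f))"
    unfolding free_on_def by simp
  have c: "(case (r, x, g) of (r, x, g) \<Rightarrow> basis_elem R (r, x, compose {0..p} g f)) \<in> carrier (ob (free_on R P) p)"
    if "x \<in> carrier (ob P r)" "g \<in> Gamma_hom q r" for r x g
    using free_on_basis[OF free_idxI[OF that(1) Gamma_hom_comp[OF f that(2)]]] by simp
  show "act (free_on R P) p q f \<in> module_hom R (ob (free_on R P) q) (ob (free_on R P) p)"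
    unfolding e by (rule free_on_lin(1)[OF free_on_module]) (rule c)
  show "x \<in> carrier (ob P r) \<Longrightarrow> g \<in> Gamma_hom q r \<Longrightarrow>
      act (free_on R P) p q f (basis_elem R (r, x, g)) = basis_elem R (r, x, compose {0..p} g f)"
    unfolding e by (rule trans, rule free_on_lin(2)[OF free_on_module], rule c, assumption, assumption, assumption, assumption, simp)
qed

lemma free_on_right_gamma_module: "right_gamma_module R (free_on R P)"
  unfolding right_gamma_module_def
proof (intro conjI allI ballI)
  show "module R (ob (free_on R P) p)" for p by (rule free_on_module)
  show "act (free_on R P) p q f \<in> module_hom R (ob (free_on R P) q) (ob (free_on R P) p)" if "f \<in> Gamma_hom p q" for p q f
    by (rule free_on_act(1)[OF that])
  show "act (free_on R P) p p (\<lambda>i\<in>{0..p}. i) u = u" if "u \<in> carrier (ob (free_on R P) p)" for p u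
    by (rule free_on_hom_eq[OF free_on_module free_on_act(1)[OF Gamma_hom_id] mhom_id _ that])
       (auto simp: free_on_act(2)[OF Gamma_hom_id] comp_id_right)
  fix p q r f g u
  assume f: "f \<in> Gamma_hom p q" and g: "g \<in> Gamma_hom q r" and u: "u \<in> carrier (ob (free_on R P) r)"
  show "act (free_on R P) p r (compose {0..p} g f) u = act (free_on R P) p q f (act (free_on R P) q r g u)"
  proof (rule free_on_hom_eq[OF free_on_module free_on_act(1)[OF Gamma_hom_comp[OF f g]] mhom_comp[OF free_on_act(1)[OF g] free_on_act(1)[OF f]] _ u])
    fix s x h assume x: "x \<in> carrier (ob P s)" "h \<in> Gamma_hom r s"
    show "act (free_on R P) p r (compose {0..p} g f) (basis_elem R (s, x, h)) =
        act (free_on R P) p q f (act (free_on R P) q r g (basis_elem R (s, x, h)))"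
      unfolding free_on_act(2)[OF Gamma_hom_comp[OF f g] x] free_on_act(2)[OF g x] free_on_act(2)[OF f x(1) Gamma_hom_comp[OF g x(2)]]
        comp_assoc[OF f g x(2)] ..
  qed
qed

definition free_cover :: "('a, 'p) gamma_mod \<Rightarrow> nat \<Rightarrow> (nat \<times> 'p \<times> (nat \<Rightarrow> nat) \<Rightarrow> 'a) \<Rightarrow> 'p" where
  "free_cover P p = lin_comb R (ob P p) (\<lambda>(q, x, g). act P p q g x)"

lemma
  assumes P: "right_gamma_module R P"
  shows free_cover_hom: "free_cover P \<in> right_gamma_hom R (free_on R P) P"
    and free_cover_basis: "x \<in> carrier (ob P q) \<Longrightarrow> g \<in> Gamma_hom p q \<Longrightarrow> free_cover P p (basis_elem R (q, x, g)) = act P p q g x"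
proof -
  note Pm = right_gamma_moduleD[OF P]
  have c: "(case (q, x, g) of (q, x, g) \<Rightarrow> act P p q g x) \<in> carrier (ob P p)"
    if "x \<in> carrier (ob P q)" "g \<in> Gamma_hom p q" for p q x g
    using mhom_closed[OF Pm(2)[OF that(2)] that(1)] by simp
  have h: "free_cover P p \<in> module_hom R (ob (free_on R P) p) (ob P p)" for p
    unfolding free_cover_def by (rule free_on_lin(1)[OF Pm(1)]) (rule c)
  show b: "free_cover P p (basis_elem R (q, x, g)) = act P p q g x"
    if "x \<in> carrier (ob P q)" "g \<in> Gamma_hom p q" for p q x g
  proof -
    have "free_cover P p (basis_elem R (q, x, g)) = (case (q, x, g) of (q, x, g) \<Rightarrow> act P p q g x)"
      unfolding free_cover_def by (rule free_on_lin(2)[OF Pm(1) _ that]) (rule c)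
    then show ?thesis by simp
  qed
  show "free_cover P \<in> right_gamma_hom R (free_on R P) P"
    unfolding right_gamma_hom_def
  proof (intro CollectI conjI allI ballI h)
    fix p q f u assume f: "f \<in> Gamma_hom p q" and u: "u \<in> carrier (ob (free_on R P) q)"
    show "free_cover P p (act (free_on R P) p q f u) = act P p q f (free_cover P q u)"
    proof (rule free_on_hom_eq[OF Pm(1) mhom_comp[OF free_on_act(1)[OF f] h] mhom_comp[OF h Pm(2)[OF f]] _ u])
      fix r x g assume x: "x \<in> carrier (ob P r)" "g \<in> Gamma_hom q r"
      show "free_cover P p (act (free_on R P) p q f (basis_elem R (r, x, g))) = act P p q f (free_cover P q (basis_elem R (r, x, g)))"
        unfolding free_on_act(2)[OF f x] b[OF x] b[OF x(1) Gamma_hom_comp[OF f x(2)]] by (rule Pm(4)[OF f x(2,1)])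
    qed
  qed
qed

text \<open>
  A projective module is a retract of the free module that covers it. Projectivity speaks about
  lifting problems between modules of one element type, that of \<open>free_on\<close>, so \<open>P\<close> as the target of
  the cover is replaced by a copy in this type. The embedding sends \<open>u\<close> to a basis element with
  arbitrary other coordinates and is injective because \<open>1 \<noteq> 0\<close> in the ring.
\<close>

lemma projective_retract:
  fixes P :: "('a, 'p) gamma_mod"
  assumes P: "projective_gamma R P" and nz: "\<one> \<noteq> \<zero>"
  shows "\<exists>\<Lambda>\<in>right_gamma_hom R P (free_on R P). \<forall>p. \<forall>u\<in>carrier (ob P p). free_cover P p (\<Lambda> p u) = u"
proof -
  have PG: "right_gamma_module R P" using P unfolding projective_gamma_def by blast
  note Pm = right_gamma_moduleD[OF PG] and cv = right_gamma_homD[OF free_cover_hom[OF PG]]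
  define j :: "'p \<Rightarrow> nat \<times> 'p \<times> (nat \<Rightarrow> nat) \<Rightarrow> 'a" where "j u = basis_elem R (0, u, \<lambda>_. 0)" for u
  have inj: "inj j"
  proof (rule injI)
    fix u v assume "j u = j v"
    from injD[OF basis_elem_inj[OF nz] this[unfolded j_def]] show "u = v" by simp
  qed
  define N' where "N' = \<lparr>ob = (\<lambda>n. transport_module j (ob P n)), act = (\<lambda>p q f x. j (act P p q f (the_inv j x)))\<rparr>"
  have N's: "ob N' n = transport_module j (ob P n)" "act N' p q f (j u) = j (act P p q f u)" for n p q f u
    unfolding N'_def by (simp_all add: the_inv_f_f[OF inj])
  note T = transport_module[OF Pm(1) inj] transport_hom[OF Pm(1) inj] transport_carrier[OF Pm(1) inj]
  have jh: "j \<in> module_hom R (ob P n) (ob N' n)" for n unfolding N's by (rule T(2))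
  have N': "right_gamma_module R N'"
    unfolding right_gamma_module_def
  proof (intro conjI allI ballI)
    show "module R (ob N' n)" for n unfolding N's by (rule T(1))
    show "act N' p q f \<in> module_hom R (ob N' q) (ob N' p)" if f: "f \<in> Gamma_hom p q" for p q f
    proof (rule mhomI)
      fix x assume "x \<in> carrier (ob N' q)"
      then obtain u where u: "u \<in> carrier (ob P q)" "x = j u" unfolding N's T(3) by blast
      show "act N' p q f x \<in> carrier (ob N' p)"
        unfolding u(2) N's(2) by (rule mhom_closed[OF jh mhom_closed[OF Pm(2)[OF f] u(1)]])
      show "act N' p q f (c \<odot>\<^bsub>ob N' q\<^esub> x) = c \<odot>\<^bsub>ob N' p\<^esub> act N' p q f x" if c: "c \<in> carrier R" for c
        unfolding u(2) mhom_smult[OF jh c u(1), symmetric] N's(2) mhom_smult[OF Pm(2)[OF f] c u(1)]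
        by (rule mhom_smult[OF jh c mhom_closed[OF Pm(2)[OF f] u(1)]])
      fix y assume "y \<in> carrier (ob N' q)"
      then obtain v where v: "v \<in> carrier (ob P q)" "y = j v" unfolding N's T(3) by blast
      show "act N' p q f (x \<oplus>\<^bsub>ob N' q\<^esub> y) = act N' p q f x \<oplus>\<^bsub>ob N' p\<^esub> act N' p q f y"
        unfolding u(2) v(2) mhom_add[OF jh u(1) v(1), symmetric] N's(2) mhom_add[OF Pm(2)[OF f] u(1) v(1)]
        by (rule mhom_add[OF jh mhom_closed[OF Pm(2)[OF f] u(1)] mhom_closed[OF Pm(2)[OF f] v(1)]])
    qed
    show "act N' n n (\<lambda>i\<in>{0..n}. i) x = x" if "x \<in> carrier (ob N' n)" for n x
      using that Pm(3) unfolding N's(1) T(3) by (auto simp: N's(2))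
    show "act N' p r (compose {0..p} g f) x = act N' p q f (act N' q r g x)"
      if "f \<in> Gamma_hom p q" "g \<in> Gamma_hom q r" "x \<in> carrier (ob N' r)" for p q r f g x
      using that(3) Pm(4)[OF that(1,2)] unfolding N's(1) T(3) by (auto simp: N's(2))
  qed
  have \<phi>: "(\<lambda>n. j) \<in> right_gamma_hom R P N'"
    unfolding right_gamma_hom_def by (intro CollectI conjI allI ballI jh) (rule N's(2)[symmetric])
  have \<pi>: "(\<lambda>n v. j (free_cover P n v)) \<in> right_gamma_hom R (free_on R P) N'"
    unfolding right_gamma_hom_def
    by (intro CollectI conjI allI ballI mhom_comp[OF cv(1) jh]) (simp only: cv(2) N's(2))
  have onto: "\<exists>v\<in>carrier (ob (free_on R P) n). free_cover P n v = u" if u: "u \<in> carrier (ob P n)" for n u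
    by (rule bexI[OF _ free_on_basis[OF free_idxI[OF u Gamma_hom_id]]])
       (simp add: free_cover_basis[OF PG u Gamma_hom_id] Pm(3)[OF u])
  have surj: "(\<lambda>v. j (free_cover P n v)) ` carrier (ob (free_on R P) n) = carrier (ob N' n)" for n
    unfolding N's T(3)
  proof (intro equalityI subsetI)
    show "y \<in> j ` carrier (ob P n)" if "y \<in> (\<lambda>v. j (free_cover P n v)) ` carrier (ob (free_on R P) n)" for y
      using that mhom_closed[OF cv(1)] by blast
    show "y \<in> (\<lambda>v. j (free_cover P n v)) ` carrier (ob (free_on R P) n)" if y: "y \<in> j ` carrier (ob P n)" for y
    proof -
      obtain u where u: "u \<in> carrier (ob P n)" "y = j u" using y by blast
      obtain v where "v \<in> carrier (ob (free_on R P) n)" "free_cover P n v = u" using onto[OF u(1)] by blast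
      then show ?thesis using u(2) by blast
    qed
  qed
  have "\<exists>\<psi>\<in>right_gamma_hom R P (free_on R P). \<forall>n. \<forall>u\<in>carrier (ob P n). j (free_cover P n (\<psi> n u)) = j u"
    by (rule P[unfolded projective_gamma_def, THEN conjunct2, THEN spec[of _ "free_on R P"], THEN spec[of _ N'],
          THEN spec[of _ "\<lambda>n v. j (free_cover P n v)"], THEN spec[of _ "\<lambda>n. j"], THEN mp])
       (intro conjI allI free_on_right_gamma_module N' \<pi> surj \<phi>)
  then obtain \<psi> where \<psi>: "\<psi> \<in> right_gamma_hom R P (free_on R P)"
      "\<And>n u. u \<in> carrier (ob P n) \<Longrightarrow> j (free_cover P n (\<psi> n u)) = j u" by blast
  have "free_cover P n (\<psi> n u) = u" if "u \<in> carrier (ob P n)" for n u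
    using \<psi>(2)[OF that] inj by (simp add: inj_eq)
  then show ?thesis using \<psi>(1) by blast
qed

text \<open>
  The restriction of a projective right \<open>\<Gamma>\<close>-module to the based surjections is projective. It is a
  retract of a free \<open>\<Gamma>\<close>-module, and that is free over the based surjections: a basis element
  \<open>(q, x, f)\<close> is the inclusion of the image of \<open>f\<close> translated by a based surjection. So preimages
  are chosen for the elements \<open>(q, x, incl S)\<close>, of which only the value
  \<open>act P (card S) q (incl S) x\<close> in \<open>P\<close> matters.
\<close>

lemma projective_lift:
  fixes P :: "('a, 'p) gamma_mod"
  assumes P: "projective_gamma R P" and nz: "\<one> \<noteq> \<zero>"
    and Y: "surj_module R Y" and Z: "surj_module R Z"
    and \<pi>: "\<pi> \<in> surj_hom R Y Z" and \<zeta>: "\<zeta> \<in> surj_hom R P Z"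
    and im: "\<And>p u. u \<in> carrier (ob P p) \<Longrightarrow> \<zeta> p u \<in> \<pi> p ` carrier (ob Y p)"
  shows "lifts_along R P Y \<pi> \<zeta>"
proof -
  have PG: "right_gamma_module R P" using P unfolding projective_gamma_def by blast
  note Pm = right_gamma_moduleD[OF PG] and Ym = surj_moduleD[OF Y] and Zm = surj_moduleD[OF Z]
  note cv = right_gamma_homD[OF free_cover_hom[OF PG]]
  obtain \<Lambda> where \<Lambda>: "\<Lambda> \<in> right_gamma_hom R P (free_on R P)" "\<And>p u. u \<in> carrier (ob P p) \<Longrightarrow> free_cover P p (\<Lambda> p u) = u"
    using projective_retract[OF P nz] by blast
  note \<Lambda>h = right_gamma_homD[OF \<Lambda>(1)]
  let ?w = "\<lambda>q x S. act P (card S) q (incl S) x"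
  have w: "?w q x S \<in> carrier (ob P (card S))" if "x \<in> carrier (ob P q)" "S \<subseteq> {1..q}" for q x S
    by (rule mhom_closed[OF Pm(2)[OF incl_Gamma[OF that(2)]] that(1)])
  define y where "y q x S = (SOME y. y \<in> carrier (ob Y (card S)) \<and> \<pi> (card S) y = \<zeta> (card S) (?w q x S))" for q x S
  have y: "y q x S \<in> carrier (ob Y (card S))" "\<pi> (card S) (y q x S) = \<zeta> (card S) (?w q x S)"
    if "x \<in> carrier (ob P q)" "S \<subseteq> {1..q}" for q x S
  proof -
    have "\<exists>y. y \<in> carrier (ob Y (card S)) \<and> \<pi> (card S) y = \<zeta> (card S) (?w q x S)"
      using im[OF w[OF that]] by (metis imageE)
    from someI_ex[OF this] show "y q x S \<in> carrier (ob Y (card S))" "\<pi> (card S) (y q x S) = \<zeta> (card S) (?w q x S)"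
      unfolding y_def by auto
  qed
  define l where "l p = lin_comb R (ob Y p) (\<lambda>(q, x, f). act Y p (card (image_supp p f)) (onto_image p f) (y q x (image_supp p f)))" for p
  have c: "(case (q, x, f) of (q, x, f) \<Rightarrow> act Y p (card (image_supp p f)) (onto_image p f) (y q x (image_supp p f))) \<in> carrier (ob Y p)"
    if "x \<in> carrier (ob P q)" "f \<in> Gamma_hom p q" for p q x f
    using mhom_closed[OF Ym(2)[OF onto_image_surj(1)[OF that(2)]] y(1)[OF that(1) image_supp_sub[OF that(2)]]] by simp
  have lh: "l p \<in> module_hom R (ob (free_on R P) p) (ob Y p)" for p
    unfolding l_def by (rule free_on_lin(1)[OF Ym(1)]) (rule c)
  have lb: "l p (basis_elem R (q, x, f)) = act Y p (card (image_supp p f)) (onto_image p f) (y q x (image_supp p f))"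
    if "x \<in> carrier (ob P q)" "f \<in> Gamma_hom p q" for p q x f
  proof -
    have "l p (basis_elem R (q, x, f)) = (case (q, x, f) of (q, x, f) \<Rightarrow> act Y p (card (image_supp p f)) (onto_image p f) (y q x (image_supp p f)))"
      unfolding l_def by (rule free_on_lin(2)[OF Ym(1) _ that]) (rule c)
    then show ?thesis by simp
  qed
  have "(\<lambda>p u. l p (\<Lambda> p u)) \<in> surj_hom R P Y"
  proof (rule surj_homI)
    show "(\<lambda>u. l p (\<Lambda> p u)) \<in> module_hom R (ob P p) (ob Y p)" for p by (rule mhom_comp[OF \<Lambda>h(1) lh])
    fix p q f u assume f: "f \<in> based_surj p q" and u: "u \<in> carrier (ob P q)"
    note fG = based_surjD[OF f]
    have "l p (act (free_on R P) p q f v) = act Y p q f (l q v)" if v: "v \<in> carrier (ob (free_on R P) q)" for v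
    proof (rule free_on_hom_eq[OF Ym(1) mhom_comp[OF free_on_act(1)[OF fG] lh] mhom_comp[OF lh Ym(2)[OF f]] _ v])
      fix r x g assume x: "x \<in> carrier (ob P r)" "g \<in> Gamma_hom q r"
      show "l p (act (free_on R P) p q f (basis_elem R (r, x, g))) = act Y p q f (l q (basis_elem R (r, x, g)))"
        unfolding free_on_act(2)[OF fG x] lb[OF x] lb[OF x(1) Gamma_hom_comp[OF fG x(2)]]
          image_supp_comp[OF f x(2)] onto_image_comp[OF f x(2)]
        by (rule Ym(4)[OF f onto_image_surj(1)[OF x(2)] y(1)[OF x(1) image_supp_sub[OF x(2)]]])
    qed
    then show "l p (\<Lambda> p (act P p q f u)) = act Y p q f (l q (\<Lambda> q u))"
      unfolding \<Lambda>h(2)[OF fG u] using mhom_closed[OF \<Lambda>h(1) u] by blast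
  qed
  moreover have "\<pi> p (l p (\<Lambda> p u)) = \<zeta> p u" if u: "u \<in> carrier (ob P p)" for p u
  proof -
    have "\<pi> p (l p v) = \<zeta> p (free_cover P p v)" if v: "v \<in> carrier (ob (free_on R P) p)" for v
    proof (rule free_on_hom_eq[OF Zm(1) mhom_comp[OF lh surj_homD(1)[OF \<pi>]] mhom_comp[OF cv(1) surj_homD(1)[OF \<zeta>]] _ v])
      fix q x f assume x: "x \<in> carrier (ob P q)" "f \<in> Gamma_hom p q"
      let ?S = "image_supp p f"
      note S = image_supp_sub[OF x(2)] and o = onto_image_surj[OF x(2)]
      have "\<pi> p (l p (basis_elem R (q, x, f))) = act Z p (card ?S) (onto_image p f) (\<zeta> (card ?S) (?w q x ?S))"
        unfolding lb[OF x] surj_homD(2)[OF \<pi> o(1) y(1)[OF x(1) S]] y(2)[OF x(1) S] ..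
      also have "\<dots> = \<zeta> p (act P p (card ?S) (onto_image p f) (?w q x ?S))"
        by (rule surj_homD(2)[OF \<zeta> o(1) w[OF x(1) S], symmetric])
      also have "act P p (card ?S) (onto_image p f) (?w q x ?S) = act P p q f x"
        using Pm(4)[OF based_surjD[OF o(1)] incl_Gamma[OF S] x(1)] unfolding o(2) by simp
      finally show "\<pi> p (l p (basis_elem R (q, x, f))) = \<zeta> p (free_cover P p (basis_elem R (q, x, f)))"
        unfolding free_cover_basis[OF PG x] .
    qed
    from this[OF mhom_closed[OF \<Lambda>h(1) u]] show ?thesis unfolding \<Lambda>(2)[OF u] .
  qed
  ultimately show ?thesis by (intro bexI[of _ "\<lambda>p u. l p (\<Lambda> p u)"]) auto
qed

end

section \<open>Contractible complexes stay exact after tensoring\<close>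

context augmented_algebra
begin

lemma surj_hom_zero:
  assumes "surj_module k X" "surj_module k Y" "\<theta> \<in> surj_hom k X Y"
  shows "\<theta> p \<zero>\<^bsub>ob X p\<^esub> = \<zero>\<^bsub>ob Y p\<^esub>"
  by (rule mhom_zero[OF surj_moduleD(1)[OF assms(1)] surj_moduleD(1)[OF assms(2)] surj_homD(1)[OF assms(3)]])

lemma surj_hom_id: "(\<lambda>p u. u) \<in> surj_hom k X X"
  by (rule surj_homI[OF mhom_id]) auto

lemma surj_hom_diff:
  assumes X: "surj_module k X" and Y: "surj_module k Y" and \<theta>: "\<theta> \<in> surj_hom k X Y" and \<xi>: "\<xi> \<in> surj_hom k X Y"
  shows "(\<lambda>p u. \<theta> p u \<ominus>\<^bsub>ob Y p\<^esub> \<xi> p u) \<in> surj_hom k X Y"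
proof (rule surj_homI)
  note Ym = surj_moduleD[OF Y]
  show "(\<lambda>u. \<theta> p u \<ominus>\<^bsub>ob Y p\<^esub> \<xi> p u) \<in> module_hom k (ob X p) (ob Y p)" for p
    unfolding a_minus_def by (rule mhom_sum[OF Ym(1) surj_homD(1)[OF \<theta>] mhom_neg[OF Ym(1) surj_homD(1)[OF \<xi>]]])
  show "\<theta> p (act X p q f u) \<ominus>\<^bsub>ob Y p\<^esub> \<xi> p (act X p q f u) = act Y p q f (\<theta> q u \<ominus>\<^bsub>ob Y q\<^esub> \<xi> q u)"
    if f: "f \<in> based_surj p q" and u: "u \<in> carrier (ob X q)" for p q f u
    unfolding surj_homD(2)[OF \<theta> f u] surj_homD(2)[OF \<xi> f u]
    by (rule mhom_minus[OF Ym(1) Ym(1) Ym(2)[OF f] mhom_closed[OF surj_homD(1)[OF \<theta>] u]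
          mhom_closed[OF surj_homD(1)[OF \<xi>] u], symmetric])
qed

text \<open>
  The usual inductive construction of a contraction of an exact complex with the lifting property:
  the identity minus \<open>h \<circ> \<delta>\<close> takes values in cycles, hence in boundaries, and is lifted. In the
  index \<open>n\<close> of the differential \<open>\<delta> n\<close> from degree \<open>n + 1\<close> to degree \<open>n\<close>, exactness at \<open>0\<close> means
  surjectivity.
\<close>

lemma natural_contraction:
  fixes K :: "nat \<Rightarrow> ('k, 'x) gamma_mod"
  assumes K: "\<And>n. surj_module k (K n)"
    and \<delta>: "\<And>n. \<delta> n \<in> surj_hom k (K (Suc n)) (K n)"
    and dd: "\<And>n p u. u \<in> carrier (ob (K (Suc (Suc n))) p) \<Longrightarrow> \<delta> n p (\<delta> (Suc n) p u) = \<zero>\<^bsub>ob (K n) p\<^esub>"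
    and ex0: "\<And>p u. u \<in> carrier (ob (K 0) p) \<Longrightarrow> u \<in> \<delta> 0 p ` carrier (ob (K (Suc 0)) p)"
    and exS: "\<And>n p u. u \<in> carrier (ob (K (Suc n)) p) \<Longrightarrow> \<delta> n p u = \<zero>\<^bsub>ob (K n) p\<^esub> \<Longrightarrow>
        u \<in> \<delta> (Suc n) p ` carrier (ob (K (Suc (Suc n))) p)"
    and lift: "\<And>n \<zeta>. \<zeta> \<in> surj_hom k (K n) (K n) \<Longrightarrow>
        (\<And>p u. u \<in> carrier (ob (K n) p) \<Longrightarrow> \<zeta> p u \<in> \<delta> n p ` carrier (ob (K (Suc n)) p)) \<Longrightarrow>
        lifts_along k (K n) (K (Suc n)) (\<delta> n) \<zeta>"
  shows "\<exists>h. (\<forall>n. h n \<in> surj_hom k (K n) (K (Suc n))) \<and>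
     (\<forall>p. \<forall>u\<in>carrier (ob (K 0) p). \<delta> 0 p (h 0 p u) = u) \<and>
     (\<forall>n p. \<forall>u\<in>carrier (ob (K (Suc n)) p). \<delta> (Suc n) p (h (Suc n) p u) = u \<ominus>\<^bsub>ob (K (Suc n)) p\<^esub> h n p (\<delta> n p u))"
proof -
  note Km = surj_moduleD[OF K] and \<delta>h = surj_homD[OF \<delta>]
  \<comment> \<open>The last conjunct, \<open>\<delta> h \<delta> = \<delta>\<close>, is what makes the next step possible.\<close>
  define good where "good n h \<longleftrightarrow> h \<in> surj_hom k (K n) (K (Suc n)) \<and>
      (n = 0 \<longrightarrow> (\<forall>p. \<forall>u\<in>carrier (ob (K 0) p). \<delta> 0 p (h p u) = u)) \<and>
      (\<forall>p. \<forall>w\<in>carrier (ob (K (Suc n)) p). \<delta> n p (h p (\<delta> n p w)) = \<delta> n p w)" for n and h :: "nat \<Rightarrow> 'x \<Rightarrow> 'x"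
  define step where "step n h h' \<longleftrightarrow> (\<forall>p. \<forall>u\<in>carrier (ob (K (Suc n)) p).
      \<delta> (Suc n) p (h' p u) = u \<ominus>\<^bsub>ob (K (Suc n)) p\<^esub> h p (\<delta> n p u))" for n and h h' :: "nat \<Rightarrow> 'x \<Rightarrow> 'x"
  have "\<exists>h. good 0 h"
  proof -
    obtain h where h: "h \<in> surj_hom k (K 0) (K (Suc 0))" "\<And>p u. u \<in> carrier (ob (K 0) p) \<Longrightarrow> \<delta> 0 p (h p u) = u"
      using lift[of "\<lambda>p u. u" 0, OF surj_hom_id ex0] by blast
    then have "good 0 h" unfolding good_def using mhom_closed[OF \<delta>h(1)] by auto
    then show ?thesis by (rule exI[of _ h])
  qed
  moreover have "\<exists>h'. good (Suc n) h' \<and> step n h h'" if g: "good n h" for n h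
  proof -
    have h: "h \<in> surj_hom k (K n) (K (Suc n))"
      "\<And>p w. w \<in> carrier (ob (K (Suc n)) p) \<Longrightarrow> \<delta> n p (h p (\<delta> n p w)) = \<delta> n p w"
      using g unfolding good_def by auto
    note hd = surj_hom_comp[OF \<delta> h(1)]
    let ?\<zeta> = "\<lambda>p u. u \<ominus>\<^bsub>ob (K (Suc n)) p\<^esub> h p (\<delta> n p u)"
    have \<zeta>: "?\<zeta> \<in> surj_hom k (K (Suc n)) (K (Suc n))"
      by (rule surj_hom_diff[OF K K surj_hom_id hd])
    have im: "?\<zeta> p u \<in> \<delta> (Suc n) p ` carrier (ob (K (Suc (Suc n))) p)" if u: "u \<in> carrier (ob (K (Suc n)) p)" for p u
    proof (rule exS)
      show "?\<zeta> p u \<in> carrier (ob (K (Suc n)) p)" by (rule mhom_closed[OF surj_homD(1)[OF \<zeta>] u])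
      have "\<delta> n p (?\<zeta> p u) = \<delta> n p u \<ominus>\<^bsub>ob (K n) p\<^esub> \<delta> n p u"
        using mhom_minus[OF Km(1) Km(1) \<delta>h(1) u mhom_closed[OF surj_homD(1)[OF hd] u]] h(2)[OF u] by simp
      then show "\<delta> n p (?\<zeta> p u) = \<zero>\<^bsub>ob (K n) p\<^esub>"
        using module_minus_eq_zero[OF Km(1) mhom_closed[OF \<delta>h(1) u] mhom_closed[OF \<delta>h(1) u]] by simp
    qed
    obtain h' where h': "h' \<in> surj_hom k (K (Suc n)) (K (Suc (Suc n)))"
      "\<And>p u. u \<in> carrier (ob (K (Suc n)) p) \<Longrightarrow> \<delta> (Suc n) p (h' p u) = ?\<zeta> p u"
      using lift[OF \<zeta> im] by blast
    have "\<delta> (Suc n) p (h' p (\<delta> (Suc n) p w)) = \<delta> (Suc n) p w" if w: "w \<in> carrier (ob (K (Suc (Suc n))) p)" for p w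
      unfolding h'(2)[OF mhom_closed[OF \<delta>h(1) w]] dd[OF w] surj_hom_zero[OF K K h(1)]
      by (rule module_minus_zero[OF Km(1) mhom_closed[OF \<delta>h(1) w]])
    then have "good (Suc n) h'" unfolding good_def using h'(1) by auto
    moreover have "step n h h'" unfolding step_def using h'(2) by auto
    ultimately show ?thesis by blast
  qed
  ultimately have "\<exists>h. \<forall>n. good n (h n) \<and> step n (h n) (h (Suc n))"
    by (rule dependent_nat_choice)
  then obtain h where h: "\<And>n. good n (h n)" "\<And>n. step n (h n) (h (Suc n))" by blast
  show ?thesis
    by (intro exI[of _ h] conjI allI ballI)
       (use h(1)[unfolded good_def] h(2)[unfolded step_def] in \<open>simp_all only: simp_thms\<close>)
qed

text \<open>
  Here \<open>T n\<close> with \<open>\<tau> n\<close> is a tensor product of \<open>K n\<close> and \<open>U\<close>. Being natural, the maps \<open>h n\<close> induce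
  maps \<open>H n\<close> between tensor products, and the contraction identities carry over because they hold on
  generators.
\<close>

theorem contraction_exact:
  fixes K :: "nat \<Rightarrow> ('k, 'x) gamma_mod" and T :: "nat \<Rightarrow> ('k, 't) module"
  assumes K: "\<And>n. surj_module k (K n)"
    and \<delta>: "\<And>n. \<delta> n \<in> surj_hom k (K (Suc n)) (K n)"
    and h: "\<And>n. h n \<in> surj_hom k (K n) (K (Suc n))"
    and h0: "\<And>p u. u \<in> carrier (ob (K 0) p) \<Longrightarrow> \<delta> 0 p (h 0 p u) = u"
    and hS: "\<And>n p u. u \<in> carrier (ob (K (Suc n)) p) \<Longrightarrow>
        \<delta> (Suc n) p (h (Suc n) p u) = u \<ominus>\<^bsub>ob (K (Suc n)) p\<^esub> h n p (\<delta> n p u)"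
    and T: "\<And>n. module k (T n)" and \<tau>: "\<And>n. balanced (K n) (T n) (\<tau> n)"
    and gen: "\<And>n. generates k (T n) (pairing_values (K n) (\<tau> n))"
    and univ: "\<And>n \<beta>. balanced (K n) (T (Suc n)) \<beta> \<Longrightarrow> factors_through (K n) (\<tau> n) (T n) (T (Suc n)) \<beta>"
    and D: "\<And>n. D n \<in> module_hom k (T (Suc n)) (T n)"
    and D\<tau>: "\<And>n p u a m. u \<in> carrier (ob (K (Suc n)) p) \<Longrightarrow> a \<in> tuples p I \<Longrightarrow> m \<in> carrier M \<Longrightarrow>
        D n (\<tau> (Suc n) p u a m) = \<tau> n p (\<delta> n p u) a m"
  shows "z \<in> carrier (T 0) \<Longrightarrow> z \<in> D 0 ` carrier (T (Suc 0))"
    and "z \<in> carrier (T (Suc n)) \<Longrightarrow> D n z = \<zero>\<^bsub>T n\<^esub> \<Longrightarrow> z \<in> D (Suc n) ` carrier (T (Suc (Suc n)))"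
proof -
  note Km = surj_moduleD[OF K] and \<delta>h = surj_homD[OF \<delta>] and hh = surj_homD[OF h]
  define ok where "ok n H \<longleftrightarrow> H \<in> module_hom k (T n) (T (Suc n)) \<and> (\<forall>p. \<forall>u\<in>carrier (ob (K n) p). \<forall>a\<in>tuples p I. \<forall>m\<in>carrier M.
      H (\<tau> n p u a m) = \<tau> (Suc n) p (h n p u) a m)" for n H
  define H where "H n = (SOME H. ok n H)" for n
  have "\<exists>H. ok n H" for n
    using univ[OF balanced_pull[OF h \<tau>]] unfolding ok_def by blast
  then have "ok n (H n)" for n unfolding H_def by (rule someI_ex)
  then have H: "\<And>n. H n \<in> module_hom k (T n) (T (Suc n))"
    "\<And>n p u a m. u \<in> carrier (ob (K n) p) \<Longrightarrow> a \<in> tuples p I \<Longrightarrow> m \<in> carrier M \<Longrightarrow> H n (\<tau> n p u a m) = \<tau> (Suc n) p (h n p u) a m"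
    unfolding ok_def by blast+
  show "z \<in> D 0 ` carrier (T (Suc 0))" if z: "z \<in> carrier (T 0)" for z
  proof -
    have "D 0 (H 0 z) = z"
    proof (rule mhom_eq_on_generators[OF gen T T mhom_comp[OF H(1) D] mhom_id _ z])
      fix g assume "g \<in> pairing_values (K 0) (\<tau> 0)"
      then obtain p u a m where g: "g = \<tau> 0 p u a m" and u: "u \<in> carrier (ob (K 0) p)" and a: "a \<in> tuples p I" and m: "m \<in> carrier M"
        by blast
      show "D 0 (H 0 g) = g"
        unfolding g H(2)[OF u a m] D\<tau>[OF mhom_closed[OF hh(1) u] a m] h0[OF u] ..
    qed
    then show ?thesis using mhom_closed[OF H(1) z] by (metis imageI)
  qed
  show "z \<in> D (Suc n) ` carrier (T (Suc (Suc n)))" if z: "z \<in> carrier (T (Suc n))" and Dz: "D n z = \<zero>\<^bsub>T n\<^esub>" for z n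
  proof -
    have hm: "(\<lambda>z. z \<ominus>\<^bsub>T (Suc n)\<^esub> H n (D n z)) \<in> module_hom k (T (Suc n)) (T (Suc n))"
      unfolding a_minus_def by (rule mhom_sum[OF T mhom_id mhom_neg[OF T mhom_comp[OF D H(1)]]])
    have "D (Suc n) (H (Suc n) z) = z \<ominus>\<^bsub>T (Suc n)\<^esub> H n (D n z)"
    proof (rule mhom_eq_on_generators[OF gen T T mhom_comp[OF H(1) D] hm _ z])
      fix g assume "g \<in> pairing_values (K (Suc n)) (\<tau> (Suc n))"
      then obtain p u a m where g: "g = \<tau> (Suc n) p u a m" and u: "u \<in> carrier (ob (K (Suc n)) p)"
        and a: "a \<in> tuples p I" and m: "m \<in> carrier M" by blast
      note du = mhom_closed[OF \<delta>h(1) u]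
      show "D (Suc n) (H (Suc n) g) = g \<ominus>\<^bsub>T (Suc n)\<^esub> H n (D n g)"
        unfolding g H(2)[OF u a m] D\<tau>[OF mhom_closed[OF hh(1) u] a m] D\<tau>[OF u a m] H(2)[OF du a m] hS[OF u]
        by (rule mhom_minus[OF Km(1) T balancedD(1)[OF \<tau> a m] u mhom_closed[OF hh(1) du]])
    qed
    also have "\<dots> = z" unfolding Dz mhom_zero[OF T T H(1)] by (rule module_minus_zero[OF T z])
    finally show ?thesis using mhom_closed[OF H(1) z] by (metis imageI)
  qed
qed

subsection \<open>Sums and shifts of pairings\<close>

text \<open>
  The terms of a mapping cone are direct sums, so pairings with \<open>U\<close>, their universal property and
  the lifting property have to be carried over to direct sums.
\<close>

definition prod_gm :: "('k, 'x) gamma_mod \<Rightarrow> ('k, 'y) gamma_mod \<Rightarrow> ('k, 'x \<times> 'y) gamma_mod" where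
  "prod_gm X Y = \<lparr>ob = (\<lambda>p. prod_module (ob X p) (ob Y p)), act = (\<lambda>p q f u. (act X p q f (fst u), act Y p q f (snd u)))\<rparr>"

lemma prod_gm_simps [simp]:
  "ob (prod_gm X Y) p = prod_module (ob X p) (ob Y p)"
  "act (prod_gm X Y) p q f u = (act X p q f (fst u), act Y p q f (snd u))"
  by (simp_all add: prod_gm_def)

lemma prod_gm_surj_module:
  assumes X: "surj_module k X" and Y: "surj_module k Y"
  shows "surj_module k (prod_gm X Y)"
  unfolding surj_module_def
proof (intro conjI allI ballI)
  note Xm = surj_moduleD[OF X] and Ym = surj_moduleD[OF Y]
  show "module k (ob (prod_gm X Y) p)" for p using prod_module_module[OF Xm(1) Ym(1)] by simp
  show "act (prod_gm X Y) p q f \<in> module_hom k (ob (prod_gm X Y) q) (ob (prod_gm X Y) p)" if f: "f \<in> based_surj p q" for p q f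
    unfolding prod_gm_simps(1) prod_gm_simps(2)[abs_def]
    by (rule pair_hom[OF mhom_comp[OF fst_hom[OF Xm(1) Ym(1)] Xm(2)[OF f]] mhom_comp[OF snd_hom[OF Xm(1) Ym(1)] Ym(2)[OF f]]])
  show "act (prod_gm X Y) p p (\<lambda>i\<in>{0..p}. i) u = u" if "u \<in> carrier (ob (prod_gm X Y) p)" for p u
    using that Xm(3) Ym(3) by (cases u) auto
  show "act (prod_gm X Y) p r (compose {0..p} g f) u = act (prod_gm X Y) p q f (act (prod_gm X Y) q r g u)"
    if "f \<in> based_surj p q" "g \<in> based_surj q r" "u \<in> carrier (ob (prod_gm X Y) r)" for p q r f g u
    using that(3) Xm(4)[OF that(1,2)] Ym(4)[OF that(1,2)] by (cases u) auto
qed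

text \<open>The zero module, as a submodule of \<open>V\<close> so that it keeps the element type.\<close>

definition zero_sub :: "('k, 'v) module \<Rightarrow> ('k, 'v) module" where
  "zero_sub V = V\<lparr>carrier := {\<zero>\<^bsub>V\<^esub>}\<rparr>"

lemma zero_sub_simps [simp]: "carrier (zero_sub V) = {\<zero>\<^bsub>V\<^esub>}" "\<zero>\<^bsub>zero_sub V\<^esub> = \<zero>\<^bsub>V\<^esub>"
  by (simp_all add: zero_sub_def)

lemma zero_sub_module: "module k V \<Longrightarrow> module k (zero_sub V)"
  unfolding zero_sub_def
proof (rule submodule.submodule_is_module)
  assume V: "module k V"
  interpret V: module k V by (rule V)
  show "submodule {\<zero>\<^bsub>V\<^esub>} k V" by (rule submoduleI'[OF V]) auto
qed

lemma zero_sub_hom_to: "module k V \<Longrightarrow> (\<lambda>x. \<zero>\<^bsub>V\<^esub>) \<in> module_hom k W (zero_sub V)"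
  using mhom_0[OF zero_sub_module, of V W] by simp

text \<open>
  The part of the mapping cone that comes from the source of the comparison map: in degree \<open>n + 1\<close>
  the resolution in degree \<open>n\<close>, and zero in degree \<open>0\<close>. The two definitions below do the same for
  \<open>C\<Gamma>(I, M)\<close> and the pairing.
\<close>

definition bar_shift :: "nat \<Rightarrow> ('k, strg \<times> (nat \<Rightarrow> nat) \<Rightarrow> 'k) gamma_mod" where
  "bar_shift n = (case n of 0 \<Rightarrow> \<lparr>ob = (\<lambda>p. zero_sub (ob (bar k 0) p)), act = (\<lambda>p q f u. \<zero>\<^bsub>ob (bar k 0) p\<^esub>)\<rparr> | Suc n \<Rightarrow> bar k n)"

definition C_shift where "C_shift n = (case n of 0 \<Rightarrow> zero_sub (C 0) | Suc n \<Rightarrow> C n)"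

definition pair_C_shift where
  "pair_C_shift n p r a m = (case n of 0 \<Rightarrow> \<zero>\<^bsub>C 0\<^esub> | Suc n \<Rightarrow> pair_C n p r a m)"

lemma shift_simps [simp]:
  "bar_shift (Suc n) = bar k n" "C_shift (Suc n) = C n" "pair_C_shift (Suc n) p r a m = pair_C n p r a m"
  "ob (bar_shift 0) p = zero_sub (ob (bar k 0) p)" "act (bar_shift 0) p q f u = \<zero>\<^bsub>ob (bar k 0) p\<^esub>"
  "C_shift 0 = zero_sub (C 0)" "pair_C_shift 0 p r a m = \<zero>\<^bsub>C 0\<^esub>"
  by (simp_all add: bar_shift_def C_shift_def pair_C_shift_def)

lemma bar_shift_surj_module: "surj_module k (bar_shift n)"
proof (cases n)
  case 0
  have e: "act (bar_shift 0) p q f = (\<lambda>u. \<zero>\<^bsub>ob (bar k 0) p\<^esub>)" for p q f by (intro ext) simp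
  have "surj_module k (bar_shift 0)"
    unfolding surj_module_def e
    by (auto simp: zero_sub_module[OF k.bar_module] zero_sub_hom_to[OF k.bar_module])
  then show ?thesis using 0 by simp
next
  case (Suc n)
  then show ?thesis using k.bar_surj_module by simp
qed

lemma C_shift_module: "module k (C_shift n)"
  by (cases n) (auto simp: zero_sub_module[OF C_module] C_module)

lemma pair_C_shift_balanced: "balanced (bar_shift n) (C_shift n) (pair_C_shift n)"
proof (cases n)
  case 0
  have "balanced (bar_shift 0) (C_shift 0) (pair_C_shift 0)"
  proof (rule balancedI)
    show "(\<lambda>u. pair_C_shift 0 p u a m) \<in> module_hom k (ob (bar_shift 0) p) (C_shift 0)" for p a m
      by (simp add: zero_sub_hom_to[OF C_module])
    have "mlin I p (C_shift 0) (\<lambda>a m. \<zero>\<^bsub>C_shift 0\<^esub>)" for p by (rule mlin_zero[OF C_shift_module])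
    then show "mlin I p (C_shift 0) (pair_C_shift 0 p u)" for p u by (simp add: pair_C_shift_def[abs_def])
  qed (simp add: act_tuple_def)
  then show ?thesis using 0 by simp
next
  case (Suc n)
  moreover have "pair_C_shift (Suc n) = pair_C n" by (intro ext) simp
  ultimately show ?thesis using pair_C_balanced by simp
qed

lemma pair_C_shift_generates:
  "generates k (C_shift n) (pairing_values (bar_shift n) (pair_C_shift n))"
proof (cases n)
  case 0
  show ?thesis
    unfolding 0 generates_def
    using submoduleD(2)[OF C_shift_module, of _ 0] by auto
next
  case (Suc n)
  then show ?thesis using pair_C_generates by simp
qed

lemma pair_C_shift_universal:
  assumes Z: "module k Z" and \<beta>: "balanced (bar_shift n) Z \<beta>"
  shows "factors_through (bar_shift n) (pair_C_shift n) (C_shift n) Z \<beta>"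
proof (cases n)
  case 0
  have "\<beta> p r a m = \<zero>\<^bsub>Z\<^esub>" if "r \<in> carrier (ob (bar_shift n) p)" "a \<in> tuples p I" "m \<in> carrier M" for p r a m
    using mhom_zero[OF surj_moduleD(1)[OF bar_shift_surj_module] Z balancedD(1)[OF \<beta> that(2,3)]] that(1) 0 by simp
  then show ?thesis by (intro bexI[OF _ mhom_0[OF Z]]) auto
next
  case (Suc n)
  then show ?thesis using pair_C_universal[OF Z] \<beta> by simp
qed

lemma bar_shift_lift:
  assumes Y: "surj_module k Y" and Z: "surj_module k Z"
    and \<pi>: "\<pi> \<in> surj_hom k Y Z" and \<zeta>: "\<zeta> \<in> surj_hom k (bar_shift n) Z"
    and im: "\<And>p u. u \<in> carrier (ob (bar_shift n) p) \<Longrightarrow> \<zeta> p u \<in> \<pi> p ` carrier (ob Y p)"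
  shows "lifts_along k (bar_shift n) Y \<pi> \<zeta>"
proof (cases n)
  case 0
  note Ym = surj_moduleD[OF Y]
  have "(\<lambda>p u. \<zero>\<^bsub>ob Y p\<^esub>) \<in> surj_hom k (bar_shift n) Y"
    by (rule surj_homI[OF mhom_0[OF Ym(1)]]) (simp add: mhom_zero[OF Ym(1) Ym(1) Ym(2)])
  moreover have "\<zeta> p u = \<zero>\<^bsub>ob Z p\<^esub>" if "u \<in> carrier (ob (bar_shift n) p)" for p u
    using surj_hom_zero[OF bar_shift_surj_module Z \<zeta>, of p] that 0 by simp
  ultimately show ?thesis using surj_hom_zero[OF Y Z \<pi>] by (intro bexI) auto
next
  case (Suc n)
  then show ?thesis using k.bar_lift[OF Y Z \<pi>] \<zeta> im by simp
qed

definition prod_pair where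
  "prod_pair \<sigma> \<tau> p u a m = (\<sigma> p (fst u) a m, \<tau> p (snd u) a m)"

lemma prod_pair_balanced:
  assumes X: "surj_module k X" and Y: "surj_module k Y" and S: "module k S" and T: "module k T"
    and \<sigma>: "balanced X S \<sigma>" and \<tau>: "balanced Y T \<tau>"
  shows "balanced (prod_gm X Y) (prod_module S T) (prod_pair \<sigma> \<tau>)"
proof (rule balancedI)
  note Xm = surj_moduleD[OF X] and Ym = surj_moduleD[OF Y]
  show "(\<lambda>u. prod_pair \<sigma> \<tau> p u a m) \<in> module_hom k (ob (prod_gm X Y) p) (prod_module S T)"
    if a: "a \<in> tuples p I" "m \<in> carrier M" for p a m
    unfolding prod_pair_def prod_gm_simps
    by (rule pair_hom[OF mhom_comp[OF fst_hom[OF Xm(1) Ym(1)] balancedD(1)[OF \<sigma> a]]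
          mhom_comp[OF snd_hom[OF Xm(1) Ym(1)] balancedD(1)[OF \<tau> a]]])
  show "mlin I p (prod_module S T) (prod_pair \<sigma> \<tau> p u)" if "u \<in> carrier (ob (prod_gm X Y) p)" for p u
  proof -
    have u: "fst u \<in> carrier (ob X p)" "snd u \<in> carrier (ob Y p)" using that by auto
    note s = mlinD[OF balancedD(2)[OF \<sigma> u(1)]] and t = mlinD[OF balancedD(2)[OF \<tau> u(2)]]
    show ?thesis unfolding prod_pair_def[abs_def]
      by (rule mlinI) (auto intro: pair_hom[OF s(1) t(1)] pair_hom[OF s(3) t(3)])
  qed
  show "prod_pair \<sigma> \<tau> p (act (prod_gm X Y) p q f u) a m = act_tuple p q f (prod_pair \<sigma> \<tau> q u) a m"
    if "f \<in> based_surj p q" "u \<in> carrier (ob (prod_gm X Y) q)" "a \<in> tuples p I" "m \<in> carrier M" for p q f u a m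
    using that(2) balancedD(3)[OF \<sigma> that(1) _ that(3,4)] balancedD(3)[OF \<tau> that(1) _ that(3,4)]
    by (cases u) (auto simp: prod_pair_def act_tuple_def)
qed

lemma prod_pair_inl:
  assumes Y: "surj_module k Y" and T: "module k T" and \<tau>: "balanced Y T \<tau>" and a: "a \<in> tuples p I" "m \<in> carrier M"
  shows "prod_pair \<sigma> \<tau> p (r, \<zero>\<^bsub>ob Y p\<^esub>) a m = (\<sigma> p r a m, \<zero>\<^bsub>T\<^esub>)"
  using mhom_zero[OF surj_moduleD(1)[OF Y] T balancedD(1)[OF \<tau> a]] by (simp add: prod_pair_def)

lemma prod_pair_inr:
  assumes X: "surj_module k X" and S: "module k S" and \<sigma>: "balanced X S \<sigma>" and a: "a \<in> tuples p I" "m \<in> carrier M"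
  shows "prod_pair \<sigma> \<tau> p (\<zero>\<^bsub>ob X p\<^esub>, u) a m = (\<zero>\<^bsub>S\<^esub>, \<tau> p u a m)"
  using mhom_zero[OF surj_moduleD(1)[OF X] S balancedD(1)[OF \<sigma> a]] by (simp add: prod_pair_def)

lemma prod_pair_generates:
  assumes X: "surj_module k X" and Y: "surj_module k Y" and S: "module k S" and T: "module k T"
    and \<sigma>: "balanced X S \<sigma>" and \<tau>: "balanced Y T \<tau>"
    and gS: "generates k S (pairing_values X \<sigma>)"
    and gT: "generates k T (pairing_values Y \<tau>)"
  shows "generates k (prod_module S T)
    (pairing_values (prod_gm X Y) (prod_pair \<sigma> \<tau>))" (is "generates k _ ?G")
  unfolding generates_def
proof (intro conjI allI impI subsetI)
  note Xm = surj_moduleD[OF X] and Ym = surj_moduleD[OF Y] and P = prod_module_module[OF S T]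
  interpret S: module k S by (rule S)
  interpret T: module k T by (rule T)
  show "g \<in> carrier (prod_module S T)" if "g \<in> ?G" for g
    using that balancedD(4)[OF prod_pair_balanced[OF X Y S T \<sigma> \<tau>]] by blast
  fix N z assume N: "submodule N k (prod_module S T)" "?G \<subseteq> N" and z: "z \<in> carrier (prod_module S T)"
  note D = submoduleD[OF P N(1)]
  have zX: "\<zero>\<^bsub>ob X p\<^esub> \<in> carrier (ob X p)" and zY: "\<zero>\<^bsub>ob Y p\<^esub> \<in> carrier (ob Y p)" for p
    using abelian_monoid.zero_closed[OF abelian_group.axioms(1)[OF module_abelian]] Xm(1) Ym(1) by blast+
  have "fst z \<in> {s \<in> carrier S. (s, \<zero>\<^bsub>T\<^esub>) \<in> N}"
  proof (rule generatesD[OF gS submodule_vimage[OF S P inl_hom[OF S T] N(1)]], safe)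
    fix p r a m assume r: "r \<in> carrier (ob X p)" "a \<in> tuples p I" "m \<in> carrier M"
    show "\<sigma> p r a m \<in> carrier S" by (rule balancedD(4)[OF \<sigma> r])
    have "prod_pair \<sigma> \<tau> p (r, \<zero>\<^bsub>ob Y p\<^esub>) a m \<in> ?G" using r zY by fastforce
    then show "(\<sigma> p r a m, \<zero>\<^bsub>T\<^esub>) \<in> N" using N(2) unfolding prod_pair_inl[OF Y T \<tau> r(2,3)] by blast
  qed (use z in auto)
  moreover have "snd z \<in> {t \<in> carrier T. (\<zero>\<^bsub>S\<^esub>, t) \<in> N}"
  proof (rule generatesD[OF gT submodule_vimage[OF T P inr_hom[OF S T] N(1)]], safe)
    fix p r a m assume r: "r \<in> carrier (ob Y p)" "a \<in> tuples p I" "m \<in> carrier M"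
    show "\<tau> p r a m \<in> carrier T" by (rule balancedD(4)[OF \<tau> r])
    have "prod_pair \<sigma> \<tau> p (\<zero>\<^bsub>ob X p\<^esub>, r) a m \<in> ?G" using r zX by fastforce
    then show "(\<zero>\<^bsub>S\<^esub>, \<tau> p r a m) \<in> N" using N(2) unfolding prod_pair_inr[OF X S \<sigma> r(2,3)] by blast
  qed (use z in auto)
  ultimately have "(fst z, \<zero>\<^bsub>T\<^esub>) \<oplus>\<^bsub>prod_module S T\<^esub> (\<zero>\<^bsub>S\<^esub>, snd z) \<in> N" by (intro D(3)) auto
  then show "z \<in> N" using z by (cases z) auto
qed

lemma inl_surj_hom: "surj_module k X \<Longrightarrow> surj_module k Y \<Longrightarrow> (\<lambda>p r. (r, \<zero>\<^bsub>ob Y p\<^esub>)) \<in> surj_hom k X (prod_gm X Y)"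
  by (rule surj_homI)
     (simp_all add: inl_hom[OF surj_moduleD(1) surj_moduleD(1)] mhom_zero[OF surj_moduleD(1) surj_moduleD(1) surj_moduleD(2)])

lemma inr_surj_hom: "surj_module k X \<Longrightarrow> surj_module k Y \<Longrightarrow> (\<lambda>p r. (\<zero>\<^bsub>ob X p\<^esub>, r)) \<in> surj_hom k Y (prod_gm X Y)"
  by (rule surj_homI)
     (simp_all add: inr_hom[OF surj_moduleD(1) surj_moduleD(1)] mhom_zero[OF surj_moduleD(1) surj_moduleD(1) surj_moduleD(2)])

lemma prod_split:
  assumes "module k V" "module k W" "u \<in> carrier (prod_module V W)"
  shows "u = (fst u, \<zero>\<^bsub>W\<^esub>) \<oplus>\<^bsub>prod_module V W\<^esub> (\<zero>\<^bsub>V\<^esub>, snd u)"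
    and "(fst u, \<zero>\<^bsub>W\<^esub>) \<in> carrier (prod_module V W)" and "(\<zero>\<^bsub>V\<^esub>, snd u) \<in> carrier (prod_module V W)"
proof -
  interpret V: module k V by fact
  interpret W: module k W by fact
  show "u = (fst u, \<zero>\<^bsub>W\<^esub>) \<oplus>\<^bsub>prod_module V W\<^esub> (\<zero>\<^bsub>V\<^esub>, snd u)"
    "(fst u, \<zero>\<^bsub>W\<^esub>) \<in> carrier (prod_module V W)" "(\<zero>\<^bsub>V\<^esub>, snd u) \<in> carrier (prod_module V W)"
    using assms(3) by (cases u; simp)+
qed

lemma prod_pair_universal:
  assumes X: "surj_module k X" and Y: "surj_module k Y" and S: "module k S" and T: "module k T"
    and \<sigma>: "balanced X S \<sigma>" and \<tau>: "balanced Y T \<tau>" and Z: "module k Z" and \<beta>: "balanced (prod_gm X Y) Z \<beta>"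
    and uS: "\<And>\<beta>. balanced X Z \<beta> \<Longrightarrow> factors_through X \<sigma> S Z \<beta>"
    and uT: "\<And>\<beta>. balanced Y Z \<beta> \<Longrightarrow> factors_through Y \<tau> T Z \<beta>"
  shows "factors_through (prod_gm X Y) (prod_pair \<sigma> \<tau>) (prod_module S T) Z \<beta>"
proof -
  note Xm = surj_moduleD[OF X] and Ym = surj_moduleD[OF Y]
  obtain h1 where h1: "h1 \<in> module_hom k S Z" "\<And>p u a m. u \<in> carrier (ob X p) \<Longrightarrow> a \<in> tuples p I \<Longrightarrow> m \<in> carrier M \<Longrightarrow>
      h1 (\<sigma> p u a m) = \<beta> p (u, \<zero>\<^bsub>ob Y p\<^esub>) a m"
    using uS[OF balanced_pull[OF inl_surj_hom[OF X Y] \<beta>]] by blast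
  obtain h2 where h2: "h2 \<in> module_hom k T Z" "\<And>p u a m. u \<in> carrier (ob Y p) \<Longrightarrow> a \<in> tuples p I \<Longrightarrow> m \<in> carrier M \<Longrightarrow>
      h2 (\<tau> p u a m) = \<beta> p (\<zero>\<^bsub>ob X p\<^esub>, u) a m"
    using uT[OF balanced_pull[OF inr_surj_hom[OF X Y] \<beta>]] by blast
  have "h1 (fst (prod_pair \<sigma> \<tau> p u a m)) \<oplus>\<^bsub>Z\<^esub> h2 (snd (prod_pair \<sigma> \<tau> p u a m)) = \<beta> p u a m"
    if u: "u \<in> carrier (ob (prod_gm X Y) p)" and a: "a \<in> tuples p I" and m: "m \<in> carrier M" for p u a m
  proof -
    have u': "u \<in> carrier (prod_module (ob X p) (ob Y p))" using u by simp
    note s = prod_split[OF Xm(1) Ym(1) u']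
    have "\<beta> p u a m = \<beta> p (fst u, \<zero>\<^bsub>ob Y p\<^esub>) a m \<oplus>\<^bsub>Z\<^esub> \<beta> p (\<zero>\<^bsub>ob X p\<^esub>, snd u) a m"
      using mhom_add[OF balancedD(1)[OF \<beta> a m], unfolded prod_gm_simps, OF s(2,3)] s(1) by simp
    then show ?thesis using h1(2)[OF _ a m] h2(2)[OF _ a m] u by (simp add: prod_pair_def mem_Times_iff)
  qed
  then show ?thesis by (intro bexI[OF _ copair_hom[OF S T Z h1(1) h2(1)]]) auto
qed

lemma prod_lift:
  assumes X: "surj_module k X" and Y: "surj_module k Y" and U: "surj_module k U" and Z: "surj_module k Z"
    and \<pi>: "\<pi> \<in> surj_hom k U Z" and \<zeta>: "\<zeta> \<in> surj_hom k (prod_gm X Y) Z"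
    and im: "\<And>p u. u \<in> carrier (ob (prod_gm X Y) p) \<Longrightarrow> \<zeta> p u \<in> \<pi> p ` carrier (ob U p)"
    and lX: "\<And>\<zeta>. \<zeta> \<in> surj_hom k X Z \<Longrightarrow> (\<And>p u. u \<in> carrier (ob X p) \<Longrightarrow> \<zeta> p u \<in> \<pi> p ` carrier (ob U p)) \<Longrightarrow>
        lifts_along k X U \<pi> \<zeta>"
    and lY: "\<And>\<zeta>. \<zeta> \<in> surj_hom k Y Z \<Longrightarrow> (\<And>p u. u \<in> carrier (ob Y p) \<Longrightarrow> \<zeta> p u \<in> \<pi> p ` carrier (ob U p)) \<Longrightarrow>
        lifts_along k Y U \<pi> \<zeta>"
  shows "lifts_along k (prod_gm X Y) U \<pi> \<zeta>"
proof -
  note Xm = surj_moduleD[OF X] and Ym = surj_moduleD[OF Y] and Um = surj_moduleD[OF U] and Zm = surj_moduleD[OF Z]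
  note inl = inl_surj_hom[OF X Y] and inr = inr_surj_hom[OF X Y]
  have "(\<lambda>p u. \<zeta> p (u, \<zero>\<^bsub>ob Y p\<^esub>)) \<in> surj_hom k X Z" by (rule surj_hom_comp[OF inl \<zeta>])
  from lX[OF this im] obtain \<xi>1 where \<xi>1: "\<xi>1 \<in> surj_hom k X U"
    "\<And>p u. u \<in> carrier (ob X p) \<Longrightarrow> \<pi> p (\<xi>1 p u) = \<zeta> p (u, \<zero>\<^bsub>ob Y p\<^esub>)"
    using mhom_closed[OF surj_homD(1)[OF inl]] by blast
  have "(\<lambda>p u. \<zeta> p (\<zero>\<^bsub>ob X p\<^esub>, u)) \<in> surj_hom k Y Z" by (rule surj_hom_comp[OF inr \<zeta>])
  from lY[OF this im] obtain \<xi>2 where \<xi>2: "\<xi>2 \<in> surj_hom k Y U"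
    "\<And>p u. u \<in> carrier (ob Y p) \<Longrightarrow> \<pi> p (\<xi>2 p u) = \<zeta> p (\<zero>\<^bsub>ob X p\<^esub>, u)"
    using mhom_closed[OF surj_homD(1)[OF inr]] by blast
  let ?\<xi> = "\<lambda>p u. \<xi>1 p (fst u) \<oplus>\<^bsub>ob U p\<^esub> \<xi>2 p (snd u)"
  note c1 = mhom_closed[OF surj_homD(1)[OF \<xi>1(1)]] and c2 = mhom_closed[OF surj_homD(1)[OF \<xi>2(1)]]
  have "?\<xi> \<in> surj_hom k (prod_gm X Y) U"
  proof (rule surj_homI)
    show "?\<xi> p \<in> module_hom k (ob (prod_gm X Y) p) (ob U p)" for p
      unfolding prod_gm_simps by (rule copair_hom[OF Xm(1) Ym(1) Um(1) surj_homD(1)[OF \<xi>1(1)] surj_homD(1)[OF \<xi>2(1)]])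
    show "?\<xi> p (act (prod_gm X Y) p q f u) = act U p q f (?\<xi> q u)"
      if f: "f \<in> based_surj p q" and u: "u \<in> carrier (ob (prod_gm X Y) q)" for p q f u
    proof -
      have u': "fst u \<in> carrier (ob X q)" "snd u \<in> carrier (ob Y q)" using u by auto
      show ?thesis
        using surj_homD(2)[OF \<xi>1(1) f u'(1)] surj_homD(2)[OF \<xi>2(1) f u'(2)] mhom_add[OF Um(2)[OF f] c1[OF u'(1)] c2[OF u'(2)]]
        by simp
    qed
  qed
  moreover have "\<pi> p (?\<xi> p u) = \<zeta> p u" if u: "u \<in> carrier (ob (prod_gm X Y) p)" for p u
  proof -
    have u': "u \<in> carrier (prod_module (ob X p) (ob Y p))" "fst u \<in> carrier (ob X p)" "snd u \<in> carrier (ob Y p)" using u by auto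
    note s = prod_split[OF Xm(1) Ym(1) u'(1)]
    have "\<zeta> p u = \<zeta> p (fst u, \<zero>\<^bsub>ob Y p\<^esub>) \<oplus>\<^bsub>ob Z p\<^esub> \<zeta> p (\<zero>\<^bsub>ob X p\<^esub>, snd u)"
      using mhom_add[OF surj_homD(1)[OF \<zeta>], unfolded prod_gm_simps, OF s(2,3)] s(1) by simp
    then show ?thesis
      using mhom_add[OF surj_homD(1)[OF \<pi>] c1[OF u'(2)] c2[OF u'(3)]] \<xi>1(2)[OF u'(2)] \<xi>2(2)[OF u'(3)] by simp
  qed
  ultimately show ?thesis by (intro bexI[of _ ?\<xi>]) auto
qed

end

section \<open>The comparison map and its cone\<close>

lemma projective_resolutionD:
  assumes "projective_resolution k G P d \<eta>"
  shows "projective_gamma k (P s)" "right_gamma_module k (P s)"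
    and "d (Suc s) \<in> right_gamma_hom k (P (Suc s)) (P s)"
    and "\<eta> \<in> right_gamma_hom k (P 0) G"
    and "\<eta> n ` carrier (ob (P 0) n) = carrier (ob G n)"
    and "{u \<in> carrier (ob (P 0) n). \<eta> n u = \<zero>\<^bsub>ob G n\<^esub>} = d 1 n ` carrier (ob (P 1) n)"
    and "{u \<in> carrier (ob (P (Suc s)) n). d (Suc s) n u = \<zero>\<^bsub>ob (P s) n\<^esub>} = d (Suc (Suc s)) n ` carrier (ob (P (Suc (Suc s))) n)"
proof -
  note D = assms[unfolded projective_resolution_def]
  note D2 = D[THEN conjunct2] note D3 = D2[THEN conjunct2] note D4 = D3[THEN conjunct2]
  note D5 = D4[THEN conjunct2] note D6 = D5[THEN conjunct2]
  show "projective_gamma k (P s)" by (rule D[THEN conjunct1, THEN spec])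
  then show "right_gamma_module k (P s)" unfolding projective_gamma_def by (rule conjunct1)
  show "d (Suc s) \<in> right_gamma_hom k (P (Suc s)) (P s)" by (rule D2[THEN conjunct1, THEN spec])
  show "\<eta> \<in> right_gamma_hom k (P 0) G" by (rule D3[THEN conjunct1])
  show "\<eta> n ` carrier (ob (P 0) n) = carrier (ob G n)" by (rule D4[THEN conjunct1, THEN spec])
  show "{u \<in> carrier (ob (P 0) n). \<eta> n u = \<zero>\<^bsub>ob G n\<^esub>} = d 1 n ` carrier (ob (P 1) n)"
    by (rule D5[THEN conjunct1, THEN spec])
  show "{u \<in> carrier (ob (P (Suc s)) n). d (Suc s) n u = \<zero>\<^bsub>ob (P s) n\<^esub>} = d (Suc (Suc s)) n ` carrier (ob (P (Suc (Suc s))) n)"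
    by (rule D6[THEN spec, THEN spec])
qed

lemma module_add_minus:
  assumes "module k V" "x \<in> carrier V" "y \<in> carrier V"
  shows "(x \<oplus>\<^bsub>V\<^esub> y) \<ominus>\<^bsub>V\<^esub> x = y"
proof -
  interpret V: module k V by fact
  show ?thesis using assms(2,3) by (simp add: V.M.a_comm[of x y] a_minus_def V.M.a_assoc V.M.r_neg)
qed

lemma module_neg_eq_zero:
  assumes "module k V" "u \<in> carrier V" "\<ominus>\<^bsub>V\<^esub> u = \<zero>\<^bsub>V\<^esub>"
  shows "u = \<zero>\<^bsub>V\<^esub>"
proof -
  interpret module k V by (rule assms(1))
  have "u = \<ominus>\<^bsub>V\<^esub> (\<ominus>\<^bsub>V\<^esub> u)" using assms(2) by simp
  then show ?thesis unfolding assms(3) by simp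
qed

text \<open>
  The hypotheses \<open>inj\<close> and \<open>surj\<close> spell out that the mapping cone of \<open>\<phi>\<close> is exact: a cycle whose
  image is a boundary is a boundary, and every cycle of \<open>W\<close> is the image of a cycle up to a
  boundary.
\<close>

lemma homology_module_iso:
  fixes V :: "nat \<Rightarrow> ('k, 'v) module" and W :: "nat \<Rightarrow> ('k, 'w) module"
  assumes V: "\<And>n. module k (V n)" and W: "\<And>n. module k (W n)"
    and dV: "\<And>n. dV (Suc n) \<in> module_hom k (V (Suc n)) (V n)" and dW: "\<And>n. dW (Suc n) \<in> module_hom k (W (Suc n)) (W n)"
    and ddV: "\<And>n x. x \<in> carrier (V (Suc (Suc n))) \<Longrightarrow> dV (Suc n) (dV (Suc (Suc n)) x) = \<zero>\<^bsub>V n\<^esub>"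
    and ddW: "\<And>n x. x \<in> carrier (W (Suc (Suc n))) \<Longrightarrow> dW (Suc n) (dW (Suc (Suc n)) x) = \<zero>\<^bsub>W n\<^esub>"
    and \<phi>: "\<And>n. \<phi> n \<in> module_hom k (V n) (W n)"
    and ch: "\<And>n x. x \<in> carrier (V (Suc n)) \<Longrightarrow> \<phi> n (dV (Suc n) x) = dW (Suc n) (\<phi> (Suc n) x)"
    and inj: "\<And>n z w. z \<in> carrier (V n) \<Longrightarrow> n = 0 \<or> dV n z = \<zero>\<^bsub>V (n - 1)\<^esub> \<Longrightarrow> w \<in> carrier (W (Suc n)) \<Longrightarrow> \<phi> n z = dW (Suc n) w \<Longrightarrow>
        z \<in> dV (Suc n) ` carrier (V (Suc n))"
    and surj: "\<And>n y. y \<in> carrier (W n) \<Longrightarrow> n = 0 \<or> dW n y = \<zero>\<^bsub>W (n - 1)\<^esub> \<Longrightarrow>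
        \<exists>x\<in>carrier (V n). (n = 0 \<or> dV n x = \<zero>\<^bsub>V (n - 1)\<^esub>) \<and> (\<exists>w\<in>carrier (W (Suc n)). y = \<phi> n x \<oplus>\<^bsub>W n\<^esub> dW (Suc n) w)"
  shows "graded_isomorphic k (homology V dV) (homology W dW)"
proof -
  have sub: "submodule {z \<in> carrier (X n). n = 0 \<or> d n z = \<zero>\<^bsub>X (n - 1)\<^esub>} k (X n)"
    if "\<And>n. module k (X n)" "\<And>n. d (Suc n) \<in> module_hom k (X (Suc n)) (X n)" for X :: "nat \<Rightarrow> ('k, 'u) module" and d n
  proof (cases n)
    case 0
    have "{z \<in> carrier (X 0). 0 = (0::nat) \<or> d 0 z = \<zero>\<^bsub>X (0 - 1)\<^esub>} = carrier (X 0)" by simp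
    then show ?thesis unfolding 0 using module.carrier_is_submodule[OF that(1)] by simp
  next
    case (Suc m)
    have "{z \<in> carrier (X (Suc m)). Suc m = 0 \<or> d (Suc m) z = \<zero>\<^bsub>X (Suc m - 1)\<^esub>} =
        {z \<in> carrier (X (Suc m)). d (Suc m) z = \<zero>\<^bsub>X m\<^esub>}" by simp
    then show ?thesis unfolding Suc using mhom_kernel[OF that(1,1,2)] by simp
  qed
  have subI: "submodule N k (X\<lparr>carrier := Z\<rparr>)" if "module k X" "submodule Z k X" "submodule N k X" "N \<subseteq> Z"
    for X :: "('k, 'u) module" and Z N
    using submoduleD[OF that(1,3)] that(4)
    by (intro submoduleI'[OF submodule.submodule_is_module[OF that(2,1)]]) auto
  have "\<exists>\<psi>. \<psi> \<in> module_iso k (homology V dV n) (homology W dW n)" for n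
  proof -
    let ?ZV = "{z \<in> carrier (V n). n = 0 \<or> dV n z = \<zero>\<^bsub>V (n - 1)\<^esub>}" and ?ZW = "{z \<in> carrier (W n). n = 0 \<or> dW n z = \<zero>\<^bsub>W (n - 1)\<^esub>}"
    let ?BV = "dV (Suc n) ` carrier (V (Suc n))" and ?BW = "dW (Suc n) ` carrier (W (Suc n))"
    note zV = sub[of V dV n, OF V dV] and zW = sub[of W dW n, OF W dW]
    have BV: "?BV \<subseteq> ?ZV"
    proof (rule image_subsetI)
      fix x assume x: "x \<in> carrier (V (Suc n))"
      have "n = 0 \<or> dV n (dV (Suc n) x) = \<zero>\<^bsub>V (n - 1)\<^esub>" by (cases n) (use ddV x in simp_all)
      then show "dV (Suc n) x \<in> ?ZV" using mhom_closed[OF dV x] by simp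
    qed
    have BW: "?BW \<subseteq> ?ZW"
    proof (rule image_subsetI)
      fix x assume x: "x \<in> carrier (W (Suc n))"
      have "n = 0 \<or> dW n (dW (Suc n) x) = \<zero>\<^bsub>W (n - 1)\<^esub>" by (cases n) (use ddW x in simp_all)
      then show "dW (Suc n) x \<in> ?ZW" using mhom_closed[OF dW x] by simp
    qed
    note mV = submodule.submodule_is_module[OF zV V] and mW = submodule.submodule_is_module[OF zW W]
    note bV = subI[OF V zV mhom_image[OF V V dV] BV] and bW = subI[OF W zW mhom_image[OF W W dW] BW]
    have cyc: "\<phi> n z \<in> ?ZW" if "z \<in> ?ZV" for z
    proof (cases n)
      case 0
      then show ?thesis using that mhom_closed[OF \<phi>] by auto
    next
      case (Suc m)
      then have "dW (Suc m) (\<phi> (Suc m) z) = \<zero>\<^bsub>W m\<^esub>"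
        using ch[of z m] that mhom_zero[OF V W \<phi>] by simp
      then show ?thesis using that mhom_closed[OF \<phi>] Suc by auto
    qed
    have \<phi>': "\<phi> n \<in> module_hom k ((V n)\<lparr>carrier := ?ZV\<rparr>) ((W n)\<lparr>carrier := ?ZW\<rparr>)"
    proof (rule mhomI)
      fix x assume x: "x \<in> carrier ((V n)\<lparr>carrier := ?ZV\<rparr>)"
      show "\<phi> n x \<in> carrier ((W n)\<lparr>carrier := ?ZW\<rparr>)" using cyc x by simp
      show "\<phi> n (c \<odot>\<^bsub>(V n)\<lparr>carrier := ?ZV\<rparr>\<^esub> x) = c \<odot>\<^bsub>(W n)\<lparr>carrier := ?ZW\<rparr>\<^esub> \<phi> n x" if "c \<in> carrier k" for c
        using mhom_smult[OF \<phi> that] x by simp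
      show "\<phi> n (x \<oplus>\<^bsub>(V n)\<lparr>carrier := ?ZV\<rparr>\<^esub> y) = \<phi> n x \<oplus>\<^bsub>(W n)\<lparr>carrier := ?ZW\<rparr>\<^esub> \<phi> n y"
        if "y \<in> carrier ((V n)\<lparr>carrier := ?ZV\<rparr>)" for y
        using mhom_add[OF \<phi>] x that by simp
    qed
    show ?thesis
      unfolding homology_def
    proof (rule quotient_iso[OF mV bV mW bW \<phi>'])
      fix x assume "x \<in> carrier ((V n)\<lparr>carrier := ?ZV\<rparr>)"
      then have x: "x \<in> carrier (V n)" "n = 0 \<or> dV n x = \<zero>\<^bsub>V (n - 1)\<^esub>" by auto
      show "\<phi> n x \<in> ?BW \<longleftrightarrow> x \<in> ?BV"
      proof
        assume "\<phi> n x \<in> ?BW"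
        then show "x \<in> ?BV" using inj[OF x] by blast
      next
        assume "x \<in> ?BV"
        then obtain y where y: "y \<in> carrier (V (Suc n))" "x = dV (Suc n) y" by blast
        show "\<phi> n x \<in> ?BW" unfolding y(2) ch[OF y(1)] using mhom_closed[OF \<phi> y(1)] by blast
      qed
    next
      let ?W' = "(W n)\<lparr>carrier := ?ZW\<rparr>"
      interpret W': module k ?W' by (rule mW)
      fix y assume y: "y \<in> carrier ?W'"
      then have y': "y \<in> carrier (W n)" "n = 0 \<or> dW n y = \<zero>\<^bsub>W (n - 1)\<^esub>" by auto
      obtain x w where x: "x \<in> carrier (V n)" "n = 0 \<or> dV n x = \<zero>\<^bsub>V (n - 1)\<^esub>" and w: "w \<in> carrier (W (Suc n))"
        and e: "y = \<phi> n x \<oplus>\<^bsub>W n\<^esub> dW (Suc n) w" using surj[OF y'] by blast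
      have px: "\<phi> n x \<in> carrier ?W'" using cyc[of x] x by simp
      have bw: "dW (Suc n) w \<in> carrier ?W'" using BW w by auto
      have "y \<ominus>\<^bsub>?W'\<^esub> \<phi> n x = (\<phi> n x \<oplus>\<^bsub>?W'\<^esub> dW (Suc n) w) \<ominus>\<^bsub>?W'\<^esub> \<phi> n x" unfolding e by simp
      also have "\<dots> = dW (Suc n) w"
        by (rule module_add_minus[OF mW px bw])
      finally show "\<exists>x\<in>carrier ((V n)\<lparr>carrier := ?ZV\<rparr>). y \<ominus>\<^bsub>?W'\<^esub> \<phi> n x \<in> ?BW"
        using x w by (intro bexI[of _ x]) auto
    qed
  qed
  then show ?thesis unfolding graded_isomorphic_def by (intro choice allI)
qed

context augmented_algebra
begin

context
  fixes P :: "nat \<Rightarrow> ('k, 'p) gamma_mod" and d :: "nat \<Rightarrow> nat \<Rightarrow> 'p \<Rightarrow> 'p" and \<eta> :: "nat \<Rightarrow> 'p \<Rightarrow> nat \<Rightarrow> 'k"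
  assumes res: "projective_resolution k (t_mod k) P d \<eta>" and nz: "\<one>\<^bsub>k\<^esub> \<noteq> \<zero>\<^bsub>k\<^esub>"
begin

lemmas proj = projective_resolutionD(1)[OF res] and PG = projective_resolutionD(2)[OF res]
  and dG = projective_resolutionD(3)[OF res] and \<eta>G = projective_resolutionD(4)[OF res]
  and \<eta>_onto = projective_resolutionD(5)[OF res] and \<eta>_ker = projective_resolutionD(6)[OF res]
  and d_ker = projective_resolutionD(7)[OF res]

lemma PS: "surj_module k (P n)"
  by (rule gamma_surj_module[OF PG])

lemma t_surj_module: "surj_module k (t_mod k)"
  by (rule gamma_surj_module[OF k.t_right_gamma_module])

lemma Pm: "module k (ob (P n) p)"
  by (rule right_gamma_moduleD(1)[OF PG])

lemmas dS = right_gamma_surj_hom[OF dG] and \<eta>S = right_gamma_surj_hom[OF \<eta>G]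
lemmas dh = right_gamma_homD(1)[OF dG] and \<eta>h = right_gamma_homD(1)[OF \<eta>G]

lemma d_d: "u \<in> carrier (ob (P (Suc (Suc n))) p) \<Longrightarrow> d (Suc n) p (d (Suc (Suc n)) p u) = \<zero>\<^bsub>ob (P n) p\<^esub>"
  using d_ker[of n p] by blast

lemma \<eta>_d: "u \<in> carrier (ob (P 1) p) \<Longrightarrow> \<eta> p (d 1 p u) = \<zero>\<^bsub>ob (t_mod k) p\<^esub>"
  using \<eta>_ker[of p] by blast

lemma bar_d_surj_hom: "(\<lambda>p. bar_d k (Suc n) p) \<in> surj_hom k (bar k (Suc n)) (bar k n)"
  using k.bar_d_hom[of "Suc n"] k.bar_d_natural[of "Suc n"] by (intro surj_homI) auto

lemma bar_aug_surj_hom: "(\<lambda>p. bar_aug k p) \<in> surj_hom k (bar k 0) (t_mod k)"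
  by (rule surj_homI) (rule k.bar_aug_hom, rule k.bar_aug_natural)

lemma bar_d_hom_Suc: "bar_d k (Suc n) p \<in> module_hom k (ob (bar k (Suc n)) p) (ob (bar k n) p)"
  by (rule surj_homD(1)[OF bar_d_surj_hom])

lemma bar_d_bar_d_Suc: "u \<in> carrier (ob (bar k (Suc (Suc n))) p) \<Longrightarrow> bar_d k (Suc n) p (bar_d k (Suc (Suc n)) p u) = \<zero>\<^bsub>ob (bar k n) p\<^esub>"
  using k.bar_d_bar_d[of "Suc n" u p] by simp

definition bar_cycle where
  "bar_cycle n p r \<longleftrightarrow> (if n = 0 then bar_aug k p r = \<zero>\<^bsub>ob (t_mod k) p\<^esub> else bar_d k n p r = \<zero>\<^bsub>ob (bar k (n - 1)) p\<^esub>)"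

lemma bar_exact: "r \<in> carrier (ob (bar k n) p) \<Longrightarrow> bar_cycle n p r \<Longrightarrow> \<exists>r'\<in>carrier (ob (bar k (Suc n)) p). r = bar_d k (Suc n) p r'"
  using k.bar_s_cycle[of "Suc n" r p] mhom_closed[OF k.bar_s_hom, of r n p]
  by (intro bexI[of _ "bar_s k n p r"]) (auto simp: bar_cycle_def One_nat_def split: if_splits)

text \<open>
  The comparison theorem for resolutions over the based surjections, with \<open>bar k\<close> as the projective
  complex: lift the augmentation through \<open>\<eta>\<close>, and then each \<open>\<phi> n \<circ> d\<close>, which has values in cycles,
  through the differential of \<open>P\<close>.
\<close>

lemma comparison:
  "\<exists>\<phi>. (\<forall>n. \<phi> n \<in> surj_hom k (bar k n) (P n)) \<and>
     (\<forall>p. \<forall>r\<in>carrier (ob (bar k 0) p). \<eta> p (\<phi> 0 p r) = bar_aug k p r) \<and>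
     (\<forall>n p. \<forall>r\<in>carrier (ob (bar k (Suc n)) p). d (Suc n) p (\<phi> (Suc n) p r) = \<phi> n p (bar_d k (Suc n) p r))"
proof -
  \<comment> \<open>The last conjunct, that \<open>\<phi> n \<circ> d\<close> has values in boundaries, is what makes the next step
    possible.\<close>
  define good where "good n \<phi> \<longleftrightarrow> \<phi> \<in> surj_hom k (bar k n) (P n) \<and>
      (n = 0 \<longrightarrow> (\<forall>p. \<forall>r\<in>carrier (ob (bar k 0) p). \<eta> p (\<phi> p r) = bar_aug k p r)) \<and>
      (\<forall>p. \<forall>r\<in>carrier (ob (bar k (Suc n)) p). \<phi> p (bar_d k (Suc n) p r) \<in> d (Suc n) p ` carrier (ob (P (Suc n)) p))"
    for n and \<phi> :: "nat \<Rightarrow> (strg \<times> (nat \<Rightarrow> nat) \<Rightarrow> 'k) \<Rightarrow> 'p"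
  define step where "step n \<phi> \<phi>' \<longleftrightarrow>
      (\<forall>p. \<forall>r\<in>carrier (ob (bar k (Suc n)) p). d (Suc n) p (\<phi>' p r) = \<phi> p (bar_d k (Suc n) p r))"
    for n and \<phi> \<phi>' :: "nat \<Rightarrow> (strg \<times> (nat \<Rightarrow> nat) \<Rightarrow> 'k) \<Rightarrow> 'p"
  have "\<exists>\<phi>. good 0 \<phi>"
  proof -
    have "bar_aug k p u \<in> \<eta> p ` carrier (ob (P 0) p)" if "u \<in> carrier (ob (bar k 0) p)" for p u
      unfolding \<eta>_onto by (rule mhom_closed[OF k.bar_aug_hom that])
    then obtain \<phi> where \<phi>: "\<phi> \<in> surj_hom k (bar k 0) (P 0)"
      "\<And>p r. r \<in> carrier (ob (bar k 0) p) \<Longrightarrow> \<eta> p (\<phi> p r) = bar_aug k p r"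
      using k.bar_lift[OF PS t_surj_module \<eta>S bar_aug_surj_hom] by blast
    have "\<phi> p (bar_d k (Suc 0) p r) \<in> d (Suc 0) p ` carrier (ob (P (Suc 0)) p)" if r: "r \<in> carrier (ob (bar k (Suc 0)) p)" for p r
    proof -
      have c: "bar_d k (Suc 0) p r \<in> carrier (ob (bar k 0) p)" by (rule mhom_closed[OF bar_d_hom_Suc r])
      have "\<eta> p (\<phi> p (bar_d k (Suc 0) p r)) = \<zero>\<^bsub>ob (t_mod k) p\<^esub>"
        unfolding \<phi>(2)[OF c] using k.bar_aug_bar_d[of r p] r by (simp add: One_nat_def)
      then show ?thesis using \<eta>_ker[of p] mhom_closed[OF surj_homD(1)[OF \<phi>(1)] c] unfolding One_nat_def by blast
    qed
    then have "good 0 \<phi>" unfolding good_def using \<phi> by blast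
    then show ?thesis by (rule exI[of _ \<phi>])
  qed
  moreover have "\<exists>\<phi>'. good (Suc n) \<phi>' \<and> step n \<phi> \<phi>'" if g: "good n \<phi>" for n \<phi>
  proof -
    have \<phi>: "\<phi> \<in> surj_hom k (bar k n) (P n)"
      "\<And>p r. r \<in> carrier (ob (bar k (Suc n)) p) \<Longrightarrow> \<phi> p (bar_d k (Suc n) p r) \<in> d (Suc n) p ` carrier (ob (P (Suc n)) p)"
      using g unfolding good_def by blast+
    obtain \<phi>' where \<phi>': "\<phi>' \<in> surj_hom k (bar k (Suc n)) (P (Suc n))"
      "\<And>p r. r \<in> carrier (ob (bar k (Suc n)) p) \<Longrightarrow> d (Suc n) p (\<phi>' p r) = \<phi> p (bar_d k (Suc n) p r)"
      using k.bar_lift[OF PS PS dS surj_hom_comp[OF bar_d_surj_hom \<phi>(1)] \<phi>(2)] by blast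
    have "\<phi>' p (bar_d k (Suc (Suc n)) p r) \<in> d (Suc (Suc n)) p ` carrier (ob (P (Suc (Suc n))) p)"
      if r: "r \<in> carrier (ob (bar k (Suc (Suc n))) p)" for p r
    proof -
      have c: "bar_d k (Suc (Suc n)) p r \<in> carrier (ob (bar k (Suc n)) p)" by (rule mhom_closed[OF bar_d_hom_Suc r])
      have "d (Suc n) p (\<phi>' p (bar_d k (Suc (Suc n)) p r)) = \<zero>\<^bsub>ob (P n) p\<^esub>"
        unfolding \<phi>'(2)[OF c] bar_d_bar_d_Suc[OF r] by (rule surj_hom_zero[OF k.bar_surj_module PS \<phi>(1)])
      then show ?thesis using d_ker[of n p] mhom_closed[OF surj_homD(1)[OF \<phi>'(1)] c] by blast
    qed
    then have "good (Suc n) \<phi>'" unfolding good_def using \<phi>'(1) by blast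
    moreover have "step n \<phi> \<phi>'" unfolding step_def using \<phi>'(2) by blast
    ultimately show ?thesis by blast
  qed
  ultimately have "\<exists>\<phi>. \<forall>n. good n (\<phi> n) \<and> step n (\<phi> n) (\<phi> (Suc n))"
    by (rule dependent_nat_choice)
  then obtain \<phi> where \<phi>: "\<And>n. good n (\<phi> n)" "\<And>n. step n (\<phi> n) (\<phi> (Suc n))" by blast
  show ?thesis
    by (intro exI[of _ \<phi>] conjI allI ballI)
       (use \<phi>(1)[unfolded good_def] \<phi>(2)[unfolded step_def] in \<open>simp_all only: simp_thms\<close>)
qed

abbreviation En where "En n \<equiv> gamma_tensor k (P n) L"

text \<open>
  The differential of the source of a comparison map enters its mapping cone with the opposite sign.
\<close>

definition bar_shift_d where
  "bar_shift_d n p r = (case n of 0 \<Rightarrow> \<zero>\<^bsub>ob (bar k 0) p\<^esub> | Suc m \<Rightarrow> \<ominus>\<^bsub>ob (bar k m) p\<^esub> bar_d k (Suc m) p r)"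

definition C_shift_d where
  "C_shift_d n c = (case n of 0 \<Rightarrow> \<zero>\<^bsub>C 0\<^esub> | Suc m \<Rightarrow> \<ominus>\<^bsub>C m\<^esub> RW_boundary k A I M (Suc m) c)"

lemma shift_d_simps [simp]:
  "bar_shift_d 0 p r = \<zero>\<^bsub>ob (bar k 0) p\<^esub>" "bar_shift_d (Suc m) p r = \<ominus>\<^bsub>ob (bar k m) p\<^esub> bar_d k (Suc m) p r"
  "C_shift_d 0 c = \<zero>\<^bsub>C 0\<^esub>" "C_shift_d (Suc m) c = \<ominus>\<^bsub>C m\<^esub> RW_boundary k A I M (Suc m) c"
  by (simp_all add: bar_shift_d_def C_shift_d_def)

lemma bar_shift_d_hom: "bar_shift_d n \<in> surj_hom k (bar k n) (bar_shift n)"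
proof (cases n)
  case 0
  have e: "bar_shift_d 0 p = (\<lambda>r. \<zero>\<^bsub>ob (bar k 0) p\<^esub>)" for p by (intro ext) simp
  show ?thesis unfolding 0 by (rule surj_homI) (simp_all add: e zero_sub_hom_to[OF k.bar_module])
next
  case (Suc m)
  have e: "bar_shift_d (Suc m) p = (\<lambda>r. \<ominus>\<^bsub>ob (bar k m) p\<^esub> bar_d k (Suc m) p r)" for p by (intro ext) simp
  note h = surj_homD[OF bar_d_surj_hom[of m]]
  show ?thesis unfolding Suc shift_simps
  proof (rule surj_homI)
    show "bar_shift_d (Suc m) p \<in> module_hom k (ob (bar k (Suc m)) p) (ob (bar k m) p)" for p
      unfolding e by (rule mhom_neg[OF k.bar_module h(1)])
    show "bar_shift_d (Suc m) p (act (bar k (Suc m)) p q f u) = act (bar k m) p q f (bar_shift_d (Suc m) q u)"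
      if "f \<in> based_surj p q" "u \<in> carrier (ob (bar k (Suc m)) q)" for p q f u
      unfolding shift_d_simps h(2)[OF that]
      by (rule mhom_uminus[OF k.bar_module k.bar_module k.bar_act(1)[OF that(1)] mhom_closed[OF h(1) that(2)], symmetric])
  qed
qed

lemma boundary_hom: "RW_boundary k A I M (Suc m) \<in> module_hom k (C (Suc m)) (C m)"
  using RW_boundary_hom[of "Suc m"] by (simp add: One_nat_def)

lemma boundary_pair_C:
  "r \<in> carrier (ob (bar k (Suc m)) p) \<Longrightarrow> a \<in> tuples p I \<Longrightarrow> m' \<in> carrier M \<Longrightarrow>
    RW_boundary k A I M (Suc m) (pair_C (Suc m) p r a m') = pair_C m p (bar_d k (Suc m) p r) a m'"
  using RW_boundary_pair_C[of "Suc m" r p a m'] by (simp add: One_nat_def)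

lemma C_shift_d_hom: "C_shift_d n \<in> module_hom k (C n) (C_shift n)"
proof (cases n)
  case 0
  have e: "C_shift_d 0 = (\<lambda>r. \<zero>\<^bsub>C 0\<^esub>)" by (intro ext) simp
  show ?thesis unfolding 0 e by (simp add: zero_sub_hom_to[OF C_module])
next
  case (Suc m)
  have e: "C_shift_d (Suc m) = (\<lambda>r. \<ominus>\<^bsub>C m\<^esub> RW_boundary k A I M (Suc m) r)" by (intro ext) simp
  show ?thesis unfolding Suc e shift_simps by (rule mhom_neg[OF C_module boundary_hom])
qed

lemma C_shift_d_tau:
  assumes r: "r \<in> carrier (ob (bar k n) p)" and a: "a \<in> tuples p I" "m \<in> carrier M"
  shows "C_shift_d n (pair_C n p r a m) = pair_C_shift n p (bar_shift_d n p r) a m"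
proof (cases n)
  case (Suc m')
  show ?thesis
    using r unfolding Suc shift_d_simps shift_simps
    using mhom_uminus[OF k.bar_module C_module pair_C_hom[OF a] mhom_closed[OF bar_d_hom_Suc]] boundary_pair_C[OF _ a] by simp
qed simp

lemma dE_hom: "gamma_tensor_map k (P (Suc n)) (P n) L (d (Suc n)) \<in> module_hom k (En (Suc n)) (En n)"
  by (rule gamma_tensor_map_hom[OF PG PG L_left_module dG])

lemma Em: "module k (En n)"
  by (rule E_module[OF PG])

text \<open>
  The cone \<open>K n = bar (n - 1) \<oplus> P n\<close> of the comparison map is exact, has a natural contraction, and
  its tensor product with \<open>U\<close> is the cone \<open>T n = C\<Gamma>\<^sub>n\<^sub>-\<^sub>1(I, M) \<oplus> (P n \<otimes> L(A, M))\<close>. Exactness of the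
  latter is read off as bijectivity on homology.
\<close>

theorem comparison_quasi_iso:
  "graded_isomorphic k (HGamma_ideal k A I M) (HGamma k A M P d)"
proof -
  obtain \<phi> where \<phi>: "\<And>n. \<phi> n \<in> surj_hom k (bar k n) (P n)"
    and \<phi>0: "\<And>p r. r \<in> carrier (ob (bar k 0) p) \<Longrightarrow> \<eta> p (\<phi> 0 p r) = bar_aug k p r"
    and \<phi>S: "\<And>n p r. r \<in> carrier (ob (bar k (Suc n)) p) \<Longrightarrow> d (Suc n) p (\<phi> (Suc n) p r) = \<phi> n p (bar_d k (Suc n) p r)"
    using comparison by blast
  note \<phi>h = surj_homD(1)[OF \<phi>]
  define dE where "dE n = gamma_tensor_map k (P n) (P (n - 1)) L (d n)" for n
  have dEh: "dE (Suc n) \<in> module_hom k (En (Suc n)) (En n)" for n unfolding dE_def using dE_hom by simp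
  have dEt: "dE (Suc n) (pair_E (P (Suc n)) p u a m) = pair_E (P n) p (d (Suc n) p u) a m"
    if "u \<in> carrier (ob (P (Suc n)) p)" "a \<in> tuples p I" "m \<in> carrier M" for n p u a m
    unfolding dE_def using pair_E_map[OF PG PG dG that] by simp
  let ?\<tau>E = "\<lambda>n. pair_E (P n)"
  note tE = pair_E_balanced[OF PG]
  have "factors_through (bar k n) (pair_C n) (C n) (En n) (\<lambda>p r. ?\<tau>E n p (\<phi> n p r))" for n
    by (rule pair_C_universal[OF Em balanced_pull[OF \<phi> tE]])
  then obtain \<Phi> where \<Phi>: "\<And>n. \<Phi> n \<in> module_hom k (C n) (En n)"
    "\<And>n p r a m. r \<in> carrier (ob (bar k n) p) \<Longrightarrow> a \<in> tuples p I \<Longrightarrow> m \<in> carrier M \<Longrightarrow> \<Phi> n (pair_C n p r a m) = ?\<tau>E n p (\<phi> n p r) a m"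
    by metis
  define K where "K n = prod_gm (bar_shift n) (P n)" for n
  define \<delta> where "\<delta> n p u = (bar_shift_d n p (fst u), \<phi> n p (fst u) \<oplus>\<^bsub>ob (P n) p\<^esub> d (Suc n) p (snd u))" for n p u
  define T where "T n = prod_module (C_shift n) (En n)" for n
  define \<tau> where "\<tau> n = prod_pair (pair_C_shift n) (?\<tau>E n)" for n
  define D where "D n z = (C_shift_d n (fst z), \<Phi> n (fst z) \<oplus>\<^bsub>En n\<^esub> dE (Suc n) (snd z))" for n z
  have KS: "surj_module k (K n)" for n unfolding K_def by (rule prod_gm_surj_module[OF bar_shift_surj_module PS])
  have Kob: "carrier (ob (K (Suc n)) p) = carrier (ob (bar k n) p) \<times> carrier (ob (P (Suc n)) p)"
    "carrier (ob (K 0) p) = {\<zero>\<^bsub>ob (bar k 0) p\<^esub>} \<times> carrier (ob (P 0) p)"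
    "\<zero>\<^bsub>ob (K n) p\<^esub> = (\<zero>\<^bsub>ob (bar_shift n) p\<^esub>, \<zero>\<^bsub>ob (P n) p\<^esub>)" for n p
    unfolding K_def by simp_all
  have Tm: "module k (T n)" for n unfolding T_def by (rule prod_module_module[OF C_shift_module Em])
  have \<delta>h: "\<delta> n \<in> surj_hom k (K (Suc n)) (K n)" for n
  proof (rule surj_homI)
    show "\<delta> n p \<in> module_hom k (ob (K (Suc n)) p) (ob (K n) p)" for p
      unfolding \<delta>_def[abs_def] K_def prod_gm_simps shift_simps
      by (rule pair_hom[OF mhom_comp[OF fst_hom[OF k.bar_module Pm] surj_homD(1)[OF bar_shift_d_hom]]
            copair_hom[OF k.bar_module Pm Pm \<phi>h dh]])
    show "\<delta> n p (act (K (Suc n)) p q f u) = act (K n) p q f (\<delta> n q u)"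
      if f: "f \<in> based_surj p q" and u: "u \<in> carrier (ob (K (Suc n)) q)" for p q f u
    proof -
      have u': "fst u \<in> carrier (ob (bar k n) q)" "snd u \<in> carrier (ob (P (Suc n)) q)" using u unfolding Kob by auto
      show ?thesis
        unfolding \<delta>_def K_def prod_gm_simps shift_simps fst_conv snd_conv
        using surj_homD(2)[OF bar_shift_d_hom f u'(1)] surj_homD(2)[OF \<phi> f u'(1)] surj_homD(2)[OF dS f u'(2)]
          mhom_add[OF surj_moduleD(2)[OF PS f] mhom_closed[OF \<phi>h u'(1)] mhom_closed[OF dh u'(2)]] by simp
    qed
  qed
  \<comment> \<open>\<open>\<delta> (r, v) = (- d r, \<phi> r + d v)\<close> squares to zero because \<open>\<phi>\<close> is a chain map.\<close>
  have dd: "\<delta> n p (\<delta> (Suc n) p u) = \<zero>\<^bsub>ob (K n) p\<^esub>" if u: "u \<in> carrier (ob (K (Suc (Suc n))) p)" for n p u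
  proof -
    interpret Pn: module k "ob (P n) p" by (rule Pm)
    have u': "fst u \<in> carrier (ob (bar k (Suc n)) p)" "snd u \<in> carrier (ob (P (Suc (Suc n))) p)" using u unfolding Kob by auto
    let ?r = "bar_d k (Suc n) p (fst u)"
    have r: "?r \<in> carrier (ob (bar k n) p)" by (rule mhom_closed[OF bar_d_hom_Suc u'(1)])
    interpret Rn: module k "ob (bar k n) p" by (rule k.bar_module)
    have "bar_shift_d n p (\<ominus>\<^bsub>ob (bar k n) p\<^esub> ?r) = \<zero>\<^bsub>ob (bar_shift n) p\<^esub>"
    proof (cases n)
      case (Suc m)
      interpret Rm: module k "ob (bar k m) p" by (rule k.bar_module)
      show ?thesis using mhom_uminus[OF k.bar_module k.bar_module bar_d_hom_Suc, of ?r m] r u'(1) bar_d_bar_d_Suc[of "fst u" m p]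
        unfolding Suc by simp
    qed simp
    moreover have "\<phi> n p (\<ominus>\<^bsub>ob (bar k n) p\<^esub> ?r) = \<ominus>\<^bsub>ob (P n) p\<^esub> \<phi> n p ?r"
      by (rule mhom_uminus[OF k.bar_module Pm \<phi>h r])
    moreover have "d (Suc n) p (\<phi> (Suc n) p (fst u) \<oplus>\<^bsub>ob (P (Suc n)) p\<^esub> d (Suc (Suc n)) p (snd u)) = \<phi> n p ?r"
      using mhom_add[OF dh mhom_closed[OF \<phi>h u'(1)] mhom_closed[OF dh u'(2)]] \<phi>S[OF u'(1)] d_d[OF u'(2)]
        mhom_closed[OF \<phi>h r] by simp
    ultimately show ?thesis unfolding \<delta>_def Kob using mhom_closed[OF \<phi>h r] by (simp add: Pn.l_neg)
  qed
  \<comment> \<open>In degree \<open>0\<close>, \<open>v\<close> and the image of \<open>r = bar_sec (\<eta> v)\<close> agree under \<open>\<eta>\<close>, so they differ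
    by a boundary.\<close>
  have ex0: "u \<in> \<delta> 0 p ` carrier (ob (K (Suc 0)) p)" if u: "u \<in> carrier (ob (K 0) p)" for p u
  proof -
    interpret P0: module k "ob (P 0) p" by (rule Pm)
    obtain v where v: "u = (\<zero>\<^bsub>ob (bar k 0) p\<^esub>, v)" "v \<in> carrier (ob (P 0) p)" using u unfolding Kob by auto
    define r where "r = bar_sec k p (\<eta> p v)"
    have \<eta>v: "\<eta> p v \<in> carrier (ob (t_mod k) p)" by (rule mhom_closed[OF \<eta>h v(2)])
    have r: "r \<in> carrier (ob (bar k 0) p)" unfolding r_def by (rule mhom_closed[OF k.bar_sec_hom \<eta>v])
    note fr = mhom_closed[OF \<phi>h r]
    have "\<eta> p (v \<ominus>\<^bsub>ob (P 0) p\<^esub> \<phi> 0 p r) = \<eta> p v \<ominus>\<^bsub>ob (t_mod k) p\<^esub> \<eta> p v"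
      using mhom_minus[OF Pm k.t_module \<eta>h v(2) fr] \<phi>0[OF r] k.bar_aug_bar_sec[OF \<eta>v] unfolding r_def by simp
    then have "\<eta> p (v \<ominus>\<^bsub>ob (P 0) p\<^esub> \<phi> 0 p r) = \<zero>\<^bsub>ob (t_mod k) p\<^esub>"
      using module_minus_eq_zero[OF k.t_module \<eta>v \<eta>v] by simp
    then obtain w where w: "w \<in> carrier (ob (P 1) p)" "v \<ominus>\<^bsub>ob (P 0) p\<^esub> \<phi> 0 p r = d 1 p w"
      using \<eta>_ker[of p] v(2) fr P0.M.minus_closed by blast
    have "\<phi> 0 p r \<oplus>\<^bsub>ob (P 0) p\<^esub> d 1 p w = v"
      unfolding w(2)[symmetric] using v(2) fr by (simp add: a_minus_def P0.M.a_ac P0.M.r_neg) 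
    then have "u = \<delta> 0 p (r, w)" unfolding \<delta>_def v(1) by (simp add: One_nat_def)
    then show ?thesis using r w(1) unfolding Kob by (auto simp: One_nat_def)
  qed
  \<comment> \<open>If \<open>(r, v)\<close> is a cycle then so is \<open>r\<close>, hence \<open>r = d r'\<close>; now \<open>\<phi> r' + v\<close> is a cycle and
    so equals some \<open>d w\<close>, and \<open>(- r', w)\<close> is a preimage of \<open>(r, v)\<close>.\<close>
  have exS: "u \<in> \<delta> (Suc n) p ` carrier (ob (K (Suc (Suc n))) p)"
    if u: "u \<in> carrier (ob (K (Suc n)) p)" and z: "\<delta> n p u = \<zero>\<^bsub>ob (K n) p\<^esub>" for n p u
  proof -
    interpret Pn: module k "ob (P n) p" by (rule Pm)
    interpret PSn: module k "ob (P (Suc n)) p" by (rule Pm)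
    interpret Rn: module k "ob (bar k n) p" by (rule k.bar_module)
    obtain r v where rv: "u = (r, v)" and r: "r \<in> carrier (ob (bar k n) p)" and v: "v \<in> carrier (ob (P (Suc n)) p)"
      using u unfolding Kob by auto
    have z1: "bar_shift_d n p r = \<zero>\<^bsub>ob (bar_shift n) p\<^esub>" and z2: "\<phi> n p r \<oplus>\<^bsub>ob (P n) p\<^esub> d (Suc n) p v = \<zero>\<^bsub>ob (P n) p\<^esub>"
      using z unfolding \<delta>_def rv Kob by auto
    note fr = mhom_closed[OF \<phi>h r] and dv = mhom_closed[OF dh v]
    have "bar_cycle n p r"
    proof (cases n)
      case 0
      interpret t: module k "ob (t_mod k) p" by (rule k.t_module)
      have "\<eta> p (\<phi> 0 p r \<oplus>\<^bsub>ob (P 0) p\<^esub> d (Suc 0) p v) = \<zero>\<^bsub>ob (t_mod k) p\<^esub>"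
        using z2 mhom_zero[OF Pm k.t_module \<eta>h] unfolding 0 by simp
      then have "\<eta> p (\<phi> 0 p r) \<oplus>\<^bsub>ob (t_mod k) p\<^esub> \<eta> p (d (Suc 0) p v) = \<zero>\<^bsub>ob (t_mod k) p\<^esub>"
        using mhom_add[OF \<eta>h fr[unfolded 0] dv[unfolded 0]] by simp
      moreover have "\<eta> p (d (Suc 0) p v) = \<zero>\<^bsub>ob (t_mod k) p\<^esub>" using \<eta>_d[of v p] v unfolding 0 One_nat_def by simp
      ultimately show ?thesis using \<phi>0 r mhom_closed[OF k.bar_aug_hom] unfolding bar_cycle_def 0 by simp
    next
      case (Suc m)
      interpret Rm: module k "ob (bar k m) p" by (rule k.bar_module)
      have c: "bar_d k (Suc m) p r \<in> carrier (ob (bar k m) p)" using mhom_closed[OF bar_d_hom_Suc] r unfolding Suc by blast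
      have "\<ominus>\<^bsub>ob (bar k m) p\<^esub> bar_d k (Suc m) p r = \<zero>\<^bsub>ob (bar k m) p\<^esub>" using z1 unfolding Suc by simp
      then have "bar_d k (Suc m) p r = \<zero>\<^bsub>ob (bar k m) p\<^esub>"
        by (rule module_neg_eq_zero[OF k.bar_module c])
      then show ?thesis unfolding bar_cycle_def Suc by simp
    qed
    from bar_exact[OF r this] obtain r' where r': "r' \<in> carrier (ob (bar k (Suc n)) p)" "r = bar_d k (Suc n) p r'" ..
    interpret RSn: module k "ob (bar k (Suc n)) p" by (rule k.bar_module)
    note fr' = mhom_closed[OF \<phi>h r'(1)]
    let ?w = "\<phi> (Suc n) p r' \<oplus>\<^bsub>ob (P (Suc n)) p\<^esub> v"
    have "d (Suc n) p ?w = \<zero>\<^bsub>ob (P n) p\<^esub>"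
      using mhom_add[OF dh fr' v] \<phi>S[OF r'(1)] z2 r'(2) by simp
    then obtain w where w: "w \<in> carrier (ob (P (Suc (Suc n))) p)" "?w = d (Suc (Suc n)) p w"
      using d_ker[of n p] PSn.M.a_closed[OF fr' v] by blast
    have "\<phi> (Suc n) p (\<ominus>\<^bsub>ob (bar k (Suc n)) p\<^esub> r') \<oplus>\<^bsub>ob (P (Suc n)) p\<^esub> d (Suc (Suc n)) p w = v"
      unfolding w(2)[symmetric] mhom_uminus[OF k.bar_module Pm \<phi>h r'(1)]
      using fr' v by (simp add: PSn.M.a_assoc[symmetric] PSn.M.l_neg)
    moreover have "bar_shift_d (Suc n) p (\<ominus>\<^bsub>ob (bar k (Suc n)) p\<^esub> r') = r"
      using mhom_uminus[OF k.bar_module k.bar_module bar_d_hom_Suc r'(1)] r'(2) r by simp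
    ultimately have "u = \<delta> (Suc n) p (\<ominus>\<^bsub>ob (bar k (Suc n)) p\<^esub> r', w)" unfolding \<delta>_def rv by simp
    then show ?thesis using r'(1) w(1) unfolding Kob by auto
  qed
  have lift: "lifts_along k (K n) (K (Suc n)) (\<delta> n) \<zeta>"
    if \<zeta>: "\<zeta> \<in> surj_hom k (K n) (K n)" and im: "\<And>p u. u \<in> carrier (ob (K n) p) \<Longrightarrow> \<zeta> p u \<in> \<delta> n p ` carrier (ob (K (Suc n)) p)"
    for n \<zeta>
    unfolding K_def[of n]
    by (rule prod_lift[OF bar_shift_surj_module PS KS KS \<delta>h])
       (use \<zeta> im bar_shift_lift[OF KS KS \<delta>h] k.projective_lift[OF proj nz KS KS \<delta>h] in \<open>auto simp: K_def[of n]\<close>)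
  obtain h where h: "\<And>n. h n \<in> surj_hom k (K n) (K (Suc n))"
    "\<And>p u. u \<in> carrier (ob (K 0) p) \<Longrightarrow> \<delta> 0 p (h 0 p u) = u"
    "\<And>n p u. u \<in> carrier (ob (K (Suc n)) p) \<Longrightarrow> \<delta> (Suc n) p (h (Suc n) p u) = u \<ominus>\<^bsub>ob (K (Suc n)) p\<^esub> h n p (\<delta> n p u)"
    using natural_contraction[OF KS \<delta>h dd ex0 exS lift] by blast
  have \<tau>b: "balanced (K n) (T n) (\<tau> n)" for n
    unfolding K_def T_def \<tau>_def by (rule prod_pair_balanced[OF bar_shift_surj_module PS C_shift_module Em pair_C_shift_balanced tE])
  have \<tau>g: "generates k (T n) (pairing_values (K n) (\<tau> n))" for n
    unfolding K_def T_def \<tau>_def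
    by (rule prod_pair_generates[OF bar_shift_surj_module PS C_shift_module Em pair_C_shift_balanced tE pair_C_shift_generates pair_E_generates[OF PG]])
  have univ: "factors_through (K n) (\<tau> n) (T n) (T (Suc n)) \<beta>"
    if "balanced (K n) (T (Suc n)) \<beta>" for n \<beta>
    unfolding K_def T_def[of n] \<tau>_def
    by (rule prod_pair_universal[OF bar_shift_surj_module PS C_shift_module Em pair_C_shift_balanced tE Tm that[unfolded K_def]
          pair_C_shift_universal[OF Tm] pair_E_universal[OF PG Tm]])
  have Dh: "D n \<in> module_hom k (T (Suc n)) (T n)" for n
    unfolding D_def[abs_def] T_def shift_simps
    by (rule pair_hom[OF mhom_comp[OF fst_hom[OF C_module Em] C_shift_d_hom] copair_hom[OF C_module Em Em \<Phi>(1) dEh]])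
  have D\<tau>: "D n (\<tau> (Suc n) p u a m) = \<tau> n p (\<delta> n p u) a m"
    if u: "u \<in> carrier (ob (K (Suc n)) p)" and a: "a \<in> tuples p I" "m \<in> carrier M" for n p u a m
  proof -
    have u': "fst u \<in> carrier (ob (bar k n) p)" "snd u \<in> carrier (ob (P (Suc n)) p)" using u unfolding Kob by auto
    show ?thesis
      unfolding D_def \<tau>_def \<delta>_def prod_pair_def fst_conv snd_conv shift_simps
      using C_shift_d_tau[OF u'(1) a] \<Phi>(2)[OF u'(1) a] dEt[OF u'(2) a]
        mhom_add[OF balancedD(1)[OF tE a] mhom_closed[OF \<phi>h u'(1)] mhom_closed[OF dh u'(2)]] by simp
  qed
  note exact = contraction_exact[where K = K and T = T and \<delta> = \<delta> and h = h and \<tau> = \<tau> and D = D,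
      OF KS \<delta>h h Tm \<tau>b \<tau>g univ Dh D\<tau>]
  have exact0: "z \<in> D 0 ` carrier (T (Suc 0))" if "z \<in> carrier (T 0)" for z
    by (rule exact(1)) (assumption | rule that)+
  have exactS: "z \<in> D (Suc n) ` carrier (T (Suc (Suc n)))"
    if "z \<in> carrier (T (Suc n))" "D n z = \<zero>\<^bsub>T n\<^esub>" for n z
    by (rule exact(2)) (assumption | rule that)+
  let ?bd = "RW_boundary k A I M"
  have dd_C: "?bd (Suc n) (?bd (Suc (Suc n)) x) = \<zero>\<^bsub>C n\<^esub>" if x: "x \<in> carrier (C (Suc (Suc n)))" for n x
  proof (rule mhom_eq_on_generators[OF pair_C_generates C_module C_module mhom_comp[OF boundary_hom boundary_hom] mhom_0[OF C_module] _ x])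
    fix g assume "g \<in> pairing_values (bar k (Suc (Suc n))) (pair_C (Suc (Suc n)))"
    then obtain p r a m where g: "g = pair_C (Suc (Suc n)) p r a m" "r \<in> carrier (ob (bar k (Suc (Suc n))) p)" and a: "a \<in> tuples p I" "m \<in> carrier M"
      by blast
    show "?bd (Suc n) (?bd (Suc (Suc n)) g) = \<zero>\<^bsub>C n\<^esub>"
      unfolding g(1) boundary_pair_C[OF g(2) a] boundary_pair_C[OF mhom_closed[OF bar_d_hom_Suc g(2)] a] bar_d_bar_d_Suc[OF g(2)]
      by (rule mhom_zero[OF k.bar_module C_module pair_C_hom[OF a]])
  qed
  have dd_E: "dE (Suc n) (dE (Suc (Suc n)) x) = \<zero>\<^bsub>En n\<^esub>" if x: "x \<in> carrier (En (Suc (Suc n)))" for n x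
  proof (rule mhom_eq_on_generators[OF pair_E_generates[OF PG] Em Em mhom_comp[OF dEh dEh] mhom_0[OF Em] _ x])
    fix g assume "g \<in> pairing_values (P (Suc (Suc n))) (pair_E (P (Suc (Suc n))))"
    then obtain p r a m where g: "g = pair_E (P (Suc (Suc n))) p r a m" "r \<in> carrier (ob (P (Suc (Suc n))) p)" and a: "a \<in> tuples p I" "m \<in> carrier M"
      by blast
    show "dE (Suc n) (dE (Suc (Suc n)) g) = \<zero>\<^bsub>En n\<^esub>"
      unfolding g(1) dEt[OF g(2) a] dEt[OF mhom_closed[OF dh g(2)] a] d_d[OF g(2)]
      by (rule mhom_zero[OF Pm Em balancedD(1)[OF tE a]])
  qed
  have ch: "\<Phi> n (?bd (Suc n) x) = dE (Suc n) (\<Phi> (Suc n) x)" if x: "x \<in> carrier (C (Suc n))" for n x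
  proof (rule mhom_eq_on_generators[OF pair_C_generates C_module Em mhom_comp[OF boundary_hom \<Phi>(1)] mhom_comp[OF \<Phi>(1) dEh] _ x])
    fix g assume "g \<in> pairing_values (bar k (Suc n)) (pair_C (Suc n))"
    then obtain p r a m where g: "g = pair_C (Suc n) p r a m" "r \<in> carrier (ob (bar k (Suc n)) p)" and a: "a \<in> tuples p I" "m \<in> carrier M"
      by blast
    show "\<Phi> n (?bd (Suc n) g) = dE (Suc n) (\<Phi> (Suc n) g)"
      unfolding g(1) boundary_pair_C[OF g(2) a] \<Phi>(2)[OF mhom_closed[OF bar_d_hom_Suc g(2)] a] \<Phi>(2)[OF g(2) a]
        dEt[OF mhom_closed[OF \<phi>h g(2)] a] \<phi>S[OF g(2)] ..
  qed
  have Tob: "carrier (T (Suc n)) = carrier (C n) \<times> carrier (En (Suc n))" "carrier (T 0) = {\<zero>\<^bsub>C 0\<^esub>} \<times> carrier (En 0)"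
    "\<zero>\<^bsub>T n\<^esub> = (\<zero>\<^bsub>C_shift n\<^esub>, \<zero>\<^bsub>En n\<^esub>)" for n unfolding T_def by simp_all
  have "graded_isomorphic k (homology C ?bd) (homology En dE)"
  proof (rule homology_module_iso[where V = C and W = En and dV = ?bd and dW = dE and \<phi> = \<Phi>, OF C_module Em boundary_hom dEh dd_C dd_E \<Phi>(1) ch])
    fix n z w assume z: "z \<in> carrier (C n)" "n = 0 \<or> ?bd n z = \<zero>\<^bsub>C (n - 1)\<^esub>"
      and w: "w \<in> carrier (En (Suc n))" "\<Phi> n z = dE (Suc n) w"
    interpret Cn: module k "C n" by (rule C_module)
    interpret CSn: module k "C (Suc n)" by (rule C_module)
    interpret En': module k "En n" by (rule Em)
    interpret ESn: module k "En (Suc n)" by (rule Em)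
    \<comment> \<open>The relation \<open>\<Phi> z = d w\<close> makes this pair a cycle of the cone.\<close>
    let ?z = "(z, \<ominus>\<^bsub>En (Suc n)\<^esub> w)"
    have zT: "?z \<in> carrier (T (Suc n))" unfolding Tob using z w by simp
    have "C_shift_d n z = \<zero>\<^bsub>C_shift n\<^esub>"
    proof (cases n)
      case (Suc m)
      interpret Cm: module k "C m" by (rule C_module)
      show ?thesis using z(2) unfolding Suc by simp
    qed simp
    moreover have "\<Phi> n z \<oplus>\<^bsub>En n\<^esub> dE (Suc n) (\<ominus>\<^bsub>En (Suc n)\<^esub> w) = \<zero>\<^bsub>En n\<^esub>"
      unfolding w(2) mhom_uminus[OF Em Em dEh w(1)] using mhom_closed[OF dEh w(1)] by (simp add: En'.r_neg)
    ultimately have "D n ?z = \<zero>\<^bsub>T n\<^esub>" unfolding D_def Tob by simp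
    from exactS[OF zT this] obtain c e where ce: "c \<in> carrier (C (Suc n))" "?z = D (Suc n) (c, e)" unfolding Tob by auto
    then have "z = \<ominus>\<^bsub>C n\<^esub> ?bd (Suc n) c" unfolding D_def by simp
    also have "\<dots> = ?bd (Suc n) (\<ominus>\<^bsub>C (Suc n)\<^esub> c)" by (rule mhom_uminus[OF C_module C_module boundary_hom ce(1), symmetric])
    finally show "z \<in> ?bd (Suc n) ` carrier (C (Suc n))" using ce(1) by blast
  next
    fix n y assume y: "y \<in> carrier (En n)" "n = 0 \<or> dE n y = \<zero>\<^bsub>En (n - 1)\<^esub>"
    show "\<exists>x\<in>carrier (C n). (n = 0 \<or> ?bd n x = \<zero>\<^bsub>C (n - 1)\<^esub>) \<and> (\<exists>w\<in>carrier (En (Suc n)). y = \<Phi> n x \<oplus>\<^bsub>En n\<^esub> dE (Suc n) w)"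
    proof (cases n)
      case 0
      have "(\<zero>\<^bsub>C 0\<^esub>, y) \<in> carrier (T 0)" unfolding Tob using y unfolding 0 by simp
      from exact0[OF this] obtain c e where "c \<in> carrier (C 0)" "e \<in> carrier (En (Suc 0))" "(\<zero>\<^bsub>C 0\<^esub>, y) = D 0 (c, e)"
        unfolding Tob by auto
      then show ?thesis unfolding 0 D_def by auto
    next
      case (Suc m)
      interpret Cm: module k "C m" by (rule C_module)
      interpret Em': module k "En m" by (rule Em)
      \<comment> \<open>A cycle \<open>y\<close> of the target is a cycle of the cone; a preimage expresses it through
        \<open>\<Phi>\<close> up to a boundary.\<close>
      have zT: "(\<zero>\<^bsub>C m\<^esub>, y) \<in> carrier (T (Suc m))" unfolding Tob using y unfolding Suc by simp
      have "D m (\<zero>\<^bsub>C m\<^esub>, y) = \<zero>\<^bsub>T m\<^esub>"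
        unfolding D_def Tob using y(2) mhom_zero[OF C_module C_shift_module C_shift_d_hom, of m] mhom_zero[OF C_module Em \<Phi>(1), of m]
        unfolding Suc by simp
      from exactS[OF zT this] obtain c e where ce: "c \<in> carrier (C (Suc m))" "e \<in> carrier (En (Suc (Suc m)))"
        "(\<zero>\<^bsub>C m\<^esub>, y) = D (Suc m) (c, e)" unfolding Tob by auto
      then have "\<zero>\<^bsub>C m\<^esub> = \<ominus>\<^bsub>C m\<^esub> ?bd (Suc m) c" and "y = \<Phi> (Suc m) c \<oplus>\<^bsub>En (Suc m)\<^esub> dE (Suc (Suc m)) e"
        unfolding D_def by auto
      moreover from this(1) have "?bd (Suc m) c = \<zero>\<^bsub>C m\<^esub>"
        by (intro module_neg_eq_zero[OF C_module mhom_closed[OF boundary_hom ce(1)]]) (rule sym)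
      ultimately show ?thesis using ce unfolding Suc by auto
    qed
  qed
  then show ?thesis unfolding HGamma_ideal_def HGamma_def Tor_Gamma_def dE_def .
qed

end

end

theorem theorem4p18:
  fixes k :: "'k ring"
    and A :: "('k, 'a) module"
    and M :: "('a, 'm) module"
    and ract :: "'m \<Rightarrow> 'a \<Rightarrow> 'm"
    and \<epsilon> :: "'a \<Rightarrow> 'k"
    and \<iota> :: "rat \<Rightarrow> 'k"
    and P :: "nat \<Rightarrow> ('k, 'p) gamma_mod"
    and d :: "nat \<Rightarrow> nat \<Rightarrow> 'p \<Rightarrow> 'p"
    and \<eta> :: "nat \<Rightarrow> 'p \<Rightarrow> nat \<Rightarrow> 'k"
  assumes "cring k"
    and "\<iota> \<in> ring_hom rat_ring k" and "inj \<iota>"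
    and "algebra k A"
    and "flat_module k A"
    and "augmentation k A \<epsilon>"
    and "symmetric_bimodule A M ract"
    and "projective_resolution k (t_mod k) P d \<eta>"
  shows "graded_isomorphic k (HGamma_ideal k A (a_kernel A k \<epsilon>) M) (HGamma k A M P d)"
proof -
  interpret augmented_algebra k A M \<epsilon>
    using assms(1,4,6,7) by (intro augmented_algebra.intro) (auto simp: symmetric_bimodule_def)
  have one: "\<iota> 1 = \<one>\<^bsub>k\<^esub>" and add: "\<iota> (x + y) = \<iota> x \<oplus>\<^bsub>k\<^esub> \<iota> y" and cl: "\<iota> x \<in> carrier k" for x y
    using assms(2) unfolding ring_hom_def rat_ring_def by auto
  \<comment> \<open>The embedding of the rationals shows that \<open>k\<close> is not the zero ring.\<close>
  have "\<iota> 0 = \<zero>\<^bsub>k\<^esub>" using add[of 0 0] cl[of 0] by (metis add_0 k.add.r_cancel_one')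
  then have "\<one>\<^bsub>k\<^esub> \<noteq> \<zero>\<^bsub>k\<^esub>" using one assms(3) by (metis injD zero_neq_one)
  then show ?thesis by (rule comparison_quasi_iso[OF assms(8)])
qed

end
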